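(* Let $H^\omega=\Delta+\lambda V^\omega$, $\lambda>0$, be the Anderson model on $\ell^2(\mathbb{B})$, where $\mathbb{B}$ is the Bethe lattice of degree $K+1$, and let $m\ge 1$ be an integer. Assume: (a) The single site distribution $\mu$ is absolutely continuous with respect to Lebesgue measure on $\mathbb{R}$, $d\mu(x)=g(x)\,dx$, with $g\in C^m_c(\mathbb{R})$. (b) $J\subset\mathbb{R}$ is a compact interval for which there exist $s\in(0,1)$, $C_s>0$ and $\xi_s>0$ such that for all $n_1,n_2\in\mathbb{B}$ and all $L>0$ $$\sup_{\Re(z)\in J,\ \Im(z)>0}\mathbb{E}\Big(\big|\langle\delta_{n_1},(H^\omega_L-z)^{-1}\delta_{n_2}\rangle\big|^s\Big)\le C_s e^{-\xi_s d(n_1,n_2)},$$ where $\xi_s>2\ln(K+1)\,(3+p)$ for some integer $p$ with $1\le p\le m$. Moreover, this estimate holds with the same constants $C_s,\xi_s$ if the density $g$ of $\omega_n$ is replaced by its derivatives at finitely many vertices $n$ (that is, by normalized densities $|g^{(k)}|/\|g^{(k)}\|_1$ with $1\le k\le m$, where $k$ may depend on the vertex). Then the integrated density of states $\mathcal{N}(E)=\mathbb{E}\big(\langle\delta_0,E_{H^\omega}(-\infty,E]\,\delta_0\rangle\big)$ is continuously differentiable up to order $p$ in $J$, i.e. $\mathcal{N}\in C^p(J)$.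
   Context: The Bethe lattice $\mathbb{B}$ is the infinite connected graph with no closed loops in which every vertex has degree $K+1$ ($K$ a positive integer); $d(n_1,n_2)$ is the length of the shortest path connecting $n_1$ and $n_2$, and a fixed vertex is chosen as origin and denoted $0$. $\{\delta_n\}_{n\in\mathbb{B}}$ is the standard basis of $\ell^2(\mathbb{B})$ and $P_n$ is the orthogonal projection onto the span of $\delta_n$. Anderson model: $(\Delta u)(n)=\sum_{k:\,d(k,n)=1}u(k)$ and $(V^\omega u)(n)=\omega_n u(n)$ for $u\in\ell^2(\mathbb{B})$, where $\{\omega_n\}_{n\in\mathbb{B}}$ are i.i.d. real random variables with common compactly supported distribution $\mu$ (the single site distribution). $\mathbb{P}=\bigotimes_{n\in\mathbb{B}}\mu$ on $\Omega=\mathbb{R}^{\mathbb{B}}$, and $\mathbb{E}$ is the corresponding expectation. $E_A(\cdot)$ denotes the spectral (projection-valued) measure of a self-adjoint operator $A$. Finite volume: $\Lambda_L=\{n\in\mathbb{B}:d(n,0)\le L\}$ ($L$ an integer), $\chi_L$ is the orthogonal projection onto $\ell^2(\Lambda_L)$, and $H^\omega_L=\chi_L\Delta\chi_L+\lambda\sum_{n\in\Lambda_L}\omega_nP_n$ is a matrix of size $|\Lambda_L|$ acting on $\ell^2(\Lambda_L)$. Matrix elements $\langle\delta_{n_1},(H^\omega_L-z)^{-1}\delta_{n_2}\rangle$ are taken to be $0$ if $n_1$ or $n_2$ is not in $\Lambda_L$. $C^m_c(\mathbb{R})$ is the set of functions with compact support that are continuously differentiable up to order $m$. *)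

theory Defs
  imports "HOL-Probability.Probability"
begin

section \<open>The Bethe lattice\<close>

text \<open>The vertex set is the whole type \<open>'v\<close>; \<open>adj\<close> is the adjacency relation of a simple graph.\<close>

definition has_cycle :: "('v \<Rightarrow> 'v \<Rightarrow> bool) \<Rightarrow> bool" where
  "has_cycle adj \<longleftrightarrow>
     (\<exists>xs. 3 \<le> length xs \<and> distinct xs \<and> successively adj xs \<and> adj (last xs) (hd xs))"

definition bethe_lattice :: "('v \<Rightarrow> 'v \<Rightarrow> bool) \<Rightarrow> nat \<Rightarrow> bool" where
  "bethe_lattice adj K \<longleftrightarrow>
     infinite (UNIV :: 'v set) \<and> symp adj \<and> irreflp adj \<and>
     (\<forall>x y. adj\<^sup>*\<^sup>* x y) \<and> \<not> has_cycle adj \<and>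
     (\<forall>n. card {k. adj n k} = K + 1)"

definition lattice_dist :: "('v \<Rightarrow> 'v \<Rightarrow> bool) \<Rightarrow> 'v \<Rightarrow> 'v \<Rightarrow> nat" where
  "lattice_dist adj x y = (LEAST k. (adj ^^ k) x y)"

definition vol :: "('v \<Rightarrow> 'v \<Rightarrow> bool) \<Rightarrow> 'v \<Rightarrow> nat \<Rightarrow> 'v set" where
  "vol adj orig L = {n. lattice_dist adj n orig \<le> L}"

section \<open>The Hilbert space \<open>\<ell>\<^sup>2\<close>\<close>

definition ell2 :: "('v \<Rightarrow> complex) set" where
  "ell2 = {u. (\<lambda>n. (cmod (u n))\<^sup>2) summable_on UNIV}"

text \<open>The inner product is linear in the second argument.\<close>

definition ell2_inner :: "('v \<Rightarrow> complex) \<Rightarrow> ('v \<Rightarrow> complex) \<Rightarrow> complex" where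
  "ell2_inner u v = (\<Sum>\<^sub>\<infinity>n. cnj (u n) * v n)"

definition delta :: "'v \<Rightarrow> 'v \<Rightarrow> complex" where
  "delta n = (\<lambda>k. if k = n then 1 else 0)"

definition restr :: "'v set \<Rightarrow> ('v \<Rightarrow> complex) \<Rightarrow> ('v \<Rightarrow> complex)" where
  "restr S u = (\<lambda>n. if n \<in> S then u n else 0)"

text \<open>\<open>restr S\<close> is the orthogonal projection onto \<open>\<ell>\<^sup>2(S)\<close>, identified with the vectors
  of \<open>\<ell>\<^sup>2\<close> vanishing outside \<open>S\<close>; in particular \<open>restr {n}\<close> is \<open>P\<^sub>n\<close> and
  \<open>restr (vol adj orig L)\<close> is \<open>\<chi>\<^sub>L\<close>.\<close>

definition ell2_on :: "'v set \<Rightarrow> ('v \<Rightarrow> complex) set" where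
  "ell2_on S = {u \<in> ell2. \<forall>n. n \<notin> S \<longrightarrow> u n = 0}"

section \<open>Spectral measures of self-adjoint operators\<close>

definition orthogonal_projection :: "(('v \<Rightarrow> complex) \<Rightarrow> ('v \<Rightarrow> complex)) \<Rightarrow> bool" where
  "orthogonal_projection P \<longleftrightarrow>
     (\<forall>u\<in>ell2. P u \<in> ell2) \<and>
     (\<forall>u\<in>ell2. \<forall>v\<in>ell2. \<forall>c. P (\<lambda>n. c * u n + v n) = (\<lambda>n. c * P u n + P v n)) \<and>
     (\<forall>u\<in>ell2. P (P u) = P u) \<and>
     (\<forall>u\<in>ell2. \<forall>v\<in>ell2. ell2_inner (P u) v = ell2_inner u (P v))"

definition projection_valued_measure ::
    "(real set \<Rightarrow> ('v \<Rightarrow> complex) \<Rightarrow> ('v \<Rightarrow> complex)) \<Rightarrow> bool" where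
  "projection_valued_measure E \<longleftrightarrow>
     (\<forall>B\<in>sets borel. orthogonal_projection (E B)) \<and>
     (\<forall>u\<in>ell2. E UNIV u = u) \<and>
     (\<forall>B\<in>sets borel. \<forall>C\<in>sets borel. \<forall>u\<in>ell2. E (B \<inter> C) u = E B (E C u)) \<and>
     (\<forall>B :: nat \<Rightarrow> real set. range B \<subseteq> sets borel \<longrightarrow> disjoint_family B \<longrightarrow>
        (\<forall>u\<in>ell2. \<forall>v\<in>ell2.
           (\<lambda>i. ell2_inner v (E (B i) u)) sums ell2_inner v (E (\<Union>i. B i) u)))"

text \<open>The scalar measure \<open>B \<mapsto> \<langle>u, E(B) u\<rangle>\<close>.\<close>

definition scalar_measure ::
    "(real set \<Rightarrow> ('v \<Rightarrow> complex) \<Rightarrow> ('v \<Rightarrow> complex)) \<Rightarrow> ('v \<Rightarrow> complex) \<Rightarrow> real measure" where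
  "scalar_measure E u =
     measure_of UNIV (sets borel) (\<lambda>B. ennreal (Re (ell2_inner u (E B u))))"

text \<open>\<open>E\<close> is the spectral measure of the (possibly unbounded) self-adjoint operator \<open>A\<close>
  with domain \<open>D\<close>, i.e. \<open>A = \<integral> x dE(x)\<close>. Since \<open>A\<close> is linear, the quadratic form
  on \<open>D\<close> determines \<open>A\<close> by polarization.\<close>

definition is_spectral_measure ::
    "('v \<Rightarrow> complex) set \<Rightarrow> (('v \<Rightarrow> complex) \<Rightarrow> ('v \<Rightarrow> complex)) \<Rightarrow>
     (real set \<Rightarrow> ('v \<Rightarrow> complex) \<Rightarrow> ('v \<Rightarrow> complex)) \<Rightarrow> bool" where
  "is_spectral_measure D A E \<longleftrightarrow>
     projection_valued_measure E \<and>
     D = {u \<in> ell2. integrable (scalar_measure E u) (\<lambda>x. x\<^sup>2)} \<and>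
     (\<forall>u\<in>D. ell2_inner u (A u) = complex_of_real (\<integral>x. x \<partial>scalar_measure E u))"

text \<open>By the spectral theorem such an \<open>E\<close> exists for self-adjoint \<open>A\<close>, and its values on Borel
  sets and vectors of \<open>ell2\<close> are unique; only those values are used below.\<close>

definition spectral_measure ::
    "('v \<Rightarrow> complex) set \<Rightarrow> (('v \<Rightarrow> complex) \<Rightarrow> ('v \<Rightarrow> complex)) \<Rightarrow>
     real set \<Rightarrow> ('v \<Rightarrow> complex) \<Rightarrow> ('v \<Rightarrow> complex)" where
  "spectral_measure D A = (SOME E. is_spectral_measure D A E)"

section \<open>The Anderson model\<close>

definition laplacian :: "('v \<Rightarrow> 'v \<Rightarrow> bool) \<Rightarrow> ('v \<Rightarrow> complex) \<Rightarrow> ('v \<Rightarrow> complex)" where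
  "laplacian adj u = (\<lambda>n. \<Sum>k | lattice_dist adj k n = 1. u k)"

definition potential :: "('v \<Rightarrow> real) \<Rightarrow> ('v \<Rightarrow> complex) \<Rightarrow> ('v \<Rightarrow> complex)" where
  "potential \<omega> u = (\<lambda>n. complex_of_real (\<omega> n) * u n)"

definition anderson ::
    "('v \<Rightarrow> 'v \<Rightarrow> bool) \<Rightarrow> real \<Rightarrow> ('v \<Rightarrow> real) \<Rightarrow> ('v \<Rightarrow> complex) \<Rightarrow> ('v \<Rightarrow> complex)" where
  "anderson adj lam \<omega> u = (\<lambda>n. laplacian adj u n + complex_of_real lam * potential \<omega> u n)"

text \<open>For a compactly supported single site distribution this is \<open>ell2\<close> for almost every
  \<open>\<omega>\<close>; since the laplacian is bounded, \<open>anderson adj lam \<omega>\<close> is self-adjoint on it for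
  every \<open>\<omega>\<close>.\<close>

definition anderson_dom :: "('v \<Rightarrow> real) \<Rightarrow> ('v \<Rightarrow> complex) set" where
  "anderson_dom \<omega> = {u \<in> ell2. potential \<omega> u \<in> ell2}"

definition anderson_box ::
    "('v \<Rightarrow> 'v \<Rightarrow> bool) \<Rightarrow> 'v \<Rightarrow> real \<Rightarrow> nat \<Rightarrow> ('v \<Rightarrow> real) \<Rightarrow>
     ('v \<Rightarrow> complex) \<Rightarrow> ('v \<Rightarrow> complex)" where
  "anderson_box adj orig lam L \<omega> u = (\<lambda>n.
     restr (vol adj orig L) (laplacian adj (restr (vol adj orig L) u)) n
     + complex_of_real lam * (\<Sum>k\<in>vol adj orig L. complex_of_real (\<omega> k) * restr {k} u n))"

text \<open>The matrix element \<open>\<langle>\<delta>\<^sub>n\<^sub>1, (H\<^sub>L - z)\<^sup>-\<^sup>1 \<delta>\<^sub>n\<^sub>2\<rangle>\<close>; the inverse is taken on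
  \<open>\<ell>\<^sup>2(\<Lambda>\<^sub>L)\<close>, where \<open>H\<^sub>L - z\<close> is bijective if \<open>Im z > 0\<close>.\<close>

definition box_resolvent ::
    "('v \<Rightarrow> 'v \<Rightarrow> bool) \<Rightarrow> 'v \<Rightarrow> real \<Rightarrow> nat \<Rightarrow> ('v \<Rightarrow> real) \<Rightarrow> complex \<Rightarrow> 'v \<Rightarrow> 'v \<Rightarrow> complex" where
  "box_resolvent adj orig lam L \<omega> z n1 n2 =
     (if n1 \<in> vol adj orig L \<and> n2 \<in> vol adj orig L
      then ell2_inner (delta n1)
             (inv_into (ell2_on (vol adj orig L))
                (\<lambda>u n. anderson_box adj orig lam L \<omega> u n - z * u n) (delta n2))
      else 0)"

text \<open>The fractional moment bound for independent \<open>\<omega>\<^sub>n\<close> with distributions \<open>\<nu> n\<close>. The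
  expectation and the supremum are taken in \<open>ennreal\<close>, so that finiteness is part of the claim.\<close>

definition fractional_moment_bound ::
    "('v \<Rightarrow> 'v \<Rightarrow> bool) \<Rightarrow> 'v \<Rightarrow> real \<Rightarrow> ('v \<Rightarrow> real measure) \<Rightarrow> real set \<Rightarrow>
     real \<Rightarrow> real \<Rightarrow> real \<Rightarrow> bool" where
  "fractional_moment_bound adj orig lam \<nu> J s C \<xi> \<longleftrightarrow>
     (\<forall>n1 n2. \<forall>L>0.
        (SUP z\<in>{z. Re z \<in> J \<and> Im z > 0}.
           \<integral>\<^sup>+\<omega>. ennreal (cmod (box_resolvent adj orig lam L \<omega> z n1 n2) powr s)
             \<partial>(\<Pi>\<^sub>M n\<in>UNIV. \<nu> n))
        \<le> ennreal (C * exp (- \<xi> * real (lattice_dist adj n1 n2))))"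

text \<open>\<open>H\<^sup>\<omega>\<close> is bounded only for almost every \<open>\<omega>\<close>. Integrating over the completion of
  the product measure makes the integral independent of the exceptional null set; it does not
  change the integral of a function measurable for the product \<open>\<sigma>\<close>-algebra.\<close>

definition integrated_dos ::
    "('v \<Rightarrow> 'v \<Rightarrow> bool) \<Rightarrow> 'v \<Rightarrow> real \<Rightarrow> real measure \<Rightarrow> real \<Rightarrow> real" where
  "integrated_dos adj orig lam \<mu> x =
     (\<integral>\<omega>. Re (ell2_inner (delta orig)
                (spectral_measure (anderson_dom \<omega>) (anderson adj lam \<omega>) {..x} (delta orig)))
        \<partial>completion (\<Pi>\<^sub>M n\<in>UNIV. \<mu>))"

section \<open>Differentiability classes and densities\<close>

text \<open>On a closed interval \<open>S\<close> the derivatives at the end points are one-sided.\<close>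

definition C_diff_on :: "nat \<Rightarrow> (real \<Rightarrow> real) \<Rightarrow> real set \<Rightarrow> bool" where
  "C_diff_on k f S \<longleftrightarrow>
     (\<exists>F :: nat \<Rightarrow> real \<Rightarrow> real. F 0 = f \<and>
        (\<forall>i<k. \<forall>x\<in>S. (F i has_real_derivative F (Suc i) x) (at x within S)) \<and>
        (\<forall>i\<le>k. continuous_on S (F i)))"

definition C_diff_compact_support :: "nat \<Rightarrow> (real \<Rightarrow> real) \<Rightarrow> bool" where
  "C_diff_compact_support k f \<longleftrightarrow> C_diff_on k f UNIV \<and> compact (closure {x. f x \<noteq> 0})"

text \<open>The probability measure with density \<open>\<bar>g\<^sup>(\<^sup>k\<^sup>)\<bar> / \<parallel>g\<^sup>(\<^sup>k\<^sup>)\<parallel>\<^sub>1\<close>.\<close>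

definition deriv_measure :: "(real \<Rightarrow> real) \<Rightarrow> nat \<Rightarrow> real measure" where
  "deriv_measure g k = density lborel
     (\<lambda>x. ennreal (\<bar>(deriv ^^ k) g x\<bar> / (\<integral>y. \<bar>(deriv ^^ k) g y\<bar> \<partial>lborel)))"

end

theory Submission
  imports Defs "HOL-Real_Asymp.Real_Asymp" "Jordan_Normal_Form.Determinant"
begin

text \<open>
  Let \<open>\<nu>\<^sub>L\<close> be the spectral measure of the box operator \<open>H\<^sub>L\<close> at the origin and \<open>G\<^sub>L(z)\<close> its Green
  function. Integrating \<open>G\<^sub>L\<close> up a vertical line gives a distribution function,
  \<open>1/2 - (1/\<pi>) \<integral>\<^sub>0\<^sup>\<infinity> Re G\<^sub>L(0, 0; x + i\<eta>) d\<eta> = \<nu>\<^sub>L(-\<infinity>, x) + \<nu>\<^sub>L{x}/2\<close>, called \<open>fermi L \<omega> x\<close> below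
  (\<open>fermi_eq_sgn\<close>). It lies in \<open>[0, 1]\<close> and depends on finitely many coordinates of \<open>\<omega>\<close>.

  Smoothness comes from the densities alone. Adding a constant to the potential shifts the energy,
  so \<open>fermi L \<omega> x = fermi L (\<omega> - x/\<lambda>) 0\<close> (\<open>fermi_shift\<close>). After a translation of the integration
  variables the energy occurs only in the factors \<open>g(\<omega>\<^sub>n + x/\<lambda>)\<close>, and a \<open>j\<close>-fold derivative in \<open>x\<close> of an
  expectation is \<open>\<lambda>\<^sup>-\<^sup>j\<close> times a sum over words \<open>n\<^sub>1 \<dots> n\<^sub>j\<close> of vertices, where a vertex occurring \<open>k\<close>
  times in the word carries \<open>g\<^sup>(\<^sup>k\<^sup>)\<close> instead of \<open>g\<close> (\<open>smoothed_deriv\<close>). Normalising these factors turns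
  each summand into a bounded constant times an expectation for which the fractional moment bound is
  also assumed (\<open>weight_expectation\<close>).

  The expectation over the box of radius \<open>n\<close> is the telescoping sum of the increments from radius
  \<open>L\<close> to \<open>L + 1\<close>. By the geometric resolvent identity, \<open>G\<^sub>L(0, 0) - G\<^sub>L\<^sub>+\<^sub>1(0, 0)\<close> is a sum over the edges
  leaving the smaller box of products \<open>G\<^sub>L\<^sub>+\<^sub>1(n, 0) G\<^sub>L(k, 0)\<close>, where \<open>n\<close> and \<open>k\<close> are far from the origin.
  Interpolation between this and the trivial resolvent bounds makes the increment integrable over
  the vertical line with the exponential decay of the fractional moments
  (\<open>green_increment_split\<close>, \<open>fermi_increment_expectation\<close>). The \<open>j\<close>-th derivative of the \<open>L\<close>-th increment is
  therefore at most a constant times \<open>|\<Lambda>\<^sub>L\<^sub>+\<^sub>1|\<^sup>j\<^sup>+\<^sup>2 exp (-\<xi>L)\<close>, and the hypothesis on the rate makes this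
  summable for \<open>j \<le> p\<close> because \<open>|\<Lambda>\<^sub>L| \<le> (K + 1)\<^sup>2\<^sup>L\<close>. The Weierstrass test shows that the sum is of class
  \<open>C\<^sup>p\<close> (\<open>dos_terms_summable\<close>, \<open>C_diff_on_series\<close>).

  The sum is the integrated density of states (\<open>mean_converges\<close>). Matrix elements of \<open>H\<^sup>k\<close> at the
  origin only see the ball of radius \<open>k\<close>, so all moments of \<open>\<nu>\<^sub>L\<close> converge to those of the infinite
  operator and \<open>\<nu>\<^sub>L\<close> converges weakly for almost every \<open>\<omega>\<close>. The limit has no atom at \<open>x \<in> J\<close>:
  since \<open>\<nu>\<^sub>L{x} \<le> \<eta> Im G\<^sub>L(0, 0; x + i\<eta>)\<close>, the fractional moment bound forces the expected mass of the
  atom to be \<open>O(\<eta>\<^sup>s)\<close> for every \<open>\<eta>\<close> (\<open>dos_atomless\<close>).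

  The infinite operator enters through an arbitrary projection-valued measure that represents it.
  Existence and uniqueness of this measure are proved with moments: positivity of the operators
  \<open>T\<^sup>k (1 - T)\<^sup>l\<close> for \<open>0 \<le> T \<le> 1\<close> and Hausdorff's theorem yield a measure for every vector
  (\<open>ex_unit_spectral_measure\<close>), polarisation and the Riesz representation yield the projections
  (\<open>spectral_theorem\<close>), and any other candidate has compact support and the same moments
  (\<open>spectral_measure_unique\<close>).
\<close>

section \<open>Measures determined by their moments\<close>

text \<open>
  A signed measure on the line, given as a finite sum of positive measures with bounded signed
  densities. Linear identities between several spectral measures (polarisation, additivity) are
  statements that such a signed measure vanishes, which avoids a theory of signed measures.
\<close>

definition family_integral ::
    "'i set \<Rightarrow> ('i \<Rightarrow> real measure) \<Rightarrow> ('i \<Rightarrow> real \<Rightarrow> real) \<Rightarrow> (real \<Rightarrow> real) \<Rightarrow> real" where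
  "family_integral I M h f = (\<Sum>i\<in>I. \<integral>t. f t * h i t \<partial>M i)"

locale signed_family =
  fixes I :: "'i set" and M :: "'i \<Rightarrow> real measure" and h :: "'i \<Rightarrow> real \<Rightarrow> real" and R c :: real
  assumes finite_index: "finite I"
    and finite_measures: "\<And>i. i \<in> I \<Longrightarrow> finite_measure (M i)"
    and borel_sets: "\<And>i. i \<in> I \<Longrightarrow> sets (M i) = sets borel"
    and support: "\<And>i. i \<in> I \<Longrightarrow> AE t in M i. \<bar>t\<bar> \<le> R"
    and density_measurable: "\<And>i. i \<in> I \<Longrightarrow> h i \<in> borel_measurable borel"
    and density_bounded: "\<And>i t. i \<in> I \<Longrightarrow> \<bar>t\<bar> \<le> R \<Longrightarrow> \<bar>h i t\<bar> \<le> c"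
begin

abbreviation "\<Phi> \<equiv> family_integral I M h"

lemma measurable_M: "i \<in> I \<Longrightarrow> f \<in> borel_measurable borel \<Longrightarrow> f \<in> borel_measurable (M i)"
  using borel_sets measurable_cong_sets by blast

lemma integrable_term:
  assumes i: "i \<in> I" and f: "f \<in> borel_measurable borel" and b: "\<And>t. \<bar>t\<bar> \<le> R \<Longrightarrow> \<bar>f t\<bar> \<le> b"
  shows "integrable (M i) (\<lambda>t. f t * h i t)"
proof -
  interpret finite_measure "M i" by (rule finite_measures[OF i])
  have "AE t in M i. norm (f t * h i t) \<le> b * c"
    using support[OF i]
  proof eventually_elim
    case (elim t)
    have "0 \<le> b" using b[OF elim] by linarith
    then show ?case using b[OF elim] density_bounded[OF i elim] by (simp add: abs_mult mult_mono)
  qed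
  then show ?thesis
    by (intro integrable_const_bound[of _ "b*c"]) (use f i density_measurable in \<open>auto intro!: measurable_M borel_measurable_times\<close>)
qed

lemma \<Phi>_limit:
  assumes f: "\<And>n. f n \<in> borel_measurable borel" and g: "g \<in> borel_measurable borel"
    and b: "\<And>n t. \<bar>t\<bar> \<le> R \<Longrightarrow> \<bar>f n t\<bar> \<le> b"
    and lim: "\<And>t. \<bar>t\<bar> \<le> R \<Longrightarrow> (\<lambda>n. f n t) \<longlonglongrightarrow> g t"
  shows "(\<lambda>n. \<Phi> (f n)) \<longlonglongrightarrow> \<Phi> g"
  unfolding family_integral_def
proof (rule tendsto_sum)
  fix i assume i: "i \<in> I"
  interpret finite_measure "M i" by (rule finite_measures[OF i])
  have hM: "h i \<in> borel_measurable (M i)" using i density_measurable measurable_M by blast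
  show "(\<lambda>n. \<integral>t. f n t * h i t \<partial>M i) \<longlonglongrightarrow> (\<integral>t. g t * h i t \<partial>M i)"
  proof (rule integral_dominated_convergence)
    show "(\<lambda>t. g t * h i t) \<in> borel_measurable (M i)"
      using g i density_measurable by (auto intro!: measurable_M borel_measurable_times)
    show "(\<lambda>t. f n t * h i t) \<in> borel_measurable (M i)" for n
      using f i density_measurable by (auto intro!: measurable_M borel_measurable_times)
    show "integrable (M i) (\<lambda>t. b * c)" by simp
    show "AE t in M i. (\<lambda>n. f n t * h i t) \<longlonglongrightarrow> g t * h i t"
      using support[OF i] by eventually_elim (auto intro!: tendsto_mult lim)
    show "AE t in M i. norm (f n t * h i t) \<le> b * c" for n
      using support[OF i]
    proof eventually_elim
      case (elim t)
      have "0 \<le> b" using b[OF elim, of n] by linarith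
      then show ?case using b[OF elim, of n] density_bounded[OF i elim] by (simp add: abs_mult mult_mono)
    qed
  qed
qed

lemma \<Phi>_add:
  assumes "f \<in> borel_measurable borel" "g \<in> borel_measurable borel"
    and "\<And>t. \<bar>t\<bar> \<le> R \<Longrightarrow> \<bar>f t\<bar> \<le> b" "\<And>t. \<bar>t\<bar> \<le> R \<Longrightarrow> \<bar>g t\<bar> \<le> b'"
  shows "\<Phi> (\<lambda>t. f t + g t) = \<Phi> f + \<Phi> g"
  unfolding family_integral_def sum.distrib[symmetric]
  by (intro sum.cong refl) (simp add: distrib_right integrable_term[OF _ assms(1,3)] integrable_term[OF _ assms(2,4)])

lemma \<Phi>_cmult: "\<Phi> (\<lambda>t. a * f t) = a * \<Phi> f"
  unfolding family_integral_def sum_distrib_left by (intro sum.cong refl) (simp add: mult.assoc)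

lemma \<Phi>_sum:
  assumes "finite K" and "\<And>k. k \<in> K \<Longrightarrow> f k \<in> borel_measurable borel"
    and "\<And>k t. k \<in> K \<Longrightarrow> \<bar>t\<bar> \<le> R \<Longrightarrow> \<bar>f k t\<bar> \<le> b k"
  shows "\<Phi> (\<lambda>t. \<Sum>k\<in>K. f k t) = (\<Sum>k\<in>K. \<Phi> (f k))"
  using assms
proof (induction K)
  case (insert k K)
  have "\<Phi> (\<lambda>t. \<Sum>k\<in>insert k K. f k t) = \<Phi> (\<lambda>t. f k t + (\<Sum>k\<in>K. f k t))" using insert by simp
  also have "\<dots> = \<Phi> (f k) + \<Phi> (\<lambda>t. \<Sum>k\<in>K. f k t)"
  proof (rule \<Phi>_add)
    show "\<And>t. \<bar>t\<bar> \<le> R \<Longrightarrow> \<bar>\<Sum>k\<in>K. f k t\<bar> \<le> (\<Sum>k\<in>K. b k)"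
      by (rule order_trans[OF sum_abs]) (auto intro!: sum_mono insert.prems)
  qed (use insert.prems in auto)
  finally show ?case using insert by simp
qed (simp add: family_integral_def)

text \<open>
  By Stone--Weierstrass, polynomials approximate a continuous function uniformly on the compact
  interval that carries the measures.
\<close>

lemma moments_vanish_imp_continuous:
  assumes mom: "\<And>k. \<Phi> (\<lambda>t. t ^ k) = 0" and f: "continuous_on UNIV f"
  shows "\<Phi> f = 0"
proof -
  have fb: "f \<in> borel_measurable borel" using f by (rule borel_measurable_continuous_onI)
  have "\<exists>p. real_polynomial_function p \<and> (\<forall>t\<in>{-R..R}. \<bar>f t - p t\<bar> < 1 / real (Suc n))" for n
  proof -
    have "continuous_on {-R..R} f" using f by (rule continuous_on_subset) simp
    moreover have "0 < 1 / real (Suc n)" by simp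
    ultimately obtain p where "real_polynomial_function p" "\<And>t. t \<in> {-R..R} \<Longrightarrow> \<bar>f t - p t\<bar> < 1 / real (Suc n)"
      using Stone_Weierstrass_real_polynomial_function[OF compact_Icc] by blast
    then show ?thesis by blast
  qed
  then obtain p where p: "\<And>n. real_polynomial_function (p n)"
    and close: "\<And>n t. t \<in> {-R..R} \<Longrightarrow> \<bar>f t - p n t\<bar> < 1 / real (Suc n)" by metis
  have p0: "\<Phi> (p n) = 0" for n
  proof -
    obtain a N where a: "p n = (\<lambda>x. \<Sum>i\<le>N. a i * x ^ i)" using p[of n] real_polynomial_function_iff_sum by blast
    have "\<Phi> (\<lambda>x. \<Sum>i\<le>N. a i * x ^ i) = (\<Sum>i\<le>N. \<Phi> (\<lambda>x. a i * x ^ i))"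
      by (rule \<Phi>_sum[where b = "\<lambda>i. \<bar>a i\<bar> * R ^ i"])
        (auto simp: abs_mult power_abs intro!: mult_left_mono power_mono)
    then show ?thesis using a by (simp add: \<Phi>_cmult mom)
  qed
  have comp: "compact (f ` {-R..R})" by (intro compact_continuous_image continuous_on_subset[OF f]) auto
  then obtain b where b: "\<And>t. t \<in> {-R..R} \<Longrightarrow> \<bar>f t\<bar> \<le> b"
    using compact_imp_bounded bounded_iff by (metis image_eqI real_norm_def)
  have "(\<lambda>n. \<Phi> (p n)) \<longlonglongrightarrow> \<Phi> f"
  proof (rule \<Phi>_limit[where b = "b + 1"])
    show "p n \<in> borel_measurable borel" for n
      using p[of n] unfolding real_polynomial_function_iff_sum by (auto intro!: borel_measurable_continuous_onI continuous_intros)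
    show "\<bar>p n t\<bar> \<le> b + 1" if "\<bar>t\<bar> \<le> R" for n t
    proof -
      have t: "t \<in> {-R..R}" using that by auto
      have "1 / real (Suc n) \<le> 1" by simp
      then show ?thesis using close[OF t, of n] b[OF t] by linarith
    qed
    show "(\<lambda>n. p n t) \<longlonglongrightarrow> f t" if "\<bar>t\<bar> \<le> R" for t
    proof -
      have t: "t \<in> {-R..R}" using that by auto
      have "(\<lambda>n. p n t - f t) \<longlonglongrightarrow> 0"
        by (rule Lim_null_comparison[OF _ LIMSEQ_inverse_real_of_nat])
          (use close[OF t] in \<open>auto intro!: always_eventually simp: abs_minus_commute inverse_eq_divide less_imp_le\<close>)
      then show ?thesis by (simp add: LIM_zero_iff)
    qed
  qed (use fb in auto)
  then show ?thesis by (simp add: p0 LIMSEQ_const_iff)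
qed

text \<open>
  The indicator of a half-line is a bounded pointwise limit of continuous ramps.
\<close>

lemma vanish_atMost:
  assumes cts: "\<And>f. continuous_on UNIV f \<Longrightarrow> \<Phi> f = 0"
  shows "\<Phi> (indicator {..x}) = 0"
proof -
  define f where "f n t = max 0 (min 1 (1 - real n * (t - x)))" for n :: nat and t
  have "(\<lambda>n. \<Phi> (f n)) \<longlonglongrightarrow> \<Phi> (indicator {..x})"
  proof (rule \<Phi>_limit[where b = 1])
    show "f n \<in> borel_measurable borel" for n unfolding f_def by measurable
    show "\<bar>f n t\<bar> \<le> 1" for n t by (auto simp: f_def)
    show "(\<lambda>n. f n t) \<longlonglongrightarrow> indicator {..x} t" for t
    proof (cases "t \<le> x")
      case True
      then have "f n t = 1" for n using mult_nonneg_nonpos[of "real n" "t - x"] by (simp add: f_def)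
      then show ?thesis using True by simp
    next
      case False
      then obtain N where N: "1 < real N * (t - x)" using reals_Archimedean3[of "t - x"] by auto
      have "\<forall>\<^sub>F n in sequentially. f n t = 0"
      proof (rule eventually_sequentiallyI)
        fix n assume "N \<le> n"
        then have "real N * (t - x) \<le> real n * (t - x)" using False by (intro mult_right_mono) auto
        then show "f n t = 0" using N by (simp add: f_def)
      qed
      then show ?thesis using False by (simp add: tendsto_eventually)
    qed
  qed auto
  moreover have "\<Phi> (f n) = 0" for n
    by (rule cts) (auto simp: f_def intro!: continuous_intros)
  ultimately show ?thesis by (simp add: LIMSEQ_const_iff)
qed

text \<open>
  Half-lines generate the Borel sets and are stable under intersection, so the Dynkin argument
  applies.
\<close>

lemma moments_vanish_imp_sets:
  assumes mom: "\<And>k. \<Phi> (\<lambda>t. t ^ k) = 0" and B: "B \<in> sets borel"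
  shows "\<Phi> (indicator B) = 0"
proof -
  note cts = moments_vanish_imp_continuous[OF mom]
  have univ: "\<Phi> (\<lambda>t. 1) = 0" using mom[of 0] by simp
  have gen: "sets borel = sigma_sets UNIV (range (\<lambda>x::real. {..x}))"
    unfolding borel_eq_atMost by (subst sets_measure_of) auto
  have stable: "Int_stable (range (\<lambda>x::real. {..x}))" by (auto simp: Int_stable_def intro!: image_eqI[of _ _ "min _ _"])
  have subset_Pow: "range (\<lambda>x::real. {..x}) \<subseteq> Pow UNIV" by simp
  from B have "B \<in> sigma_sets UNIV (range (\<lambda>x::real. {..x}))" using gen by simp
  from stable subset_Pow this show ?thesis
  proof (induction rule: sigma_sets_induct_disjoint)
    case (basic A)
    then show ?case using vanish_atMost[OF cts] by auto
  next
    case empty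
    then show ?case by (simp add: family_integral_def)
  next
    case (compl A)
    have A: "A \<in> sets borel" using compl gen by simp
    have "\<Phi> (\<lambda>t. indicator A t + indicator (UNIV - A) t) = \<Phi> (indicator A) + \<Phi> (indicator (UNIV - A))"
      by (rule \<Phi>_add[where b = 1 and b' = 1]) (use A in \<open>auto simp: indicator_def\<close>)
    moreover have "(\<lambda>t. indicator A t + indicator (UNIV - A) t) = (\<lambda>t. 1::real)" by (auto simp: indicator_def)
    ultimately show ?case using compl univ by simp
  next
    case (union A)
    have A: "A i \<in> sets borel" for i using union gen by auto
    have "(\<lambda>n. \<Phi> (\<lambda>t. \<Sum>i<n. indicator (A i) t)) \<longlonglongrightarrow> \<Phi> (indicator (\<Union>i. A i))"
    proof (rule \<Phi>_limit[where b = 1])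
      have eq: "(\<Sum>i<n. indicator (A i) t) = (indicator (\<Union>i<n. A i) t :: real)" for n t
        using union(1) by (subst indicator_UN_disjoint) (auto simp: disjoint_family_on_def)
      show "\<bar>\<Sum>i<n. indicator (A i) t\<bar> \<le> (1::real)" for n t
        unfolding eq by (auto simp: indicator_def)
      show "(\<lambda>n. \<Sum>i<n. indicator (A i) t) \<longlonglongrightarrow> (indicator (\<Union>i. A i) t :: real)" for t
        unfolding eq by (rule LIMSEQ_indicator_UN)
    qed (use A in auto)
    moreover have "\<Phi> (\<lambda>t. \<Sum>i<n. indicator (A i) t) = 0" for n
    proof -
      have "\<Phi> (\<lambda>t. \<Sum>i<n. indicator (A i) t) = (\<Sum>i<n. \<Phi> (indicator (A i)))"
        by (rule \<Phi>_sum[where b = "\<lambda>_. 1"]) (use A in \<open>auto simp: indicator_def\<close>)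
      then show ?thesis by (simp add: union)
    qed
    ultimately show ?case by (simp add: LIMSEQ_const_iff)
  qed
qed

text \<open>
  Monotone approximation by simple functions, first for nonnegative functions. The bound is
  quantified inside the induction because every approximating function needs its own.
\<close>

lemma sets_vanish_imp_bounded:
  assumes sets0: "\<And>B. B \<in> sets borel \<Longrightarrow> \<Phi> (indicator B) = 0"
    and f: "f \<in> borel_measurable borel" and b: "\<And>t. \<bar>t\<bar> \<le> R \<Longrightarrow> \<bar>f t\<bar> \<le> b"
  shows "\<Phi> f = 0"
proof -
  have pos: "\<forall>b. (\<forall>t. \<bar>t\<bar> \<le> R \<longrightarrow> \<bar>u t\<bar> \<le> b) \<longrightarrow> \<Phi> u = 0"
    if u: "u \<in> borel_measurable borel" "\<And>t. 0 \<le> u t" for u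
    using u
  proof (induct rule: borel_measurable_induct_real)
    case (set A)
    then show ?case using sets0 by simp
  next
    case (mult u a)
    show ?case
    proof (intro allI impI)
      fix b assume b: "\<forall>t. \<bar>t\<bar> \<le> R \<longrightarrow> \<bar>a * u t\<bar> \<le> b"
      show "\<Phi> (\<lambda>t. a * u t) = 0"
      proof (cases "a = 0")
        case False
        then have "\<forall>t. \<bar>t\<bar> \<le> R \<longrightarrow> \<bar>u t\<bar> \<le> b / a"
          using b mult(1) by (auto simp: abs_mult pos_le_divide_eq mult.commute)
        then have "\<Phi> u = 0" using mult(4) by blast
        then show ?thesis by (simp add: \<Phi>_cmult)
      qed (simp add: family_integral_def)
    qed
  next
    case (add u v)
    show ?case
    proof (intro allI impI)
      fix b assume b: "\<forall>t. \<bar>t\<bar> \<le> R \<longrightarrow> \<bar>v t + u t\<bar> \<le> b"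
      have ub: "\<forall>t. \<bar>t\<bar> \<le> R \<longrightarrow> \<bar>u t\<bar> \<le> b" and vb: "\<forall>t. \<bar>t\<bar> \<le> R \<longrightarrow> \<bar>v t\<bar> \<le> b"
        using add(2,5) b by (smt (verit))+
      have "\<Phi> (\<lambda>t. v t + u t) = \<Phi> v + \<Phi> u"
        proof (rule \<Phi>_add)
        show "v \<in> borel_measurable borel" "u \<in> borel_measurable borel" by fact+
        show "\<bar>v t\<bar> \<le> b" "\<bar>u t\<bar> \<le> b" if "\<bar>t\<bar> \<le> R" for t using vb ub that by blast+
      qed
      moreover have "\<Phi> u = 0" "\<Phi> v = 0" using add(3,7) ub vb by blast+
      ultimately show "\<Phi> (\<lambda>t. v t + u t) = 0" by simp
    qed
  next
    case (seq U)
    show ?case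
    proof (intro allI impI)
      fix b assume *: "\<forall>t. \<bar>t\<bar> \<le> R \<longrightarrow> \<bar>u t\<bar> \<le> b"
      have le: "U i t \<le> u t" for i t
        using seq(4) seq(5)[of t] by (intro incseq_le[of "\<lambda>i. U i t"]) (auto simp: incseq_def le_fun_def)
      have Ub: "\<forall>t. \<bar>t\<bar> \<le> R \<longrightarrow> \<bar>U i t\<bar> \<le> b" for i
        using * le[of i] seq(2)[of i] by (smt (verit))
      have "(\<lambda>i. \<Phi> (U i)) \<longlonglongrightarrow> \<Phi> u"
        proof (rule \<Phi>_limit)
        show "U i \<in> borel_measurable borel" for i by fact
        show "u \<in> borel_measurable borel" by fact
        show "\<bar>U i t\<bar> \<le> b" if "\<bar>t\<bar> \<le> R" for i t using Ub that by blast
        show "(\<lambda>i. U i t) \<longlonglongrightarrow> u t" for t using seq(5) by simp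
      qed
      moreover have "\<Phi> (U i) = 0" for i
        using Ub[of i] seq(3)[of i] by blast
      ultimately show "\<Phi> u = 0" by (simp add: LIMSEQ_const_iff)
    qed
  qed
  have part: "\<Phi> (\<lambda>t. max 0 (g t)) = 0"
    if g: "g \<in> borel_measurable borel" "\<And>t. \<bar>t\<bar> \<le> R \<Longrightarrow> \<bar>g t\<bar> \<le> b" for g
  proof -
    have "(\<lambda>t. max 0 (g t)) \<in> borel_measurable borel" using g(1) by simp
    moreover have "\<bar>max 0 (g t)\<bar> \<le> b" if "\<bar>t\<bar> \<le> R" for t using g(2)[OF that] by linarith
    ultimately show ?thesis using pos[of "\<lambda>t. max 0 (g t)"] by (metis max.cobounded1)
  qed
  have "\<Phi> (\<lambda>t. max 0 (f t)) = 0" by (rule part) (fact f, fact b)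
  moreover have "\<Phi> (\<lambda>t. max 0 (- f t)) = 0" by (rule part) (use f b in auto)
  moreover have "\<Phi> (\<lambda>t. max 0 (f t) + (-1) * max 0 (- f t)) = \<Phi> (\<lambda>t. max 0 (f t)) + \<Phi> (\<lambda>t. (-1) * max 0 (- f t))"
  proof (rule \<Phi>_add[where b = b and b' = b])
    show "\<bar>max 0 (f t)\<bar> \<le> b" "\<bar>(-1) * max 0 (- f t)\<bar> \<le> b" if "\<bar>t\<bar> \<le> R" for t
      using b[OF that] by (auto simp: max_def)
  qed (use f in auto)
  moreover have "(\<lambda>t. max 0 (f t) + (-1) * max 0 (- f t)) = f"
  proof
    fix t show "max 0 (f t) + (-1) * max 0 (- f t) = f t" by (cases "0 \<le> f t") simp_all
  qed
  moreover have "\<Phi> (\<lambda>t. (-1) * max 0 (- f t)) = (-1) * \<Phi> (\<lambda>t. max 0 (- f t))" by (rule \<Phi>_cmult)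
  ultimately show ?thesis by (metis add.right_neutral mult_zero_right)
qed

lemma moments_vanish_imp_bounded:
  assumes "\<And>k. \<Phi> (\<lambda>t. t ^ k) = 0" and "f \<in> borel_measurable borel" and "\<And>t. \<bar>t\<bar> \<le> R \<Longrightarrow> \<bar>f t\<bar> \<le> b"
  shows "\<Phi> f = 0"
  using sets_vanish_imp_bounded[OF moments_vanish_imp_sets[OF assms(1)] assms(2,3)] by simp

end

lemma measures_eqI_moments:
  fixes M N :: "real measure"
  assumes M: "finite_measure M" "sets M = sets borel" "AE t in M. \<bar>t\<bar> \<le> R"
    and N: "finite_measure N" "sets N = sets borel" "AE t in N. \<bar>t\<bar> \<le> R"
    and mom: "\<And>k. (\<integral>t. t ^ k \<partial>M) = (\<integral>t. t ^ k \<partial>N)"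
  shows "M = N"
proof -
  interpret M: finite_measure M by fact
  interpret N: finite_measure N by fact
  interpret signed_family "{False, True}" "\<lambda>i. if i then M else N" "\<lambda>i t. if i then 1 else -1" R 1
    by (rule signed_family.intro) (use M N in \<open>auto\<close>)
  have "\<Phi> (indicator B) = 0" if "B \<in> sets borel" for B
    using that by (rule moments_vanish_imp_sets[rotated]) (simp add: family_integral_def mom)
  then have *: "measure M B = measure N B" if "B \<in> sets borel" for B
    using that M(2) N(2) by (fastforce simp: family_integral_def)
  show ?thesis
    by (rule measure_eqI) (use * M(2) N(2) in \<open>auto simp: M.emeasure_eq_measure N.emeasure_eq_measure\<close>)
qed

section \<open>The Hausdorff moment problem\<close>

text \<open>
  Weak convergence only tests bounded continuous functions; the uniform support makes the clamped
  power, which is one of these, agree with the power.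
\<close>

lemma moment_limit:
  fixes M :: "nat \<Rightarrow> real measure"
  assumes M: "\<And>n. real_distribution (M n)" and supp: "\<And>n. AE t in M n. \<bar>t\<bar> \<le> R"
    and mom: "\<And>k. (\<lambda>n. \<integral>t. t ^ k \<partial>M n) \<longlonglongrightarrow> m k"
    and N: "real_distribution N" and conv: "weak_conv_m M N"
  shows "AE t in N. \<bar>t\<bar> \<le> R" and "(\<integral>t. t ^ k \<partial>N) = m k"
proof -
  interpret M: real_distribution "M n" for n by (rule M)
  interpret N: real_distribution N by (rule N)
  note weak = weak_conv_imp_integral_bdd_continuous_conv[OF M N conv]
  define f where "f t = min 1 (max 0 (\<bar>t\<bar> - R))" for t :: real
  have f_cont: "isCont f t" for t
    unfolding f_def by (intro continuous_intros)
  have f_bound: "norm (f t) \<le> 1" for t by (simp add: f_def)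
  have f_borel[measurable]: "f \<in> borel_measurable borel" unfolding f_def by measurable
  have "(\<lambda>n. integral\<^sup>L (M n) f) \<longlonglongrightarrow> integral\<^sup>L N f" by (rule weak[OF f_cont f_bound])
  moreover have "integral\<^sup>L (M n) f = 0" for n
  proof -
    have "AE t in M n. f t = 0" using supp[of n] by eventually_elim (simp add: f_def)
    then show ?thesis by (rule integral_eq_zero_AE)
  qed
  ultimately have "integral\<^sup>L N f = 0" by (simp add: LIMSEQ_const_iff)
  moreover have "integrable N f" by (rule N.integrable_const_bound[of _ 1]) (use f_bound in auto)
  ultimately have "AE t in N. f t = 0"
    by (subst (asm) integral_nonneg_eq_0_iff_AE) (auto simp: f_def)
  then show supp_N: "AE t in N. \<bar>t\<bar> \<le> R"
    by eventually_elim (auto simp: f_def min_def max_def split: if_splits)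
  define h where "h t = (max (-R) (min R t)) ^ k" for t :: real
  have h_cont: "isCont h t" for t
    unfolding h_def by (intro continuous_intros)
  have h_bound: "norm (h t) \<le> \<bar>R\<bar> ^ k" for t
    unfolding h_def real_norm_def power_abs by (rule power_mono) auto
  have h_borel[measurable]: "h \<in> borel_measurable borel" unfolding h_def by measurable
  have h_eq: "h t = t ^ k" if "\<bar>t\<bar> \<le> R" for t
  proof -
    have "max (-R) (min R t) = t" using that by linarith
    then show ?thesis by (simp add: h_def)
  qed
  have "(\<lambda>n. integral\<^sup>L (M n) h) \<longlonglongrightarrow> integral\<^sup>L N h" by (rule weak[OF h_cont h_bound])
  moreover have "integral\<^sup>L (M n) h = (\<integral>t. t ^ k \<partial>M n)" for n
  proof (rule integral_cong_AE)
    show "AE t in M n. h t = t ^ k" using supp[of n] by eventually_elim (rule h_eq)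
  qed auto
  moreover have "integral\<^sup>L N h = (\<integral>t. t ^ k \<partial>N)"
  proof (rule integral_cong_AE)
    show "AE t in N. h t = t ^ k" using supp_N by eventually_elim (rule h_eq)
  qed auto
  ultimately show "(\<integral>t. t ^ k \<partial>N) = m k" using mom[of k] LIMSEQ_unique by fastforce
qed

text \<open>
  A common compact support gives tightness, so every subsequence has a weakly convergent
  subsubsequence; all limit points have the same moments and coincide.
\<close>

theorem method_of_moments:
  fixes M :: "nat \<Rightarrow> real measure"
  assumes M: "\<And>n. real_distribution (M n)" and supp: "\<And>n. AE t in M n. \<bar>t\<bar> \<le> R"
    and mom: "\<And>k. (\<lambda>n. \<integral>t. t ^ k \<partial>M n) \<longlonglongrightarrow> m k"
  obtains N where "real_distribution N" "AE t in N. \<bar>t\<bar> \<le> R" "\<And>k. (\<integral>t. t ^ k \<partial>N) = m k" "weak_conv_m M N"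
proof -
  have tight: "tight M"
    unfolding tight_def
  proof (intro conjI allI impI M)
    fix e :: real assume e: "0 < e"
    have "measure (M n) {-\<bar>R\<bar> - 1<..\<bar>R\<bar> + 1} = 1" for n
    proof -
      interpret real_distribution "M n" by (rule M)
      have "AE t in M n. t \<in> {-\<bar>R\<bar> - 1<..\<bar>R\<bar> + 1}" using supp[of n] by eventually_elim auto
      then show ?thesis by (subst prob_eq_1) auto
    qed
    then show "\<exists>a b. a < b \<and> (\<forall>n. measure (M n) {a<..b} > 1 - e)"
      using e by (intro exI[of _ "-\<bar>R\<bar> - 1"] exI[of _ "\<bar>R\<bar> + 1"]) auto
  qed
  have sub: "(AE t in N. \<bar>t\<bar> \<le> R) \<and> (\<forall>k. (\<integral>t. t ^ k \<partial>N) = m k)"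
    if "strict_mono s" "real_distribution N" "weak_conv_m (M \<circ> s) N" for s N
  proof -
    have "(\<lambda>n. \<integral>t. t ^ k \<partial>(M \<circ> s) n) \<longlonglongrightarrow> m k" for k
      using LIMSEQ_subseq_LIMSEQ[OF mom that(1), of k] by (simp add: o_def)
    moreover have "real_distribution ((M \<circ> s) n)" "AE t in (M \<circ> s) n. \<bar>t\<bar> \<le> R" for n
      using M[of "s n"] supp[of "s n"] by (simp_all only: o_apply)
    ultimately show ?thesis using moment_limit[of "M \<circ> s" R m N] that by blast
  qed
  obtain r N where N: "strict_mono (r :: nat \<Rightarrow> nat)" "real_distribution N" "weak_conv_m (M \<circ> id \<circ> r) N"
    using tight_imp_convergent_subsubsequence[OF tight strict_mono_id] by blast
  have NN: "AE t in N. \<bar>t\<bar> \<le> R" "\<And>k. (\<integral>t. t ^ k \<partial>N) = m k"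
    using sub[OF N(1,2)] N(3) by (auto simp: o_def)
  have "weak_conv_m M N"
  proof (rule tight_subseq_weak_converge[OF M N(2) tight])
    fix s \<nu> assume s: "strict_mono s" "real_distribution \<nu>" "weak_conv_m (M \<circ> s) \<nu>"
    interpret \<nu>: real_distribution \<nu> by (rule s(2))
    interpret N: real_distribution N by (rule N(2))
    have "\<nu> = N"
      by (rule measures_eqI_moments[where R = R])
        (use sub[OF s] NN \<nu>.finite_measure_axioms N.finite_measure_axioms in auto)
    then show "weak_conv_m (M \<circ> s) N" using s(3) by simp
  qed
  then show ?thesis using that N(2) NN by blast
qed

text \<open>
  For the moments of a measure \<open>N\<close> this is the integral of \<open>t\<^sup>k (1 - t)\<^sup>l\<close> against \<open>N\<close>; its
  nonnegativity is Hausdorff's condition for the interval \<open>[0, 1]\<close>.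
\<close>

fun moment_difference :: "(nat \<Rightarrow> real) \<Rightarrow> nat \<Rightarrow> nat \<Rightarrow> real" where
  "moment_difference a 0 k = a k"
| "moment_difference a (Suc l) k = moment_difference a l k - moment_difference a l (Suc k)"

lemma sum_choose_Suc:
  fixes x :: "nat \<Rightarrow> real"
  shows "(\<Sum>i\<le>Suc n. real (Suc n choose i) * x i) = (\<Sum>i\<le>n. real (n choose i) * (x i + x (Suc i)))"
proof -
  have "(\<Sum>i\<le>Suc n. real (Suc n choose i) * x i) = x 0 + (\<Sum>i\<le>n. real (Suc n choose Suc i) * x (Suc i))"
    by (subst sum.atMost_Suc_shift) simp
  also have "\<dots> = (x 0 + (\<Sum>i\<le>n. real (n choose Suc i) * x (Suc i))) + (\<Sum>i\<le>n. real (n choose i) * x (Suc i))"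
    by (simp add: sum.distrib distrib_right)
  also have "x 0 + (\<Sum>i\<le>n. real (n choose Suc i) * x (Suc i)) = (\<Sum>i\<le>Suc n. real (n choose i) * x i)"
    by (subst sum.atMost_Suc_shift) simp
  also have "\<dots> = (\<Sum>i\<le>n. real (n choose i) * x i)" by simp
  finally show ?thesis by (simp add: sum.distrib distrib_left)
qed

text \<open>
  The binomial expansion of \<open>1 = (t + (1 - t))\<^sup>n\<close>, at the level of moments.
\<close>

lemma moment_difference_expand:
  "moment_difference a l k = (\<Sum>i\<le>n. real (n choose i) * moment_difference a (l + n - i) (k + i))"
proof (induction n)
  case (Suc n)
  have "moment_difference a l k = (\<Sum>i\<le>n. real (n choose i) *
      (moment_difference a (l + Suc n - i) (k + i) + moment_difference a (l + Suc n - Suc i) (k + Suc i)))"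
    unfolding Suc.IH
  proof (intro sum.cong refl)
    fix i assume "i \<in> {..n}"
    then have "l + Suc n - i = Suc (l + n - i)" by auto
    then show "real (n choose i) * moment_difference a (l + n - i) (k + i) = real (n choose i) *
      (moment_difference a (l + Suc n - i) (k + i) + moment_difference a (l + Suc n - Suc i) (k + Suc i))" by simp
  qed
  then show ?case by (subst sum_choose_Suc) simp
qed simp

text \<open>
  The ratio of binomial coefficients is a product of \<open>j\<close> factors \<open>(k - i)/(N - i)\<close>, each close to
  \<open>k/N\<close>.
\<close>

lemma choose_ratio_close:
  assumes "k \<le> N" "2 * j < N"
  shows "\<bar>real (k choose j) / real (N choose j) - (real k / real N) ^ j\<bar> \<le> real j * (real j / (real N - real j))"
proof -
  have Npos: "real N - real i > 0" if "i < j" for i using assms that by linarith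
  have "real (k choose j) / real (N choose j) = (\<Prod>i=0..<j. (real k - real i) / (real N - real i))"
    by (simp add: binomial_gbinomial gbinomial_prod_rev prod_dividef)
  moreover have "(real k / real N) ^ j = (\<Prod>i=0..<j. real k / real N)" by simp
  moreover have "norm ((\<Prod>i=0..<j. (real k - real i) / (real N - real i)) - (\<Prod>i=0..<j. real k / real N))
      \<le> (\<Sum>i=0..<j. norm ((real k - real i) / (real N - real i) - real k / real N))"
  proof (rule norm_prod_diff)
    fix i assume "i \<in> {0..<j}"
    then have i: "i < j" by simp
    have "\<bar>real k - real i\<bar> \<le> real N - real i" using i assms by linarith
    then show "norm ((real k - real i) / (real N - real i)) \<le> 1"
      using Npos[OF i] by (simp add: abs_divide)
  qed (use assms in auto)
  moreover have "(\<Sum>i=0..<j. norm ((real k - real i) / (real N - real i) - real k / real N))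
      \<le> (\<Sum>i=0..<j. real j / (real N - real j))"
  proof (rule sum_mono)
    fix i assume "i \<in> {0..<j}"
    then have i: "i < j" by simp
    have N0: "real N > 0" using assms by simp
    have "(real k - real i) / (real N - real i) - real k / real N = - (real i * ((real N - real k) / real N)) / (real N - real i)"
      using Npos[OF i] N0 by (simp add: field_simps)
    then have "norm ((real k - real i) / (real N - real i) - real k / real N)
        = real i * ((real N - real k) / real N) / (real N - real i)"
      using Npos[OF i] N0 assms by (simp add: abs_divide abs_mult)
    also have "\<dots> \<le> real j * 1 / (real N - real j)"
      using i assms N0 by (intro frac_le mult_mono) auto
    finally show "norm ((real k - real i) / (real N - real i) - real k / real N) \<le> real j / (real N - real j)" by simp
  qed
  ultimately show ?thesis by simp
qed

text \<open>
  The Bernstein weights \<open>w\<^sub>n\<^sub>k\<close> at the points \<open>k/n\<close> form probability measures. Their factorial moments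
  equal \<open>a\<^sub>j\<close> exactly, and factorial moments differ from ordinary moments by \<open>O(1/n)\<close>, so the method of
  moments produces the measure.
\<close>

theorem hausdorff_moment_problem:
  fixes a :: "nat \<Rightarrow> real"
  assumes pos: "\<And>l k. 0 \<le> moment_difference a l k" and a0: "a 0 = 1"
  obtains N where "real_distribution N" "AE t in N. \<bar>t\<bar> \<le> 1" "\<And>k. (\<integral>t. t ^ k \<partial>N) = a k"
proof -
  define w where "w n k = real (n choose k) * moment_difference a (n - k) k" for n k
  have w0: "0 \<le> w n k" for n k unfolding w_def using pos by simp
  have factorial: "(\<Sum>k\<le>n. w n k * (real (k choose j) / real (n choose j))) = a j" if "j \<le> n" for n j
  proof -
    have "(\<Sum>k\<le>n. w n k * (real (k choose j) / real (n choose j)))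
        = (\<Sum>k\<in>{j..n}. w n k * (real (k choose j) / real (n choose j)))"
      by (rule sum.mono_neutral_right) (auto simp: binomial_eq_0)
    also have "\<dots> = (\<Sum>i\<le>n - j. w n (i + j) * (real ((i + j) choose j) / real (n choose j)))"
      by (rule sum.reindex_bij_witness[of _ "\<lambda>i. i + j" "\<lambda>k. k - j"]) (use that in auto)
    also have "\<dots> = (\<Sum>i\<le>n - j. real ((n - j) choose i) * moment_difference a (0 + (n - j) - i) (j + i))"
    proof (rule sum.cong[OF refl])
      fix i assume "i \<in> {..n - j}"
      then have i: "i + j \<le> n" using that by auto
      have "(n choose (i + j)) * ((i + j) choose j) = (n choose j) * ((n - j) choose i)"
        using choose_mult[of j "i + j" n] i by simp
      then have "real (n choose (i + j)) * real ((i + j) choose j) = real (n choose j) * real ((n - j) choose i)"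
        by (metis of_nat_mult)
      moreover have "real (n choose j) \<noteq> 0" using that by simp
      ultimately have "real (n choose (i + j)) * (real ((i + j) choose j) / real (n choose j)) = real ((n - j) choose i)"
        by (simp add: field_simps)
      then have "real (n choose (i + j)) * (real ((i + j) choose j) / real (n choose j)) * moment_difference a (n - (i + j)) (i + j)
          = real ((n - j) choose i) * moment_difference a (n - (i + j)) (i + j)" by simp
      moreover have "0 + (n - j) - i = n - (i + j)" by simp
      ultimately show "w n (i + j) * (real ((i + j) choose j) / real (n choose j))
          = real ((n - j) choose i) * moment_difference a (0 + (n - j) - i) (j + i)"
        unfolding w_def by (metis add.commute mult.commute mult.left_commute)
    qed
    also have "\<dots> = a j" using moment_difference_expand[of a 0 j "n - j"] by simp
    finally show ?thesis .
  qed
  have total: "(\<Sum>k\<le>n. w n k) = 1" for n using factorial[of 0 n] a0 by simp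
  (* The grid has Suc n intervals, so that its mesh is defined for every n. *)
  define M where "M n = distr (density (count_space {..Suc n}) (\<lambda>k. ennreal (w (Suc n) k))) borel (\<lambda>k. real k / real (Suc n))" for n
  have integral_M: "integral\<^sup>L (M n) f = (\<Sum>k\<le>Suc n. w (Suc n) k * f (real k / real (Suc n)))"
    if [measurable]: "f \<in> borel_measurable borel" for f :: "real \<Rightarrow> real" and n
    unfolding M_def
    by (subst integral_distr, simp, simp, subst integral_density)
      (auto simp: w0 lebesgue_integral_count_space_finite)
  have prob: "real_distribution (M n)" for n
  proof -
    have "emeasure (M n) (space (M n)) = (\<Sum>k\<le>Suc n. ennreal (w (Suc n) k))"
      unfolding M_def by (subst emeasure_distr) (auto simp: emeasure_density nn_integral_count_space_finite)
    also have "\<dots> = 1" using total[of "Suc n"] w0 by (subst sum_ennreal) auto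
    finally have "prob_space (M n)" by (rule prob_spaceI)
    then show ?thesis unfolding real_distribution_def real_distribution_axioms_def by (simp add: M_def)
  qed
  have supp: "AE t in M n. \<bar>t\<bar> \<le> 1" for n
    unfolding M_def by (subst AE_distr_iff) (auto simp: AE_density AE_count_space divide_simps)
  have mom: "(\<lambda>n. \<integral>t. t ^ j \<partial>M n) \<longlonglongrightarrow> a j" for j
  proof (rule LIM_zero_cancel, rule Lim_null_comparison)
    show "\<forall>\<^sub>F n in sequentially. norm ((\<integral>t. t ^ j \<partial>M n) - a j) \<le> real j * (real j / (real (Suc n) - real j))"
    proof (rule eventually_sequentiallyI[of "2 * j"])
      fix n assume n: "2 * j \<le> n"
      let ?r = "\<lambda>k. real (k choose j) / real (Suc n choose j)" and ?p = "\<lambda>k. (real k / real (Suc n)) ^ j"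
      have "(\<integral>t. t ^ j \<partial>M n) - a j = (\<Sum>k\<le>Suc n. w (Suc n) k * ?p k) - (\<Sum>k\<le>Suc n. w (Suc n) k * ?r k)"
        using n by (subst factorial) (auto simp: integral_M)
      also have "\<dots> = (\<Sum>k\<le>Suc n. w (Suc n) k * (?p k - ?r k))"
        by (simp only: sum_subtractf right_diff_distrib)
      also have "norm \<dots> \<le> (\<Sum>k\<le>Suc n. w (Suc n) k * (real j * (real j / (real (Suc n) - real j))))"
      proof (rule sum_norm_le)
        fix k assume "k \<in> {..Suc n}"
        then have "\<bar>?r k - ?p k\<bar> \<le> real j * (real j / (real (Suc n) - real j))"
          using n by (intro choose_ratio_close) auto
        then show "norm (w (Suc n) k * (?p k - ?r k)) \<le> w (Suc n) k * (real j * (real j / (real (Suc n) - real j)))"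
          using w0 unfolding real_norm_def abs_mult by (intro mult_mono) (auto simp: abs_minus_commute)
      qed
      also have "\<dots> = real j * (real j / (real (Suc n) - real j))"
        by (simp only: sum_distrib_right[symmetric] total mult_1)
      finally show "norm ((\<integral>t. t ^ j \<partial>M n) - a j) \<le> real j * (real j / (real (Suc n) - real j))" .
    qed
    show "(\<lambda>n. real j * (real j / (real (Suc n) - real j))) \<longlonglongrightarrow> 0" by real_asymp
  qed
  from method_of_moments[OF prob supp mom] that show ?thesis by metis
qed

section \<open>Spectral measures of a bounded symmetric operator\<close>

text \<open>
  Boundedness is the form bound \<open>-R \<le> A \<le> R\<close>. The construction of spectral measures uses only the inner
  products \<open>\<langle>u, A\<^sup>k u\<rangle>\<close>, so it takes place in an arbitrary real inner product space.
\<close>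

locale bounded_symmetric =
  fixes A :: "'h::real_inner \<Rightarrow> 'h" and R :: real
  assumes linear_op: "linear A"
    and symmetric: "inner (A u) v = inner u (A v)"
    and bounded: "\<bar>inner u (A u)\<bar> \<le> R * inner u u"
    and R_pos: "0 < R"
begin

lemma linear_pow: "linear (A ^^ k)"
proof (induction k)
  case 0
  then show ?case by (simp add: linear_id flip: id_def)
next
  case (Suc k)
  then show ?case using linear_compose[OF Suc linear_op] by (simp add: o_def)
qed

lemma symmetric_pow: "inner ((A ^^ k) u) v = inner u ((A ^^ k) v)"
  by (induction k arbitrary: u v) (simp_all add: symmetric funpow_swap1)

lemma pow_add: "(A ^^ k) ((A ^^ l) u) = (A ^^ (k + l)) u"
  by (simp add: funpow_add)

text \<open>
  The affine rescaling of \<open>A\<close> to an operator between 0 and 1, and its complement.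
\<close>

definition T :: "'h \<Rightarrow> 'h" where "T u = (1 / (2 * R)) *\<^sub>R (A u + R *\<^sub>R u)"
definition S :: "'h \<Rightarrow> 'h" where "S u = u - T u"

lemma linear_T: "linear T" and linear_S: "linear S"
proof -
  show T: "linear T"
    by (rule linearI) (simp_all add: T_def linear_add[OF linear_op] linear_scale[OF linear_op] algebra_simps)
  show "linear S"
    by (rule linearI) (simp_all add: S_def linear_add[OF T] linear_scale[OF T] algebra_simps)
qed

lemma symmetric_T: "inner (T u) v = inner u (T v)"
  by (simp add: T_def inner_left_distrib inner_right_distrib symmetric)

lemma symmetric_S: "inner (S u) v = inner u (S v)"
  by (simp add: S_def inner_diff_left inner_diff_right symmetric_T)

lemma T_S_commute: "T (S u) = S (T u)"
  by (simp add: S_def linear_diff[OF linear_T])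

lemma pow_T_S_commute: "(T ^^ k) (S u) = S ((T ^^ k) u)" "(S ^^ k) (T u) = T ((S ^^ k) u)"
  by (induction k) (simp_all add: T_S_commute)

lemma linear_T_pow: "linear (T ^^ k)"
proof (induction k)
  case 0
  then show ?case by (simp add: linear_id flip: id_def)
next
  case (Suc k)
  then show ?case using linear_compose[OF Suc linear_T] by (simp add: o_def)
qed

lemma T_nonneg: "0 \<le> inner u (T u)" and S_nonneg: "0 \<le> inner u (S u)"
proof -
  have b: "inner u (A u) \<le> R * inner u u" "- (R * inner u u) \<le> inner u (A u)"
    using bounded[of u] by linarith+
  have e: "inner u (T u) = (inner u (A u) + R * inner u u) / (2 * R)"
    by (simp add: T_def inner_right_distrib)
  show "0 \<le> inner u (T u)" unfolding e using b R_pos by simp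
  have "inner u (T u) \<le> inner u u" unfolding e using b R_pos by (simp add: divide_le_eq)
  then show "0 \<le> inner u (S u)" by (simp add: S_def inner_diff_right)
qed

text \<open>
  Pairs of equal factors move to the other side of the inner product by symmetry. The remaining
  mixed case is \<open>TS = TST + STS\<close>, which follows from \<open>T + S = 1\<close>.
\<close>

lemma product_nonneg: "0 \<le> inner u ((T ^^ k) ((S ^^ l) u))"
proof (induction "k + l" arbitrary: k l u rule: less_induct)
  case less
  consider k' where "k = Suc (Suc k')" | l' where "l = Suc (Suc l')" | "k \<le> 1" "l \<le> 1"
    by (metis One_nat_def not_less_eq_eq old.nat.exhaust zero_le)
  then show ?case
  proof cases
    case 1
    have "inner u ((T ^^ k) ((S ^^ l) u)) = inner (T u) ((T ^^ k') ((S ^^ l) (T u)))"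
      unfolding 1 by (simp add: symmetric_T pow_T_S_commute flip: funpow_swap1)
    then show ?thesis using less[of k' l "T u"] 1 by simp
  next
    case 2
    have "inner u ((T ^^ k) ((S ^^ l) u)) = inner (S u) ((T ^^ k) ((S ^^ l') (S u)))"
      unfolding 2 by (simp add: symmetric_S pow_T_S_commute flip: funpow_swap1)
    then show ?thesis using less[of k l' "S u"] 2 by simp
  next
    case 3
    have "inner u (T (S u)) = inner (T u) (S (T u)) + inner (S u) (T (S u))"
    proof -
      have "u = T u + S u" by (simp add: S_def)
      then have "inner u (T (S u)) = inner (T u + S u) (T (S u))" by metis
      then show ?thesis by (simp add: inner_add_left T_S_commute)
    qed
    then have "0 \<le> inner u (T (S u))" using T_nonneg[of "S u"] S_nonneg[of "T u"] by simp
    with 3 T_nonneg S_nonneg show ?thesis by (auto simp: le_Suc_eq)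
  qed
qed

lemma moment_difference_T:
  "moment_difference (\<lambda>j. inner u ((T ^^ j) u)) l k = inner u ((T ^^ k) ((S ^^ l) u))"
proof (induction l arbitrary: k)
  case (Suc l)
  have "(T ^^ k) ((S ^^ Suc l) u) = (T ^^ k) ((S ^^ l) u) - (T ^^ Suc k) ((S ^^ l) u)"
    unfolding funpow.simps o_apply by (subst S_def) (simp add: linear_diff[OF linear_T_pow] funpow_swap1)
  then show ?case using Suc by (simp add: inner_diff_right)
qed simp

text \<open>
  Hausdorff's theorem for \<open>T\<close>, transported by \<open>t \<mapsto> 2Rt - R\<close>. A measure supported in \<open>[-1, 1]\<close>
  is mapped into \<open>[-3R, 3R]\<close>, which explains the constant 3 in the supports below.
\<close>

lemma ex_unit_spectral_measure:
  assumes u: "inner u u = 1"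
  obtains N where "real_distribution N" "AE t in N. \<bar>t\<bar> \<le> 3 * R" "\<And>k. (\<integral>t. t ^ k \<partial>N) = inner u ((A ^^ k) u)"
proof -
  have "\<And>l k. 0 \<le> moment_difference (\<lambda>j. inner u ((T ^^ j) u)) l k"
    unfolding moment_difference_T by (rule product_nonneg)
  moreover have "inner u ((T ^^ 0) u) = 1" using u by simp
  ultimately obtain N where N: "real_distribution N" "AE t in N. \<bar>t\<bar> \<le> 1"
      "\<And>k. (\<integral>t. t ^ k \<partial>N) = inner u ((T ^^ k) u)"
    using hausdorff_moment_problem[of "\<lambda>j. inner u ((T ^^ j) u)"] by metis
  interpret N: real_distribution N by (rule N(1))
  let ?\<phi> = "\<lambda>t. 2 * R * t - R"
  have int: "integrable N (\<lambda>t. t ^ j * ?\<phi> t ^ k)" for j k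
  proof (rule N.integrable_const_bound)
    show "AE t in N. norm (t ^ j * ?\<phi> t ^ k) \<le> (3 * R) ^ k"
      using N(2)
    proof eventually_elim
      case (elim t)
      have "2 * R * \<bar>t\<bar> \<le> 2 * R" using elim R_pos by simp
      then have "\<bar>2 * R * t\<bar> \<le> 2 * R" using R_pos by (simp add: abs_mult)
      then have "\<bar>?\<phi> t\<bar> \<le> 3 * R" using R_pos by linarith
      then have "\<bar>t\<bar> ^ j * \<bar>?\<phi> t\<bar> ^ k \<le> 1 * (3 * R) ^ k"
        using elim R_pos by (intro mult_mono power_mono power_le_one) auto
      then show ?case by (simp add: abs_mult power_abs)
    qed
  qed simp
  have A_eq: "A v = (2 * R) *\<^sub>R T v - R *\<^sub>R v" for v
    using R_pos by (simp add: T_def)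
  have mom: "(\<integral>t. t ^ j * ?\<phi> t ^ k \<partial>N) = inner u ((T ^^ j) ((A ^^ k) u))" for j k
  proof (induction k arbitrary: j)
    case 0
    then show ?case using N(3) by simp
  next
    case (Suc k)
    have "(\<integral>t. t ^ j * ?\<phi> t ^ Suc k \<partial>N)
        = (\<integral>t. 2 * R * (t ^ Suc j * ?\<phi> t ^ k) - R * (t ^ j * ?\<phi> t ^ k) \<partial>N)"
      by (rule Bochner_Integration.integral_cong) (simp_all add: algebra_simps)
    also have "\<dots> = 2 * R * inner u ((T ^^ Suc j) ((A ^^ k) u)) - R * inner u ((T ^^ j) ((A ^^ k) u))"
      by (subst Bochner_Integration.integral_diff) (use int[of "Suc j" k] int[of j k] in \<open>simp_all only: Suc integral_mult_right_zero integrable_mult_right\<close>)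
    also have "\<dots> = inner u ((T ^^ j) ((A ^^ Suc k) u))"
      by (simp add: A_eq linear_diff[OF linear_T_pow] linear_scale[OF linear_T_pow] inner_diff_right flip: funpow_swap1)
    finally show ?case .
  qed
  show ?thesis
  proof (rule that[of "distr N borel ?\<phi>"])
    show "real_distribution (distr N borel ?\<phi>)"
      by (rule N.real_distribution_distr) simp
    show "AE t in distr N borel ?\<phi>. \<bar>t\<bar> \<le> 3 * R"
    proof (subst AE_distr_iff)
      show "AE t in N. \<bar>?\<phi> t\<bar> \<le> 3 * R" using N(2)
      proof eventually_elim
        case (elim t)
        have "2 * R * \<bar>t\<bar> \<le> 2 * R" using elim R_pos by simp
        then have "\<bar>2 * R * t\<bar> \<le> 2 * R" using R_pos by (simp add: abs_mult)
        then show ?case using R_pos by linarith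
      qed
    qed simp_all
    show "(\<integral>t. t ^ k \<partial>distr N borel ?\<phi>) = inner u ((A ^^ k) u)" for k
      using mom[of 0 k] by (subst integral_distr) simp_all
  qed
qed

definition is_spectral :: "'h \<Rightarrow> real measure \<Rightarrow> bool" where
  "is_spectral u N \<longleftrightarrow> finite_measure N \<and> sets N = sets borel \<and> (AE t in N. \<bar>t\<bar> \<le> 3 * R) \<and>
     (\<forall>k. (\<integral>t. t ^ k \<partial>N) = inner u ((A ^^ k) u))"

lemma ex_spectral: "\<exists>N. is_spectral u N"
proof (cases "u = 0")
  case True
  have "(A ^^ k) 0 = 0" for k by (rule linear_0[OF linear_pow])
  moreover have "AE t in null_measure borel. \<bar>t\<bar> \<le> 3 * R" by (simp add: AE_iff_null null_sets_def)
  moreover have "finite_measure (null_measure borel :: real measure)" by (rule finite_measureI) simp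
  ultimately have "is_spectral u (null_measure borel)" using True by (simp add: is_spectral_def integral_null_measure)
  then show ?thesis ..
next
  case False
  define e where "e = (1 / norm u) *\<^sub>R u"
  have "inner e e = 1" using False by (simp add: e_def dot_square_norm power2_eq_square)
  then obtain N where N: "real_distribution N" "AE t in N. \<bar>t\<bar> \<le> 3 * R" "\<And>k. (\<integral>t. t ^ k \<partial>N) = inner e ((A ^^ k) e)"
    using ex_unit_spectral_measure[of e] by metis
  interpret N: real_distribution N by (rule N(1))
  let ?c = "(norm u)\<^sup>2"
  let ?D = "density N (\<lambda>_. ennreal ?c)"
  have "inner u ((A ^^ k) u) = ?c * inner e ((A ^^ k) e)" for k
    using False by (simp add: e_def linear_scale[OF linear_pow] power2_eq_square)
  moreover have "(\<integral>t. t ^ k \<partial>?D) = ?c * (\<integral>t. t ^ k \<partial>N)" for k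
    by (subst integral_density) simp_all
  moreover have "finite_measure ?D"
    by (rule finite_measureI) (simp add: emeasure_density N.emeasure_eq_measure ennreal_mult_eq_top_iff)
  moreover have "AE t in ?D. \<bar>t\<bar> \<le> 3 * R"
    using N(2) by (subst AE_density) auto
  ultimately have "is_spectral u ?D" using N(3) by (simp add: is_spectral_def)
  then show ?thesis ..
qed

definition spectral :: "'h \<Rightarrow> real measure" where "spectral u = (SOME N. is_spectral u N)"

lemma spectral: "is_spectral u (spectral u)"
  unfolding spectral_def by (rule someI_ex) (rule ex_spectral)

lemma finite_spectral: "finite_measure (spectral u)"
  and sets_spectral [measurable_cong, simp]: "sets (spectral u) = sets borel"
  and support_spectral: "AE t in spectral u. \<bar>t\<bar> \<le> 3 * R"
  and moment_spectral: "(\<integral>t. t ^ k \<partial>spectral u) = inner u ((A ^^ k) u)"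
  using spectral[of u] by (auto simp: is_spectral_def)

lemma space_spectral [simp]: "space (spectral u) = UNIV"
  using sets_eq_imp_space_eq[OF sets_spectral[of u]] by simp

lemma spectral_eqI:
  assumes "finite_measure N" "sets N = sets borel" "AE t in N. \<bar>t\<bar> \<le> R'"
    and "\<And>k. (\<integral>t. t ^ k \<partial>N) = inner u ((A ^^ k) u)"
  shows "N = spectral u"
proof (rule measures_eqI_moments[where R = "max R' (3 * R)"])
  show "AE t in N. \<bar>t\<bar> \<le> max R' (3 * R)" using assms(3) by eventually_elim auto
  show "AE t in spectral u. \<bar>t\<bar> \<le> max R' (3 * R)" using support_spectral by eventually_elim auto
qed (use assms finite_spectral moment_spectral in auto)

lemma measure_spectral_UNIV: "measure (spectral u) UNIV = inner u u"
  using moment_spectral[where k = 0 and u = u] by simp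

lemma measure_spectral_le: "measure (spectral u) B \<le> inner u u"
  using finite_measure.bounded_measure[OF finite_spectral[of u], of B] measure_spectral_UNIV[of u] by simp

text \<open>
  A linear relation between spectral measures holds for bounded functions as soon as it holds for
  powers. Every algebraic identity of the functional calculus is obtained from this.
\<close>

lemma combination_zero:
  fixes v :: "'i \<Rightarrow> 'h"
  assumes I: "finite I" and h: "\<And>i. i \<in> I \<Longrightarrow> h i \<in> borel_measurable borel"
    and hb: "\<And>i t. i \<in> I \<Longrightarrow> \<bar>t\<bar> \<le> 3 * R \<Longrightarrow> \<bar>h i t\<bar> \<le> c"
    and mom: "\<And>k. (\<Sum>i\<in>I. \<integral>t. t ^ k * h i t \<partial>spectral (v i)) = 0"
    and f: "f \<in> borel_measurable borel" and fb: "\<And>t. \<bar>t\<bar> \<le> 3 * R \<Longrightarrow> \<bar>f t\<bar> \<le> b"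
  shows "(\<Sum>i\<in>I. \<integral>t. f t * h i t \<partial>spectral (v i)) = 0"
proof -
  interpret signed_family I "\<lambda>i. spectral (v i)" h "3 * R" c
    by (rule signed_family.intro) (use I h hb finite_spectral support_spectral in auto)
  show ?thesis using moments_vanish_imp_bounded[OF _ f fb] mom by (simp add: family_integral_def)
qed

lemma integrable_spectral:
  assumes "f \<in> borel_measurable borel" "\<And>t. \<bar>t\<bar> \<le> 3 * R \<Longrightarrow> \<bar>f t\<bar> \<le> (b::real)"
  shows "integrable (spectral u) f"
proof -
  interpret finite_measure "spectral u" by (rule finite_spectral)
  show ?thesis
    by (rule integrable_const_bound[of _ b])
      (use support_spectral[of u] assms in \<open>auto elim: eventually_mono\<close>)
qed

text \<open>
  The form \<open>\<langle>v, f(A) u\<rangle>\<close>, before \<open>f(A)\<close> is available, by polarisation of the spectral measures.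
\<close>

definition polar :: "(real \<Rightarrow> real) \<Rightarrow> 'h \<Rightarrow> 'h \<Rightarrow> real" where
  "polar f v u = ((\<integral>t. f t \<partial>spectral (v + u)) - (\<integral>t. f t \<partial>spectral (v - u))) / 4"

lemma polar_moment: "polar (\<lambda>t. t ^ k) v u = inner v ((A ^^ k) u)"
proof -
  have "inner u ((A ^^ k) v) = inner v ((A ^^ k) u)" by (metis inner_commute symmetric_pow)
  then show ?thesis
    by (simp add: polar_def moment_spectral linear_add[OF linear_pow] linear_diff[OF linear_pow]
        inner_add_left inner_add_right inner_diff_left inner_diff_right)
qed

text \<open>
  Functions for which \<open>polar\<close> is meaningful: boundedness is asked only on the interval carrying the
  spectral measures, so that powers are included.
\<close>

definition tame :: "(real \<Rightarrow> real) \<Rightarrow> bool" where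
  "tame f \<longleftrightarrow> f \<in> borel_measurable borel \<and> (\<exists>b. \<forall>t. \<bar>t\<bar> \<le> 3 * R \<longrightarrow> \<bar>f t\<bar> \<le> b)"

lemma tame_mult: "tame f \<Longrightarrow> tame g \<Longrightarrow> tame (\<lambda>t. f t * g t)"
  unfolding tame_def
proof (elim conjE exE, intro conjI)
  fix b c assume "\<forall>t. \<bar>t\<bar> \<le> 3 * R \<longrightarrow> \<bar>f t\<bar> \<le> b" "\<forall>t. \<bar>t\<bar> \<le> 3 * R \<longrightarrow> \<bar>g t\<bar> \<le> c"
  then show "\<exists>b. \<forall>t. \<bar>t\<bar> \<le> 3 * R \<longrightarrow> \<bar>f t * g t\<bar> \<le> b"
    by (intro exI[of _ "b * c"]) (auto simp: abs_mult intro!: mult_mono intro: order_trans[OF abs_ge_zero])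
qed simp

lemma tame_power: "tame (\<lambda>t. t ^ k)"
  unfolding tame_def by (auto simp: power_abs intro!: exI[of _ "(3 * R) ^ k"] power_mono)

lemma tame_indicator: "B \<in> sets borel \<Longrightarrow> tame (indicator B)"
  unfolding tame_def by (auto simp: indicator_def intro!: exI[of _ 1])

lemma tame_const: "tame (\<lambda>t. c)"
  unfolding tame_def by auto

text \<open>
  The form version of \<open>combination_zero\<close>; the index set is doubled to hold both terms of the
  polarisation.
\<close>

lemma polar_combination:
  fixes v u :: "'i \<Rightarrow> 'h" and h :: "'i \<Rightarrow> real \<Rightarrow> real"
  assumes I: "finite I" and h: "\<And>i. i \<in> I \<Longrightarrow> tame (h i)"
    and mom: "\<And>k. (\<Sum>i\<in>I. polar (\<lambda>t. t ^ k * h i t) (v i) (u i)) = 0"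
    and f: "tame f"
  shows "(\<Sum>i\<in>I. polar (\<lambda>t. f t * h i t) (v i) (u i)) = 0"
proof -
  from h obtain c where c: "\<And>i t. i \<in> I \<Longrightarrow> \<bar>t\<bar> \<le> 3 * R \<Longrightarrow> \<bar>h i t\<bar> \<le> c i"
    unfolding tame_def by metis
  have cb: "\<bar>h i t\<bar> \<le> (\<Sum>i\<in>I. \<bar>c i\<bar>)" if "i \<in> I" "\<bar>t\<bar> \<le> 3 * R" for i t
  proof -
    have "\<bar>h i t\<bar> \<le> \<bar>c i\<bar>" using c[OF that] by linarith
    also have "\<dots> \<le> (\<Sum>i\<in>I. \<bar>c i\<bar>)" using that I by (intro member_le_sum) auto
    finally show ?thesis .
  qed
  let ?J = "I \<times> {True, False}"
  let ?h = "\<lambda>p t. (if snd p then 1 / 4 else - 1 / 4) * h (fst p) t"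
  let ?v = "\<lambda>p. if snd p then v (fst p) + u (fst p) else v (fst p) - u (fst p)"
  have eq: "(\<Sum>p\<in>?J. \<integral>t. g t * ?h p t \<partial>spectral (?v p)) = (\<Sum>i\<in>I. polar (\<lambda>t. g t * h i t) (v i) (u i))"
    (is "?L = _") for g
  proof -
    have "?L = (\<Sum>i\<in>I. \<Sum>s\<in>{True, False}. \<integral>t. g t * ?h (i, s) t \<partial>spectral (?v (i, s)))"
      by (subst sum.cartesian_product) (simp add: case_prod_unfold cong: if_cong)
    also have "\<dots> = (\<Sum>i\<in>I. polar (\<lambda>t. g t * h i t) (v i) (u i))"
    proof (rule sum.cong[OF refl])
      fix i assume "i \<in> I"
      have 1: "(\<lambda>t. g t * (a * h i t)) = (\<lambda>t. a * (g t * h i t))" for a by (simp add: fun_eq_iff)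
      show "(\<Sum>s\<in>{True, False}. \<integral>t. g t * ?h (i, s) t \<partial>spectral (?v (i, s))) = polar (\<lambda>t. g t * h i t) (v i) (u i)"
        by (simp add: polar_def 1 diff_divide_distrib del: times_divide_eq_left times_divide_eq_right)
    qed
    finally show ?thesis .
  qed
  obtain b where b: "\<forall>t. \<bar>t\<bar> \<le> 3 * R \<longrightarrow> \<bar>f t\<bar> \<le> b" and fm: "f \<in> borel_measurable borel"
    using f unfolding tame_def by (elim conjE exE)
  have "(\<Sum>p\<in>?J. \<integral>t. f t * ?h p t \<partial>spectral (?v p)) = 0"
  proof (rule combination_zero[where I = ?J and h = ?h and v = ?v and f = f and b = b])
    show "finite ?J" using I by simp
    show "f \<in> borel_measurable borel" by (rule fm)
    show "\<bar>f t\<bar> \<le> b" if "\<bar>t\<bar> \<le> 3 * R" for t using b that by simp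
    show "?h p \<in> borel_measurable borel" if "p \<in> ?J" for p using h[of "fst p"] that by (auto simp: tame_def)
    show "(\<Sum>p\<in>?J. \<integral>t. t ^ k * ?h p t \<partial>spectral (?v p)) = 0" for k
      unfolding eq using mom by simp
    show "\<bar>?h p t\<bar> \<le> (\<Sum>i\<in>I. \<bar>c i\<bar>)" if "p \<in> ?J" "\<bar>t\<bar> \<le> 3 * R" for p t
      using cb[of "fst p" t] that by (auto simp: abs_mult)
  qed
  then show ?thesis unfolding eq .
qed

end

section \<open>Spectral projections and their uniqueness\<close>

context bounded_symmetric
begin

lemma polar_times_const: "polar (\<lambda>t. f t * c) v u = c * polar f v u"
  by (simp add: polar_def diff_divide_distrib right_diff_distrib mult.commute)

lemma polar_pow_left:
  assumes f: "tame f"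
  shows "polar f ((A ^^ k) v) u = polar (\<lambda>t. f t * t ^ k) v u"
proof -
  have "(\<Sum>i\<in>{0, 1::nat}. polar (\<lambda>t. f t * (if i = 0 then 1 else - (t ^ k)))
      (if i = 0 then (A ^^ k) v else v) u) = 0"
  proof (rule polar_combination)
    show "tame (\<lambda>t. if i = 0 then 1 else - (t ^ k))" for i :: nat
      using tame_mult[OF tame_const[of "-1"] tame_power[of k]] tame_const[of 1] by (cases "i = 0") simp_all
    show "(\<Sum>i\<in>{0, 1::nat}. polar (\<lambda>t. t ^ j * (if i = 0 then 1 else - (t ^ k)))
      (if i = 0 then (A ^^ k) v else v) u) = 0" for j
    proof -
      have "polar (\<lambda>t. t ^ j * (- (t ^ k))) v u = - polar (\<lambda>t. t ^ (j + k)) v u"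
        using polar_times_const[of "\<lambda>t. t ^ (j + k)" "-1" v u] by (simp add: power_add)
      then show ?thesis by (simp add: polar_moment symmetric_pow pow_add add.commute)
    qed
  qed (use f in auto)
  moreover have "polar (\<lambda>t. f t * (- (t ^ k))) v u = - polar (\<lambda>t. f t * t ^ k) v u"
    using polar_times_const[of "\<lambda>t. f t * t ^ k" "-1" v u] by simp
  ultimately show ?thesis by simp
qed

lemma polar_add_left:
  assumes f: "tame f"
  shows "polar f (v + v') u = polar f v u + polar f v' u"
proof -
  have "(\<Sum>i\<in>{0, 1, 2::nat}. polar (\<lambda>t. f t * (if i = 0 then 1 else -1))
      (if i = 0 then v + v' else if i = 1 then v else v') u) = 0"
  proof (rule polar_combination)
    show "tame (\<lambda>t. if i = 0 then 1 else - 1)" for i :: nat by (rule tame_const)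
  qed (use f in \<open>auto simp: polar_times_const polar_moment inner_add_left simp del: mult_minus_right\<close>)
  then show ?thesis by (simp add: polar_times_const del: mult_minus_right)
qed

lemma polar_scale_left:
  assumes f: "tame f"
  shows "polar f (c *\<^sub>R v) u = c * polar f v u"
proof -
  have "(\<Sum>i\<in>{0, 1::nat}. polar (\<lambda>t. f t * (if i = 0 then 1 else -c))
      (if i = 0 then c *\<^sub>R v else v) u) = 0"
  proof (rule polar_combination)
    show "tame (\<lambda>t. if i = 0 then 1 else - c)" for i :: nat by (rule tame_const)
  qed (use f in \<open>auto simp: polar_times_const polar_moment simp del: mult_minus_right\<close>)
  then show ?thesis by (simp add: polar_times_const del: mult_minus_right)
qed

lemma polar_commute:
  assumes f: "tame f"
  shows "polar f v u = polar f u v"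
proof -
  have sym: "inner v ((A ^^ k) u) = inner u ((A ^^ k) v)" for k by (metis inner_commute symmetric_pow)
  have "(\<Sum>i\<in>{0, 1::nat}. polar (\<lambda>t. f t * (if i = 0 then 1 else -1))
      (if i = 0 then v else u) (if i = 0 then u else v)) = 0"
  proof (rule polar_combination)
    show "tame (\<lambda>t. if i = 0 then 1 else - 1)" for i :: nat by (rule tame_const)
  qed (use f sym in \<open>auto simp: polar_times_const polar_moment simp del: mult_minus_right\<close>)
  then show ?thesis by (simp add: polar_times_const del: mult_minus_right)
qed

lemma polar_diag:
  assumes f: "tame f"
  shows "polar f u u = (\<integral>t. f t \<partial>spectral u)"
proof -
  obtain b where b: "\<forall>t. \<bar>t\<bar> \<le> 3 * R \<longrightarrow> \<bar>f t\<bar> \<le> b" and fm: "f \<in> borel_measurable borel"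
    using f unfolding tame_def by (elim conjE exE)
  have "(\<Sum>i\<in>{0, 1::nat}. \<integral>t. f t * (if i = 0 then 1 else -(c\<^sup>2)) \<partial>spectral (if i = 0 then c *\<^sub>R u else u)) = 0" for c
  proof (rule combination_zero[where b = b and c = "max 1 (c\<^sup>2)"])
    show "(\<Sum>i\<in>{0, 1::nat}. \<integral>t. t ^ k * (if i = 0 then 1 else -(c\<^sup>2)) \<partial>spectral (if i = 0 then c *\<^sub>R u else u)) = 0" for k
      by (simp add: moment_spectral linear_scale[OF linear_pow] power2_eq_square)
  qed (use b fm in auto)
  then have sc: "(\<integral>t. f t \<partial>spectral (c *\<^sub>R u)) = c\<^sup>2 * (\<integral>t. f t \<partial>spectral u)" for c
    by (simp add: mult.commute)
  show ?thesis using sc[of 2] sc[of 0] by (simp add: polar_def scaleR_2)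
qed

text \<open>
  Polarisation gives the bound by \<open>(\<parallel>v\<parallel>\<^sup>2 + \<parallel>u\<parallel>\<^sup>2)/2\<close>; scaling both vectors to norm one gives
  the Cauchy--Schwarz form that the Riesz representation needs.
\<close>

lemma polar_indicator_bound: "\<bar>polar (indicator B) v u\<bar> \<le> norm v * norm u" if B: "B \<in> sets borel"
proof -
  note ti = tame_indicator[OF B]
  have half: "\<bar>polar (indicator B) v u\<bar> \<le> (inner v v + inner u u) / 2" for v u
  proof -
    have p: "polar (indicator B) v u = (measure (spectral (v + u)) B - measure (spectral (v - u)) B) / 4"
      using B by (simp add: polar_def)
    have "inner (v + u) (v + u) + inner (v - u) (v - u) = 2 * (inner v v + inner u u)"
      by (simp add: inner_add_left inner_add_right inner_diff_left inner_diff_right)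
    then show ?thesis
      unfolding p using measure_spectral_le[of "v + u" B] measure_spectral_le[of "v - u" B]
        measure_nonneg[of "spectral (v + u)" B] measure_nonneg[of "spectral (v - u)" B]
        inner_ge_zero[of "v + u"] inner_ge_zero[of "v - u"] by argo
  qed
  show ?thesis
  proof (cases "v = 0 \<or> u = 0")
    case True
    have "polar (indicator B) 0 u = 0" using polar_scale_left[OF ti, of 0 0 u] by simp
    moreover have "polar (indicator B) v 0 = 0" using polar_commute[OF ti, of v 0] polar_scale_left[OF ti, of 0 0 v] by simp
    ultimately show ?thesis using True by auto
  next
    case False
    define v' u' where "v' = (1 / norm v) *\<^sub>R v" and "u' = (1 / norm u) *\<^sub>R u"
    have n: "inner v' v' = 1" "inner u' u' = 1" using False by (simp_all add: v'_def u'_def dot_square_norm power2_eq_square)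
    have "v = norm v *\<^sub>R v'" "u = norm u *\<^sub>R u'" using False by (simp_all add: v'_def u'_def)
    then have "polar (indicator B) v u = norm v * (norm u * polar (indicator B) v' u')"
      using polar_scale_left[OF ti] polar_commute[OF ti] by metis
    moreover have "\<bar>polar (indicator B) v' u'\<bar> \<le> 1" using half[of v' u'] n by simp
    then have "norm v * (norm u * \<bar>polar (indicator B) v' u'\<bar>) \<le> norm v * (norm u * 1)"
      by (intro mult_left_mono) auto
    ultimately show ?thesis by (simp add: abs_mult)
  qed
qed

end

text \<open>
  The operators \<open>P B\<close> represent the forms of indicator functions. That they exist is a consequence of
  completeness and is settled later for the concrete Hilbert space.
\<close>

locale spectral_family = bounded_symmetric A R for A :: "'h::real_inner \<Rightarrow> 'h" and R +
  fixes P :: "real set \<Rightarrow> 'h \<Rightarrow> 'h"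
  assumes form: "B \<in> sets borel \<Longrightarrow> inner v (P B u) = polar (indicator B) v u"
begin

lemma proj_eqI: "(\<And>v. inner v x = inner v y) \<Longrightarrow> x = (y :: 'h)"
  using vector_eq_ldot by blast

lemma proj_symmetric: "B \<in> sets borel \<Longrightarrow> inner (P B u) v = inner u (P B v)"
  using form[of B u v] form[of B v u] polar_commute[OF tame_indicator, of B u v] by (simp add: inner_commute)

lemma proj_linear: assumes B: "B \<in> sets borel" shows "linear (P B)"
proof (rule linearI; rule proj_eqI)
  fix u v w :: 'h and c :: real
  show "inner w (P B (u + v)) = inner w (P B u + P B v)"
    using proj_symmetric[OF B] by (metis inner_add_right)
  show "inner w (P B (c *\<^sub>R u)) = inner w (c *\<^sub>R P B u)"
    using proj_symmetric[OF B] by (metis inner_scaleR_right)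
qed

text \<open>
  The identity \<open>f(A) P(B) = (f \<cdot> 1\<^sub>B)(A)\<close>; it holds for powers by symmetry of \<open>A\<close>, hence in
  general.
\<close>

lemma polar_proj:
  assumes B: "B \<in> sets borel" and f: "tame f"
  shows "polar f v (P B u) = polar (\<lambda>t. f t * indicator B t) v u"
proof -
  have "(\<Sum>i\<in>{0, 1::nat}. polar (\<lambda>t. f t * (if i = 0 then 1 else - indicator B t))
      v (if i = 0 then P B u else u)) = 0"
  proof (rule polar_combination)
    show "tame (\<lambda>t. if i = 0 then 1 else - indicator B t)" for i :: nat
      using tame_mult[OF tame_const[of "-1"] tame_indicator[OF B]] tame_const[of 1] by (cases "i = 0") simp_all
    show "(\<Sum>i\<in>{0, 1::nat}. polar (\<lambda>t. t ^ k * (if i = 0 then 1 else - indicator B t))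
      v (if i = 0 then P B u else u)) = 0" for k
    proof -
      have "polar (\<lambda>t. t ^ k) v (P B u) = polar (\<lambda>t. indicator B t * t ^ k) v u"
        using form[OF B, of "(A ^^ k) v" u] polar_pow_left[OF tame_indicator[OF B], of k v u]
        by (simp add: polar_moment symmetric_pow)
      moreover have "polar (\<lambda>t. t ^ k * (- indicator B t)) v u = - polar (\<lambda>t. indicator B t * t ^ k) v u"
        using polar_times_const[of "\<lambda>t. indicator B t * t ^ k" "-1" v u] by (simp add: mult.commute)
      ultimately show ?thesis by simp
    qed
  qed (use f in auto)
  moreover have "polar (\<lambda>t. f t * (- indicator B t)) v u = - polar (\<lambda>t. f t * indicator B t) v u"
    using polar_times_const[of "\<lambda>t. f t * indicator B t" "-1" v u] by simp
  ultimately show ?thesis by simp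
qed

lemma proj_mult:
  assumes "B \<in> sets borel" "C \<in> sets borel"
  shows "P (B \<inter> C) u = P B (P C u)"
proof (rule proj_eqI)
  fix v
  have "(\<lambda>t. indicator B t * indicator C t :: real) = indicator (B \<inter> C)" by (simp add: fun_eq_iff indicator_inter_arith)
  then show "inner v (P (B \<inter> C) u) = inner v (P B (P C u))"
    using assms by (simp add: form polar_proj tame_indicator)
qed

lemma proj_UNIV: "P UNIV u = u"
proof (rule proj_eqI)
  fix v
  have "inner v (P UNIV u) = polar (indicator UNIV) v u" by (rule form) simp
  also have "indicator UNIV = (\<lambda>t::real. t ^ 0 :: real)" by (simp add: fun_eq_iff)
  also have "polar \<dots> v u = inner v u" unfolding polar_moment by simp
  finally show "inner v (P UNIV u) = inner v u" .
qed

lemma proj_measure: "B \<in> sets borel \<Longrightarrow> inner u (P B u) = measure (spectral u) B"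
  by (simp add: form polar_diag tame_indicator)

lemma proj_sums:
  assumes B: "range B \<subseteq> sets borel" and disj: "disjoint_family B"
  shows "(\<lambda>i. inner v (P (B i) u)) sums inner v (P (\<Union>i. B i) u)"
proof -
  have Bi: "B i \<in> sets borel" for i using B by auto
  have "(\<lambda>i. measure (spectral w) (B i)) sums measure (spectral w) (\<Union>i. B i)" for w
  proof -
    interpret finite_measure "spectral w" by (rule finite_spectral)
    show ?thesis by (rule finite_measure_UNION) (use B disj in auto)
  qed
  from sums_divide[OF sums_diff[OF this[of "v + u"] this[of "v - u"]], of 4]
  show ?thesis using Bi by (simp add: form polar_def)
qed

text \<open>
  For real scalars this says that the projections commute with a complex structure \<open>J\<close> that commutes
  with \<open>A\<close>, i.e. that they are complex linear.
\<close>

lemma proj_commutes: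
  assumes J: "linear J" "\<And>u v. inner (J u) (J v) = inner u v" "\<And>u. J (J u) = - u" "\<And>u. A (J u) = J (A u)"
    and B: "B \<in> sets borel"
  shows "P B (J u) = J (P B u)"
proof (rule proj_eqI)
  fix v
  have JA: "(A ^^ k) (J u) = J ((A ^^ k) u)" for k u by (induction k) (simp_all add: J)
  have sp: "spectral (J u) = spectral u" for u
    by (rule spectral_eqI[OF finite_spectral sets_spectral support_spectral])
      (simp add: moment_spectral JA J)
  have "polar f (J x) (J u) = polar f x u" for f x u
    unfolding polar_def linear_add[OF J(1), symmetric] linear_diff[OF J(1), symmetric] sp ..
  then have "inner (J x) (P B (J u)) = inner (J x) (J (P B u))" for x
    using B by (simp add: form J)
  moreover have "v = J (- J v)" using J by (simp add: linear_neg)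
  ultimately show "inner v (P B (J u)) = inner v (J (P B u))" by metis
qed

end

context bounded_symmetric
begin

text \<open>
  A projection-valued measure whose first moments reproduce the form of \<open>A\<close> is the spectral
  family. Its projections reduce \<open>A\<close>; on the range of a projection for a set outside \<open>[-R, R]\<close> the form
  of \<open>A\<close> would exceed its bound, so the measures are compactly supported. Then
  \<open>\<langle>A\<^sup>k u, E(B) u\<rangle> = \<integral>\<^sub>B x\<^sup>k\<close> follows by induction on \<open>k\<close>, and equal moments give equal measures.
\<close>

lemma spectral_measure_unique:
  fixes E :: "real set \<Rightarrow> 'h \<Rightarrow> 'h" and m :: "'h \<Rightarrow> real measure" and u :: 'h
  assumes sym: "\<And>B u v. B \<in> sets borel \<Longrightarrow> inner (E B u) v = inner u (E B v)"
    and add: "\<And>B u v. B \<in> sets borel \<Longrightarrow> E B (u + v) = E B u + E B v"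
    and mult: "\<And>B C u. B \<in> sets borel \<Longrightarrow> C \<in> sets borel \<Longrightarrow> E (B \<inter> C) u = E B (E C u)"
    and univ: "\<And>u. E UNIV u = u"
    and fin: "\<And>u. finite_measure (m u)" and sets_m: "\<And>u. sets (m u) = sets borel"
    and m: "\<And>B u. B \<in> sets borel \<Longrightarrow> measure (m u) B = inner u (E B u)"
    and int: "\<And>u. integrable (m u) (\<lambda>x. x)" and op: "\<And>u. inner u (A u) = (\<integral>x. x \<partial>m u)"
  shows "m u = spectral u"
proof -
  interpret m: finite_measure "m w" for w by (rule fin)
  note [measurable_cong, simp] = sets_m
  have space_m [simp]: "space (m u) = UNIV" for u using sets_eq_imp_space_eq[OF sets_m[of u]] by simp
  have diff: "E B (u - v) = E B u - E B v" if "B \<in> sets borel" for B u v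
    using add[OF that, of "u - v" v] by (simp add: algebra_simps)
  have E_empty: "E {} u = 0" for u
  proof -
    have "inner (E {} u) (E {} u) = inner u (E {} u)" using sym[of "{}" u "E {} u"] mult[of "{}" "{}" u] by simp
    also have "\<dots> = 0" using m[of "{}" u] by simp
    finally show ?thesis by simp
  qed
  have E_compl: "E B u + E (- B) u = u" if B: "B \<in> sets borel" for B u
  proof -
    define S where "S u = E B u + E (- B) u - u" for u
    have S_add: "S (u + v) = S u + S v" for u v using B by (simp add: S_def add)
    have S_sym: "inner (S u) v = inner u (S v)" for u v
      using B by (simp add: S_def inner_add_left inner_add_right inner_diff_left inner_diff_right sym)
    have S0: "inner u (S u) = 0" for u
    proof -
      have "measure (m u) (UNIV - B) = measure (m u) UNIV - measure (m u) B"
        using B m.finite_measure_compl[of B u] by simp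
      then show ?thesis using B m[of UNIV u] m[of B u] m[of "- B" u] univ[of u]
        by (simp add: S_def inner_add_right inner_diff_right Compl_eq_Diff_UNIV)
    qed
    have "inner v (S u) = 0" for v
    proof -
      have "inner (u + v) (S (u + v)) = inner u (S v) + inner v (S u)"
        using S0[of u] S0[of v] by (simp add: S_add inner_add_left inner_add_right)
      moreover have "inner u (S v) = inner v (S u)" using S_sym[of u v] by (simp add: inner_commute)
      ultimately show ?thesis using S0[of "u + v"] by simp
    qed
    from this[of "S u"] show ?thesis by (simp add: S_def)
  qed
  have idem: "E B (E B u) = E B u" if "B \<in> sets borel" for B u using mult[OF that that, of u] by simp
  have orth: "E B (E (- B) u) = 0" "E (- B) (E B u) = 0" if "B \<in> sets borel" for B u
    using mult[of B "- B" u] mult[of "- B" B u] that E_empty by simp_all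
  have m_proj: "(\<integral>x. x \<partial>m (E B u)) = (\<integral>x. indicator B x * x \<partial>m u)" if B: "B \<in> sets borel" for B u
  proof -
    have "m (E B u) = density (m u) (indicator B)"
    proof (rule measure_eqI)
      fix C assume "C \<in> sets (m (E B u))"
      then have C: "C \<in> sets borel" by simp
      have "measure (m (E B u)) C = inner u (E (B \<inter> (C \<inter> B)) u)"
        using B C by (simp add: m sym mult)
      also have "B \<inter> (C \<inter> B) = B \<inter> C" by blast
      finally have "measure (m (E B u)) C = measure (m u) (B \<inter> C)" using B C by (simp add: m)
      then show "emeasure (m (E B u)) C = emeasure (density (m u) (indicator B)) C"
        using B C by (simp add: emeasure_density m.emeasure_eq_measure nn_integral_indicator indicator_inter_arith[symmetric] del: indicator_inter_arith)
    qed simp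
    moreover have "(\<lambda>x. indicator B x :: ennreal) = (\<lambda>x. ennreal (indicator B x))" by (simp add: fun_eq_iff indicator_def)
    ultimately show ?thesis using B by (simp add: integral_density)
  qed
  (* The first moment of m v, for v = E B a + E (- B) b, splits over B and its complement, so the
     mixed terms of the form cancel. *)
  have cross: "inner (E B a) (A (E (- B) b)) = 0" if B: "B \<in> sets borel" for B a b
  proof -
    define v where "v = E B a + E (- B) b"
    have Ev: "E B v = E B a" "E (- B) v = E (- B) b" using B by (simp_all add: v_def add idem orth)
    have i: "integrable (m v) (\<lambda>x. indicator C x * x)" if "C \<in> sets borel" for C
      using integrable_mult_indicator[OF _ int[of v], of C] that by simp
    have "inner v (A v) = (\<integral>x. indicator B x * x + indicator (- B) x * x \<partial>m v)"
      unfolding op by (rule Bochner_Integration.integral_cong) (auto simp: indicator_def)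
    also have "\<dots> = inner (E B a) (A (E B a)) + inner (E (- B) b) (A (E (- B) b))"
      using B i[of B] i[of "- B"] by (simp add: op m_proj[symmetric] Ev)
    finally have "inner (E B a) (A (E (- B) b)) + inner (E (- B) b) (A (E B a)) = 0"
      by (simp add: v_def linear_add[OF linear_op] inner_add_left inner_add_right)
    moreover have "inner (E (- B) b) (A (E B a)) = inner (E B a) (A (E (- B) b))"
      by (metis symmetric inner_commute)
    ultimately show ?thesis by simp
  qed
  have compress: "inner a (A (E B b)) = inner (E B a) (A (E B b))" if B: "B \<in> sets borel" for B a b
  proof -
    have "inner (E B a + E (- B) a) (A (E B b)) = inner (E B a) (A (E B b))"
      using cross[of "- B" a b] B by (simp add: inner_add_left)
    then show ?thesis using E_compl[OF B, of a] by simp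
  qed
  (* The sign c treats both half-lines at once: c x exceeds R on B, against the form bound. *)
  have tail: "AE x in m u. x \<notin> B"
    if B: "B \<in> sets borel" and c: "\<bar>c\<bar> = 1" "\<And>x. x \<in> B \<Longrightarrow> R < c * x" for B c u
  proof -
    have i: "integrable (m u) (\<lambda>x. indicator B x * x)" "integrable (m u) (\<lambda>x. indicator B x * R)"
      using integrable_mult_indicator[OF _ int[of u], of B] integrable_mult_indicator[of B "m u" "\<lambda>_. R"] B
      by (simp_all only: sets_m m.integrable_const real_scaleR_def)
    have "c * inner (E B u) (A (E B u)) \<le> \<bar>inner (E B u) (A (E B u))\<bar>"
      using c(1) by (metis abs_ge_self abs_mult mult_1)
    also have "\<dots> \<le> R * inner (E B u) (E B u)" by (rule bounded)
    also have "inner (E B u) (E B u) = measure (m u) B" using B by (simp add: m sym idem)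
    finally have "c * (\<integral>x. indicator B x * x \<partial>m u) \<le> (\<integral>x. indicator B x * R \<partial>m u)"
      using B by (simp add: op m_proj mult.commute)
    then have "(\<integral>x. c * (indicator B x * x) - indicator B x * R \<partial>m u) \<le> 0"
      using i by simp
    moreover have nn: "AE x in m u. 0 \<le> c * (indicator B x * x) - indicator B x * R"
      using c(2) by (intro AE_I2) (auto simp: indicator_def less_imp_le)
    moreover have "0 \<le> (\<integral>x. c * (indicator B x * x) - indicator B x * R \<partial>m u)"
      using nn by (rule integral_nonneg_AE)
    ultimately have "(\<integral>x. c * (indicator B x * x) - indicator B x * R \<partial>m u) = 0" by linarith
    moreover have "integrable (m u) (\<lambda>x. c * (indicator B x * x) - indicator B x * R)" using i by simp
    ultimately have "AE x in m u. c * (indicator B x * x) - indicator B x * R = 0"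
      using integral_nonneg_eq_0_iff_AE[OF _ nn] by blast
    then show ?thesis
      by eventually_elim (use c(2) in \<open>force simp: indicator_def split: if_splits\<close>)
  qed
  have supp: "AE x in m u. \<bar>x\<bar> \<le> R" for u
    using tail[of "{R<..}" 1 u] tail[of "{..<-R}" "-1" u] by auto
  have moment: "inner ((A ^^ k) u) (E B u) = (\<integral>x. indicator B x * x ^ k \<partial>m u)" if B: "B \<in> sets borel" for k B
    using B
  proof (induction k arbitrary: B)
    case 0
    then show ?case by (simp add: m)
  next
    case (Suc k)
    define a where "a = (A ^^ k) u"
    (* The signed measure with values <a, E C u> - \<integral>_C x^k dm(u), where the first part is polarised; the
       induction hypothesis says that it vanishes. *)
    let ?M = "\<lambda>i::nat. if i = 0 then m (a + u) else if i = 1 then m (a - u) else m u"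
    let ?h = "\<lambda>i::nat. \<lambda>t. if i = 0 then 1 / 4 else if i = 1 then - 1 / 4 else - (t ^ k)"
    interpret sf: signed_family "{0, 1, 2}" ?M ?h R "max 1 (R ^ k)"
    proof (rule signed_family.intro)
      fix i t assume "i \<in> {0, 1, 2::nat}" "\<bar>t\<bar> \<le> R"
      then show "\<bar>?h i t\<bar> \<le> max 1 (R ^ k)"
        using power_mono[of "\<bar>t\<bar>" R k] by (auto simp: power_abs max_def)
    qed (use fin supp in auto)
    have expand: "sf.\<Phi> f = ((\<integral>t. f t \<partial>m (a + u)) - (\<integral>t. f t \<partial>m (a - u))) / 4 - (\<integral>t. f t * t ^ k \<partial>m u)" for f
      by (simp add: family_integral_def diff_divide_distrib)
    have polarize: "inner a (S b) = (inner (a + b) (S (a + b)) - inner (a - b) (S (a - b))) / 4"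
      if "\<And>u v. S (u + v) = S u + S v" "\<And>u v. S (u - v) = S u - S v" "\<And>u v. inner (S u) v = inner u (S v)"
      for S :: "'h \<Rightarrow> 'h" and a b
    proof -
      have "inner b (S a) = inner a (S b)" using that(3)[of a b] by (simp add: inner_commute)
      then show ?thesis by (simp add: that(1,2) inner_add_left inner_add_right inner_diff_left inner_diff_right)
    qed
    have sets0: "sf.\<Phi> (indicator C) = 0" if C: "C \<in> sets borel" for C
    proof -
      have "inner a (E C u) = (inner (a + u) (E C (a + u)) - inner (a - u) (E C (a - u))) / 4"
        by (rule polarize) (use C in \<open>simp_all add: add diff sym\<close>)
      then show ?thesis unfolding expand using C Suc.IH[OF C] by (simp add: m a_def)
    qed
    have "sf.\<Phi> (\<lambda>t. indicator B t * t) = 0"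
      by (rule sf.sets_vanish_imp_bounded[OF sets0, where b = R]) (use Suc.prems R_pos in \<open>auto simp: indicator_def\<close>)
    then have "((\<integral>t. indicator B t * t \<partial>m (a + u)) - (\<integral>t. indicator B t * t \<partial>m (a - u))) / 4
        = (\<integral>t. indicator B t * t ^ Suc k \<partial>m u)"
      unfolding expand by (simp add: mult.assoc)
    moreover have "inner ((A ^^ Suc k) u) (E B u) = inner (E B a) (A (E B u))"
      using compress[OF Suc.prems, of a u] by (simp add: symmetric a_def)
    moreover have "inner (E B a) (A (E B u)) = inner a (E B (A (E B u)))" using Suc.prems by (simp add: sym)
    moreover have "inner a (E B (A (E B u))) = (inner (a + u) (E B (A (E B (a + u)))) - inner (a - u) (E B (A (E B (a - u))))) / 4"
      by (rule polarize)
        (use Suc.prems in \<open>simp_all add: add diff sym symmetric linear_add[OF linear_op] linear_diff[OF linear_op]\<close>)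
    moreover have "inner v (E B (A (E B v))) = (\<integral>t. indicator B t * t \<partial>m v)" for v
      using Suc.prems by (simp add: sym[symmetric] op m_proj)
    ultimately show ?case by simp
  qed
  have "(\<integral>t. t ^ k \<partial>m u) = inner u ((A ^^ k) u)" for k
    using moment[of UNIV k] by (simp add: univ symmetric_pow)
  from spectral_eqI[OF fin[of u] sets_m[of u] supp[of u] this] show ?thesis .
qed

end

section \<open>The Hilbert space of square-summable functions\<close>

text \<open>
  Functions in \<open>ell2\<close> as a real inner product space with real part of the complex inner product.
  The complex structure is kept separately as the operator \<open>mult_i\<close>.
\<close>

typedef 'v l2 = "ell2 :: ('v \<Rightarrow> complex) set"
  morphisms coord vec_of
  by (rule exI[of _ "\<lambda>_. 0"]) (simp add: ell2_def)

setup_lifting type_definition_l2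

lemma ell2I_bound:
  assumes "v \<in> ell2" and "\<And>n. (cmod (u n))\<^sup>2 \<le> c * (cmod (v n))\<^sup>2"
  shows "u \<in> ell2"
  unfolding ell2_def mem_Collect_eq
  by (rule summable_on_comparison_test[where f = "\<lambda>n. c * (cmod (v n))\<^sup>2"])
    (use assms in \<open>auto simp: ell2_def intro!: summable_on_cmult_right\<close>)

lemma cmod_add_square_le: "(cmod (a + b))\<^sup>2 \<le> 2 * (cmod a)\<^sup>2 + 2 * (cmod b)\<^sup>2"
proof -
  have "(cmod (a + b))\<^sup>2 \<le> (cmod a + cmod b)\<^sup>2" by (intro power_mono norm_triangle_ineq) simp
  also have "\<dots> \<le> 2 * (cmod a)\<^sup>2 + 2 * (cmod b)\<^sup>2"
    using sum_squares_bound[of "cmod a" "cmod b"] by (simp add: power2_sum)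
  finally show ?thesis .
qed

lemma ell2_add: assumes "u \<in> ell2" "v \<in> ell2" shows "(\<lambda>n. u n + v n) \<in> ell2"
  unfolding ell2_def mem_Collect_eq
  by (rule summable_on_comparison_test[where f = "\<lambda>n. 2 * (cmod (u n))\<^sup>2 + 2 * (cmod (v n))\<^sup>2"])
    (use assms in \<open>auto simp: ell2_def intro!: summable_on_cmult_right summable_on_add cmod_add_square_le\<close>)

lemma ell2_cmult: assumes "u \<in> ell2" shows "(\<lambda>n. c * u n) \<in> ell2"
  by (rule ell2I_bound[OF assms, where c = "(cmod c)\<^sup>2"]) (simp add: norm_mult power_mult_distrib)

lemma ell2_diff: assumes "u \<in> ell2" "v \<in> ell2" shows "(\<lambda>n. u n - v n) \<in> ell2"
  using ell2_add[OF assms(1) ell2_cmult[OF assms(2), of "-1"]] by simp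

lemma ell2_finite_support: assumes "finite F" "\<And>n. n \<notin> F \<Longrightarrow> u n = 0" shows "u \<in> ell2"
  unfolding ell2_def mem_Collect_eq
  using summable_on_cong_neutral[of UNIV F "\<lambda>n. (cmod (u n))\<^sup>2" "\<lambda>n. (cmod (u n))\<^sup>2"] assms by auto

lemma delta_ell2 [simp]: "delta n \<in> ell2"
  by (rule ell2_finite_support[of "{n}"]) (auto simp: delta_def)

lemma restr_ell2: "u \<in> ell2 \<Longrightarrow> restr S u \<in> ell2"
  by (rule ell2I_bound[where c = 1]) (auto simp: restr_def)

lemma ell2_inner_summable:
  assumes "u \<in> ell2" "v \<in> ell2"
  shows "(\<lambda>n. cnj (u n) * v n) summable_on UNIV"
proof (rule abs_summable_summable, rule summable_on_comparison_test[where f = "\<lambda>n. (cmod (u n))\<^sup>2 + (cmod (v n))\<^sup>2"])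
  show "(\<lambda>n. (cmod (u n))\<^sup>2 + (cmod (v n))\<^sup>2) summable_on UNIV"
    using assms by (auto simp: ell2_def intro!: summable_on_add)
  show "norm (cnj (u n) * v n) \<le> (cmod (u n))\<^sup>2 + (cmod (v n))\<^sup>2" for n
    using sum_squares_bound[of "cmod (u n)" "cmod (v n)"]
      mult_nonneg_nonneg[OF norm_ge_zero[of "u n"] norm_ge_zero[of "v n"]]
    unfolding norm_mult complex_mod_cnj by linarith
qed simp

lemma ell2_inner_add_right:
  "u \<in> ell2 \<Longrightarrow> v \<in> ell2 \<Longrightarrow> w \<in> ell2 \<Longrightarrow> ell2_inner u (\<lambda>n. v n + w n) = ell2_inner u v + ell2_inner u w"
  unfolding ell2_inner_def distrib_left by (rule infsum_add) (auto intro: ell2_inner_summable)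

lemma ell2_inner_cmult_right: "ell2_inner u (\<lambda>n. c * v n) = c * ell2_inner u v"
  unfolding ell2_inner_def by (subst infsum_cmult_right'[symmetric]) (simp add: ac_simps)

lemma ell2_inner_commute: "ell2_inner v u = cnj (ell2_inner u v)"
  unfolding ell2_inner_def by (subst infsum_cnj[symmetric]) (simp add: mult.commute)

lemma ell2_inner_self:
  assumes "u \<in> ell2"
  shows "ell2_inner u u = of_real (\<Sum>\<^sub>\<infinity>n. (cmod (u n))\<^sup>2)"
proof -
  have "ell2_inner u u = (\<Sum>\<^sub>\<infinity>n. complex_of_real ((cmod (u n))\<^sup>2))"
    unfolding ell2_inner_def by (rule infsum_cong) (simp add: mult.commute flip: complex_norm_square)
  also have "\<dots> = of_real (\<Sum>\<^sub>\<infinity>n. (cmod (u n))\<^sup>2)"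
    using assms by (intro infsumI has_sum_of_real has_sum_infsum) (simp add: ell2_def)
  finally show ?thesis .
qed

lemma ell2_inner_delta: "ell2_inner (delta n) u = u n"
proof -
  have "ell2_inner (delta n) u = (\<Sum>\<^sub>\<infinity>k\<in>{n}. cnj (delta n k) * u k)"
    unfolding ell2_inner_def by (rule infsum_cong_neutral) (auto simp: delta_def)
  then show ?thesis by (simp add: delta_def)
qed

instantiation l2 :: (type) real_vector
begin

lift_definition zero_l2 :: "'a l2" is "\<lambda>_. 0" by (simp add: ell2_def)
lift_definition plus_l2 :: "'a l2 \<Rightarrow> 'a l2 \<Rightarrow> 'a l2" is "\<lambda>u v n. u n + v n" by (rule ell2_add)
lift_definition minus_l2 :: "'a l2 \<Rightarrow> 'a l2 \<Rightarrow> 'a l2" is "\<lambda>u v n. u n - v n" by (rule ell2_diff)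
lift_definition uminus_l2 :: "'a l2 \<Rightarrow> 'a l2" is "\<lambda>u n. - u n" using ell2_cmult[of _ "-1"] by simp
lift_definition scaleR_l2 :: "real \<Rightarrow> 'a l2 \<Rightarrow> 'a l2" is "\<lambda>c u n. of_real c * u n" by (rule ell2_cmult)
instance
proof
  fix u v w :: "'a l2" and a b :: real
  show "u + v + w = u + (v + w)" by transfer (simp add: add.assoc)
  show "u + v = v + u" by transfer (simp add: add.commute)
  show "0 + u = u" by transfer simp
  show "- u + u = 0" by transfer simp
  show "u - v = u + - v" by transfer simp
  show "a *\<^sub>R (u + v) = a *\<^sub>R u + a *\<^sub>R v" by transfer (simp add: distrib_left)
  show "(a + b) *\<^sub>R u = a *\<^sub>R u + b *\<^sub>R u" by transfer (simp add: distrib_right)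
  show "a *\<^sub>R b *\<^sub>R u = (a * b) *\<^sub>R u" by transfer (simp add: mult.assoc)
  show "1 *\<^sub>R u = u" by transfer simp
qed

end

instantiation l2 :: (type) real_inner
begin

lift_definition inner_l2 :: "'a l2 \<Rightarrow> 'a l2 \<Rightarrow> real" is "\<lambda>u v. Re (ell2_inner u v)" .
definition norm_l2 :: "'a l2 \<Rightarrow> real" where "norm_l2 u = sqrt (inner u u)"
definition sgn_l2 :: "'a l2 \<Rightarrow> 'a l2" where "sgn_l2 u = u /\<^sub>R norm u"
definition dist_l2 :: "'a l2 \<Rightarrow> 'a l2 \<Rightarrow> real" where "dist_l2 u v = norm (u - v)"
definition uniformity_l2 :: "('a l2 \<times> 'a l2) filter" where
  "uniformity_l2 = (INF e\<in>{0<..}. principal {(x, y). dist x y < e})"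
definition open_l2 :: "'a l2 set \<Rightarrow> bool" where
  "open_l2 U = (\<forall>x\<in>U. eventually (\<lambda>(x', y). x' = x \<longrightarrow> y \<in> U) uniformity)"

instance
proof
  fix u v w :: "'a l2" and a b :: real
  show "dist u v = norm (u - v)" by (simp add: dist_l2_def)
  show "sgn u = u /\<^sub>R norm u" by (simp add: sgn_l2_def)
  show "(uniformity :: ('a l2 \<times> 'a l2) filter) = (INF e\<in>{0<..}. principal {(x, y). dist x y < e})"
    by (simp add: uniformity_l2_def)
  show "open U = (\<forall>x\<in>U. eventually (\<lambda>(x', y). x' = x \<longrightarrow> y \<in> U) uniformity)" for U :: "'a l2 set"
    by (simp add: open_l2_def)
  show "inner u v = inner v u" by transfer (metis ell2_inner_commute cnj.sel(1))
  show "inner (u + v) w = inner u w + inner v w"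
  proof transfer
    fix u v w :: "'a \<Rightarrow> complex" assume "u \<in> ell2" "v \<in> ell2" "w \<in> ell2"
    then have "ell2_inner w (\<lambda>n. u n + v n) = ell2_inner w u + ell2_inner w v" by (simp add: ell2_inner_add_right)
    then show "Re (ell2_inner (\<lambda>n. u n + v n) w) = Re (ell2_inner u w) + Re (ell2_inner v w)"
      by (metis ell2_inner_commute cnj.sel(1) plus_complex.sel(1))
  qed
  show "inner (a *\<^sub>R u) v = a * inner u v"
  proof transfer
    fix a and u v :: "'a \<Rightarrow> complex"
    have "ell2_inner v (\<lambda>n. of_real a * u n) = of_real a * ell2_inner v u" by (rule ell2_inner_cmult_right)
    then show "Re (ell2_inner (\<lambda>n. of_real a * u n) v) = a * Re (ell2_inner u v)"
      by (subst (1 2) ell2_inner_commute) simp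
  qed
  show "0 \<le> inner u u"
    by transfer (simp add: ell2_inner_self infsum_nonneg)
  show "inner u u = 0 \<longleftrightarrow> u = 0"
  proof transfer
    fix u :: "'a \<Rightarrow> complex" assume u: "u \<in> ell2"
    have eq: "Re (ell2_inner u u) = (\<Sum>\<^sub>\<infinity>n. (cmod (u n))\<^sup>2)" by (simp add: ell2_inner_self[OF u])
    show "Re (ell2_inner u u) = 0 \<longleftrightarrow> u = (\<lambda>_. 0)"
    proof
      assume "Re (ell2_inner u u) = 0"
      then have "(\<Sum>\<^sub>\<infinity>n. (cmod (u n))\<^sup>2) \<le> 0" by (simp only: eq)
      then have "(cmod (u n))\<^sup>2 = 0" for n
        by (rule nonneg_infsum_le_0D) (use u in \<open>auto simp: ell2_def\<close>)
      then show "u = (\<lambda>_. 0)" by (simp add: fun_eq_iff)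
    next
      assume "u = (\<lambda>_. 0)"
      then show "Re (ell2_inner u u) = 0" unfolding eq by simp
    qed
  qed
  show "norm u = sqrt (inner u u)" by (simp add: norm_l2_def)
qed

end

lift_definition basis :: "'v \<Rightarrow> 'v l2" is delta by simp
lift_definition mult_i :: "'v l2 \<Rightarrow> 'v l2" is "\<lambda>u n. \<i> * u n" by (rule ell2_cmult)

lemma coord_simps [simp]:
  "coord (u + v) n = coord u n + coord v n" "coord (u - v) n = coord u n - coord v n"
  "coord (a *\<^sub>R u) n = of_real a * coord u n" "coord 0 n = 0" "coord (- u) n = - coord u n"
  "coord (mult_i u) n = \<i> * coord u n" "coord (basis k) n = delta k n"
  by (transfer, simp)+

lemma coord_ell2 [simp]: "coord u \<in> ell2"
  using coord by blast

lemma coord_sum: "coord (\<Sum>i\<in>I. f i) n = (\<Sum>i\<in>I. coord (f i) n)"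
  by (induction I rule: infinite_finite_induct) auto

lemma l2_eqI: "(\<And>n. coord u n = coord v n) \<Longrightarrow> u = v"
  by (metis coord_inject ext)

lemma inner_l2_eq: "inner u v = Re (ell2_inner (coord u) (coord v))"
  by transfer rule

lemma coord_vec_of [simp]: "u \<in> ell2 \<Longrightarrow> coord (vec_of u) = u"
  by (rule vec_of_inverse)

lemma norm_l2_square: "(norm u)\<^sup>2 = (\<Sum>\<^sub>\<infinity>n. (cmod (coord u n))\<^sup>2)"
  by (simp add: power2_norm_eq_inner inner_l2_eq ell2_inner_self)

lemma mult_i_linear: "linear mult_i"
  by (rule linearI; rule l2_eqI) (simp_all add: algebra_simps)

lemma mult_i_square: "mult_i (mult_i u) = - u"
  by (rule l2_eqI) (simp add: mult.assoc[symmetric])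

lemma ell2_inner_eq: "ell2_inner (coord u) (coord v) = Complex (inner u v) (inner (mult_i u) v)"
proof -
  have "ell2_inner (\<lambda>n. \<i> * coord u n) (coord v) = cnj (\<i> * ell2_inner (coord v) (coord u))"
    by (subst ell2_inner_commute) (simp add: ell2_inner_cmult_right)
  also have "\<dots> = - \<i> * ell2_inner (coord u) (coord v)"
    by (simp flip: ell2_inner_commute)
  finally have "inner (mult_i u) v = Im (ell2_inner (coord u) (coord v))"
    unfolding inner_l2_eq by (simp add: mult_i.rep_eq)
  then show ?thesis by (simp add: complex_eq_iff inner_l2_eq)
qed

lemma mult_i_isometry: "inner (mult_i u) (mult_i v) = inner u v"
proof -
  have "ell2_inner (coord (mult_i u)) (coord (mult_i v)) = ell2_inner (coord u) (coord v)"
    unfolding ell2_inner_def by (rule infsum_cong) (simp add: complex_eq_iff)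
  then show ?thesis unfolding inner_l2_eq by simp
qed

lemma inner_basis: "inner (basis n) u = Re (coord u n)" "inner (mult_i (basis n)) u = Im (coord u n)"
proof -
  have "ell2_inner (coord (basis n)) (coord u) = coord u n"
    by (simp add: basis.rep_eq ell2_inner_delta)
  then show "inner (basis n) u = Re (coord u n)" "inner (mult_i (basis n)) u = Im (coord u n)"
    unfolding ell2_inner_eq by (metis complex.sel)+
qed

definition truncate :: "'v set \<Rightarrow> 'v l2 \<Rightarrow> 'v l2" where
  "truncate F v = (\<Sum>n\<in>F. Re (coord v n) *\<^sub>R basis n + Im (coord v n) *\<^sub>R mult_i (basis n))"

lemma coord_truncate: "finite F \<Longrightarrow> coord (truncate F v) n = (if n \<in> F then coord v n else 0)"
proof -
  assume F: "finite F"
  have "coord (truncate F v) n = (\<Sum>k\<in>F. if k = n then coord v n else 0)"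
    unfolding truncate_def coord_sum
    by (rule sum.cong) (auto simp: delta_def complex_eq_iff)
  then show ?thesis using F by simp
qed

lemma norm_truncate: "finite F \<Longrightarrow> (norm (truncate F v))\<^sup>2 = (\<Sum>n\<in>F. (cmod (coord v n))\<^sup>2)"
proof -
  assume F: "finite F"
  have "(\<Sum>\<^sub>\<infinity>n. (cmod (coord (truncate F v) n))\<^sup>2) = (\<Sum>\<^sub>\<infinity>n\<in>F. (cmod (coord v n))\<^sup>2)"
    by (rule infsum_cong_neutral) (auto simp: coord_truncate[OF F])
  then show ?thesis using F by (simp add: norm_l2_square)
qed

text \<open>
  Finitely supported vectors are dense, so a bounded functional is determined on the basis.
\<close>

lemma truncate_tendsto: "((\<lambda>F. truncate F v) \<longlongrightarrow> v) (finite_subsets_at_top UNIV)"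
proof -
  have sumb: "(\<lambda>n. (cmod (coord v n))\<^sup>2) summable_on UNIV" using coord_ell2[of v] by (simp add: ell2_def del: coord_ell2)
  have dist: "(norm (truncate F v - v))\<^sup>2 = (norm v)\<^sup>2 - (\<Sum>n\<in>F. (cmod (coord v n))\<^sup>2)" if F: "finite F" for F
  proof -
    have "inner (truncate F v) v = (\<Sum>n\<in>F. (cmod (coord v n))\<^sup>2)"
      unfolding truncate_def inner_sum_left
      by (rule sum.cong) (simp_all add: inner_add_left inner_basis cmod_power2, simp add: power2_eq_square)
    moreover have "inner (truncate F v) (truncate F v) = (\<Sum>n\<in>F. (cmod (coord v n))\<^sup>2)"
      using norm_truncate[OF F, of v] by (simp add: power2_norm_eq_inner)
    ultimately show ?thesis
      by (simp add: power2_norm_eq_inner inner_diff_left inner_diff_right inner_commute[of v "truncate F v"])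
  qed
  have "((\<lambda>F. \<Sum>n\<in>F. (cmod (coord v n))\<^sup>2) \<longlongrightarrow> (norm v)\<^sup>2) (finite_subsets_at_top UNIV)"
    using has_sum_infsum[OF sumb] unfolding has_sum_def norm_l2_square .
  then have "((\<lambda>F. (norm v)\<^sup>2 - (\<Sum>n\<in>F. (cmod (coord v n))\<^sup>2)) \<longlongrightarrow> 0) (finite_subsets_at_top UNIV)"
    using tendsto_diff[OF tendsto_const[of "(norm v)\<^sup>2"]] by fastforce
  moreover have "\<forall>\<^sub>F F in finite_subsets_at_top UNIV. (norm v)\<^sup>2 - (\<Sum>n\<in>F. (cmod (coord v n))\<^sup>2) = (norm (truncate F v - v))\<^sup>2"
    using eventually_finite_subsets_at_top_weakI[of UNIV "\<lambda>F. (norm v)\<^sup>2 - (\<Sum>n\<in>F. (cmod (coord v n))\<^sup>2) = (norm (truncate F v - v))\<^sup>2"] dist by simp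
  ultimately have "((\<lambda>F. (norm (truncate F v - v))\<^sup>2) \<longlongrightarrow> 0) (finite_subsets_at_top UNIV)"
    by (rule Lim_transform_eventually)
  from tendsto_real_sqrt[OF this] have "((\<lambda>F. norm (truncate F v - v)) \<longlongrightarrow> 0) (finite_subsets_at_top UNIV)" by simp
  then show ?thesis by (simp add: tendsto_norm_zero_iff LIM_zero_iff)
qed

lemma bounded_linear_eqI_basis:
  fixes f g :: "'v l2 \<Rightarrow> real"
  assumes f: "bounded_linear f" and g: "bounded_linear g"
    and eq: "\<And>n. f (basis n) = g (basis n)" "\<And>n. f (mult_i (basis n)) = g (mult_i (basis n))"
  shows "f v = g v"
proof -
  interpret f: bounded_linear f by fact
  interpret g: bounded_linear g by fact
  have "f (truncate F v) = g (truncate F v)" for F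
    unfolding truncate_def by (simp add: f.sum g.sum f.add g.add f.scaleR g.scaleR eq)
  moreover have "((\<lambda>F. f (truncate F v)) \<longlongrightarrow> f v) (finite_subsets_at_top UNIV)"
    by (rule f.tendsto[OF truncate_tendsto])
  moreover have "((\<lambda>F. g (truncate F v)) \<longlongrightarrow> g v) (finite_subsets_at_top UNIV)"
    by (rule g.tendsto[OF truncate_tendsto])
  ultimately show ?thesis
    using tendsto_unique[OF finite_subsets_at_top_neq_bot] by (metis (mono_tags, lifting) tendsto_cong always_eventually)
qed

text \<open>
  The coordinates of the representing vector are the values on the standard basis. They are square
  summable because the functional is bounded on their truncations.
\<close>

lemma l2_riesz:
  fixes f :: "'v l2 \<Rightarrow> real"
  assumes f: "linear f" and bound: "\<And>v. \<bar>f v\<bar> \<le> norm v * c"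
  obtains w where "\<And>v. inner v w = f v"
proof -
  have bl: "bounded_linear f" using f bound by (intro bounded_linear_intro[where K = c]) (auto simp: linear_add linear_scale)
  define w where "w n = Complex (f (basis n)) (f (mult_i (basis n)))" for n
  have bnd: "(\<Sum>n\<in>F. (cmod (w n))\<^sup>2) \<le> c\<^sup>2" if F: "finite F" for F
  proof -
    define v where "v = (\<Sum>n\<in>F. Re (w n) *\<^sub>R basis n + Im (w n) *\<^sub>R mult_i (basis n))"
    have "(\<lambda>n. if n \<in> F then w n else 0) \<in> ell2" by (rule ell2_finite_support[OF F]) simp
    then have "v = truncate F (vec_of (\<lambda>n. if n \<in> F then w n else 0))"
      unfolding v_def truncate_def by (intro sum.cong) simp_all
    then have nv: "(norm v)\<^sup>2 = (\<Sum>n\<in>F. (cmod (w n))\<^sup>2)"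
      using F \<open>_ \<in> ell2\<close> by (simp add: norm_truncate)
    have "f v = (\<Sum>n\<in>F. (cmod (w n))\<^sup>2)"
      unfolding v_def linear_sum[OF f] by (rule sum.cong) (simp_all add: linear_add[OF f] linear_scale[OF f] w_def cmod_power2, simp add: power2_eq_square)
    then have le: "(norm v)\<^sup>2 \<le> norm v * c" using bound[of v] nv by linarith
    have "(norm v)\<^sup>2 \<le> c\<^sup>2"
    proof (cases "v = 0")
      case False
      then have "norm v \<le> c" using le by (simp add: power2_eq_square)
      then show ?thesis by (simp add: power_mono)
    qed simp
    then show ?thesis using nv by simp
  qed
  have w: "w \<in> ell2"
    unfolding ell2_def mem_Collect_eq
    by (rule nonneg_bdd_above_summable_on) (auto intro!: bdd_aboveI2[where M = "c\<^sup>2"] bnd)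
  have "inner v (vec_of w) = f v" for v
    by (rule bounded_linear_eqI_basis[OF bounded_linear_inner_left bl])
      (simp_all add: inner_basis w, simp_all add: w_def)
  then show ?thesis by (rule that)
qed

section \<open>Growth of balls in the Bethe lattice\<close>

locale bethe =
  fixes adj :: "'v \<Rightarrow> 'v \<Rightarrow> bool" and K :: nat and orig :: 'v
  assumes bethe: "bethe_lattice adj K"
begin

lemma adj_sym: "adj x y \<Longrightarrow> adj y x"
  and adj_irrefl: "\<not> adj x x"
  and connected: "adj\<^sup>*\<^sup>* x y"
  and degree: "card {k. adj n k} = K + 1"
proof -
  note b = bethe[unfolded bethe_lattice_def]
  from b have sym: "symp adj" by (elim conjE)
  from b have irrefl: "irreflp adj" by (elim conjE)
  from b have conn: "\<forall>x y. adj\<^sup>*\<^sup>* x y" by (elim conjE)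
  from b have deg: "\<forall>n. card {k. adj n k} = K + 1" by (elim conjE)
  show "adj x y \<Longrightarrow> adj y x" using sym by (rule sympD)
  show "\<not> adj x x" using irrefl by (rule irreflpD)
  show "adj\<^sup>*\<^sup>* x y" using conn by (elim allE)
  show "card {k. adj n k} = K + 1" using deg by (elim allE)
qed

lemma finite_nbrs [simp]: "finite {k. adj n k}"
  using degree[of n] by (intro card_ge_0_finite) simp

lemma dist_path: "(adj ^^ lattice_dist adj x y) x y"
proof -
  have "\<exists>k. (adj ^^ k) x y" using connected[of x y] unfolding rtranclp_power .
  then show ?thesis unfolding lattice_dist_def by (rule LeastI_ex)
qed

lemma dist_le: "(adj ^^ k) x y \<Longrightarrow> lattice_dist adj x y \<le> k"
  unfolding lattice_dist_def by (rule Least_le)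

lemma dist_self [simp]: "lattice_dist adj x x = 0"
  using dist_le[of 0 x x] by simp

lemma dist_eq_0_iff: "lattice_dist adj x y = 0 \<longleftrightarrow> x = y"
  using dist_path[of x y] by auto

lemma dist_eq_1_iff: "lattice_dist adj x y = 1 \<longleftrightarrow> adj x y"
proof
  assume d: "lattice_dist adj x y = 1"
  have "(adj ^^ 1) x y" using dist_path[of x y] unfolding d .
  then show "adj x y" unfolding relpowp_1 .
next
  assume a: "adj x y"
  then have "(adj ^^ 1) x y" unfolding relpowp_1 .
  then have "lattice_dist adj x y \<le> 1" by (rule dist_le)
  moreover have "lattice_dist adj x y \<noteq> 0" using a adj_irrefl[of x] unfolding dist_eq_0_iff by metis
  ultimately show "lattice_dist adj x y = 1" by (metis le_antisym less_one linorder_not_le)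
qed

lemma laplacian_eq: "laplacian adj u n = (\<Sum>k | adj n k. u k)"
proof -
  have "{k. lattice_dist adj k n = 1} = {k. adj n k}" unfolding dist_eq_1_iff by (rule Collect_cong, rule iffI) (erule adj_sym)+
  then show ?thesis unfolding laplacian_def by simp
qed

lemma dist_nbr: "adj x y \<Longrightarrow> lattice_dist adj x z \<le> Suc (lattice_dist adj y z)"
proof -
  assume "adj x y"
  from relpowp_Suc_I2[OF this dist_path[of y z]] show ?thesis by (rule dist_le)
qed

lemma dist_Suc_nbr:
  assumes "lattice_dist adj x z = Suc d" obtains y where "adj x y" "lattice_dist adj y z \<le> d"
proof -
  have "(adj ^^ Suc d) x z" using dist_path[of x z] unfolding assms .
  from relpowp_Suc_D2[OF this] obtain y where "adj x y \<and> (adj ^^ d) y z" ..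
  then show ?thesis using that[of y] dist_le[of d y z] by simp
qed

abbreviation box :: "nat \<Rightarrow> 'v set" where "box L \<equiv> vol adj orig L"

lemma box_mono: "L \<le> L' \<Longrightarrow> box L \<subseteq> box L'"
  by (auto simp: vol_def)

lemma orig_in_box [simp]: "orig \<in> box L"
  by (simp add: vol_def)

lemma nbr_in_box: "n \<in> box L \<Longrightarrow> adj k n \<Longrightarrow> k \<in> box (Suc L)"
  using dist_nbr[of k n orig] by (auto simp: vol_def)

lemma box_0: "box 0 = {orig}"
  by (auto simp: vol_def dist_eq_0_iff)

lemma box_Suc_subset: "box (Suc L) \<subseteq> (\<Union>k\<in>box L. insert k {n. adj k n})"
proof
  fix n assume n: "n \<in> box (Suc L)"
  show "n \<in> (\<Union>k\<in>box L. insert k {n. adj k n})"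
  proof (cases "n \<in> box L")
    case False
    then have "lattice_dist adj n orig = Suc L" using n by (simp add: vol_def)
    then obtain y where "adj n y" "lattice_dist adj y orig \<le> L" by (rule dist_Suc_nbr)
    then have "y \<in> box L" "adj y n" using adj_sym[of n y] by (simp_all add: vol_def)
    then show ?thesis by blast
  qed auto
qed

text \<open>
  Each vertex of a ball contributes itself and its \<open>K + 1\<close> neighbours to the next ball. This crude
  bound, with base \<open>K + 2 \<le> (K + 1)\<^sup>2\<close>, is compatible with the assumed decay rate.
\<close>

lemma box_growth: "finite (box L) \<and> card (box L) \<le> (K + 2) ^ L"
proof (induction L)
  case 0
  then show ?case by (simp add: box_0)
next
  case (Suc L)
  let ?U = "\<Union>k\<in>box L. insert k {n. adj k n}"
  have fin: "finite ?U" using Suc by auto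
  have "card (box (Suc L)) \<le> card ?U" using fin box_Suc_subset by (rule card_mono)
  also have "\<dots> \<le> (\<Sum>k\<in>box L. card (insert k {n. adj k n}))" using Suc by (intro card_UN_le) auto
  also have "\<dots> \<le> (\<Sum>k\<in>box L. K + 2)"
    by (intro sum_mono) (use card_insert_le_m1 degree in \<open>simp add: card_insert_if\<close>)
  also have "\<dots> \<le> (K + 2) ^ L * (K + 2)" unfolding sum_constant of_nat_id using Suc by (intro mult_right_mono) auto
  finally show ?case using finite_subset[OF box_Suc_subset fin] by (simp add: mult.commute)
qed

lemma finite_box [simp]: "finite (box L)" and card_box: "card (box L) \<le> (K + 2) ^ L"
  using box_growth by auto

lemma countable_vertices: "countable (UNIV :: 'v set)"
proof -
  have "(UNIV :: 'v set) = (\<Union>L. box L)" by (auto simp: vol_def)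
  then show ?thesis by (metis countable_UN countableI_type countable_finite finite_box)
qed

lemma boundary_dist:
  assumes "n \<in> box L" "n' \<in> box (Suc L)" "n' \<notin> box L" "adj n' n"
  shows "lattice_dist adj n orig = L" "lattice_dist adj n' orig = Suc L"
  using assms dist_nbr[of n' n orig] by (auto simp: vol_def)

end

section \<open>Bounded self-adjoint operators on square-summable functions\<close>

text \<open>
  The type \<open>l2\<close> provides the real inner product space in which the abstract spectral theory applies;
  the norm bound implies the form bound there.
\<close>

locale ell2_operator =
  fixes A :: "('v \<Rightarrow> complex) \<Rightarrow> ('v \<Rightarrow> complex)" and R :: real
  assumes maps: "u \<in> ell2 \<Longrightarrow> A u \<in> ell2"
    and complex_linear: "u \<in> ell2 \<Longrightarrow> v \<in> ell2 \<Longrightarrow> A (\<lambda>n. c * u n + v n) = (\<lambda>n. c * A u n + A v n)"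
    and hermitian: "u \<in> ell2 \<Longrightarrow> v \<in> ell2 \<Longrightarrow> ell2_inner (A u) v = ell2_inner u (A v)"
    and norm_bound: "u \<in> ell2 \<Longrightarrow> norm (vec_of (A u)) \<le> R * norm (vec_of u)"
    and R_positive: "0 < R"
begin

definition Op :: "'v l2 \<Rightarrow> 'v l2" where "Op u = vec_of (A (coord u))"

lemma coord_Op: "coord (Op u) = A (coord u)"
  by (simp add: Op_def maps)

lemma coord_combination: "coord (a *\<^sub>R u + b *\<^sub>R mult_i u + v) = (\<lambda>n. Complex a b * coord u n + coord v n)"
  by (simp add: fun_eq_iff complex_eq_iff)

lemma Op_combination: "Op (a *\<^sub>R u + b *\<^sub>R mult_i u + v) = a *\<^sub>R Op u + b *\<^sub>R mult_i (Op u) + Op v"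
  unfolding coord_inject[symmetric] coord_combination coord_Op by (simp add: complex_linear)

lemma linear_Op: "linear Op"
proof (rule linearI)
  show add: "Op (u + v) = Op u + Op v" for u v using Op_combination[of 1 u 0 v] by simp
  show "Op (c *\<^sub>R u) = c *\<^sub>R Op u" for c u
    using Op_combination[of c u 0 0] add[of 0 0] by simp
qed

lemma Op_mult_i: "Op (mult_i u) = mult_i (Op u)"
  using Op_combination[of 0 u 1 0] linear_0[OF linear_Op] by simp

lemma Op_symmetric: "inner (Op u) v = inner u (Op v)"
  unfolding inner_l2_eq coord_Op by (simp add: hermitian)

lemma Op_bounded: "\<bar>inner u (Op u)\<bar> \<le> R * inner u u"
proof -
  have "\<bar>inner u (Op u)\<bar> \<le> norm u * norm (Op u)" by (rule Cauchy_Schwarz_ineq2)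
  also have "norm (Op u) \<le> R * norm u"
    using norm_bound[OF coord_ell2[of u]] by (simp add: Op_def coord_inverse)
  finally show ?thesis by (simp add: mult_left_mono dot_square_norm power2_eq_square mult.left_commute)
qed

sublocale bounded_symmetric Op R
  by (rule bounded_symmetric.intro) (fact linear_Op Op_symmetric Op_bounded R_positive)+

lemma inner_mult_i_left: "inner (mult_i u) v = - inner u (mult_i v)"
  using mult_i_isometry[of "u" "mult_i v"] by (simp add: mult_i_square)

lemma inner_mult_i_Op: "inner (mult_i u) (Op u) = 0"
proof -
  have "inner (mult_i u) (Op u) = - inner u (mult_i (Op u))" by (rule inner_mult_i_left)
  also have "\<dots> = - inner (Op u) (mult_i u)" by (simp flip: Op_mult_i add: Op_symmetric)
  finally show ?thesis by (simp add: inner_commute)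
qed

definition Proj :: "real set \<Rightarrow> 'v l2 \<Rightarrow> 'v l2" where
  "Proj B u = (SOME w. \<forall>v. inner v w = polar (indicator B) v u)"

sublocale spectral_family Op R Proj
proof
  fix B :: "real set" and u v :: "'v l2"
  assume B: "B \<in> sets borel"
  note ti = tame_indicator[OF B]
  have "linear (\<lambda>v. polar (indicator B) v u)"
    by (rule linearI) (simp_all add: polar_add_left[OF ti] polar_scale_left[OF ti])
  then obtain w where "\<And>v. inner v w = polar (indicator B) v u"
    using l2_riesz[of "\<lambda>v. polar (indicator B) v u" "norm u"] polar_indicator_bound[OF B] by metis
  then have "\<exists>w. \<forall>v. inner v w = polar (indicator B) v u" by blast
  from someI_ex[OF this] show "inner v (Proj B u) = polar (indicator B) v u"
    unfolding Proj_def by blast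
qed

lemma measure_of_borel:
  assumes "sets M = sets borel" "\<And>B. B \<in> sets borel \<Longrightarrow> f B = emeasure M B"
  shows "measure_of UNIV (sets borel) f = (M :: real measure)"
proof -
  have sp: "space M = UNIV" using sets_eq_imp_space_eq[OF assms(1)] by simp
  have "measure_of UNIV (sets borel) f = measure_of (space M) (sets M) (emeasure M)"
    unfolding sp assms(1)
    by (rule measure_of_eq) (use assms(2) sets.sigma_sets_eq[of "borel :: real measure"] in auto)
  then show ?thesis by (simp add: measure_of_of_measure)
qed

text \<open>
  The projections come from the Riesz representation; they are complex linear because they commute
  with multiplication by the imaginary unit.
\<close>

theorem spectral_theorem: "\<exists>E. is_spectral_measure ell2 A E"
proof
  define E where "E B u = coord (Proj B (vec_of u))" for B :: "real set" and u :: "'v \<Rightarrow> complex"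
  note J = proj_commutes[OF mult_i_linear mult_i_isometry mult_i_square Op_mult_i]
  have inner_E: "ell2_inner u (E B v) = Complex (inner (vec_of u) (Proj B (vec_of v))) (inner (mult_i (vec_of u)) (Proj B (vec_of v)))"
    if "u \<in> ell2" for u v B
    using ell2_inner_eq[of "vec_of u" "Proj B (vec_of v)"] that by (simp add: E_def)
  have vec_of_E: "vec_of (E B u) = Proj B (vec_of u)" for B u by (simp add: E_def coord_inverse)
  have proj: "orthogonal_projection (E B)" if B: "B \<in> sets borel" for B
    unfolding orthogonal_projection_def
  proof (intro conjI ballI allI)
    fix u v :: "'v \<Rightarrow> complex" and c assume u: "u \<in> ell2" and v: "v \<in> ell2"
    show "E B u \<in> ell2" by (simp add: E_def)
    have lin: "coord (Proj B (a *\<^sub>R x + b *\<^sub>R mult_i x + y)) = (\<lambda>n. Complex a b * coord (Proj B x) n + coord (Proj B y) n)" for a b x y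
      unfolding coord_combination[symmetric] using proj_linear[OF B]
      by (simp add: linear_add linear_scale J[OF B])
    have "coord (Re c *\<^sub>R vec_of u + Im c *\<^sub>R mult_i (vec_of u) + vec_of v) = (\<lambda>n. c * u n + v n)"
      unfolding coord_combination using u v by simp
    then have "vec_of (\<lambda>n. c * u n + v n) = Re c *\<^sub>R vec_of u + Im c *\<^sub>R mult_i (vec_of u) + vec_of v"
      by (metis coord_inverse)
    then show "E B (\<lambda>n. c * u n + v n) = (\<lambda>n. c * E B u n + E B v n)" by (simp add: E_def lin)
    show "E B (E B u) = E B u"
      using proj_mult[OF B B, of "vec_of u"] by (simp add: E_def coord_inverse)
    have "ell2_inner (E B u) v = cnj (ell2_inner v (E B u))" by (rule ell2_inner_commute)
    also have "\<dots> = ell2_inner u (E B v)"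
    proof -
      let ?u = "vec_of u" and ?v = "vec_of v"
      have "inner ?u (Proj B ?v) = inner ?v (Proj B ?u)" by (metis proj_symmetric[OF B] inner_commute)
      moreover have "inner (mult_i ?u) (Proj B ?v) = inner (mult_i (Proj B ?u)) ?v"
        by (metis proj_symmetric[OF B] J[OF B])
      moreover have "inner (mult_i (Proj B ?u)) ?v = - inner (mult_i ?v) (Proj B ?u)"
        using inner_mult_i_left[of "Proj B ?u" ?v] inner_commute[of "mult_i ?v" "Proj B ?u"] by simp
      ultimately show ?thesis unfolding inner_E[OF u] inner_E[OF v] by (simp add: complex_eq_iff)
    qed
    finally show "ell2_inner (E B u) v = ell2_inner u (E B v)" .
  qed
  have pvm: "projection_valued_measure E"
    unfolding projection_valued_measure_def
  proof (intro conjI ballI allI impI)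
    show "orthogonal_projection (E B)" if "B \<in> sets borel" for B using that by (rule proj)
    show "E UNIV u = u" if "u \<in> ell2" for u using that by (simp add: E_def proj_UNIV)
    show "E (B \<inter> C) u = E B (E C u)" if "B \<in> sets borel" "C \<in> sets borel" for B C u
      using proj_mult[OF that] by (simp add: E_def coord_inverse)
    fix B :: "nat \<Rightarrow> real set" and u v :: "'v \<Rightarrow> complex"
    assume "range B \<subseteq> sets borel" "disjoint_family B" and v: "v \<in> ell2"
    from proj_sums[OF this(1,2)]
    show "(\<lambda>i. ell2_inner v (E (B i) u)) sums ell2_inner v (E (\<Union>i. B i) u)"
      unfolding inner_E[OF v] sums_complex_iff by simp
  qed
  have scalar: "scalar_measure E u = spectral (vec_of u)" if u: "u \<in> ell2" for u
    unfolding scalar_measure_def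
  proof (rule measure_of_borel)
    interpret finite_measure "spectral (vec_of u)" by (rule finite_spectral)
    show "ennreal (Re (ell2_inner u (E B u))) = emeasure (spectral (vec_of u)) B" if "B \<in> sets borel" for B
      using that by (simp add: inner_E[OF u] proj_measure emeasure_eq_measure)
  qed simp
  show "is_spectral_measure ell2 A E"
    unfolding is_spectral_measure_def
  proof (intro conjI ballI pvm)
    have "integrable (spectral u) (\<lambda>x. x\<^sup>2)" for u
      using tame_power[of 2] unfolding tame_def by (metis integrable_spectral)
    then show "ell2 = {u \<in> ell2. integrable (scalar_measure E u) (\<lambda>x. x\<^sup>2)}" by (auto simp: scalar)
    fix u :: "'v \<Rightarrow> complex" assume u: "u \<in> ell2"
    have "ell2_inner u (A u) = Complex (inner (vec_of u) (Op (vec_of u))) (inner (mult_i (vec_of u)) (Op (vec_of u)))"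
      using ell2_inner_eq[of "vec_of u" "Op (vec_of u)"] u by (simp add: coord_Op)
    also have "\<dots> = of_real (\<integral>x. x \<partial>spectral (vec_of u))"
      using moment_spectral[where k = 1 and u = "vec_of u"] by (simp add: inner_mult_i_Op complex_eq_iff)
    finally show "ell2_inner u (A u) = complex_of_real (\<integral>x. x \<partial>scalar_measure E u)" by (simp add: scalar[OF u])
  qed
qed

text \<open>
  Any representing projection-valued measure satisfies the hypotheses of the abstract uniqueness
  lemma. The work is to show that its scalar measures are genuine finite measures.
\<close>

theorem spectral_measure_eq:
  assumes E: "is_spectral_measure ell2 A E" and B: "B \<in> sets borel" and u: "u \<in> ell2"
  shows "Re (ell2_inner u (E B u)) = measure (spectral (vec_of u)) B"
proof -
  note pvm = E[unfolded is_spectral_measure_def, THEN conjunct1, unfolded projection_valued_measure_def]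
  have proj: "orthogonal_projection (E B)" if "B \<in> sets borel" for B using pvm that by blast
  define P where "P B w = vec_of (E B (coord w))" for B w
  have E_ell2: "E B w \<in> ell2" if "B \<in> sets borel" "w \<in> ell2" for B w
    using proj[OF that(1)] that(2) unfolding orthogonal_projection_def by blast
  have coord_P: "coord (P B w) = E B (coord w)" if "B \<in> sets borel" for B w
    using E_ell2[OF that] by (simp add: P_def)
  define m where "m w = scalar_measure E (coord w)" for w
  have form: "inner w (P B w') = Re (ell2_inner (coord w) (E B (coord w')))" if "B \<in> sets borel" for B w w'
    unfolding inner_l2_eq by (simp add: coord_P[OF that])
  have sym: "inner (P B w) w' = inner w (P B w')" if B: "B \<in> sets borel" for B w w'
    unfolding inner_l2_eq coord_P[OF B] using proj[OF B] unfolding orthogonal_projection_def by simp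
  have add: "P B (w + w') = P B w + P B w'" if B: "B \<in> sets borel" for B w w'
  proof -
    have "E B (\<lambda>n. 1 * coord w n + coord w' n) = (\<lambda>n. 1 * E B (coord w) n + E B (coord w') n)"
      using proj[OF B] unfolding orthogonal_projection_def by (metis coord_ell2)
    then have eq: "E B (\<lambda>n. coord w n + coord w' n) = (\<lambda>n. E B (coord w) n + E B (coord w') n)" by simp
    have coord_add: "coord (w + w') = (\<lambda>n. coord w n + coord w' n)" by (simp add: fun_eq_iff)
    show ?thesis
      by (rule l2_eqI) (simp add: coord_P[OF B] coord_add eq)
  qed
  have mult: "P (B \<inter> C) w = P B (P C w)" if "B \<in> sets borel" "C \<in> sets borel" for B C w
  proof -
    have "E (B \<inter> C) (coord w) = E B (E C (coord w))" using that pvm coord_ell2[of w] by blast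
    then show ?thesis unfolding P_def[of "B \<inter> C"] P_def[of B] coord_P[OF that(2)] by simp
  qed
  have univ: "P UNIV w = w" for w
    using pvm by (simp add: P_def coord_inverse)
  have nonneg: "0 \<le> inner w (P B w)" if B: "B \<in> sets borel" for B w
  proof -
    have "inner w (P B w) = inner (P B w) (P B w)" using mult[OF B B, of w] by (simp add: sym[OF B])
    then show ?thesis by simp
  qed
  have sums: "(\<lambda>i. inner w (P (B i) w)) sums inner w (P (\<Union>i. B i) w)"
    if "range B \<subseteq> sets borel" "disjoint_family B" for B :: "nat \<Rightarrow> real set" and w
  proof -
    have "(\<lambda>i. ell2_inner (coord w) (E (B i) (coord w))) sums ell2_inner (coord w) (E (\<Union>i. B i) (coord w))"
      using pvm that coord_ell2[of w] by blast
    then have "(\<lambda>i. Re (ell2_inner (coord w) (E (B i) (coord w)))) sums Re (ell2_inner (coord w) (E (\<Union>i. B i) (coord w)))"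
      by (rule sums_Re)
    moreover have "B i \<in> sets borel" for i using that(1) by auto
    moreover have "(\<Union>i. B i) \<in> sets borel" using that(1) by auto
    ultimately show ?thesis by (simp add: form)
  qed
  have sets_m: "sets (m w) = sets borel" for w
    unfolding m_def scalar_measure_def using sets.sigma_sets_eq[of "borel :: real measure"] by (subst sets_measure_of) auto
  have em: "emeasure (m w) B = ennreal (inner w (P B w))" if B: "B \<in> sets borel" for w B
  proof -
    let ?f = "\<lambda>B. ennreal (Re (ell2_inner (coord w) (E B (coord w))))"
    have "emeasure (measure_of UNIV (sets borel) ?f) B = ?f B"
    proof (rule emeasure_measure_of)
      have sm: "sets (measure_of UNIV (sets borel) ?f) = sets borel" using sets_m[of w] by (simp add: m_def scalar_measure_def)
      have e: "?f B = ennreal (inner w (P B w))" if "B \<in> sets borel" for B by (simp add: form that)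
      show "positive (sets (measure_of UNIV (sets borel) ?f)) ?f"
      proof -
        have "summable (\<lambda>_::nat. inner w (P {} w))"
          using sums[of "\<lambda>_. {}" w, THEN sums_summable] by (simp add: disjoint_family_on_def)
        then have "inner w (P {} w) = 0" by (simp add: summable_const_iff)
        then show ?thesis unfolding positive_def using e[of "{}"] by simp
      qed
      show "countably_additive (sets (measure_of UNIV (sets borel) ?f)) ?f"
      proof (rule countably_additiveI)
        fix C :: "nat \<Rightarrow> real set"
        assume C: "range C \<subseteq> sets (measure_of UNIV (sets borel) ?f)" "disjoint_family C" "(\<Union>i. C i) \<in> sets (measure_of UNIV (sets borel) ?f)"
        have C': "C i \<in> sets borel" for i using C(1) sm by auto
        have "(\<Sum>i. ennreal (inner w (P (C i) w))) = ennreal (inner w (P (\<Union>i. C i) w))"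
          using sums[of C w] C(1,2) sm nonneg[OF C'] by (intro suminf_ennreal_eq) auto
        then show "(\<Sum>i. ?f (C i)) = ?f (\<Union>i. C i)" using e C' C(3) sm by simp
      qed
      show "B \<in> sets (measure_of UNIV (sets borel) ?f)" using B sm by simp
    qed auto
    then show ?thesis by (simp add: m_def scalar_measure_def form B)
  qed
  have fin: "finite_measure (m w)" for w
    by (rule finite_measureI) (use sets_eq_imp_space_eq[OF sets_m[of w]] em[of UNIV w] in simp)
  have dom: "integrable (m w) (\<lambda>x. x\<^sup>2)" for w
    using E coord_ell2[of w] unfolding is_spectral_measure_def m_def by blast
  have "m (vec_of u) = spectral (vec_of u)"
  proof (rule spectral_measure_unique[where E = P])
    show "measure (m w) B = inner w (P B w)" if "B \<in> sets borel" for B w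
      using em[OF that] nonneg[OF that] by (simp add: measure_def)
    show "integrable (m w) (\<lambda>x. x)" for w
    proof -
      interpret finite_measure "m w" by (rule fin)
      show ?thesis
        by (rule square_integrable_imp_integrable[OF _ dom]) (subst measurable_cong_sets[OF sets_m refl], simp)
    qed
    show "inner w (Op w) = (\<integral>x. x \<partial>m w)" for w
    proof -
      have "ell2_inner (coord w) (A (coord w)) = complex_of_real (\<integral>x. x \<partial>m w)"
        using E unfolding is_spectral_measure_def m_def by simp
      then show ?thesis by (simp add: inner_l2_eq coord_Op)
    qed
  qed (fact sym add mult univ fin sets_m)+
  moreover have "measure (m (vec_of u)) B = inner (vec_of u) (P B (vec_of u))"
    using em[OF B, of "vec_of u"] nonneg[OF B] by (simp add: measure_def)
  ultimately show ?thesis using u by (simp add: form B)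
qed

end

section \<open>Resolvents and Stieltjes transforms\<close>

context bounded_symmetric
begin

lemma spectral_isometry:
  assumes "\<And>u v. inner (J u) (J v) = inner u v" "\<And>u. A (J u) = J (A u)"
  shows "spectral (J u) = spectral u"
proof (rule spectral_eqI[OF finite_spectral sets_spectral support_spectral, symmetric])
  have "(A ^^ k) (J u) = J ((A ^^ k) u)" for k by (induction k) (simp_all add: assms)
  then show "(\<integral>t. t ^ k \<partial>spectral u) = inner (J u) ((A ^^ k) (J u))" for k
    by (simp add: moment_spectral assms)
qed

lemma integrable_tame: "tame f \<Longrightarrow> integrable (spectral u) f"
  unfolding tame_def using integrable_spectral by blast

lemma polar_plus: "tame f \<Longrightarrow> tame g \<Longrightarrow> polar (\<lambda>t. f t + g t) v u = polar f v u + polar g v u"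
  unfolding polar_def by (simp add: integrable_tame diff_divide_distrib add_divide_distrib)

lemma tame_scale_power: "tame (\<lambda>t. t ^ k * c)"
  by (rule tame_mult[OF tame_power tame_const])

lemma tame_add: "tame f \<Longrightarrow> tame g \<Longrightarrow> tame (\<lambda>t. f t + g t)"
  unfolding tame_def
proof (elim conjE exE, intro conjI)
  fix b c assume "\<forall>t. \<bar>t\<bar> \<le> 3 * R \<longrightarrow> \<bar>f t\<bar> \<le> b" "\<forall>t. \<bar>t\<bar> \<le> 3 * R \<longrightarrow> \<bar>g t\<bar> \<le> c"
  then show "\<exists>b. \<forall>t. \<bar>t\<bar> \<le> 3 * R \<longrightarrow> \<bar>f t + g t\<bar> \<le> b"
    by (intro exI[of _ "b + c"]) (meson abs_triangle_ineq add_mono order_trans)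
qed simp

lemma polar_quadratic:
  "polar (\<lambda>t. t ^ k * (a + b * t + c * t\<^sup>2)) v u
    = inner v ((A ^^ k) (a *\<^sub>R u + b *\<^sub>R A u + c *\<^sub>R A (A u)))"
proof -
  have "(\<lambda>t::real. t ^ k * (a + b * t + c * t\<^sup>2)) = (\<lambda>t. (t ^ k * a + t ^ (k + 1) * b) + t ^ (k + 2) * c)"
    by (simp add: fun_eq_iff power_add algebra_simps power2_eq_square)
  then have "polar (\<lambda>t. t ^ k * (a + b * t + c * t\<^sup>2)) v u
      = a * polar (\<lambda>t. t ^ k) v u + b * polar (\<lambda>t. t ^ (k + 1)) v u + c * polar (\<lambda>t. t ^ (k + 2)) v u"
    by (simp only: polar_plus tame_add tame_scale_power polar_times_const)
  moreover have "(A ^^ k) (A w) = (A ^^ (k + 1)) w" "(A ^^ k) (A (A w)) = (A ^^ (k + 2)) w" for w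
    by (simp_all add: funpow_swap1)
  ultimately show ?thesis
    by (simp only: polar_moment linear_add[OF linear_pow] linear_scale[OF linear_pow] inner_add_right inner_scaleR_right)
qed

lemma tame_inverse_quadratic: "0 < \<eta> \<Longrightarrow> tame (\<lambda>t. 1 / ((t - x)\<^sup>2 + \<eta>\<^sup>2))"
  unfolding tame_def
proof (intro conjI exI[of _ "1 / \<eta>\<^sup>2"] allI impI)
  fix t assume "0 < \<eta>"
  then show "\<bar>1 / ((t - x)\<^sup>2 + \<eta>\<^sup>2)\<bar> \<le> 1 / \<eta>\<^sup>2"
    by (simp add: abs_of_nonneg frac_le sum_power2_gt_zero_iff add_nonneg_pos)
qed simp

text \<open>
  Real and imaginary part of \<open>\<langle>e, (A - z)\<^sup>-\<^sup>1 e\<rangle>\<close>, with \<open>z = x + i\<eta>\<close> and \<open>i\<close> represented by \<open>J\<close>. Applying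
  \<open>A - x + \<eta>J\<close> to the resolvent equation gives \<open>((A - x)\<^sup>2 + \<eta>\<^sup>2) w = (A - x) e + \<eta> J e\<close>, and the
  functional calculus divides by the positive quadratic.
\<close>

lemma stieltjes_representation:
  assumes J: "linear J" "\<And>u v. inner (J u) (J v) = inner u v" "\<And>u. J (J u) = - u" "\<And>u. A (J u) = J (A u)"
    and eq: "A w - x *\<^sub>R w - \<eta> *\<^sub>R J w = e" and \<eta>: "0 < \<eta>"
  shows "inner e w = (\<integral>t. (t - x) / ((t - x)\<^sup>2 + \<eta>\<^sup>2) \<partial>spectral e)"
    and "inner (J e) w = (\<integral>t. \<eta> / ((t - x)\<^sup>2 + \<eta>\<^sup>2) \<partial>spectral e)"
proof -
  let ?q = "\<lambda>t. (t - x)\<^sup>2 + \<eta>\<^sup>2"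
  have q_pos: "0 < ?q t" for t using \<eta> by (simp add: sum_power2_gt_zero_iff)
  note tq = tame_inverse_quadratic[OF \<eta>, of x]
  let ?h = "\<lambda>i::nat. \<lambda>t. if i = 0 then (x\<^sup>2 + \<eta>\<^sup>2) + (- 2 * x) * t + 1 * t\<^sup>2 else if i = 1 then x + (- 1) * t + 0 * t\<^sup>2 else - \<eta> + 0 * t + 0 * t\<^sup>2"
  let ?u = "\<lambda>i::nat. if i = 0 then w else if i = 1 then e else J e"
  have e1: "A e = A (A w) - x *\<^sub>R A w - \<eta> *\<^sub>R J (A w)"
    unfolding eq[symmetric] by (simp add: linear_diff[OF linear_op] linear_scale[OF linear_op] J)
  have e2: "J e = J (A w) - x *\<^sub>R J w + \<eta> *\<^sub>R w"
    unfolding eq[symmetric] by (simp add: linear_diff[OF J(1)] linear_scale[OF J(1)] J)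
  have twice: "(- 2 * x) *\<^sub>R y = - (x *\<^sub>R y) - x *\<^sub>R y" for y :: 'h
    by (simp flip: scaleR_minus_left scaleR_diff_left)
  (* ((A - x)^2 + \<eta>^2) w = (A - x) e + \<eta> J e, with each term padded to a quadratic in A so that
     polar_quadratic applies to all three. *)
  have op_eq: "((x\<^sup>2 + \<eta>\<^sup>2) *\<^sub>R w + (- 2 * x) *\<^sub>R A w + 1 *\<^sub>R A (A w))
      + (x *\<^sub>R e + (- 1) *\<^sub>R A e + 0 *\<^sub>R A (A e)) + ((- \<eta>) *\<^sub>R J e + 0 *\<^sub>R A (J e) + 0 *\<^sub>R A (A (J e))) = 0"
    unfolding twice e1 e2 unfolding eq[symmetric] by (simp add: algebra_simps power2_eq_square)
  have main: "(\<Sum>i\<in>{0, 1, 2::nat}. polar (\<lambda>t. (1 / ?q t) * ?h i t) v (?u i)) = 0" for v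
  proof (rule polar_combination[OF _ _ _ tq])
    show "tame (?h i)" for i
    proof -
      have "tame (\<lambda>t. a + b * t + c * t\<^sup>2)" for a b c :: real
        using tame_add[OF tame_add[OF tame_scale_power[of 0 a] tame_scale_power[of 1 b]] tame_scale_power[of 2 c]]
        by (simp add: mult.commute)
      then show ?thesis by (cases "i = 0"; cases "i = 1"; simp only: if_True if_False simp_thms)
    qed
    show "(\<Sum>i\<in>{0, 1, 2::nat}. polar (\<lambda>t. t ^ k * ?h i t) v (?u i)) = 0" for k
    proof -
      have "(\<Sum>i\<in>{0, 1, 2::nat}. polar (\<lambda>t. t ^ k * ?h i t) v (?u i))
        = polar (\<lambda>t. t ^ k * ((x\<^sup>2 + \<eta>\<^sup>2) + (- 2 * x) * t + 1 * t\<^sup>2)) v w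
        + polar (\<lambda>t. t ^ k * (x + (- 1) * t + 0 * t\<^sup>2)) v e
        + polar (\<lambda>t. t ^ k * (- \<eta> + 0 * t + 0 * t\<^sup>2)) v (J e)" by simp
      also have "\<dots> = inner v ((A ^^ k) (((x\<^sup>2 + \<eta>\<^sup>2) *\<^sub>R w + (- 2 * x) *\<^sub>R A w + 1 *\<^sub>R A (A w))
      + (x *\<^sub>R e + (- 1) *\<^sub>R A e + 0 *\<^sub>R A (A e)) + ((- \<eta>) *\<^sub>R J e + 0 *\<^sub>R A (J e) + 0 *\<^sub>R A (A (J e)))))"
        unfolding polar_quadratic linear_add[OF linear_pow] inner_add_right ..
      finally show ?thesis unfolding op_eq by (simp add: linear_0[OF linear_pow])
    qed
  qed simp
  have one: "(1 / ?q t) * ((x\<^sup>2 + \<eta>\<^sup>2) + (- 2 * x) * t + 1 * t\<^sup>2) = t ^ 0" for t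
  proof -
    have "(x\<^sup>2 + \<eta>\<^sup>2) + (- 2 * x) * t + 1 * t\<^sup>2 = ?q t" by (simp add: power2_eq_square algebra_simps)
    then show ?thesis using q_pos[of t] \<eta> by simp
  qed
  have two: "(\<lambda>t. (1 / ?q t) * (x + (- 1) * t + 0 * t\<^sup>2)) = (\<lambda>t. ((t - x) / ?q t) * (- 1))"
    by (rule ext) (simp add: diff_divide_distrib)
  have three: "(\<lambda>t. (1 / ?q t) * (- \<eta> + 0 * t + 0 * t\<^sup>2)) = (\<lambda>t. (1 / ?q t) * (- \<eta>))" by simp
  have main': "inner v w = polar (\<lambda>t. (t - x) / ?q t) v e + \<eta> * polar (\<lambda>t. 1 / ?q t) v (J e)" for v
  proof -
    have "polar (\<lambda>t. (1 / ?q t) * ((x\<^sup>2 + \<eta>\<^sup>2) + (- 2 * x) * t + 1 * t\<^sup>2)) v w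
        + polar (\<lambda>t. (1 / ?q t) * (x + (- 1) * t + 0 * t\<^sup>2)) v e
        + polar (\<lambda>t. (1 / ?q t) * (- \<eta> + 0 * t + 0 * t\<^sup>2)) v (J e) = 0"
      using main[of v] by simp
    then show ?thesis unfolding one two three polar_times_const polar_moment by simp
  qed
  note iso = spectral_isometry[OF J(2) J(4)]
  (* J maps e - J e to e + J e, so the polarised measure of the pair (e, J e) vanishes. *)
  have "spectral (e + J e) = spectral (e - J e)"
  proof -
    have "J (e - J e) = e + J e" by (simp add: linear_diff[OF J(1)] J)
    then show ?thesis using iso[of "e - J e"] by simp
  qed
  then have p0: "polar f e (J e) = 0" for f by (simp add: polar_def)
  have p0': "polar f (J e) e = 0" if "tame f" for f using p0 polar_commute[OF that] by simp
  have tx: "tame (\<lambda>t. (t - x) / ?q t)"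
    using tame_mult[OF tame_add[OF tame_power[of 1] tame_const[of "- x"]] tq] by simp
  show "inner e w = (\<integral>t. (t - x) / ?q t \<partial>spectral e)"
    unfolding main' p0 polar_diag[OF tx] by simp
  show "inner (J e) w = (\<integral>t. \<eta> / ?q t \<partial>spectral e)"
    unfolding main' p0'[OF tx] polar_diag[OF tq] iso
    using integral_mult_right_zero[of "spectral e" \<eta> "\<lambda>t. 1 / ?q t"] by simp
qed

text \<open>
  Pairing the equation with \<open>J w\<close> removes the symmetric part, since \<open>\<langle>J w, (A - x) w\<rangle> = 0\<close>.
\<close>

lemma resolvent_bound:
  assumes J: "linear J" "\<And>u v. inner (J u) (J v) = inner u v" "\<And>u. J (J u) = - u" "\<And>u. A (J u) = J (A u)"
    and eq: "A w - x *\<^sub>R w - \<eta> *\<^sub>R J w = e" and \<eta>: "0 < \<eta>"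
  shows "\<eta> * norm w \<le> norm e"
proof -
  have skew: "inner (J u) v = - inner u (J v)" for u v using J(2)[of u "J v"] by (simp add: J)
  have "inner (J w) w = 0" using skew[of w w] by (simp add: inner_commute)
  moreover have "inner (J w) (A w) = 0"
  proof -
    have "inner (J w) (A w) = - inner (A w) (J w)"
      using skew[of w "A w"] symmetric[of w "J w"] by (simp add: J)
    then show ?thesis by (simp add: inner_commute)
  qed
  ultimately have "inner (J w) e = - \<eta> * inner w w"
    unfolding eq[symmetric] by (simp add: inner_diff_right J)
  then have "\<eta> * (norm w)\<^sup>2 = - inner (J w) e" by (simp add: power2_norm_eq_inner)
  also have "\<dots> \<le> norm (J w) * norm e" using norm_cauchy_schwarz[of "- J w" e] by simp
  also have "norm (J w) = norm w" by (simp add: norm_eq_sqrt_inner J)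
  finally show ?thesis by (cases "w = 0") (simp_all add: power2_eq_square)
qed

end

lemma vec_of_add: "u \<in> ell2 \<Longrightarrow> v \<in> ell2 \<Longrightarrow> vec_of (\<lambda>n. u n + v n) = vec_of u + vec_of v"
  by (rule l2_eqI) (simp add: ell2_add)

lemma norm_vec_of_mono:
  assumes v: "v \<in> ell2" and le: "\<And>n. cmod (u n) \<le> c * cmod (v n)" and c: "0 \<le> c"
  shows "u \<in> ell2" "norm (vec_of u) \<le> c * norm (vec_of v)"
proof -
  have sq: "(cmod (u n))\<^sup>2 \<le> c\<^sup>2 * (cmod (v n))\<^sup>2" for n
    using power_mono[OF le[of n], of 2] by (simp add: power_mult_distrib)
  then show u: "u \<in> ell2" by (rule ell2I_bound[OF v])
  have "(norm (vec_of u))\<^sup>2 \<le> (\<Sum>\<^sub>\<infinity>n. c\<^sup>2 * (cmod (v n))\<^sup>2)"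
    unfolding norm_l2_square coord_vec_of[OF u]
    by (rule infsum_mono) (use u v sq in \<open>auto simp: ell2_def intro!: summable_on_cmult_right\<close>)
  also have "\<dots> = (c * norm (vec_of v))\<^sup>2"
    by (simp add: power_mult_distrib norm_l2_square v infsum_cmult_right')
  finally show "norm (vec_of u) \<le> c * norm (vec_of v)"
    using c by (rule_tac power2_le_imp_le) auto
qed

lemma ell2_inner_add_left:
  "u \<in> ell2 \<Longrightarrow> v \<in> ell2 \<Longrightarrow> w \<in> ell2 \<Longrightarrow> ell2_inner (\<lambda>n. v n + w n) u = ell2_inner v u + ell2_inner w u"
  by (subst (1 2 3) ell2_inner_commute) (simp add: ell2_inner_add_right)

lemma ell2_operator_add:
  assumes A: "ell2_operator A R" and B: "ell2_operator B R'"
  shows "ell2_operator (\<lambda>u n. A u n + B u n) (R + R')"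
proof -
  interpret A: ell2_operator A R by (rule A)
  interpret B: ell2_operator B R' by (rule B)
  show ?thesis
  proof
    fix u v :: "'a \<Rightarrow> complex" and c assume u: "u \<in> ell2" and v: "v \<in> ell2"
    note [simp] = u v A.maps[OF u] A.maps[OF v] B.maps[OF u] B.maps[OF v]
    show "(\<lambda>n. A u n + B u n) \<in> ell2" by (simp add: ell2_add)
    show "(\<lambda>n. A (\<lambda>n. c * u n + v n) n + B (\<lambda>n. c * u n + v n) n) = (\<lambda>n. c * (A u n + B u n) + (A v n + B v n))"
      unfolding A.complex_linear[OF u v] B.complex_linear[OF u v] by (simp add: algebra_simps)
    show "ell2_inner (\<lambda>n. A u n + B u n) v = ell2_inner u (\<lambda>n. A v n + B v n)"
      by (simp add: ell2_inner_add_left ell2_inner_add_right A.hermitian B.hermitian)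
    have "norm (vec_of (\<lambda>n. A u n + B u n)) \<le> norm (vec_of (A u)) + norm (vec_of (B u))"
      by (simp add: vec_of_add norm_triangle_ineq)
    then show "norm (vec_of (\<lambda>n. A u n + B u n)) \<le> (R + R') * norm (vec_of u)"
      using A.norm_bound[OF u] B.norm_bound[OF u] by (simp add: distrib_right)
  qed (use A.R_positive B.R_positive in simp)
qed

lemma ell2_operator_multiplication:
  assumes W: "\<And>n. \<bar>\<omega> n\<bar> \<le> W" "0 < W"
  shows "ell2_operator (\<lambda>u n. complex_of_real (\<omega> n) * u n) W"
proof
  fix u v :: "'a \<Rightarrow> complex" and c assume u: "u \<in> ell2" and v: "v \<in> ell2"
  have le: "cmod (complex_of_real (\<omega> n) * u n) \<le> W * cmod (u n)" for n
    using W by (simp add: norm_mult mult_right_mono)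
  show "(\<lambda>n. complex_of_real (\<omega> n) * u n) \<in> ell2"
    "norm (vec_of (\<lambda>n. complex_of_real (\<omega> n) * u n)) \<le> W * norm (vec_of u)"
    using norm_vec_of_mono[OF u le] W by auto
  show "(\<lambda>n. complex_of_real (\<omega> n) * (c * u n + v n)) =
      (\<lambda>n. c * (complex_of_real (\<omega> n) * u n) + complex_of_real (\<omega> n) * v n)" by (simp add: algebra_simps)
  show "ell2_inner (\<lambda>n. complex_of_real (\<omega> n) * u n) v = ell2_inner u (\<lambda>n. complex_of_real (\<omega> n) * v n)"
    unfolding ell2_inner_def by (rule infsum_cong) simp
qed (rule W)

lemma ell2_operator_compression:
  assumes "ell2_operator A R"
  shows "ell2_operator (\<lambda>u. restr S (A (restr S u))) R"
proof -
  interpret ell2_operator A R by fact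
  have move: "ell2_inner (restr S u) v = ell2_inner u (restr S v)" for u v
    unfolding ell2_inner_def by (rule infsum_cong) (simp add: restr_def)
  have contract: "norm (vec_of (restr S u)) \<le> norm (vec_of u)" if "u \<in> ell2" for u
    using norm_vec_of_mono(2)[OF that, of "restr S u" 1] by (simp add: restr_def)
  show ?thesis
  proof
    fix u v :: "'a \<Rightarrow> complex" and c assume u: "u \<in> ell2" and v: "v \<in> ell2"
    note [simp] = restr_ell2[OF u, of S] restr_ell2[OF v, of S]
    show "restr S (A (restr S u)) \<in> ell2" by (simp add: restr_ell2 maps)
    have "restr S (\<lambda>n. c * u n + v n) = (\<lambda>n. c * restr S u n + restr S v n)" by (auto simp: restr_def)
    then show "restr S (A (restr S (\<lambda>n. c * u n + v n))) = (\<lambda>n. c * restr S (A (restr S u)) n + restr S (A (restr S v)) n)"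
      by (simp add: complex_linear) (auto simp: restr_def)
    show "ell2_inner (restr S (A (restr S u))) v = ell2_inner u (restr S (A (restr S v)))"
      unfolding move[of _ v] by (simp add: hermitian move)
    have "norm (vec_of (restr S (A (restr S u)))) \<le> R * norm (vec_of (restr S u))"
      using contract[OF maps] norm_bound by (meson order_trans restr_ell2 u)
    also have "\<dots> \<le> R * norm (vec_of u)" using contract[OF u] R_positive by simp
    finally show "norm (vec_of (restr S (A (restr S u)))) \<le> R * norm (vec_of u)" .
  qed (rule R_positive)
qed

context bethe
begin

text \<open>
  Every value \<open>\<phi> k\<close> is counted once for each of the \<open>K + 1\<close> neighbours of \<open>k\<close>.
\<close>

lemma neighbour_sum_bound:
  fixes \<phi> :: "'v \<Rightarrow> real"
  assumes nn: "\<And>n. 0 \<le> \<phi> n" and sm: "\<phi> summable_on UNIV"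
  shows "(\<lambda>n. \<Sum>k | adj n k. \<phi> k) summable_on UNIV"
    and "(\<Sum>\<^sub>\<infinity>n. \<Sum>k | adj n k. \<phi> k) \<le> (real K + 1) * (\<Sum>\<^sub>\<infinity>n. \<phi> n)"
proof -
  have fin: "(\<Sum>n\<in>F. \<Sum>k | adj n k. \<phi> k) \<le> (real K + 1) * (\<Sum>\<^sub>\<infinity>n. \<phi> n)" if F: "finite F" for F
  proof -
    let ?U = "\<Union>n\<in>F. {k. adj n k}"
    have U: "finite ?U" using F by simp
    have "(\<Sum>n\<in>F. \<Sum>k | adj n k. \<phi> k) = (\<Sum>n\<in>F. \<Sum>k\<in>{k \<in> ?U. adj n k}. \<phi> k)"
      by (intro sum.cong refl) auto
    also have "\<dots> = (\<Sum>k\<in>?U. \<Sum>n\<in>{n \<in> F. adj n k}. \<phi> k)" by (rule sum.swap_restrict[OF F U])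
    also have "\<dots> \<le> (\<Sum>k\<in>?U. (real K + 1) * \<phi> k)"
    proof (rule sum_mono)
      fix k
      have "card {n \<in> F. adj n k} \<le> card {n. adj k n}"
        by (rule card_mono) (use adj_sym in auto)
      then have "real (card {n \<in> F. adj n k}) \<le> real K + 1" unfolding degree by simp
      then show "(\<Sum>n\<in>{n \<in> F. adj n k}. \<phi> k) \<le> (real K + 1) * \<phi> k" using nn[of k] by (simp add: mult_right_mono)
    qed
    also have "\<dots> = (real K + 1) * (\<Sum>k\<in>?U. \<phi> k)" by (simp add: sum_distrib_left)
    also have "\<dots> \<le> (real K + 1) * (\<Sum>\<^sub>\<infinity>n. \<phi> n)"
      by (intro mult_left_mono finite_sum_le_infsum) (use sm U nn in auto)
    finally show ?thesis .
  qed
  show s: "(\<lambda>n. \<Sum>k | adj n k. \<phi> k) summable_on UNIV"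
    by (rule nonneg_bdd_above_summable_on) (use nn fin in \<open>auto intro!: sum_nonneg bdd_aboveI2\<close>)
  show "(\<Sum>\<^sub>\<infinity>n. \<Sum>k | adj n k. \<phi> k) \<le> (real K + 1) * (\<Sum>\<^sub>\<infinity>n. \<phi> n)"
    by (rule infsum_le_finite_sums[OF s]) (rule fin)
qed

lemma laplacian_square_le: "(cmod (laplacian adj u n))\<^sup>2 \<le> (real K + 1) * (\<Sum>k | adj n k. (cmod (u k))\<^sup>2)"
proof -
  have "(cmod (laplacian adj u n))\<^sup>2 \<le> (\<Sum>k | adj n k. cmod (u k))\<^sup>2"
    unfolding laplacian_eq by (intro power_mono norm_sum norm_ge_zero)
  also have "\<dots> \<le> (\<Sum>k | adj n k. (cmod (u k))\<^sup>2) * card {k. adj n k}"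
    by (rule sum_squared_le_sum_of_squares)
  finally show ?thesis unfolding degree by (simp add: mult.commute add.commute)
qed

lemma laplacian_ell2:
  assumes u: "u \<in> ell2"
  shows "laplacian adj u \<in> ell2" and "norm (vec_of (laplacian adj u)) \<le> (real K + 1) * norm (vec_of u)"
proof -
  have us: "(\<lambda>n. (cmod (u n))\<^sup>2) summable_on UNIV" using u by (simp add: ell2_def)
  note nb = neighbour_sum_bound[OF _ us]
  have s: "(\<lambda>n. (real K + 1) * (\<Sum>k | adj n k. (cmod (u k))\<^sup>2)) summable_on UNIV"
    by (intro summable_on_cmult_right nb) simp
  show L: "laplacian adj u \<in> ell2"
    unfolding ell2_def mem_Collect_eq
    by (rule summable_on_comparison_test[OF s laplacian_square_le]) simp
  have "(norm (vec_of (laplacian adj u)))\<^sup>2 \<le> (\<Sum>\<^sub>\<infinity>n. (real K + 1) * (\<Sum>k | adj n k. (cmod (u k))\<^sup>2))"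
    unfolding norm_l2_square coord_vec_of[OF L]
    by (rule infsum_mono[OF _ s laplacian_square_le]) (use L in \<open>simp add: ell2_def\<close>)
  also have "\<dots> = (real K + 1) * (\<Sum>\<^sub>\<infinity>n. \<Sum>k | adj n k. (cmod (u k))\<^sup>2)" by (rule infsum_cmult_right')
  also have "\<dots> \<le> (real K + 1) * ((real K + 1) * (\<Sum>\<^sub>\<infinity>n. (cmod (u n))\<^sup>2))"
    by (intro mult_left_mono nb) auto
  also have "\<dots> = ((real K + 1) * norm (vec_of u))\<^sup>2"
    using norm_l2_square[of "vec_of u"] u by (simp add: power_mult_distrib power2_eq_square[of "real K + 1"])
  finally show "norm (vec_of (laplacian adj u)) \<le> (real K + 1) * norm (vec_of u)"
    by (rule power2_le_imp_le) simp
qed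

lemma laplacian_linear: "laplacian adj (\<lambda>n. c * u n + v n) = (\<lambda>n. c * laplacian adj u n + laplacian adj v n)"
  unfolding laplacian_eq by (simp add: sum.distrib sum_distrib_left)

lemma laplacian_operator: "ell2_operator (laplacian adj) (real K + 1)"
proof -
  define D where "D w = vec_of (laplacian adj (coord w))" for w :: "'v l2"
  have coord_D: "coord (D w) = laplacian adj (coord w)" for w by (simp add: D_def laplacian_ell2)
  have D_lin: "D (a *\<^sub>R u + v) = a *\<^sub>R D u + D v" for a u v
    by (rule l2_eqI) (simp add: coord_D laplacian_eq sum.distrib sum_distrib_left)
  have D_i: "D (mult_i u) = mult_i (D u)" for u
    by (rule l2_eqI) (simp add: coord_D laplacian_eq sum_distrib_left)
  have D_basis: "D (basis n) = (\<Sum>k | adj n k. basis k)" for n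
  proof (rule l2_eqI)
    fix m
    have "(\<Sum>k | adj m k. delta n k) = (\<Sum>k | adj n k. delta k m)"
    proof -
      have "(\<Sum>k | adj m k. delta n k) = (if adj m n then 1 else 0)" by (simp add: delta_def)
      also have "\<dots> = (if adj n m then 1 else 0)" using adj_sym[of m n] adj_sym[of n m] by auto
      also have "\<dots> = (\<Sum>k | adj n k. if m = k then 1 else 0)" by simp
      finally show ?thesis by (simp only: delta_def)
    qed
    then show "coord (D (basis n)) m = coord (\<Sum>k | adj n k. basis k) m"
      by (simp add: coord_D laplacian_eq coord_sum)
  qed
  have D_bl: "bounded_linear D"
  proof (rule bounded_linear_intro[where K = "real K + 1"])
    show "D (u + v) = D u + D v" for u v using D_lin[of 1 u v] by simp
    then have "D 0 = 0" by (metis add.right_neutral add_left_cancel)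
    then show "D (r *\<^sub>R u) = r *\<^sub>R D u" for r u using D_lin[of r u 0] by simp
    show "norm (D u) \<le> norm u * (real K + 1)" for u
      using laplacian_ell2(2)[OF coord_ell2[of u]] by (simp add: D_def coord_inverse mult.commute)
  qed
  have mult_i_sum: "mult_i (\<Sum>k\<in>X. f k) = (\<Sum>k\<in>X. mult_i (f k))" for X :: "'v set" and f :: "'v \<Rightarrow> 'v l2"
    by (rule linear_sum[OF mult_i_linear])
  have symm: "inner (D u) v = inner u (D v)" for u v
  proof (rule bounded_linear_eqI_basis[of "\<lambda>v. inner (D u) v" "\<lambda>v. inner u (D v)"])
    show "bounded_linear (\<lambda>v. inner (D u) v)" by (rule bounded_linear_inner_right)
    show "bounded_linear (\<lambda>v. inner u (D v))" by (rule bounded_linear_compose[OF bounded_linear_inner_right D_bl])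
    show "inner (D u) (basis n) = inner u (D (basis n))" for n
      by (simp add: D_basis inner_sum_right inner_commute[of _ "basis _"] inner_basis coord_D laplacian_eq Re_sum)
    show "inner (D u) (mult_i (basis n)) = inner u (D (mult_i (basis n)))" for n
      unfolding D_i D_basis mult_i_sum
      by (simp add: inner_sum_right inner_commute[of _ "mult_i (basis _)"] inner_basis coord_D laplacian_eq Im_sum)
  qed
  show ?thesis
  proof
    fix u v :: "'v \<Rightarrow> complex" and c assume u: "u \<in> ell2" and v: "v \<in> ell2"
    show "laplacian adj u \<in> ell2" "norm (vec_of (laplacian adj u)) \<le> (real K + 1) * norm (vec_of u)"
      using laplacian_ell2[OF u] .
    show "laplacian adj (\<lambda>n. c * u n + v n) = (\<lambda>n. c * laplacian adj u n + laplacian adj v n)"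
      by (rule laplacian_linear)
    show "ell2_inner (laplacian adj u) v = ell2_inner u (laplacian adj v)"
      using ell2_inner_eq[of "D (vec_of u)" "vec_of v"] ell2_inner_eq[of "vec_of u" "D (vec_of v)"] u v
      by (simp add: coord_D symm flip: D_i)
  qed simp
qed

end

section \<open>The Green function of a box\<close>

text \<open>
  Entries of the inverse matrix by Cramer's rule. They are polynomials in the matrix entries divided
  by a determinant, which makes the resolvent measurable in the potential.
\<close>

definition cramer_inverse :: "nat \<Rightarrow> (nat \<Rightarrow> nat \<Rightarrow> complex) \<Rightarrow> nat \<Rightarrow> nat \<Rightarrow> complex" where
  "cramer_inverse N c i j = adj_mat (mat N N (\<lambda>(i, j). c i j)) $$ (i, j) / det (mat N N (\<lambda>(i, j). c i j))"

lemma cramer_inverse: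
  assumes inj: "\<And>v. (\<And>i. i < N \<Longrightarrow> (\<Sum>j<N. c i j * v j) = 0) \<Longrightarrow> (\<And>j. j < N \<Longrightarrow> v j = 0)"
    and i: "i < N" and k: "k < N"
  shows "(\<Sum>j<N. c i j * cramer_inverse N c j k) = (if i = k then 1 else 0)"
proof -
  define M where "M = mat N N (\<lambda>(i, j). c i j)"
  have M: "M \<in> carrier_mat N N" by (simp add: M_def)
  have det: "det M \<noteq> 0"
  proof
    assume "det M = 0"
    then obtain v where v: "v \<in> carrier_vec N" "v \<noteq> 0\<^sub>v N" "M *\<^sub>v v = 0\<^sub>v N"
      using det_0_iff_vec_prod_zero[OF M] by blast
    have "(\<Sum>j<N. c i j * v $ j) = 0" if "i < N" for i
    proof -
      have "(M *\<^sub>v v) $ i = (\<Sum>j<N. c i j * v $ j)"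
        using that v(1) by (simp add: M_def scalar_prod_def lessThan_atLeast0)
      then show ?thesis using that v(3) by simp
    qed
    then have "v $ j = 0" if "j < N" for j using inj[of "\<lambda>j. v $ j"] that by blast
    then have "v = 0\<^sub>v N" using v(1) by (intro eq_vecI) auto
    then show False using v(2) by simp
  qed
  have "(M * adj_mat M) $$ (i, k) = (\<Sum>j<N. c i j * adj_mat M $$ (j, k))"
    using i k adj_mat(1)[OF M] M by (simp add: scalar_prod_def lessThan_atLeast0) (simp add: M_def)
  moreover have "(M * adj_mat M) $$ (i, k) = det M * (if i = k then 1 else 0)"
    using i k by (simp add: adj_mat(2)[OF M])
  ultimately have "(\<Sum>j<N. c i j * adj_mat M $$ (j, k)) = det M * (if i = k then 1 else 0)" by simp
  then have "(\<Sum>j<N. c i j * adj_mat M $$ (j, k)) / det M = (if i = k then 1 else 0)"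
    using det by simp
  then show ?thesis unfolding cramer_inverse_def M_def[symmetric] by (simp add: sum_divide_distrib)
qed

lemma det_measurable:
  assumes "\<And>i j. i < n \<Longrightarrow> j < n \<Longrightarrow> (\<lambda>a. c a i j :: complex) \<in> borel_measurable Ms"
  shows "(\<lambda>a. det (mat n n (\<lambda>(i, j). c a i j))) \<in> borel_measurable Ms"
proof -
  have "det (mat n n (\<lambda>(i, j). c a i j)) = (\<Sum>p | p permutes {0..<n}. signof p * (\<Prod>i = 0..<n. c a i (p i)))" for a
  proof -
    have "p i < n" if "p permutes {0..<n}" "i < n" for p i
      using permutes_in_image[OF that(1), of i] that(2) by simp
    then show ?thesis by (subst det_def'[of _ n]) (auto intro!: sum.cong prod.cong)
  qed
  moreover have "(\<lambda>a. \<Sum>p | p permutes {0..<n}. signof p * (\<Prod>i = 0..<n. c a i (p i))) \<in> borel_measurable Ms"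
  proof (intro borel_measurable_sum borel_measurable_times borel_measurable_prod borel_measurable_const)
    fix p i assume "p \<in> {p. p permutes {0..<n}}" "i \<in> {0..<n}"
    then show "(\<lambda>a. c a i (p i)) \<in> borel_measurable Ms"
      using permutes_in_image[of p "{0..<n}" i] by (intro assms) auto
  qed
  ultimately show ?thesis by simp
qed

lemma cramer_inverse_measurable:
  assumes c: "\<And>i j. i < N \<Longrightarrow> j < N \<Longrightarrow> (\<lambda>a. c a i j) \<in> borel_measurable Ms"
    and i: "i < N" and j: "j < N"
  shows "(\<lambda>a. cramer_inverse N (c a) i j) \<in> borel_measurable Ms"
proof -
  have "adj_mat (mat N N (\<lambda>(i, j). c a i j)) $$ (i, j) = (- 1) ^ (j + i) *
      det (mat (N - 1) (N - 1) (\<lambda>(i', j'). c a (if i' < j then i' else Suc i') (if j' < i then j' else Suc j')))" for a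
  proof -
    have "mat_delete (mat N N (\<lambda>(i, j). c a i j)) j i =
        mat (N - 1) (N - 1) (\<lambda>(i', j'). c a (if i' < j then i' else Suc i') (if j' < i then j' else Suc j'))"
      by (rule eq_matI) (auto simp: mat_delete_def)
    then show ?thesis using i j by (simp add: adj_mat_def cofactor_def)
  qed
  moreover have "(\<lambda>a. det (mat (N - 1) (N - 1) (\<lambda>(i', j'). c a (if i' < j then i' else Suc i') (if j' < i then j' else Suc j')))) \<in> borel_measurable Ms"
    by (rule det_measurable, rule c) auto
  ultimately show ?thesis unfolding cramer_inverse_def
    using det_measurable[of N c, OF c] by (auto intro!: borel_measurable_divide borel_measurable_times)
qed

lemma vec_of_delta: "vec_of (delta n) = basis n"
  by (metis basis.rep_eq coord_inverse)

lemma norm_basis: "norm (basis n) = 1"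
  using inner_basis(1)[of n "basis n"] by (simp add: norm_eq_sqrt_inner delta_def)

lemma (in ell2_operator) resolvent_equation:
  assumes u: "u \<in> ell2" and eq: "(\<lambda>n. A u n - z * u n) = e" and e: "e \<in> ell2"
  shows "Op (vec_of u) - Re z *\<^sub>R vec_of u - Im z *\<^sub>R mult_i (vec_of u) = vec_of e"
proof (rule l2_eqI)
  fix n
  have "A u n - z * u n = e n" using eq by metis
  moreover have "z = of_real (Re z) + \<i> * of_real (Im z)" by (rule complex_eq)
  ultimately have "A u n - (of_real (Re z) + \<i> * of_real (Im z)) * u n = e n" by metis
  then show "coord (Op (vec_of u) - Re z *\<^sub>R vec_of u - Im z *\<^sub>R mult_i (vec_of u)) n = coord (vec_of e) n"
    using u e by (simp add: coord_Op algebra_simps)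
qed

locale anderson_model = bethe adj K orig for adj :: "'v \<Rightarrow> 'v \<Rightarrow> bool" and K and orig +
  fixes lam :: real
  assumes lam_pos: "0 < lam"
begin

abbreviation H_box :: "nat \<Rightarrow> ('v \<Rightarrow> real) \<Rightarrow> ('v \<Rightarrow> complex) \<Rightarrow> ('v \<Rightarrow> complex)" where
  "H_box L \<omega> \<equiv> anderson_box adj orig lam L \<omega>"

abbreviation G :: "nat \<Rightarrow> ('v \<Rightarrow> real) \<Rightarrow> complex \<Rightarrow> 'v \<Rightarrow> 'v \<Rightarrow> complex" where
  "G L \<omega> z \<equiv> box_resolvent adj orig lam L \<omega> z"

lemma H_box_eq: "H_box L \<omega> u = (\<lambda>n. restr (box L) (laplacian adj (restr (box L) u)) n
    + complex_of_real (if n \<in> box L then lam * \<omega> n else 0) * u n)"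
proof
  fix n
  have "(\<Sum>k\<in>box L. complex_of_real (\<omega> k) * restr {k} u n) = (\<Sum>k\<in>box L. if n = k then complex_of_real (\<omega> n) * u n else 0)"
    by (intro sum.cong refl) (simp add: restr_def)
  also have "\<dots> = (if n \<in> box L then complex_of_real (\<omega> n) * u n else 0)" by simp
  finally show "H_box L \<omega> u n = restr (box L) (laplacian adj (restr (box L) u)) n
    + complex_of_real (if n \<in> box L then lam * \<omega> n else 0) * u n"
    unfolding anderson_box_def by simp
qed

text \<open>
  The second summand 1 makes the bound for the multiplication part positive even if the potential vanishes.
\<close>

definition box_bound :: "nat \<Rightarrow> ('v \<Rightarrow> real) \<Rightarrow> real" where
  "box_bound L \<omega> = real K + 1 + (1 + (\<Sum>n\<in>box L. \<bar>lam * \<omega> n\<bar>))"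

lemma H_box_operator: "ell2_operator (H_box L \<omega>) (box_bound L \<omega>)"
proof -
  have "\<bar>if n \<in> box L then lam * \<omega> n else 0\<bar> \<le> 1 + (\<Sum>n\<in>box L. \<bar>lam * \<omega> n\<bar>)" for n
    using member_le_sum[of n "box L" "\<lambda>n. \<bar>lam * \<omega> n\<bar>"] sum_nonneg[of "box L" "\<lambda>n. \<bar>lam * \<omega> n\<bar>"] by auto
  moreover have "0 < 1 + (\<Sum>n\<in>box L. \<bar>lam * \<omega> n\<bar>)" by (intro add_pos_nonneg sum_nonneg) auto
  ultimately have "ell2_operator (\<lambda>u n. complex_of_real (if n \<in> box L then lam * \<omega> n else 0) * u n)
      (1 + (\<Sum>n\<in>box L. \<bar>lam * \<omega> n\<bar>))"
    by (rule ell2_operator_multiplication)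
  from ell2_operator_add[OF ell2_operator_compression[OF laplacian_operator] this]
  have "ell2_operator (\<lambda>u n. restr (box L) (laplacian adj (restr (box L) u)) n
    + complex_of_real (if n \<in> box L then lam * \<omega> n else 0) * u n) (box_bound L \<omega>)"
    unfolding box_bound_def .
  then show ?thesis by (simp only: H_box_eq[symmetric] eta_contract_eq)
qed

lemma anderson_eq: "anderson adj lam \<omega> u = (\<lambda>n. laplacian adj u n + complex_of_real (lam * \<omega> n) * u n)"
  by (simp add: anderson_def potential_def mult.assoc)

lemma anderson_operator:
  assumes W: "\<And>n. \<bar>\<omega> n\<bar> \<le> W" "0 < W"
  shows "ell2_operator (anderson adj lam \<omega>) (real K + 1 + lam * W)"
proof -
  have "\<bar>lam * \<omega> n\<bar> \<le> lam * W" for n using W(1)[of n] lam_pos by (simp add: abs_mult)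
  then have "ell2_operator (\<lambda>u n. complex_of_real (lam * \<omega> n) * u n) (lam * W)"
    using W lam_pos by (intro ell2_operator_multiplication) auto
  from ell2_operator_add[OF laplacian_operator this] show ?thesis
    by (simp only: anderson_eq[symmetric] eta_contract_eq)
qed

lemma anderson_dom_bounded:
  assumes W: "\<And>n. \<bar>\<omega> n\<bar> \<le> W"
  shows "anderson_dom \<omega> = ell2"
proof -
  have "potential \<omega> u \<in> ell2" if "u \<in> ell2" for u
    by (rule ell2I_bound[OF that, where c = "W\<^sup>2"])
      (use power_mono[OF W, of _ 2] in \<open>simp add: potential_def norm_mult power_mult_distrib mult_right_mono\<close>)
  then show ?thesis by (auto simp: anderson_dom_def)
qed

lemma H_box_apply:
  assumes f: "\<And>k. k \<notin> box L \<Longrightarrow> f k = 0" and n: "n \<in> box L"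
  shows "H_box L \<omega> f n = (\<Sum>k\<in>box L. (if adj n k then 1 else 0) * f k) + complex_of_real (lam * \<omega> n) * f n"
proof -
  have "laplacian adj (restr (box L) f) n = (\<Sum>k\<in>box L. (if adj n k then 1 else 0) * f k)"
  proof -
    have "laplacian adj (restr (box L) f) n = (\<Sum>k\<in>{k \<in> box L. adj n k}. f k)"
      unfolding laplacian_eq by (rule sum.mono_neutral_cong_right) (auto simp: restr_def)
    also have "\<dots> = (\<Sum>k\<in>box L. if adj n k then f k else 0)"
      by (rule sum.inter_filter) simp
    finally show ?thesis by (simp add: if_distrib[of "\<lambda>c. c * _"] cong: if_cong)
  qed
  then show ?thesis using n by (simp add: H_box_eq restr_def)
qed

lemma ell2_on_box: "f \<in> ell2_on (box L) \<longleftrightarrow> (\<forall>k. k \<notin> box L \<longrightarrow> f k = 0)"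
  unfolding ell2_on_def using ell2_finite_support[OF finite_box] by blast

lemma H_box_outside: "f \<in> ell2_on (box L) \<Longrightarrow> n \<notin> box L \<Longrightarrow> H_box L \<omega> f n = 0"
  by (simp add: H_box_eq restr_def ell2_on_box)

text \<open>
  The lower bound \<open>Im z\<close> of \<open>H\<^sub>L - z\<close> from \<open>resolvent_bound\<close>.
\<close>

lemma resolvent_injective:
  assumes z: "0 < Im z" and u: "u \<in> ell2_on (box L)" "v \<in> ell2_on (box L)"
    and eq: "(\<lambda>n. H_box L \<omega> u n - z * u n) = (\<lambda>n. H_box L \<omega> v n - z * v n)"
  shows "u = v"
proof -
  interpret H: ell2_operator "H_box L \<omega>" "box_bound L \<omega>" by (rule H_box_operator)
  have ell: "u \<in> ell2" "v \<in> ell2" using u by (simp_all add: ell2_on_def)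
  define w where "w = (\<lambda>n. u n - v n)"
  have w: "w \<in> ell2" unfolding w_def using ell by (rule ell2_diff)
  have "H_box L \<omega> (\<lambda>n. (-1) * v n + u n) = (\<lambda>n. (-1) * H_box L \<omega> v n + H_box L \<omega> u n)"
    using ell by (intro H.complex_linear)
  moreover have "w = (\<lambda>n. (-1) * v n + u n)" by (simp add: w_def)
  ultimately have Hw: "H_box L \<omega> w n = H_box L \<omega> u n - H_box L \<omega> v n" for n by simp
  have "(\<lambda>n. H_box L \<omega> w n - z * w n) = (\<lambda>_. 0)"
  proof
    fix n
    have "H_box L \<omega> u n - z * u n = H_box L \<omega> v n - z * v n" using fun_cong[OF eq] .
    then show "H_box L \<omega> w n - z * w n = 0" unfolding Hw by (simp add: w_def algebra_simps)
  qed
  from H.resolvent_equation[OF w this] have "H.Op (vec_of w) - Re z *\<^sub>R vec_of w - Im z *\<^sub>R mult_i (vec_of w) = vec_of (\<lambda>_. 0)"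
    by (simp add: ell2_def)
  from H.resolvent_bound[OF mult_i_linear mult_i_isometry mult_i_square H.Op_mult_i this z]
  have "norm (vec_of w) \<le> 0" using z by (simp add: zero_l2_def[symmetric] mult_le_0_iff)
  then have "coord (vec_of w) n = 0" for n by simp
  then have "w n = 0" for n using w by simp
  then show ?thesis by (simp add: w_def fun_eq_iff)
qed

text \<open>
  An enumeration of the box, to pass between functions on vertices and matrices.
\<close>

definition site :: "nat \<Rightarrow> nat \<Rightarrow> 'v" where
  "site L = (SOME e. bij_betw e {0..<card (box L)} (box L))"

lemma site_bij: "bij_betw (site L) {..<card (box L)} (box L)"
  using someI_ex[OF ex_bij_betw_nat_finite[OF finite_box[of L]]] by (simp add: site_def lessThan_atLeast0)

lemma ex_site: "n \<in> box L \<Longrightarrow> \<exists>i. i < card (box L) \<and> n = site L i"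
  using bij_betw_imp_surj_on[OF site_bij[of L]] by blast

definition box_entry :: "nat \<Rightarrow> ('v \<Rightarrow> real) \<Rightarrow> complex \<Rightarrow> nat \<Rightarrow> nat \<Rightarrow> complex" where
  "box_entry L \<omega> z i j = (if adj (site L i) (site L j) then 1 else 0)
     + (if i = j then complex_of_real (lam * \<omega> (site L i)) - z else 0)"

lemma box_entry_apply:
  assumes f: "f \<in> ell2_on (box L)" and i: "i < card (box L)"
  shows "H_box L \<omega> f (site L i) - z * f (site L i) = (\<Sum>j<card (box L). box_entry L \<omega> z i j * f (site L j))"
proof -
  have n: "site L i \<in> box L" using i site_bij[of L] by (auto simp: bij_betw_def)
  have "(\<Sum>k\<in>box L. (if adj (site L i) k then 1 else 0) * f k)
      = (\<Sum>j<card (box L). (if adj (site L i) (site L j) then 1 else 0) * f (site L j))"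
    by (rule sum.reindex_bij_betw[OF site_bij, symmetric])
  moreover have "(\<Sum>j<card (box L). (if i = j then complex_of_real (lam * \<omega> (site L i)) - z else 0) * f (site L j))
      = (complex_of_real (lam * \<omega> (site L i)) - z) * f (site L i)"
    using i by (simp add: if_distrib[of "\<lambda>c. c * _"] cong: if_cong)
  ultimately show ?thesis
    using H_box_apply[of L f "site L i" \<omega>] f n
    by (simp add: box_entry_def ell2_on_box distrib_right sum.distrib algebra_simps)
qed

lemma G_solution_exists:
  fixes \<omega> :: "'v \<Rightarrow> real"
  assumes z: "0 < Im z" and j: "j < card (box L)"
  defines "u \<equiv> \<lambda>n. if n \<in> box L then cramer_inverse (card (box L)) (box_entry L \<omega> z) (the_inv_into {..<card (box L)} (site L) n) j else 0"
  shows "u \<in> ell2_on (box L)" "(\<lambda>n. H_box L \<omega> u n - z * u n) = delta (site L j)"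
proof -
  let ?N = "card (box L)"
  show u: "u \<in> ell2_on (box L)" by (simp add: ell2_on_box u_def)
  have inv: "the_inv_into {..<?N} (site L) (site L i) = i" if "i < ?N" for i
    using site_bij[of L] that by (simp add: bij_betw_def the_inv_into_f_f)
  have in_box: "site L i \<in> box L" if "i < ?N" for i using site_bij[of L] that by (auto simp: bij_betw_def)
  have u_site: "u (site L i) = cramer_inverse ?N (box_entry L \<omega> z) i j" if "i < ?N" for i
    using that by (simp add: u_def inv in_box)
  have surj: "\<exists>i<?N. n = site L i" if "n \<in> box L" for n
    using ex_site[OF that] by blast
  have inj: "v j = 0"
    if v: "\<And>i. i < ?N \<Longrightarrow> (\<Sum>j<?N. box_entry L \<omega> z i j * v j) = 0" and j: "j < ?N" for v j
  proof -
    define f where "f n = (if n \<in> box L then v (the_inv_into {..<?N} (site L) n) else 0)" for n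
    have f: "f \<in> ell2_on (box L)" by (simp add: ell2_on_box f_def)
    have f_site: "f (site L i) = v i" if "i < ?N" for i using that by (simp add: f_def inv in_box)
    have "H_box L \<omega> f n - z * f n = 0" for n
    proof (cases "n \<in> box L")
      case True
      then obtain i where i: "i < ?N" "n = site L i" using surj by blast
      show ?thesis unfolding i(2) box_entry_apply[OF f i(1)] using v[OF i(1)] by (simp add: f_site)
    next
      case False
      then show ?thesis using H_box_outside[OF f False, of \<omega>] f by (simp add: ell2_on_box)
    qed
    moreover have zero: "(\<lambda>_. 0) \<in> ell2_on (box L)" by (simp add: ell2_on_box)
    moreover have "H_box L \<omega> (\<lambda>_. 0) n = 0" for n
      by (simp add: H_box_eq restr_def laplacian_eq)
    ultimately have "f = (\<lambda>_. 0)" by (intro resolvent_injective[OF z f zero, of \<omega>]) simp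
    then show ?thesis using f_site[OF j] by simp
  qed
  show "(\<lambda>n. H_box L \<omega> u n - z * u n) = delta (site L j)"
  proof
    fix n
    show "H_box L \<omega> u n - z * u n = delta (site L j) n"
    proof (cases "n \<in> box L")
      case True
      then obtain i where i: "i < ?N" "n = site L i" using surj by blast
      have "H_box L \<omega> u n - z * u n = (\<Sum>k<?N. box_entry L \<omega> z i k * cramer_inverse ?N (box_entry L \<omega> z) k j)"
        unfolding i(2) box_entry_apply[OF u i(1)] by (simp add: u_site)
      also have "\<dots> = (if i = j then 1 else 0)"
      proof (rule cramer_inverse)
        show "v j = 0" if "\<And>i. i < ?N \<Longrightarrow> (\<Sum>j<?N. box_entry L \<omega> z i j * v j) = 0" "j < ?N" for v j
          using that by (rule inj)
      qed (rule i(1), rule j)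
      also have "\<dots> = delta (site L j) n"
        using i j site_bij[of L] by (auto simp: delta_def bij_betw_def dest: inj_onD)
      finally show ?thesis .
    next
      case False
      then have "n \<noteq> site L j" using in_box[OF j] by auto
      then show ?thesis using H_box_outside[OF u False, of \<omega>] u False by (simp add: ell2_on_box delta_def)
    qed
  qed
qed

text \<open>
  A column of the Green function is characterised by the resolvent equation and support in the box;
  the third part is uniqueness.
\<close>

lemma G_column:
  assumes z: "0 < Im z" and n2: "n2 \<in> box L"
  shows "(\<lambda>n. G L \<omega> z n n2) \<in> ell2_on (box L)"
    and "(\<lambda>n. H_box L \<omega> (\<lambda>n. G L \<omega> z n n2) n - z * G L \<omega> z n n2) = delta n2"
    and "u \<in> ell2_on (box L) \<Longrightarrow> (\<lambda>n. H_box L \<omega> u n - z * u n) = delta n2 \<Longrightarrow> G L \<omega> z n n2 = u n"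
proof -
  obtain j where j: "j < card (box L)" "n2 = site L j" using ex_site[OF n2] by blast
  note ex = G_solution_exists[OF z j(1), of \<omega>]
  have eq: "G L \<omega> z n n2 = u n"
    if u: "u \<in> ell2_on (box L)" "(\<lambda>n. H_box L \<omega> u n - z * u n) = delta n2" for u n
  proof -
    have "inj_on (\<lambda>u n. H_box L \<omega> u n - z * u n) (ell2_on (box L))"
      using resolvent_injective[OF z] by (intro inj_onI) blast
    then have "inv_into (ell2_on (box L)) (\<lambda>u n. H_box L \<omega> u n - z * u n) (delta n2) = u"
      using inv_into_f_f[of "\<lambda>u n. H_box L \<omega> u n - z * u n" "ell2_on (box L)" u] u by simp
    then show ?thesis using u(1) n2 by (simp add: box_resolvent_def ell2_inner_delta ell2_on_box)
  qed
  then show "u \<in> ell2_on (box L) \<Longrightarrow> (\<lambda>n. H_box L \<omega> u n - z * u n) = delta n2 \<Longrightarrow> G L \<omega> z n n2 = u n" .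
  have "(\<lambda>n. G L \<omega> z n n2) = (\<lambda>n. if n \<in> box L then cramer_inverse (card (box L)) (box_entry L \<omega> z) (the_inv_into {..<card (box L)} (site L) n) j else 0)"
    by (rule ext) (rule eq[OF ex(1) ex(2)[folded j(2)]])
  then show "(\<lambda>n. G L \<omega> z n n2) \<in> ell2_on (box L)"
    and "(\<lambda>n. H_box L \<omega> (\<lambda>n. G L \<omega> z n n2) n - z * G L \<omega> z n n2) = delta n2"
    using ex j(2) by (simp_all add: fun_eq_iff)
qed

lemma G_outside: "n1 \<notin> box L \<or> n2 \<notin> box L \<Longrightarrow> G L \<omega> z n1 n2 = 0"
  by (auto simp: box_resolvent_def)

lemma G_norm_le:
  assumes z: "0 < Im z"
  shows "cmod (G L \<omega> z n1 n2) \<le> 1 / Im z"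
proof (cases "n2 \<in> box L")
  case True
  interpret H: ell2_operator "H_box L \<omega>" "box_bound L \<omega>" by (rule H_box_operator)
  note col = G_column(1,2)[OF z True, of \<omega>]
  let ?u = "\<lambda>n. G L \<omega> z n n2"
  have u: "?u \<in> ell2" using col(1) by (simp add: ell2_on_def)
  have "Im z * norm (vec_of ?u) \<le> norm (vec_of (delta n2))"
    by (rule H.resolvent_bound[OF mult_i_linear mult_i_isometry mult_i_square H.Op_mult_i
          H.resolvent_equation[OF u col(2) delta_ell2] z])
  also have "norm (vec_of (delta n2)) = 1"
    by (simp only: vec_of_delta norm_basis)
  finally have b: "norm (vec_of ?u) \<le> 1 / Im z" using z by (simp add: field_simps)
  have "cmod (?u n1) \<le> norm (vec_of ?u)"
  proof -
    have "(\<Sum>n\<in>{n1}. (cmod (?u n))\<^sup>2) \<le> (\<Sum>\<^sub>\<infinity>n. (cmod (?u n))\<^sup>2)"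
      by (rule finite_sum_le_infsum) (use u in \<open>auto simp: ell2_def\<close>)
    then have "(cmod (?u n1))\<^sup>2 \<le> (norm (vec_of ?u))\<^sup>2" by (simp add: norm_l2_square u)
    then show ?thesis by (rule power2_le_imp_le) simp
  qed
  then show ?thesis using b by simp
qed (use z in \<open>simp add: G_outside\<close>)

lemma G_measurable:
  assumes \<omega>: "\<And>n. n \<in> box L \<Longrightarrow> (\<lambda>a. \<omega> a n) \<in> borel_measurable Ms" and z: "z \<in> borel_measurable Ms"
    and pos: "\<And>a. a \<in> space Ms \<Longrightarrow> 0 < Im (z a)"
  shows "(\<lambda>a. G L (\<omega> a) (z a) n1 n2) \<in> borel_measurable Ms"
proof (cases "n1 \<in> box L \<and> n2 \<in> box L")
  case True
  then obtain i j where i: "i < card (box L)" "n1 = site L i" and j: "j < card (box L)" "n2 = site L j"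
    using ex_site[of n1 L] ex_site[of n2 L] by blast
  have inv: "the_inv_into {..<card (box L)} (site L) n1 = i"
    using site_bij[of L] i by (simp add: bij_betw_def the_inv_into_f_f)
  have "G L (\<omega> a) (z a) n1 n2 = cramer_inverse (card (box L)) (box_entry L (\<omega> a) (z a)) i j" if "a \<in> space Ms" for a
  proof -
    note ex = G_solution_exists[OF pos[OF that] j(1), of "\<omega> a"]
    show ?thesis
      using G_column(3)[OF pos[OF that] conjunct2[OF True] ex(1) ex(2)[folded j(2)], where n = n1] True inv by simp
  qed
  moreover have "(\<lambda>a. cramer_inverse (card (box L)) (box_entry L (\<omega> a) (z a)) i j) \<in> borel_measurable Ms"
  proof (rule cramer_inverse_measurable[OF _ i(1) j(1)])
    fix i j assume "i < card (box L)" "j < card (box L)"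
    then have [measurable]: "(\<lambda>a. \<omega> a (site L i)) \<in> borel_measurable Ms"
      using site_bij[of L] by (intro \<omega>) (auto simp: bij_betw_def)
    note [measurable] = z
    show "(\<lambda>a. box_entry L (\<omega> a) (z a) i j) \<in> borel_measurable Ms"
      unfolding box_entry_def by measurable
  qed
  ultimately show ?thesis by (subst measurable_cong) auto
qed (simp add: G_outside)

lemma G_cong:
  assumes "\<And>n. n \<in> box L \<Longrightarrow> \<omega> n = \<omega>' n"
  shows "G L \<omega> z n1 n2 = G L \<omega>' z n1 n2"
proof -
  have "H_box L \<omega> = H_box L \<omega>'" using assms by (simp add: H_box_eq fun_eq_iff)
  then show ?thesis by (simp add: box_resolvent_def)
qed

text \<open>
  Moving the energy into the potential; this is what makes the energy dependence accessible to
  integration by translation.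
\<close>

lemma G_shift:
  assumes \<eta>: "0 < \<eta>"
  shows "G L \<omega> (Complex x \<eta>) n1 n2 = G L (\<lambda>n. \<omega> n - x / lam) (Complex 0 \<eta>) n1 n2"
proof (cases "n2 \<in> box L")
  case True
  let ?\<omega> = "\<lambda>n. \<omega> n - x / lam"
  have z: "0 < Im (Complex 0 \<eta>)" "0 < Im (Complex x \<eta>)" using \<eta> by simp_all
  note col = G_column(1,2)[OF z(1) True, of ?\<omega>]
  let ?u = "\<lambda>n. G L ?\<omega> (Complex 0 \<eta>) n n2"
  have "H_box L \<omega> ?u n - Complex x \<eta> * ?u n = H_box L ?\<omega> ?u n - Complex 0 \<eta> * ?u n" for n
  proof (cases "n \<in> box L")
    case n: True
    have "Complex x \<eta> = complex_of_real x + Complex 0 \<eta>" by (simp add: complex_eq_iff)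
    moreover have "lam * (\<omega> n - x / lam) = lam * \<omega> n - x" using lam_pos by (simp add: field_simps)
    ultimately show ?thesis using n by (simp add: H_box_eq algebra_simps)
  next
    case False
    then show ?thesis using H_box_outside[OF col(1) False] by (simp add: G_outside)
  qed
  then have "(\<lambda>n. H_box L \<omega> ?u n - Complex x \<eta> * ?u n) = delta n2" using col(2) by simp
  from G_column(3)[OF z(2) True col(1) this] show ?thesis .
qed (simp add: G_outside)

end

section \<open>Comparison of neighbouring boxes and weak convergence\<close>

context anderson_model
begin

text \<open>
  Green's second identity for the columns \<open>u\<close> of the larger and \<open>v\<close> of the smaller box on the larger
  box. Inside the smaller box both solve the resolvent equation; outside it, \<open>v\<close> vanishes and
  \<open>(H - z) v\<close> only sees neighbours in the smaller box.
\<close>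

lemma geometric_resolvent_identity:
  assumes z: "0 < Im z"
  shows "G L \<omega> z orig orig - G (Suc L) \<omega> z orig orig
    = (\<Sum>n\<in>box (Suc L) - box L. \<Sum>k\<in>{k \<in> box L. adj n k}. G (Suc L) \<omega> z n orig * G L \<omega> z k orig)"
proof -
  let ?B = "box (Suc L)"
  define u where "u n = G (Suc L) \<omega> z n orig" for n
  define v where "v n = G L \<omega> z n orig" for n
  define S where "S f = (\<lambda>n. (\<Sum>k\<in>?B. (if adj n k then 1 else 0) * f k) + complex_of_real (lam * \<omega> n) * f n - z * f n)" for f
  have sub: "box L \<subseteq> ?B" by (rule box_mono) simp
  note colu = G_column(1,2)[where L = "Suc L" and \<omega> = \<omega>, OF z orig_in_box]
  note colv = G_column(1,2)[where L = L and \<omega> = \<omega>, OF z orig_in_box]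
  have u0: "u k = 0" if "k \<notin> ?B" for k using that by (simp add: u_def G_outside)
  have v0: "v k = 0" if "k \<notin> box L" for k using that by (simp add: v_def G_outside)
  have Su: "S u n = delta orig n" if "n \<in> ?B" for n
  proof -
    have "H_box (Suc L) \<omega> u n - z * u n = delta orig n"
      using fun_cong[OF colu(2), of n] by (simp add: u_def[abs_def])
    then show ?thesis using H_box_apply[of "Suc L" u n \<omega>] u0 that by (simp add: S_def)
  qed
  have shrink: "(\<Sum>k\<in>?B. (if adj n k then 1 else 0) * v k) = (\<Sum>k\<in>{k \<in> box L. adj n k}. v k)" for n
    by (rule sum.mono_neutral_cong_right) (use sub v0 in auto)
  have Sv_in: "S v n = delta orig n" if "n \<in> box L" for n
  proof -
    have "H_box L \<omega> v n - z * v n = delta orig n"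
      using fun_cong[OF colv(2), of n] by (simp add: v_def[abs_def])
    moreover have "(\<Sum>k\<in>box L. (if adj n k then 1 else 0) * v k) = (\<Sum>k\<in>{k \<in> box L. adj n k}. v k)"
      by (rule sum.mono_neutral_cong_right) auto
    ultimately show ?thesis using H_box_apply[of L v n \<omega>] v0 that by (simp add: S_def shrink)
  qed
  have Sv_out: "S v n = (\<Sum>k\<in>{k \<in> box L. adj n k}. v k)" if "n \<notin> box L" for n
    using v0[OF that] by (simp add: S_def shrink)
  have symmetric: "(\<Sum>n\<in>?B. v n * S u n) = (\<Sum>n\<in>?B. S v n * u n)"
  proof -
    have "(\<Sum>n\<in>?B. v n * (\<Sum>k\<in>?B. (if adj n k then 1 else 0) * u k))
        = (\<Sum>n\<in>?B. \<Sum>k\<in>?B. v n * ((if adj n k then 1 else 0) * u k))" by (simp add: sum_distrib_left)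
    also have "\<dots> = (\<Sum>k\<in>?B. \<Sum>n\<in>?B. v n * ((if adj n k then 1 else 0) * u k))" by (rule sum.swap)
    also have "\<dots> = (\<Sum>k\<in>?B. \<Sum>n\<in>?B. ((if adj k n then 1 else 0) * v n) * u k)"
    proof (intro sum.cong refl)
      fix k n
      have "adj n k = adj k n" using adj_sym[of n k] adj_sym[of k n] by (rule iffI)
      then show "v n * ((if adj n k then 1 else 0) * u k) = ((if adj k n then 1 else 0) * v n) * u k" by simp
    qed
    also have "\<dots> = (\<Sum>k\<in>?B. (\<Sum>n\<in>?B. (if adj k n then 1 else 0) * v n) * u k)" by (simp add: sum_distrib_right)
    finally show ?thesis
      by (simp add: S_def distrib_left distrib_right left_diff_distrib right_diff_distrib sum.distrib sum_subtractf ac_simps)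
  qed
  have delta_sum: "(\<Sum>n\<in>B. f n * delta orig n) = f orig" if "finite B" "orig \<in> B" for B and f :: "'v \<Rightarrow> complex"
    using that by (simp add: delta_def if_distrib[of "\<lambda>c. _ * c"] cong: if_cong)
  have "v orig = (\<Sum>n\<in>?B. v n * S u n)" by (simp add: Su delta_sum)
  also have "\<dots> = (\<Sum>n\<in>?B. S v n * u n)" by (rule symmetric)
  also have "\<dots> = (\<Sum>n\<in>box L. S v n * u n) + (\<Sum>n\<in>?B - box L. S v n * u n)"
    using sub by (simp add: sum.subset_diff[of "box L" ?B])
  also have "(\<Sum>n\<in>box L. S v n * u n) = u orig"
    using delta_sum[of "box L" u] by (simp add: Sv_in mult.commute)
  also have "(\<Sum>n\<in>?B - box L. S v n * u n) = (\<Sum>n\<in>?B - box L. \<Sum>k\<in>{k \<in> box L. adj n k}. u n * v k)"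
    by (intro sum.cong refl) (simp add: Sv_out sum_distrib_left mult.commute)
  finally show ?thesis by (simp add: u_def v_def)
qed

definition box_measure :: "nat \<Rightarrow> ('v \<Rightarrow> real) \<Rightarrow> real measure" where
  "box_measure L \<omega> = bounded_symmetric.spectral (ell2_operator.Op (H_box L \<omega>)) (box_bound L \<omega>) (basis orig)"

definition op_bound :: "real \<Rightarrow> real" where "op_bound W = real K + 1 + lam * W"

definition dos_measure :: "real \<Rightarrow> ('v \<Rightarrow> real) \<Rightarrow> real measure" where
  "dos_measure W \<omega> = bounded_symmetric.spectral (ell2_operator.Op (anderson adj lam \<omega>)) (op_bound W) (basis orig)"

lemma (in ell2_operator) coord_Op_pow: "coord ((Op ^^ k) u) = (A ^^ k) (coord u)"
  by (induction k) (simp_all add: coord_Op)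

lemma (in ell2_operator) basis_measure:
  "real_distribution (spectral (basis n))"
  "(\<integral>t. t ^ k \<partial>spectral (basis n)) = Re ((A ^^ k) (delta n) n)"
proof -
  interpret finite_measure "spectral (basis n)" by (rule finite_spectral)
  have "measure (spectral (basis n)) UNIV = 1"
    using measure_spectral_UNIV[of "basis n"] norm_basis[of n] by (simp add: norm_eq_sqrt_inner)
  then have "prob_space (spectral (basis n))"
    by (intro prob_spaceI) (simp add: emeasure_eq_measure)
  then show "real_distribution (spectral (basis n))"
    unfolding real_distribution_def real_distribution_axioms_def by simp
  show "(\<integral>t. t ^ k \<partial>spectral (basis n)) = Re ((A ^^ k) (delta n) n)"
    by (simp add: moment_spectral inner_basis coord_Op_pow basis.rep_eq)
qed

lemma box_measure_distribution: "real_distribution (box_measure L \<omega>)"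
  unfolding box_measure_def by (rule ell2_operator.basis_measure(1)[OF H_box_operator])

lemma box_measure_moment: "(\<integral>t. t ^ k \<partial>box_measure L \<omega>) = Re ((H_box L \<omega> ^^ k) (delta orig) orig)"
  unfolding box_measure_def by (rule ell2_operator.basis_measure(2)[OF H_box_operator])

lemma G_box_measure:
  assumes \<eta>: "0 < \<eta>"
  shows "Re (G L \<omega> (Complex x \<eta>) orig orig) = (\<integral>t. (t - x) / ((t - x)\<^sup>2 + \<eta>\<^sup>2) \<partial>box_measure L \<omega>)"
    and "Im (G L \<omega> (Complex x \<eta>) orig orig) = (\<integral>t. \<eta> / ((t - x)\<^sup>2 + \<eta>\<^sup>2) \<partial>box_measure L \<omega>)"
proof -
  interpret H: ell2_operator "H_box L \<omega>" "box_bound L \<omega>" by (rule H_box_operator)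
  let ?z = "Complex x \<eta>" and ?u = "\<lambda>n. G L \<omega> (Complex x \<eta>) n orig"
  have z: "0 < Im ?z" using \<eta> by simp
  note col = G_column(1,2)[where L = L and \<omega> = \<omega>, OF z orig_in_box]
  have u: "?u \<in> ell2" using col(1) by (simp add: ell2_on_def)
  have "H.Op (vec_of ?u) - Re ?z *\<^sub>R vec_of ?u - Im ?z *\<^sub>R mult_i (vec_of ?u) = vec_of (delta orig)"
    by (rule H.resolvent_equation[OF u col(2) delta_ell2])
  then have eq: "H.Op (vec_of ?u) - x *\<^sub>R vec_of ?u - \<eta> *\<^sub>R mult_i (vec_of ?u) = basis orig"
    by (simp only: vec_of_delta complex.sel)
  note rep = H.stieltjes_representation[OF mult_i_linear mult_i_isometry mult_i_square H.Op_mult_i eq \<eta>]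
  show "Re (G L \<omega> (Complex x \<eta>) orig orig) = (\<integral>t. (t - x) / ((t - x)\<^sup>2 + \<eta>\<^sup>2) \<partial>box_measure L \<omega>)"
    using rep(1) u by (simp add: inner_basis box_measure_def)
  show "Im (G L \<omega> (Complex x \<eta>) orig orig) = (\<integral>t. \<eta> / ((t - x)\<^sup>2 + \<eta>\<^sup>2) \<partial>box_measure L \<omega>)"
    using rep(2) u by (simp add: inner_basis box_measure_def)
qed

text \<open>
  The Laplacian moves mass by distance one, so the first \<open>L\<close> powers do not feel the boundary of the
  box of radius \<open>L\<close>.
\<close>

lemma finite_range:
  assumes "k \<le> L"
  shows "(H_box L \<omega> ^^ k) (delta orig) = (anderson adj lam \<omega> ^^ k) (delta orig)
    \<and> (\<forall>n. n \<notin> box k \<longrightarrow> (anderson adj lam \<omega> ^^ k) (delta orig) n = 0)"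
  using assms
proof (induction k)
  case 0
  then show ?case by (auto simp: box_0 delta_def)
next
  case (Suc k)
  define f where "f = (anderson adj lam \<omega> ^^ k) (delta orig)"
  have f0: "f n = 0" if "n \<notin> box k" for n using Suc that by (simp add: f_def)
  have lap: "laplacian adj f n = 0" if "n \<notin> box (Suc k)" for n
  proof -
    have "f m = 0" if "adj n m" for m
      using f0[of m] nbr_in_box[of m k n] that \<open>n \<notin> box (Suc k)\<close> by blast
    then show ?thesis by (simp add: laplacian_eq)
  qed
  have in_L: "box (Suc k) \<subseteq> box L" "box k \<subseteq> box (Suc k)" using Suc.prems by (auto intro!: box_mono)
  have restr_f: "restr (box L) f = f"
    using f0 in_L by (auto simp: restr_def fun_eq_iff)
  have "H_box L \<omega> f = anderson adj lam \<omega> f"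
  proof
    fix n
    show "H_box L \<omega> f n = anderson adj lam \<omega> f n"
    proof (cases "n \<in> box L")
      case False
      then have "n \<notin> box (Suc k)" "n \<notin> box k" using in_L by blast+
      then show ?thesis using lap f0 False by (simp add: H_box_eq anderson_eq restr_f restr_def)
    qed (simp add: H_box_eq anderson_eq restr_f, simp add: restr_def)
  qed
  moreover have "anderson adj lam \<omega> f n = 0" if "n \<notin> box (Suc k)" for n
    unfolding anderson_eq using lap[OF that] f0[of n] that in_L by auto
  moreover have "(H_box L \<omega> ^^ Suc k) (delta orig) = H_box L \<omega> f" using Suc by (simp add: f_def)
  ultimately show ?case by (simp add: f_def)
qed

context
  fixes W :: real and \<omega> :: "'v \<Rightarrow> real"
  assumes W: "\<And>n. \<bar>\<omega> n\<bar> \<le> W" "0 < W"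
begin

lemma H_box_operator_uniform: "ell2_operator (H_box L \<omega>) (op_bound W)"
proof -
  have "\<bar>if n \<in> box L then lam * \<omega> n else 0\<bar> \<le> lam * W" for n
    using W(1)[of n] W(2) lam_pos by (auto simp: abs_mult)
  then have "ell2_operator (\<lambda>u n. complex_of_real (if n \<in> box L then lam * \<omega> n else 0) * u n) (lam * W)"
    using W lam_pos by (intro ell2_operator_multiplication) auto
  from ell2_operator_add[OF ell2_operator_compression[OF laplacian_operator] this]
  have "ell2_operator (\<lambda>u n. restr (box L) (laplacian adj (restr (box L) u)) n
    + complex_of_real (if n \<in> box L then lam * \<omega> n else 0) * u n) (op_bound W)"
    unfolding op_bound_def .
  then show ?thesis by (simp only: H_box_eq[symmetric] eta_contract_eq)
qed

text \<open>
  The bound \<open>box_bound\<close> grows with the box. For a bounded potential a bound uniform in \<open>L\<close> is available, and the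
  spectral measure does not depend on the bound used to construct it.
\<close>

lemma box_measure_support: "AE t in box_measure L \<omega>. \<bar>t\<bar> \<le> 3 * op_bound W"
proof -
  interpret H: ell2_operator "H_box L \<omega>" "box_bound L \<omega>" by (rule H_box_operator)
  interpret H': ell2_operator "H_box L \<omega>" "op_bound W" by (rule H_box_operator_uniform)
  have eq: "H.spectral (basis orig) = H'.spectral (basis orig)"
    by (rule H'.spectral_eqI[OF H.finite_spectral H.sets_spectral H.support_spectral H.moment_spectral])
  show ?thesis unfolding box_measure_def eq by (rule H'.support_spectral)
qed

lemma dos_measure_distribution: "real_distribution (dos_measure W \<omega>)"
  unfolding dos_measure_def op_bound_def
  by (rule ell2_operator.basis_measure(1)[OF anderson_operator[OF W]])

lemma dos_measure_spectral:
  assumes B: "B \<in> sets borel"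
  shows "Re (ell2_inner (delta orig)
      (spectral_measure (anderson_dom \<omega>) (anderson adj lam \<omega>) B (delta orig))) = measure (dos_measure W \<omega>) B"
proof -
  interpret H: ell2_operator "anderson adj lam \<omega>" "op_bound W"
    unfolding op_bound_def by (rule anderson_operator[OF W])
  have "is_spectral_measure ell2 (anderson adj lam \<omega>) (spectral_measure ell2 (anderson adj lam \<omega>))"
    unfolding spectral_measure_def using someI_ex[OF H.spectral_theorem] .
  from H.spectral_measure_eq[OF this B delta_ell2[of orig]]
  show ?thesis unfolding dos_measure_def anderson_dom_bounded[OF W(1)] vec_of_delta .
qed

text \<open>
  Every moment is eventually constant in \<open>L\<close>.
\<close>

lemma box_measure_converges: "weak_conv_m (\<lambda>L. box_measure L \<omega>) (dos_measure W \<omega>)"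
proof -
  interpret H: ell2_operator "anderson adj lam \<omega>" "op_bound W"
    unfolding op_bound_def by (rule anderson_operator[OF W])
  interpret D: real_distribution "dos_measure W \<omega>" by (rule dos_measure_distribution)
  have moments: "(\<integral>t. t ^ k \<partial>dos_measure W \<omega>) = Re ((anderson adj lam \<omega> ^^ k) (delta orig) orig)" for k
    unfolding dos_measure_def by (rule H.basis_measure(2))
  have support: "AE t in dos_measure W \<omega>. \<bar>t\<bar> \<le> 3 * op_bound W"
    unfolding dos_measure_def by (rule H.support_spectral)
  have conv: "(\<lambda>L. \<integral>t. t ^ k \<partial>box_measure L \<omega>) \<longlonglongrightarrow> (\<integral>t. t ^ k \<partial>dos_measure W \<omega>)" for k
  proof (rule tendsto_eventually, rule eventually_sequentiallyI[of k])
    fix L assume "k \<le> L"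
    then show "(\<integral>t. t ^ k \<partial>box_measure L \<omega>) = (\<integral>t. t ^ k \<partial>dos_measure W \<omega>)"
      using finite_range[of k L \<omega>] by (simp add: moments box_measure_moment)
  qed
  obtain N where N: "real_distribution N" "AE t in N. \<bar>t\<bar> \<le> 3 * op_bound W"
      "\<And>k. (\<integral>t. t ^ k \<partial>N) = (\<integral>t. t ^ k \<partial>dos_measure W \<omega>)" "weak_conv_m (\<lambda>L. box_measure L \<omega>) N"
    by (rule method_of_moments[where M = "\<lambda>L. box_measure L \<omega>" and R = "3 * op_bound W"
          and m = "\<lambda>k. \<integral>t. t ^ k \<partial>dos_measure W \<omega>"])
      (rule box_measure_distribution box_measure_support conv | blast)+
  interpret N: real_distribution N by (rule N(1))
  have "N = dos_measure W \<omega>"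
    by (rule measures_eqI_moments[where R = "3 * op_bound W"])
      (use N(2,3) support N.finite_measure_axioms D.finite_measure_axioms in simp_all)
  then show ?thesis using N(4) by simp
qed

end

end

section \<open>Lorentzian integrals and product measures\<close>

text \<open>
  The antiderivative is \<open>arctan (\<eta>/|a|)\<close>. The point \<open>\<eta> = 0\<close> is a null set.
\<close>

lemma lorentz_half_line:
  assumes a: "a \<noteq> 0"
  shows "(\<integral>\<^sup>+\<eta>. ennreal (indicator {0<..} \<eta> * (\<bar>a\<bar> / (a\<^sup>2 + \<eta>\<^sup>2))) \<partial>lborel) = ennreal (pi / 2)"
proof -
  let ?f = "\<lambda>\<eta>. \<bar>a\<bar> / (a\<^sup>2 + \<eta>\<^sup>2)"
  have "(\<integral>\<^sup>+\<eta>. ennreal (indicator {0<..} \<eta> * ?f \<eta>) \<partial>lborel) = (\<integral>\<^sup>+\<eta>. ennreal (?f \<eta>) * indicator {0..} \<eta> \<partial>lborel)"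
  proof (rule nn_integral_cong_AE)
    have "AE \<eta> in lborel. \<eta> \<noteq> (0::real)" by (rule AE_lborel_singleton)
    then show "AE \<eta> in lborel. ennreal (indicator {0<..} \<eta> * ?f \<eta>) = ennreal (?f \<eta>) * indicator {0..} \<eta>"
      by eventually_elim (auto simp: indicator_def)
  qed
  also have "\<dots> = ennreal (pi / 2 - arctan (0 / \<bar>a\<bar>))"
  proof (rule nn_integral_FTC_atLeast)
    show "DERIV (\<lambda>\<eta>. arctan (\<eta> / \<bar>a\<bar>)) \<eta> :> ?f \<eta>" for \<eta>
    proof -
      define b where "b = \<bar>a\<bar>"
      have b: "0 < b" "a\<^sup>2 = b\<^sup>2" using a by (simp_all add: b_def)
      have "0 < b * b + \<eta> * \<eta>" using b by (simp add: add_pos_nonneg)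
      then have "inverse (1 + (\<eta> / b)\<^sup>2) * (1 / b) = b / (b\<^sup>2 + \<eta>\<^sup>2)"
        using b(1) by (simp add: field_simps power2_eq_square)
      then have "inverse (1 + (\<eta> / \<bar>a\<bar>)\<^sup>2) * (1 / \<bar>a\<bar>) = ?f \<eta>"
        unfolding b(2) b_def .
      moreover have "DERIV (\<lambda>\<eta>. arctan (\<eta> / \<bar>a\<bar>)) \<eta> :> inverse (1 + (\<eta> / \<bar>a\<bar>)\<^sup>2) * (1 / \<bar>a\<bar>)"
        by (rule DERIV_chain2[OF DERIV_arctan DERIV_cdivide[OF DERIV_ident]])
      ultimately show ?thesis by simp
    qed
    have "LIM \<eta> at_top. \<eta> / \<bar>a\<bar> :> at_top"
      using a by (intro filterlim_at_top_mult_tendsto_pos[OF tendsto_const _ filterlim_ident, of "1 / \<bar>a\<bar>", simplified]) simp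
    then show "((\<lambda>\<eta>. arctan (\<eta> / \<bar>a\<bar>)) \<longlongrightarrow> pi / 2) at_top"
      by (rule filterlim_compose[OF tendsto_arctan_at_top])
  qed auto
  finally show ?thesis by simp
qed

lemma lorentz_integral:
  "integrable lborel (\<lambda>\<eta>. indicator {0<..} \<eta> * (a / (a\<^sup>2 + \<eta>\<^sup>2)))"
  "(\<integral>\<eta>. indicator {0<..} \<eta> * (a / (a\<^sup>2 + \<eta>\<^sup>2)) \<partial>lborel) = pi / 2 * sgn a"
  "(\<integral>\<eta>. norm (indicator {0<..} \<eta> * (a / (a\<^sup>2 + \<eta>\<^sup>2))) \<partial>lborel) \<le> pi / 2"
proof -
  define f where "f \<eta> = indicator {0<..} \<eta> * (\<bar>a\<bar> / (a\<^sup>2 + \<eta>\<^sup>2))" for \<eta> :: real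
  have nn: "0 \<le> f \<eta>" for \<eta> by (simp add: f_def)
  have meas: "f \<in> borel_measurable borel" unfolding f_def by measurable
  have "integrable lborel f \<and> integral\<^sup>L lborel f = (if a = 0 then 0 else pi / 2)"
  proof (cases "a = 0")
    case False
    then have "(\<integral>\<^sup>+\<eta>. ennreal (f \<eta>) \<partial>lborel) = ennreal (pi / 2)" using lorentz_half_line[of a] by (simp add: f_def)
    then have "has_bochner_integral lborel f (pi / 2)"
      by (intro has_bochner_integral_nn_integral) (use nn meas in auto)
    then show ?thesis using False by (simp add: has_bochner_integral_iff)
  qed (simp add: f_def[abs_def])
  then have int: "integrable lborel f" and val: "integral\<^sup>L lborel f = (if a = 0 then 0 else pi / 2)" by auto
  have eq: "indicator {0<..} \<eta> * (a / (a\<^sup>2 + \<eta>\<^sup>2)) = sgn a * f \<eta>" for \<eta>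
    by (simp add: f_def mult_sgn_abs mult.left_commute)
  show "integrable lborel (\<lambda>\<eta>. indicator {0<..} \<eta> * (a / (a\<^sup>2 + \<eta>\<^sup>2)))" unfolding eq using int by simp
  show "(\<integral>\<eta>. indicator {0<..} \<eta> * (a / (a\<^sup>2 + \<eta>\<^sup>2)) \<partial>lborel) = pi / 2 * sgn a" unfolding eq using val by simp
  have "norm (sgn a * f \<eta>) = (if a = 0 then 0 else f \<eta>)" for \<eta>
    using nn[of \<eta>] by (simp add: abs_mult abs_sgn_eq)
  then show "(\<integral>\<eta>. norm (indicator {0<..} \<eta> * (a / (a\<^sup>2 + \<eta>\<^sup>2))) \<partial>lborel) \<le> pi / 2" unfolding eq using val by (cases "a = 0") simp_all
qed

text \<open>
  Fubini for the absolutely integrable double integral of \<open>(t - x)/((t - x)\<^sup>2 + \<eta>\<^sup>2)\<close>; the inner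
  integral over \<open>\<eta>\<close> is a multiple of \<open>sgn (t - x)\<close>.
\<close>

lemma fermi_integral:
  assumes "real_distribution N"
  shows "integrable lborel (\<lambda>\<eta>. indicator {0<..} \<eta> * (\<integral>t. (t - x) / ((t - x)\<^sup>2 + \<eta>\<^sup>2) \<partial>N))"
    and "(\<integral>\<eta>. indicator {0<..} \<eta> * (\<integral>t. (t - x) / ((t - x)\<^sup>2 + \<eta>\<^sup>2) \<partial>N) \<partial>lborel) = pi / 2 * (\<integral>t. sgn (t - x) \<partial>N)"
proof -
  interpret N: real_distribution N by fact
  interpret pair_sigma_finite N lborel by unfold_locales
  let ?f = "\<lambda>t \<eta>. indicator {0<..} \<eta> * ((t - x) / ((t - x)\<^sup>2 + \<eta>\<^sup>2)) :: real"
  have int: "integrable (N \<Otimes>\<^sub>M lborel) (case_prod ?f)"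
  proof (rule Fubini_integrable)
    show "case_prod ?f \<in> borel_measurable (N \<Otimes>\<^sub>M lborel)" by measurable
    show "integrable N (\<lambda>t. \<integral>\<eta>. norm (case_prod ?f (t, \<eta>)) \<partial>lborel)"
    proof (rule N.integrable_const_bound[of _ "pi / 2"])
      show "AE t in N. norm (\<integral>\<eta>. norm (case_prod ?f (t, \<eta>)) \<partial>lborel) \<le> pi / 2"
        using lorentz_integral(3) by (intro AE_I2) (simp add: abs_of_nonneg[OF integral_nonneg_AE])
    qed measurable
    show "AE t in N. integrable lborel (\<lambda>\<eta>. case_prod ?f (t, \<eta>))" using lorentz_integral(1) by simp
  qed
  have mult: "(\<integral>t. ?f t \<eta> \<partial>N) = indicator {0<..} \<eta> * (\<integral>t. (t - x) / ((t - x)\<^sup>2 + \<eta>\<^sup>2) \<partial>N)" for \<eta>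
    by (rule integral_mult_right_zero)
  show "integrable lborel (\<lambda>\<eta>. indicator {0<..} \<eta> * (\<integral>t. (t - x) / ((t - x)\<^sup>2 + \<eta>\<^sup>2) \<partial>N))"
    using integrable_snd[OF int] unfolding mult .
  show "(\<integral>\<eta>. indicator {0<..} \<eta> * (\<integral>t. (t - x) / ((t - x)\<^sup>2 + \<eta>\<^sup>2) \<partial>N) \<partial>lborel) = pi / 2 * (\<integral>t. sgn (t - x) \<partial>N)"
    using Fubini_integral[OF int] unfolding mult lorentz_integral(2) by simp
qed

text \<open>
  The mean value theorem bounds the difference quotients by \<open>w\<close>, so dominated convergence applies.
\<close>

lemma has_derivative_integral_dominated:
  fixes f :: "real \<Rightarrow> 'a \<Rightarrow> real"
  assumes int: "\<And>y. \<bar>y - x\<bar> \<le> 1 \<Longrightarrow> integrable M (f y)"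
    and der: "\<And>y a. \<bar>y - x\<bar> \<le> 1 \<Longrightarrow> a \<in> space M \<Longrightarrow> ((\<lambda>y. f y a) has_real_derivative f' y a) (at y)"
    and bound: "\<And>y a. \<bar>y - x\<bar> \<le> 1 \<Longrightarrow> a \<in> space M \<Longrightarrow> \<bar>f' y a\<bar> \<le> w a"
    and w: "integrable M w" and f': "f' x \<in> borel_measurable M"
  shows "((\<lambda>y. \<integral>a. f y a \<partial>M) has_real_derivative (\<integral>a. f' x a \<partial>M)) (at x)"
  unfolding has_field_derivative_iff tendsto_at_iff_sequentially
proof (intro allI impI)
  fix X :: "nat \<Rightarrow> real" assume X: "\<forall>i. X i \<in> UNIV - {x}" "X \<longlonglongrightarrow> x"
  then have Xne: "X i \<noteq> x" for i by auto
  have "\<forall>\<^sub>F i in sequentially. \<bar>X i - x\<bar> < 1" using X(2) tendstoD[of X x sequentially 1] by (simp add: dist_real_def)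
  then obtain n0 where n0: "\<And>i. n0 \<le> i \<Longrightarrow> \<bar>X i - x\<bar> < 1" unfolding eventually_sequentially by blast
  define Y where "Y i = X (i + n0)" for i
  have Y: "\<bar>Y i - x\<bar> \<le> 1" "Y i \<noteq> x" for i using n0[of "i + n0"] Xne by (simp_all add: Y_def)
  have Ylim: "Y \<longlonglongrightarrow> x" unfolding Y_def using X(2) by (rule LIMSEQ_ignore_initial_segment)
  let ?q = "\<lambda>i a. (f (Y i) a - f x a) / (Y i - x)"
  have "(\<lambda>i. \<integral>a. ?q i a \<partial>M) \<longlonglongrightarrow> (\<integral>a. f' x a \<partial>M)"
  proof (rule integral_dominated_convergence)
    show "integrable M w" by (rule w)
    show "f' x \<in> borel_measurable M" by (rule f')
    show "?q i \<in> borel_measurable M" for i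
      using int[OF Y(1)[of i]] int[of x] by (intro borel_measurable_divide borel_measurable_diff) auto
    show "AE a in M. (\<lambda>i. ?q i a) \<longlonglongrightarrow> f' x a"
    proof (rule AE_I2)
      fix a assume a: "a \<in> space M"
      have "((\<lambda>y. (f y a - f x a) / (y - x)) \<longlongrightarrow> f' x a) (at x)"
        using der[of x a] a by (simp add: has_field_derivative_iff)
      moreover have "filterlim Y (at x) sequentially"
        using Ylim Y(2) by (simp add: filterlim_at)
      ultimately show "(\<lambda>i. ?q i a) \<longlonglongrightarrow> f' x a" by (rule filterlim_compose)
    qed
    show "AE a in M. norm (?q i a) \<le> w a" for i
    proof (rule AE_I2)
      fix a assume a: "a \<in> space M"
      have "norm (f (Y i) a - f x a) \<le> w a * norm (Y i - x)"
      proof (rule field_differentiable_bound[of "{y. \<bar>y - x\<bar> \<le> 1}"])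
        show "convex {y. \<bar>y - x\<bar> \<le> 1}"
        proof -
          have "{y. \<bar>y - x\<bar> \<le> 1} = cball x 1" by (auto simp: dist_real_def)
          then show ?thesis by simp
        qed
        show "((\<lambda>y. f y a) has_field_derivative f' y a) (at y within {y. \<bar>y - x\<bar> \<le> 1})" if "y \<in> {y. \<bar>y - x\<bar> \<le> 1}" for y
          using der[of y a] a that by (auto intro: has_field_derivative_at_within)
        show "norm (f' y a) \<le> w a" if "y \<in> {y. \<bar>y - x\<bar> \<le> 1}" for y
          using bound[of y a] a that by simp
      qed (use Y in auto)
      then show "norm (?q i a) \<le> w a" using Y(2)[of i] by (simp add: abs_divide pos_divide_le_eq)
    qed
  qed
  moreover have "(\<integral>a. ?q i a \<partial>M) = ((\<integral>a. f (Y i) a \<partial>M) - (\<integral>a. f x a \<partial>M)) / (Y i - x)" for i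
    using int[OF Y(1)[of i]] int[of x] by simp
  ultimately have "(\<lambda>i. ((\<integral>a. f (Y i) a \<partial>M) - (\<integral>a. f x a \<partial>M)) / (Y i - x)) \<longlonglongrightarrow> (\<integral>a. f' x a \<partial>M)"
    by (simp only:)
  then have "(\<lambda>i. (((\<lambda>y. ((\<integral>a. f y a \<partial>M) - (\<integral>a. f x a \<partial>M)) / (y - x)) \<circ> X) (i + n0))) \<longlonglongrightarrow> (\<integral>a. f' x a \<partial>M)"
    unfolding o_def Y_def .
  then show "((\<lambda>y. ((\<integral>a. f y a \<partial>M) - (\<integral>a. f x a \<partial>M)) / (y - x)) \<circ> X) \<longlonglongrightarrow> (\<integral>a. f' x a \<partial>M)"
    by (rule LIMSEQ_offset)
qed

lemma PiM_density:
  fixes \<rho> :: "'i \<Rightarrow> real \<Rightarrow> ennreal"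
  assumes fin: "finite I" and \<rho>: "\<And>i. i \<in> I \<Longrightarrow> \<rho> i \<in> borel_measurable borel"
    and \<nu>: "\<And>i. i \<in> I \<Longrightarrow> \<nu> i = density lborel (\<rho> i)" and sf: "\<And>i. sigma_finite_measure (\<nu> i)"
  shows "PiM I \<nu> = density (PiM I (\<lambda>_. lborel)) (\<lambda>\<omega>. \<Prod>i\<in>I. \<rho> i (\<omega> i))"
proof -
  interpret \<nu>: product_sigma_finite \<nu> by (rule product_sigma_finite.intro) (rule sf)
  interpret l: product_sigma_finite "\<lambda>_::'i. lborel :: real measure" by unfold_locales
  note [measurable] = \<rho>
  have meas: "(\<lambda>\<omega>. \<Prod>i\<in>I. \<rho> i (\<omega> i)) \<in> borel_measurable (PiM I (\<lambda>_. lborel))"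
    by (intro borel_measurable_prod_ennreal measurable_compose[OF measurable_component_singleton]) auto
  show ?thesis
  proof (rule \<nu>.PiM_eqI[OF fin, symmetric])
    show "sets (density (PiM I (\<lambda>_. lborel)) (\<lambda>\<omega>. \<Prod>i\<in>I. \<rho> i (\<omega> i))) = sets (PiM I \<nu>)"
      unfolding sets_density by (rule sets_PiM_cong) (simp_all add: \<nu>)
    fix A assume A: "\<And>i. i \<in> I \<Longrightarrow> A i \<in> sets (\<nu> i)"
    then have A': "A i \<in> sets borel" if "i \<in> I" for i using A[OF that] unfolding \<nu>[OF that] by simp
    have "emeasure (density (PiM I (\<lambda>_. lborel)) (\<lambda>\<omega>. \<Prod>i\<in>I. \<rho> i (\<omega> i))) (Pi\<^sub>E I A)
        = (\<integral>\<^sup>+\<omega>. (\<Prod>i\<in>I. \<rho> i (\<omega> i)) * indicator (Pi\<^sub>E I A) \<omega> \<partial>PiM I (\<lambda>_. lborel))"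
      by (rule emeasure_density[OF meas]) (use fin A' in \<open>auto intro!: sets_PiM_I_finite\<close>)
    also have "\<dots> = (\<integral>\<^sup>+\<omega>. (\<Prod>i\<in>I. \<rho> i (\<omega> i) * indicator (A i) (\<omega> i)) \<partial>PiM I (\<lambda>_. lborel))"
    proof (rule nn_integral_cong)
      fix \<omega> assume "\<omega> \<in> space (PiM I (\<lambda>_. lborel :: real measure))"
      then have "\<omega> \<in> extensional I" by (simp add: space_PiM PiE_def)
      then have "indicator (Pi\<^sub>E I A) \<omega> = (\<Prod>i\<in>I. indicator (A i) (\<omega> i) :: ennreal)"
        using fin by (auto simp: indicator_def PiE_def Pi_def prod_zero_iff intro: prod.neutral)
      then show "(\<Prod>i\<in>I. \<rho> i (\<omega> i)) * indicator (Pi\<^sub>E I A) \<omega> = (\<Prod>i\<in>I. \<rho> i (\<omega> i) * indicator (A i) (\<omega> i))"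
        by (simp add: prod.distrib)
    qed
    also have "\<dots> = (\<Prod>i\<in>I. \<integral>\<^sup>+t. \<rho> i t * indicator (A i) t \<partial>lborel)"
      by (rule l.product_nn_integral_prod[OF fin]) (use A' in measurable)
    also have "\<dots> = (\<Prod>i\<in>I. emeasure (\<nu> i) (A i))"
      using A' by (intro prod.cong refl) (simp add: \<nu> emeasure_density)
    finally show "emeasure (density (PiM I (\<lambda>_. lborel)) (\<lambda>\<omega>. \<Prod>i\<in>I. \<rho> i (\<omega> i))) (Pi\<^sub>E I A) = (\<Prod>i\<in>I. emeasure (\<nu> i) (A i))" .
  qed
qed

lemma PiM_lborel_translation:
  fixes I :: "'i set"
  assumes fin: "finite I"
  shows "distr (PiM I (\<lambda>_. lborel :: real measure)) (PiM I (\<lambda>_. lborel)) (\<lambda>\<omega>. \<lambda>i\<in>I. a + \<omega> i) = PiM I (\<lambda>_. lborel)"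
proof -
  interpret l: product_sigma_finite "\<lambda>_::'i. lborel :: real measure" by unfold_locales
  have meas: "(\<lambda>\<omega>. \<lambda>i\<in>I. a + \<omega> i) \<in> measurable (PiM I (\<lambda>_. lborel :: real measure)) (PiM I (\<lambda>_. lborel))"
    by (rule measurable_restrict) simp
  show ?thesis
  proof (rule l.PiM_eqI[OF fin])
    fix A :: "'i \<Rightarrow> real set" assume A: "\<And>i. i \<in> I \<Longrightarrow> A i \<in> sets lborel"
    then have A': "A i \<in> sets borel" if "i \<in> I" for i using that by simp
    have sh: "emeasure lborel ((+) a -` A i) = emeasure lborel (A i)" "(+) a -` A i \<in> sets borel" if "i \<in> I" for i
    proof -
      show "(+) a -` A i \<in> sets borel" using measurable_sets[of "(+) a" borel borel "A i"] A'[OF that] by simp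
      have "emeasure (distr lborel borel ((+) a)) (A i) = emeasure lborel ((+) a -` A i)"
        using A'[OF that] by (simp add: emeasure_distr)
      then show "emeasure lborel ((+) a -` A i) = emeasure lborel (A i)" by (simp add: lborel_distr_plus)
    qed
    have "emeasure (distr (PiM I (\<lambda>_. lborel)) (PiM I (\<lambda>_. lborel)) (\<lambda>\<omega>. \<lambda>i\<in>I. a + \<omega> i)) (Pi\<^sub>E I A)
        = emeasure (PiM I (\<lambda>_. lborel)) (Pi\<^sub>E I (\<lambda>i. (+) a -` A i))"
    proof (subst emeasure_distr[OF meas])
      show "Pi\<^sub>E I A \<in> sets (PiM I (\<lambda>_. lborel))" using fin A by (intro sets_PiM_I_finite)
      show "emeasure (PiM I (\<lambda>_. lborel)) ((\<lambda>\<omega>. \<lambda>i\<in>I. a + \<omega> i) -` Pi\<^sub>E I A \<inter> space (PiM I (\<lambda>_. lborel)))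
        = emeasure (PiM I (\<lambda>_. lborel)) (Pi\<^sub>E I (\<lambda>i. (+) a -` A i))"
        by (rule arg_cong[where f = "emeasure _"]) (auto simp: space_PiM PiE_def Pi_def)
    qed
    also have "\<dots> = (\<Prod>i\<in>I. emeasure lborel (A i))"
      using l.emeasure_PiM[OF fin, of "\<lambda>i. (+) a -` A i"] sh by simp
    finally show "emeasure (distr (PiM I (\<lambda>_. lborel)) (PiM I (\<lambda>_. lborel)) (\<lambda>\<omega>. \<lambda>i\<in>I. a + \<omega> i)) (Pi\<^sub>E I A)
        = (\<Prod>i\<in>I. emeasure lborel (A i))" .
  qed simp
qed

section \<open>Differentiation of an expectation through its densities\<close>

text \<open>
  \<open>F i\<close> plays the role of the \<open>i\<close>-th derivative of a compactly supported density.
\<close>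

locale smooth_density =
  fixes F :: "nat \<Rightarrow> real \<Rightarrow> real" and m :: nat and R B :: real
  assumes F_deriv: "\<And>i t. i < m \<Longrightarrow> (F i has_real_derivative F (Suc i) t) (at t)"
    and F_cont: "\<And>i. i \<le> m \<Longrightarrow> continuous_on UNIV (F i)"
    and F_support: "\<And>i t. i \<le> m \<Longrightarrow> R < \<bar>t\<bar> \<Longrightarrow> F i t = 0"
    and F_bound: "\<And>i t. i \<le> m \<Longrightarrow> \<bar>F i t\<bar> \<le> B"
begin

text \<open>
  The product of site densities after the translation \<open>\<omega> \<mapsto> \<omega> + c x\<close>, with \<open>\<alpha> n\<close> derivatives on the
  factor of \<open>n\<close>.
\<close>

definition weight :: "'v set \<Rightarrow> real \<Rightarrow> ('v \<Rightarrow> nat) \<Rightarrow> real \<Rightarrow> ('v \<Rightarrow> real) \<Rightarrow> real" where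
  "weight \<Lambda> c \<alpha> x \<omega> = (\<Prod>n\<in>\<Lambda>. F (\<alpha> n) (\<omega> n + c * x))"

text \<open>
  A cube outside of which every weight with \<open>|c x|\<close> bounded vanishes. It provides the dominating
  functions.
\<close>

definition window :: "'v set \<Rightarrow> real \<Rightarrow> ('v \<Rightarrow> real) set" where
  "window \<Lambda> r = Pi\<^sub>E \<Lambda> (\<lambda>_. {- r..r})"

lemma F_measurable: "i \<le> m \<Longrightarrow> F i \<in> borel_measurable borel"
  by (intro borel_measurable_continuous_onI F_cont)

lemma weight_measurable:
  assumes "\<And>n. n \<in> \<Lambda> \<Longrightarrow> \<alpha> n \<le> m"
  shows "weight \<Lambda> c \<alpha> x \<in> borel_measurable (PiM \<Lambda> (\<lambda>_. lborel))"
proof -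
  have "(\<lambda>\<omega>. F (\<alpha> n) (\<omega> n + c * x)) \<in> borel_measurable (PiM \<Lambda> (\<lambda>_. lborel))" if n: "n \<in> \<Lambda>" for n
  proof -
    have [measurable]: "F (\<alpha> n) \<in> borel_measurable borel" using assms[OF n] by (rule F_measurable)
    have [measurable]: "(\<lambda>\<omega>. \<omega> n) \<in> borel_measurable (PiM \<Lambda> (\<lambda>_. lborel))"
      using measurable_component_singleton[OF n, of "\<lambda>_. lborel"] by simp
    show ?thesis by measurable
  qed
  then show ?thesis unfolding weight_def[abs_def] by (intro borel_measurable_prod)
qed

lemma weight_bound:
  assumes fin: "finite \<Lambda>" and \<alpha>: "\<And>n. n \<in> \<Lambda> \<Longrightarrow> \<alpha> n \<le> m" and x: "\<bar>c * x\<bar> \<le> b"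
    and \<omega>: "\<omega> \<in> space (PiM \<Lambda> (\<lambda>_. lborel :: real measure))"
  shows "\<bar>weight \<Lambda> c \<alpha> x \<omega>\<bar> \<le> B ^ card \<Lambda> * indicator (window \<Lambda> (R + b)) \<omega>"
proof (cases "\<omega> \<in> window \<Lambda> (R + b)")
  case True
  have "\<bar>weight \<Lambda> c \<alpha> x \<omega>\<bar> = (\<Prod>n\<in>\<Lambda>. \<bar>F (\<alpha> n) (\<omega> n + c * x)\<bar>)" by (simp add: weight_def abs_prod)
  also have "\<dots> \<le> (\<Prod>n\<in>\<Lambda>. B)" by (intro prod_mono conjI abs_ge_zero F_bound \<alpha>)
  finally show ?thesis using True by simp
next
  case False
  then obtain n where n: "n \<in> \<Lambda>" "\<not> \<bar>\<omega> n\<bar> \<le> R + b"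
    using \<omega> by (auto simp: window_def space_PiM PiE_def Pi_def abs_le_iff)
  then have "R < \<bar>\<omega> n + c * x\<bar>" using x by linarith
  then have "F (\<alpha> n) (\<omega> n + c * x) = 0" using F_support \<alpha> n by blast
  then have "weight \<Lambda> c \<alpha> x \<omega> = 0"
    using n fin by (auto simp: weight_def)
  then show ?thesis using False by simp
qed

lemma integrable_window:
  fixes \<Lambda> :: "'v set"
  assumes "finite \<Lambda>"
  shows "integrable (PiM \<Lambda> (\<lambda>_. lborel)) (indicator (window \<Lambda> r) :: ('v \<Rightarrow> real) \<Rightarrow> real)"
proof -
  interpret l: product_sigma_finite "\<lambda>_::'v. lborel :: real measure" by unfold_locales
  have "emeasure (PiM \<Lambda> (\<lambda>_. lborel)) (window \<Lambda> r) = (\<Prod>n\<in>\<Lambda>. emeasure lborel {- r..r})"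
    unfolding window_def by (rule l.emeasure_PiM[OF assms]) simp
  also have "emeasure lborel {- r..r} = ennreal (max 0 (2 * r))" by (simp add: emeasure_lborel_Icc_eq max_def ennreal_neg)
  also have "(\<Prod>n\<in>\<Lambda>. ennreal (max 0 (2 * r))) < \<infinity>"
    by (simp only: prod_constant ennreal_power max.cobounded1) simp
  finally show ?thesis
    using assms by (intro integrable_real_indicator) (auto simp: window_def intro!: sets_PiM_I_finite)
qed

lemma weight_deriv:
  assumes "finite \<Lambda>" and \<alpha>: "\<And>n. n \<in> \<Lambda> \<Longrightarrow> \<alpha> n < m"
  shows "((\<lambda>y. weight \<Lambda> c \<alpha> y \<omega>) has_real_derivative
    c * (\<Sum>n\<in>\<Lambda>. weight \<Lambda> c (\<alpha>(n := Suc (\<alpha> n))) y \<omega>)) (at y)"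
proof -
  have "((\<lambda>y. F (\<alpha> n) (\<omega> n + c * y)) has_real_derivative c * F (Suc (\<alpha> n)) (\<omega> n + c * y)) (at y)" if "n \<in> \<Lambda>" for n y
  proof -
    have "((\<lambda>y. \<omega> n + c * y) has_real_derivative c) (at y)" by (auto intro!: derivative_eq_intros)
    from DERIV_chain2[OF F_deriv[OF \<alpha>[OF that]] this] show ?thesis by (simp add: mult.commute)
  qed
  then have "((\<lambda>y. weight \<Lambda> c \<alpha> y \<omega>) has_real_derivative
      (\<Sum>n\<in>\<Lambda>. c * F (Suc (\<alpha> n)) (\<omega> n + c * y) * (\<Prod>k\<in>\<Lambda> - {n}. F (\<alpha> k) (\<omega> k + c * y)))) (at y)"
    unfolding weight_def by (rule has_field_derivative_prod)
  moreover have "c * F (Suc (\<alpha> n)) (\<omega> n + c * y) * (\<Prod>k\<in>\<Lambda> - {n}. F (\<alpha> k) (\<omega> k + c * y))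
      = c * weight \<Lambda> c (\<alpha>(n := Suc (\<alpha> n))) y \<omega>" if n: "n \<in> \<Lambda>" for n
    unfolding weight_def using assms(1) n by (subst prod.remove[of \<Lambda> n]) (auto intro!: prod.cong simp: mult.assoc)
  ultimately show ?thesis by (simp add: sum_distrib_left)
qed

lemma count_list_le_length: "count_list w n \<le> length w"
  by (induction w) auto

lemma count_list_Cons_fun: "(count_list w)(n := Suc (count_list w n)) = count_list (n # w)"
  by (auto simp: fun_eq_iff)

text \<open>
  A word records the order in which derivatives hit the vertices; only multiplicities matter for the
  integrand. Words rather than multi-indices make the Leibniz rule free of multinomial coefficients.
\<close>

definition smoothed_word :: "'v set \<Rightarrow> real \<Rightarrow> (('v \<Rightarrow> real) \<Rightarrow> real) \<Rightarrow> 'v list \<Rightarrow> real \<Rightarrow> real" where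
  "smoothed_word \<Lambda> c h w x = (\<integral>\<omega>. h \<omega> * weight \<Lambda> c (count_list w) x \<omega> \<partial>PiM \<Lambda> (\<lambda>_. lborel))"

definition words :: "'v set \<Rightarrow> nat \<Rightarrow> 'v list set" where
  "words \<Lambda> j = {w. set w \<subseteq> \<Lambda> \<and> length w = j}"

definition smoothed :: "'v set \<Rightarrow> real \<Rightarrow> (('v \<Rightarrow> real) \<Rightarrow> real) \<Rightarrow> nat \<Rightarrow> real \<Rightarrow> real" where
  "smoothed \<Lambda> c h j x = c ^ j * (\<Sum>w\<in>words \<Lambda> j. smoothed_word \<Lambda> c h w x)"

context
  fixes \<Lambda> :: "'v set" and h :: "('v \<Rightarrow> real) \<Rightarrow> real" and c :: real
  assumes fin: "finite \<Lambda>" and h: "h \<in> borel_measurable (PiM \<Lambda> (\<lambda>_. lborel))" and h1: "\<And>\<omega>. \<bar>h \<omega>\<bar> \<le> 1"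
begin

lemma weighted_bound:
  assumes \<alpha>: "\<And>n. n \<in> \<Lambda> \<Longrightarrow> \<alpha> n \<le> m" and x: "\<bar>c * x\<bar> \<le> b"
    and \<omega>: "\<omega> \<in> space (PiM \<Lambda> (\<lambda>_. lborel :: real measure))"
  shows "\<bar>h \<omega> * weight \<Lambda> c \<alpha> x \<omega>\<bar> \<le> B ^ card \<Lambda> * indicator (window \<Lambda> (R + b)) \<omega>"
proof -
  have "\<bar>h \<omega> * weight \<Lambda> c \<alpha> x \<omega>\<bar> \<le> 1 * \<bar>weight \<Lambda> c \<alpha> x \<omega>\<bar>"
    unfolding abs_mult by (intro mult_right_mono h1) simp
  also have "\<dots> \<le> B ^ card \<Lambda> * indicator (window \<Lambda> (R + b)) \<omega>" using weight_bound[OF fin \<alpha> x \<omega>] by simp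
  finally show ?thesis .
qed

lemma weighted_measurable:
  assumes \<alpha>: "\<And>n. n \<in> \<Lambda> \<Longrightarrow> \<alpha> n \<le> m"
  shows "(\<lambda>\<omega>. h \<omega> * weight \<Lambda> c \<alpha> x \<omega>) \<in> borel_measurable (PiM \<Lambda> (\<lambda>_. lborel))"
  by (intro borel_measurable_times h weight_measurable \<alpha>)

lemma weighted_integrable:
  assumes \<alpha>: "\<And>n. n \<in> \<Lambda> \<Longrightarrow> \<alpha> n \<le> m"
  shows "integrable (PiM \<Lambda> (\<lambda>_. lborel)) (\<lambda>\<omega>. h \<omega> * weight \<Lambda> c \<alpha> x \<omega>)"
proof (rule Bochner_Integration.integrable_bound)
  show "integrable (PiM \<Lambda> (\<lambda>_. lborel)) (\<lambda>\<omega>. B ^ card \<Lambda> * indicator (window \<Lambda> (R + \<bar>c * x\<bar>)) \<omega> :: real)"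
    by (intro integrable_mult_right integrable_window fin)
  show "AE \<omega> in PiM \<Lambda> (\<lambda>_. lborel). norm (h \<omega> * weight \<Lambda> c \<alpha> x \<omega>)
      \<le> norm (B ^ card \<Lambda> * indicator (window \<Lambda> (R + \<bar>c * x\<bar>)) \<omega>)"
  proof (rule AE_I2)
    fix \<omega> :: "'v \<Rightarrow> real" assume "\<omega> \<in> space (PiM \<Lambda> (\<lambda>_. lborel))"
    from weighted_bound[OF \<alpha> order_refl this]
    show "norm (h \<omega> * weight \<Lambda> c \<alpha> x \<omega>) \<le> norm (B ^ card \<Lambda> * indicator (window \<Lambda> (R + \<bar>c * x\<bar>)) \<omega> :: real)"
      unfolding real_norm_def by (meson abs_ge_self order_trans)
  qed
qed (rule weighted_measurable[OF \<alpha>])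

lemma smoothed_word_deriv:
  assumes w: "length w < m"
  shows "(smoothed_word \<Lambda> c h w has_real_derivative c * (\<Sum>n\<in>\<Lambda>. smoothed_word \<Lambda> c h (n # w) x)) (at x)"
proof -
  have \<alpha>: "count_list w n < m" for n using count_list_le_length[of w n] w by simp
  have \<alpha>': "count_list (n # w) k \<le> m" for n k using count_list_le_length[of "n # w" k] w by simp
  (* The largest translation for parameters at distance at most 1 from x. *)
  let ?b = "\<bar>c\<bar> * (\<bar>x\<bar> + 1)"
  let ?f' = "\<lambda>y \<omega>. h \<omega> * (c * (\<Sum>n\<in>\<Lambda>. weight \<Lambda> c (count_list (n # w)) y \<omega>))"
  have f'_eq: "?f' y \<omega> = c * (\<Sum>n\<in>\<Lambda>. h \<omega> * weight \<Lambda> c (count_list (n # w)) y \<omega>)" for y \<omega>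
    by (simp only: sum_distrib_left mult.left_commute)
  have "((\<lambda>y. \<integral>\<omega>. h \<omega> * weight \<Lambda> c (count_list w) y \<omega> \<partial>PiM \<Lambda> (\<lambda>_. lborel))
      has_real_derivative (\<integral>\<omega>. ?f' x \<omega> \<partial>PiM \<Lambda> (\<lambda>_. lborel))) (at x)"
  proof (rule has_derivative_integral_dominated[where w = "\<lambda>\<omega>. \<bar>c\<bar> * (real (card \<Lambda>) * (B ^ card \<Lambda> * indicator (window \<Lambda> (R + ?b)) \<omega>))"])
    show "integrable (PiM \<Lambda> (\<lambda>_. lborel)) (\<lambda>\<omega>. h \<omega> * weight \<Lambda> c (count_list w) y \<omega>)" for y
      using \<alpha> by (intro weighted_integrable) (simp add: less_imp_le)
    show "((\<lambda>y. h \<omega> * weight \<Lambda> c (count_list w) y \<omega>) has_real_derivative ?f' y \<omega>) (at y)" for y \<omega>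
      using weight_deriv[where c = c and \<omega> = \<omega> and y = y and \<alpha> = "count_list w", OF fin \<alpha>] unfolding count_list_Cons_fun by (rule DERIV_cmult)
    show "\<bar>?f' y \<omega>\<bar> \<le> \<bar>c\<bar> * (real (card \<Lambda>) * (B ^ card \<Lambda> * indicator (window \<Lambda> (R + ?b)) \<omega>))"
      if y: "\<bar>y - x\<bar> \<le> 1" and \<omega>: "\<omega> \<in> space (PiM \<Lambda> (\<lambda>_. lborel))" for y \<omega>
    proof -
      have "\<bar>y\<bar> \<le> \<bar>x\<bar> + 1" using y by linarith
      then have cy: "\<bar>c * y\<bar> \<le> ?b" unfolding abs_mult by (intro mult_left_mono) auto
      have "\<bar>\<Sum>n\<in>\<Lambda>. h \<omega> * weight \<Lambda> c (count_list (n # w)) y \<omega>\<bar> \<le> (\<Sum>n\<in>\<Lambda>. B ^ card \<Lambda> * indicator (window \<Lambda> (R + ?b)) \<omega>)"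
        by (rule order_trans[OF sum_abs]) (intro sum_mono weighted_bound[OF _ cy \<omega>] \<alpha>')
      then show ?thesis unfolding f'_eq abs_mult[of c] sum_constant by (intro mult_left_mono) auto
    qed
    show "integrable (PiM \<Lambda> (\<lambda>_. lborel)) (\<lambda>\<omega>. \<bar>c\<bar> * (real (card \<Lambda>) * (B ^ card \<Lambda> * indicator (window \<Lambda> (R + ?b)) \<omega>)))"
      by (intro integrable_mult_right integrable_window fin)
    show "?f' x \<in> borel_measurable (PiM \<Lambda> (\<lambda>_. lborel))"
      unfolding f'_eq by (intro borel_measurable_times borel_measurable_const borel_measurable_sum weighted_measurable \<alpha>')
  qed
  moreover have "(\<integral>\<omega>. ?f' x \<omega> \<partial>PiM \<Lambda> (\<lambda>_. lborel)) = c * (\<Sum>n\<in>\<Lambda>. smoothed_word \<Lambda> c h (n # w) x)"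
    unfolding f'_eq smoothed_word_def
    by (subst integral_mult_right_zero, subst Bochner_Integration.integral_sum) (intro weighted_integrable \<alpha>' refl)+
  ultimately show ?thesis unfolding smoothed_word_def[abs_def] by simp
qed

text \<open>
  Differentiation prepends a letter to each word, and every word of length \<open>j + 1\<close> arises once.
\<close>

lemma smoothed_deriv:
  assumes j: "j < m"
  shows "(smoothed \<Lambda> c h j has_real_derivative smoothed \<Lambda> c h (Suc j) x) (at x)"
proof -
  have Suc_words: "words \<Lambda> (Suc j) = (\<lambda>(w, n). n # w) ` (words \<Lambda> j \<times> \<Lambda>)"
    by (auto simp: words_def length_Suc_conv image_iff)
  have "(smoothed \<Lambda> c h j has_real_derivative c ^ j * (\<Sum>w\<in>words \<Lambda> j. c * (\<Sum>n\<in>\<Lambda>. smoothed_word \<Lambda> c h (n # w) x))) (at x)"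
    unfolding smoothed_def[abs_def]
    by (intro DERIV_cmult DERIV_sum smoothed_word_deriv) (use j in \<open>simp add: words_def\<close>)
  also have "c ^ j * (\<Sum>w\<in>words \<Lambda> j. c * (\<Sum>n\<in>\<Lambda>. smoothed_word \<Lambda> c h (n # w) x))
      = c ^ Suc j * (\<Sum>(w, n)\<in>words \<Lambda> j \<times> \<Lambda>. smoothed_word \<Lambda> c h (n # w) x)"
    by (simp add: sum.cartesian_product[symmetric] sum_distrib_left[symmetric])
  also have "(\<Sum>(w, n)\<in>words \<Lambda> j \<times> \<Lambda>. smoothed_word \<Lambda> c h (n # w) x) = (\<Sum>w\<in>words \<Lambda> (Suc j). smoothed_word \<Lambda> c h w x)"
    unfolding Suc_words by (subst sum.reindex) (auto simp: inj_on_def case_prod_unfold)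
  finally show ?thesis by (simp add: smoothed_def[abs_def])
qed

lemma smoothed_word_continuous:
  assumes w: "length w \<le> m"
  shows "isCont (smoothed_word \<Lambda> c h w) x"
  unfolding continuous_at_sequentially
proof (intro allI impI)
  fix X :: "nat \<Rightarrow> real" assume X: "X \<longlonglongrightarrow> x"
  have \<alpha>: "count_list w n \<le> m" for n using count_list_le_length[of w n] w by simp
  obtain b where b: "\<And>i. \<bar>X i\<bar> \<le> b"
    using convergent_imp_Bseq[OF convergentI[OF X]] unfolding Bseq_def by auto
  show "(smoothed_word \<Lambda> c h w \<circ> X) \<longlonglongrightarrow> smoothed_word \<Lambda> c h w x"
    unfolding o_def smoothed_word_def
  proof (rule integral_dominated_convergence)
    show "(\<lambda>\<omega>. h \<omega> * weight \<Lambda> c (count_list w) y \<omega>) \<in> borel_measurable (PiM \<Lambda> (\<lambda>_. lborel))" for y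
      by (intro weighted_measurable \<alpha>)
    show "(\<lambda>\<omega>. h \<omega> * weight \<Lambda> c (count_list w) y \<omega>) \<in> borel_measurable (PiM \<Lambda> (\<lambda>_. lborel))" for y
      by (intro weighted_measurable \<alpha>)
    show "integrable (PiM \<Lambda> (\<lambda>_. lborel)) (\<lambda>\<omega>. B ^ card \<Lambda> * indicator (window \<Lambda> (R + \<bar>c\<bar> * b)) \<omega> :: real)"
      by (intro integrable_mult_right integrable_window fin)
    show "AE \<omega> in PiM \<Lambda> (\<lambda>_. lborel). (\<lambda>i. h \<omega> * weight \<Lambda> c (count_list w) (X i) \<omega>) \<longlonglongrightarrow> h \<omega> * weight \<Lambda> c (count_list w) x \<omega>"
    proof (rule AE_I2)
      fix \<omega>
      have "isCont (F (count_list w n)) t" for n t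
        using F_cont[OF \<alpha>] by (simp add: continuous_on_eq_continuous_at)
      then have "(\<lambda>i. F (count_list w n) (\<omega> n + c * X i)) \<longlonglongrightarrow> F (count_list w n) (\<omega> n + c * x)" for n
        by (rule isCont_tendsto_compose) (intro tendsto_intros X)
      then show "(\<lambda>i. h \<omega> * weight \<Lambda> c (count_list w) (X i) \<omega>) \<longlonglongrightarrow> h \<omega> * weight \<Lambda> c (count_list w) x \<omega>"
        unfolding weight_def by (intro tendsto_mult tendsto_const tendsto_prod)
    qed
    show "AE \<omega> in PiM \<Lambda> (\<lambda>_. lborel). norm (h \<omega> * weight \<Lambda> c (count_list w) (X i) \<omega>)
        \<le> B ^ card \<Lambda> * indicator (window \<Lambda> (R + \<bar>c\<bar> * b)) \<omega>" for i
    proof (rule AE_I2)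
      fix \<omega> :: "'v \<Rightarrow> real" assume \<omega>: "\<omega> \<in> space (PiM \<Lambda> (\<lambda>_. lborel))"
      have "\<bar>c * X i\<bar> \<le> \<bar>c\<bar> * b" unfolding abs_mult by (intro mult_left_mono b) simp
      from weighted_bound[OF \<alpha> this \<omega>]
      show "norm (h \<omega> * weight \<Lambda> c (count_list w) (X i) \<omega>) \<le> B ^ card \<Lambda> * indicator (window \<Lambda> (R + \<bar>c\<bar> * b)) \<omega>" by simp
    qed
  qed
qed

lemma smoothed_continuous:
  assumes "j \<le> m"
  shows "continuous_on S (smoothed \<Lambda> c h j)"
proof -
  have "isCont (smoothed \<Lambda> c h j) x" for x
    unfolding smoothed_def[abs_def]
    by (intro continuous_intros smoothed_word_continuous) (use assms in \<open>simp add: words_def\<close>)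
  then show ?thesis by (simp add: continuous_at_imp_continuous_on)
qed

lemma card_words: "card (words \<Lambda> j) = card \<Lambda> ^ j"
  using card_lists_length_eq[OF fin] by (simp add: words_def)

end

end

text \<open>
  The witness sequence of \<open>C_diff_on\<close> on the whole line consists of the iterated derivatives, which inherit
  the compact support and are therefore bounded.
\<close>

lemma C_diff_compact_support_smooth:
  assumes g: "C_diff_compact_support m g"
  obtains R B where "smooth_density (\<lambda>i. (deriv ^^ i) g) m R B"
proof -
  obtain F where F: "F 0 = g" "\<And>i x. i < m \<Longrightarrow> (F i has_real_derivative F (Suc i) x) (at x)"
      "\<And>i. i \<le> m \<Longrightarrow> continuous_on UNIV (F i)"
    and comp: "compact (closure {x. g x \<noteq> 0})"
    using g unfolding C_diff_compact_support_def C_diff_on_def by auto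
  have eq: "(deriv ^^ i) g = F i" if "i \<le> m" for i
    using that
  proof (induction i)
    case (Suc i)
    have "deriv (F i) = F (Suc i)" by (rule ext) (rule DERIV_imp_deriv, rule F(2), use Suc.prems in simp)
    then show ?case using Suc by simp
  qed (simp add: F)
  have "bounded {x. g x \<noteq> 0}"
    using compact_imp_bounded[OF comp] bounded_subset closure_subset by metis
  then obtain R where R: "\<And>x. g x \<noteq> 0 \<Longrightarrow> \<bar>x\<bar> \<le> R" unfolding bounded_iff by auto
  have supp: "F i t = 0" if "i \<le> m" "R < \<bar>t\<bar>" for i t
    using that
  proof (induction i arbitrary: t)
    case 0
    then show ?case using R[of t] F(1) by fastforce
  next
    case (Suc i)
    have "open {t::real. R < \<bar>t\<bar>}" by (intro open_Collect_less continuous_intros)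
    then have "(F i has_real_derivative 0) (at t)"
      using Suc by (intro has_field_derivative_transform_within_open[OF DERIV_const[of 0]]) auto
    then show ?case using F(2)[of i t] Suc.prems DERIV_unique by fastforce
  qed
  have "\<exists>b. \<forall>t. \<bar>F i t\<bar> \<le> b" if i: "i \<le> m" for i
  proof -
    have "compact (F i ` {-R..R})" by (intro compact_continuous_image continuous_on_subset[OF F(3)[OF i]]) auto
    then obtain b where b: "\<And>t. t \<in> {-R..R} \<Longrightarrow> \<bar>F i t\<bar> \<le> b"
      using compact_imp_bounded bounded_iff by (metis image_eqI real_norm_def)
    have "\<bar>F i t\<bar> \<le> max 0 b" for t
    proof (cases "R < \<bar>t\<bar>")
      case False
      then have "t \<in> {-R..R}" by auto
      then show ?thesis using b[of t] by simp
    qed (simp add: supp[OF i])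
    then show ?thesis by blast
  qed
  then obtain b where b: "\<And>i t. i \<le> m \<Longrightarrow> \<bar>F i t\<bar> \<le> b i" by metis
  have bb: "\<bar>F i t\<bar> \<le> (\<Sum>i\<le>m. \<bar>b i\<bar>)" if "i \<le> m" for i t
  proof -
    have "\<bar>F i t\<bar> \<le> \<bar>b i\<bar>" using b[OF that, of t] by linarith
    also have "\<dots> \<le> (\<Sum>i\<le>m. \<bar>b i\<bar>)" using that by (intro member_le_sum) auto
    finally show ?thesis .
  qed
  have "smooth_density (\<lambda>i. (deriv ^^ i) g) m R (\<Sum>i\<le>m. \<bar>b i\<bar>)"
  proof
    fix i t assume "i < m"
    then have "(deriv ^^ i) g = F i" "(deriv ^^ Suc i) g = F (Suc i)" using eq[of i] eq[of "Suc i"] by auto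
    then show "((deriv ^^ i) g has_real_derivative (deriv ^^ Suc i) g t) (at t)" using F(2)[OF \<open>i < m\<close>] by simp
  qed (simp_all add: eq F supp bb)
  then show ?thesis by (rule that)
qed

section \<open>The finite-volume distribution function\<close>

lemma powr_subadditive:
  fixes f :: "'i \<Rightarrow> real"
  assumes t: "0 < t" "t \<le> 1" and "finite I" and f: "\<And>i. i \<in> I \<Longrightarrow> 0 \<le> f i"
  shows "(\<Sum>i\<in>I. f i) powr t \<le> (\<Sum>i\<in>I. f i powr t)"
proof -
  have two: "(a + b) powr t \<le> a powr t + b powr t" if "0 \<le> a" "0 \<le> b" for a b :: real
  proof (cases "a + b = 0")
    case True
    then show ?thesis using that by simp
  next
    case False
    then have ab: "0 < a + b" using that by simp
    have part: "c * (a + b) powr (t - 1) \<le> c powr t" if "0 \<le> c" "c \<le> a + b" for c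
    proof (cases "c = 0")
      case False
      then have "c * (a + b) powr (t - 1) \<le> c * c powr (t - 1)"
        using that t by (intro mult_left_mono powr_mono2') auto
      also have "\<dots> = c powr t" using False that by (simp add: powr_diff)
      finally show ?thesis .
    qed simp
    have "(a + b) powr t = (a + b) * (a + b) powr (t - 1)" using ab by (simp add: powr_diff)
    also have "\<dots> = a * (a + b) powr (t - 1) + b * (a + b) powr (t - 1)" by (rule distrib_right)
    also have "\<dots> \<le> a powr t + b powr t" using that by (intro add_mono part) auto
    finally show ?thesis .
  qed
  show ?thesis using assms(3) f
  proof (induction I)
    case (insert i I)
    have "(\<Sum>i\<in>insert i I. f i) powr t \<le> f i powr t + (\<Sum>i\<in>I. f i) powr t"
      using insert two[of "f i" "\<Sum>i\<in>I. f i"] by (simp add: sum_nonneg)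
    also have "\<dots> \<le> f i powr t + (\<Sum>i\<in>I. f i powr t)" using insert by simp
    finally show ?case using insert by simp
  qed simp
qed

text \<open>
  The factor \<open>\<eta>\<^sup>-\<^sup>(\<^sup>1\<^sup>-\<^sup>s\<^sup>/\<^sup>2\<^sup>)\<close> near zero comes from a bound \<open>2/\<eta>\<close> on the increment, raised to the power
  \<open>1 - s/2\<close>, and the decay \<open>\<eta>\<^sup>s\<^sup>-\<^sup>2\<close> at infinity from a bound of order \<open>1/\<eta>\<^sup>2\<close> raised to the same power. Both exponents are
  on the integrable side because \<open>0 < s < 1\<close>.
\<close>

definition kernel :: "real \<Rightarrow> real \<Rightarrow> real" where
  "kernel s \<eta> = (if \<eta> \<le> 1 then \<eta> powr (s / 2 - 1) else \<eta> powr (s - 2))"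

lemma kernel_finite:
  assumes s: "0 < s" "s < 1"
  obtains \<kappa> where "0 \<le> \<kappa>" "(\<integral>\<^sup>+\<eta>. indicator {0<..} \<eta> * ennreal (kernel s \<eta>) \<partial>lborel) \<le> ennreal \<kappa>"
proof -
  have small: "(\<integral>\<^sup>+\<eta>. ennreal (indicator {0..1} \<eta> * \<eta> powr (s / 2 - 1)) \<partial>lborel) = ennreal (1 powr (s / 2 - 1 + 1) / (s / 2 - 1 + 1))"
    by (rule nn_integral_has_integral_lebesgue[OF _ has_integral_powr_from_0]) (use s in auto)
  have large: "(\<integral>\<^sup>+\<eta>. ennreal (indicator {1..} \<eta> * \<eta> powr (s - 2)) \<partial>lborel) = ennreal (- (1 powr (s - 2 + 1)) / (s - 2 + 1))"
    by (rule nn_integral_has_integral_lebesgue[OF _ has_integral_powr_to_inf]) (use s in auto)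
  let ?\<kappa> = "2 / s + 1 / (1 - s)"
  have "(\<integral>\<^sup>+\<eta>. indicator {0<..} \<eta> * ennreal (kernel s \<eta>) \<partial>lborel)
      \<le> (\<integral>\<^sup>+\<eta>. ennreal (indicator {0..1} \<eta> * \<eta> powr (s / 2 - 1)) + ennreal (indicator {1..} \<eta> * \<eta> powr (s - 2)) \<partial>lborel)"
    by (rule nn_integral_mono) (auto simp: kernel_def indicator_def)
  also have "\<dots> = (\<integral>\<^sup>+\<eta>. ennreal (indicator {0..1} \<eta> * \<eta> powr (s / 2 - 1)) \<partial>lborel) + (\<integral>\<^sup>+\<eta>. ennreal (indicator {1..} \<eta> * \<eta> powr (s - 2)) \<partial>lborel)"
    by (rule nn_integral_add) measurable
  also have "\<dots> = ennreal ?\<kappa>"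
    unfolding small large using s by (subst ennreal_plus[symmetric]) (auto simp: field_simps divide_simps)
  finally show ?thesis using s by (intro that[of ?\<kappa>]) auto
qed

context anderson_model
begin

text \<open>
  The distribution function of the spectral measure at the origin, up to half the atom at \<open>x\<close>. The
  definition by Green functions shows its measurability in \<open>\<omega>\<close> and lets resolvent bounds control
  differences between boxes.
\<close>

definition fermi :: "nat \<Rightarrow> ('v \<Rightarrow> real) \<Rightarrow> real \<Rightarrow> real" where
  "fermi L \<omega> x = 1 / 2 - (1 / pi) * (\<integral>\<eta>. indicator {0<..} \<eta> * Re (G L \<omega> (Complex x \<eta>) orig orig) \<partial>lborel)"

lemma fermi_integrand:
  "indicator {0<..} \<eta> * Re (G L \<omega> (Complex x \<eta>) orig orig)
    = indicator {0<..} \<eta> * (\<integral>t. (t - x) / ((t - x)\<^sup>2 + \<eta>\<^sup>2) \<partial>box_measure L \<omega>)"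
  using G_box_measure(1)[of \<eta> L \<omega> x] by (cases "0 < \<eta>") auto

lemma fermi_integrable: "integrable lborel (\<lambda>\<eta>. indicator {0<..} \<eta> * Re (G L \<omega> (Complex x \<eta>) orig orig))"
  unfolding fermi_integrand by (rule fermi_integral(1)[OF box_measure_distribution])

lemma fermi_eq_sgn: "fermi L \<omega> x = (1 - (\<integral>t. sgn (t - x) \<partial>box_measure L \<omega>)) / 2"
  unfolding fermi_def fermi_integrand fermi_integral(2)[OF box_measure_distribution] by (simp add: diff_divide_distrib)

lemma fermi_range: "0 \<le> fermi L \<omega> x" "fermi L \<omega> x \<le> 1"
proof -
  interpret real_distribution "box_measure L \<omega>" by (rule box_measure_distribution)
  have int: "integrable (box_measure L \<omega>) (\<lambda>t. sgn (t - x))"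
    by (rule integrable_const_bound[of _ 1]) (auto simp: sgn_real_def)
  have "(\<integral>t. sgn (t - x) \<partial>box_measure L \<omega>) \<le> 1"
    by (rule integral_le_const[OF int]) (auto simp: sgn_real_def)
  moreover have "-1 \<le> (\<integral>t. sgn (t - x) \<partial>box_measure L \<omega>)"
    by (rule integral_ge_const[OF int]) (auto simp: sgn_real_def)
  ultimately show "0 \<le> fermi L \<omega> x" "fermi L \<omega> x \<le> 1" unfolding fermi_eq_sgn by simp_all
qed

lemma fermi_cong: "(\<And>n. n \<in> box L \<Longrightarrow> \<omega> n = \<omega>' n) \<Longrightarrow> fermi L \<omega> x = fermi L \<omega>' x"
  unfolding fermi_def using G_cong[of L \<omega> \<omega>'] by simp

lemma fermi_shift: "fermi L \<omega> x = fermi L (\<lambda>n. \<omega> n - x / lam) 0"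
proof -
  have eq: "indicator {0<..} \<eta> * Re (G L \<omega> (Complex x \<eta>) orig orig)
      = indicator {0<..} \<eta> * Re (G L (\<lambda>n. \<omega> n - x / lam) (Complex 0 \<eta>) orig orig)" for \<eta>
    using G_shift[of \<eta> L \<omega> x orig orig] by (cases "0 < \<eta>") auto
  show ?thesis unfolding fermi_def eq ..
qed

text \<open>
  The cut-off removes the half-plane where the resolvent is not controlled; the energy is replaced by
  a harmless one there.
\<close>

lemma G_half_plane_measurable:
  assumes \<omega>: "\<And>n. n \<in> box L \<Longrightarrow> (\<lambda>a. \<omega> a n) \<in> borel_measurable Ms"
    and \<eta>: "\<eta> \<in> borel_measurable Ms"
  shows "(\<lambda>a. indicator {0<..} (\<eta> a) * G L (\<omega> a) (Complex x (\<eta> a)) n1 n2) \<in> borel_measurable Ms"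
proof -
  let ?z = "\<lambda>a. Complex x (if 0 < \<eta> a then \<eta> a else 1)"
  note [measurable] = \<eta>
  have z: "?z \<in> borel_measurable Ms"
  proof -
    have "?z = (\<lambda>a. complex_of_real x + \<i> * complex_of_real (if 0 < \<eta> a then \<eta> a else 1))"
      by (auto simp: fun_eq_iff complex_eq_iff)
    then show ?thesis by simp
  qed
  have [measurable]: "(\<lambda>a. G L (\<omega> a) (?z a) n1 n2) \<in> borel_measurable Ms"
    by (rule G_measurable[OF \<omega> z]) auto
  have "(\<lambda>a. indicator {0<..} (\<eta> a) * G L (\<omega> a) (?z a) n1 n2) \<in> borel_measurable Ms" by measurable
  also have "(\<lambda>a. indicator {0<..} (\<eta> a) * G L (\<omega> a) (?z a) n1 n2)
      = (\<lambda>a. indicator {0<..} (\<eta> a) * G L (\<omega> a) (Complex x (\<eta> a)) n1 n2)" by (auto simp: fun_eq_iff indicator_def)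
  finally show ?thesis .
qed

lemma fermi_measurable:
  assumes \<omega>: "\<And>n. n \<in> box L \<Longrightarrow> (\<lambda>\<omega>. \<omega> n) \<in> borel_measurable Ms"
  shows "(\<lambda>\<omega>. fermi L \<omega> x) \<in> borel_measurable Ms"
proof -
  have "(\<lambda>p. indicator {0<..} (snd p) * G L (fst p) (Complex x (snd p)) orig orig) \<in> borel_measurable (Ms \<Otimes>\<^sub>M lborel)"
  proof (rule G_half_plane_measurable)
    show "(\<lambda>p. fst p n) \<in> borel_measurable (Ms \<Otimes>\<^sub>M lborel)" if "n \<in> box L" for n
      using measurable_compose[OF measurable_fst \<omega>[OF that]] .
  qed simp
  then have "(\<lambda>p. Re (indicator {0<..} (snd p) * G L (fst p) (Complex x (snd p)) orig orig)) \<in> borel_measurable (Ms \<Otimes>\<^sub>M lborel)"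
    by (rule measurable_compose) simp
  moreover have "Re (indicator {0<..} \<eta> * z) = indicator {0<..} \<eta> * Re z" for \<eta> :: real and z by (simp add: indicator_def)
  ultimately have "(\<lambda>(\<omega>, \<eta>). indicator {0<..} \<eta> * Re (G L \<omega> (Complex x \<eta>) orig orig)) \<in> borel_measurable (Ms \<Otimes>\<^sub>M lborel)"
    by (simp add: case_prod_unfold)
  from lborel.borel_measurable_lebesgue_integral[OF this] show ?thesis unfolding fermi_def by simp
qed

definition green_increment :: "nat \<Rightarrow> ('v \<Rightarrow> real) \<Rightarrow> complex \<Rightarrow> real" where
  "green_increment L \<omega> z = cmod (G L \<omega> z orig orig - G (Suc L) \<omega> z orig orig)"

lemma fermi_increment_le:
  "ennreal \<bar>fermi (Suc L) \<omega> x - fermi L \<omega> x\<bar>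
    \<le> (\<integral>\<^sup>+\<eta>. indicator {0<..} \<eta> * ennreal (green_increment L \<omega> (Complex x \<eta>)) \<partial>lborel)"
proof -
  let ?g = "\<lambda>L \<eta>. indicator {0<..} \<eta> * Re (G L \<omega> (Complex x \<eta>) orig orig)"
  have "fermi (Suc L) \<omega> x - fermi L \<omega> x = (1 / pi) * (\<integral>\<eta>. ?g L \<eta> - ?g (Suc L) \<eta> \<partial>lborel)"
    unfolding fermi_def using fermi_integrable[of L \<omega> x] fermi_integrable[of "Suc L" \<omega> x]
    by (simp add: right_diff_distrib)
  then have "\<bar>fermi (Suc L) \<omega> x - fermi L \<omega> x\<bar> = (1 / pi) * \<bar>\<integral>\<eta>. ?g L \<eta> - ?g (Suc L) \<eta> \<partial>lborel\<bar>"
    by (simp add: abs_mult)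
  also have "\<dots> \<le> 1 * \<bar>\<integral>\<eta>. ?g L \<eta> - ?g (Suc L) \<eta> \<partial>lborel\<bar>"
    by (rule mult_right_mono) (use pi_gt3 in auto)
  finally have "ennreal \<bar>fermi (Suc L) \<omega> x - fermi L \<omega> x\<bar> \<le> ennreal (norm (\<integral>\<eta>. ?g L \<eta> - ?g (Suc L) \<eta> \<partial>lborel))"
    by (intro ennreal_leI) simp
  also have "\<dots> \<le> (\<integral>\<^sup>+\<eta>. ennreal (norm (?g L \<eta> - ?g (Suc L) \<eta>)) \<partial>lborel)"
    by (rule integral_norm_bound_ennreal) (intro Bochner_Integration.integrable_diff fermi_integrable)
  also have "\<dots> \<le> (\<integral>\<^sup>+\<eta>. indicator {0<..} \<eta> * ennreal (green_increment L \<omega> (Complex x \<eta>)) \<partial>lborel)"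
  proof (rule nn_integral_mono)
    fix \<eta>
    show "ennreal (norm (?g L \<eta> - ?g (Suc L) \<eta>)) \<le> indicator {0<..} \<eta> * ennreal (green_increment L \<omega> (Complex x \<eta>))"
      unfolding green_increment_def using abs_Re_le_cmod[of "G L \<omega> (Complex x \<eta>) orig orig - G (Suc L) \<omega> (Complex x \<eta>) orig orig"]
      by (cases "0 < \<eta>") (auto intro!: ennreal_leI)
  qed
  finally show ?thesis .
qed

text \<open>
  The edges of the lattice that leave the box, oriented inwards.
\<close>

definition boundary_pairs :: "nat \<Rightarrow> ('v \<times> 'v) set" where
  "boundary_pairs L = (SIGMA n:box (Suc L) - box L. {k \<in> box L. adj n k})"

definition pair_bound :: "nat \<Rightarrow> real" where
  "pair_bound L = (real K + 1) * real (card (box (Suc L)))"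

lemma finite_boundary_pairs: "finite (boundary_pairs L)"
  unfolding boundary_pairs_def by (intro finite_SigmaI) auto

lemma card_boundary_pairs: "real (card (boundary_pairs L)) \<le> pair_bound L"
proof -
  have "card (boundary_pairs L) = (\<Sum>n\<in>box (Suc L) - box L. card {k \<in> box L. adj n k})"
    unfolding boundary_pairs_def by (rule card_SigmaI) auto
  also have "\<dots> \<le> (\<Sum>n\<in>box (Suc L) - box L. K + 1)"
  proof (rule sum_mono)
    fix n show "card {k \<in> box L. adj n k} \<le> K + 1"
      unfolding degree[of n, symmetric] by (rule card_mono) auto
  qed
  also have "\<dots> \<le> card (box (Suc L)) * (K + 1)"
    using card_mono[of "box (Suc L)" "box (Suc L) - box L"] unfolding sum_constant of_nat_id by (intro mult_right_mono) auto
  finally have "real (card (boundary_pairs L)) \<le> real (card (box (Suc L)) * (K + 1))" by (rule of_nat_mono)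
  then show ?thesis by (simp add: pair_bound_def algebra_simps)
qed

lemma pair_bound_ge_1: "1 \<le> pair_bound L"
proof -
  have "0 < card (box (Suc L))" using orig_in_box[of "Suc L"] by (metis card_gt_0_iff empty_iff finite_box)
  then have "1 * 1 \<le> (real K + 1) * real (card (box (Suc L)))" by (intro mult_mono) auto
  then show ?thesis by (simp add: pair_bound_def)
qed

lemma green_increment_sum:
  assumes "0 < Im z"
  shows "green_increment L \<omega> z \<le> (\<Sum>(n, k)\<in>boundary_pairs L. cmod (G (Suc L) \<omega> z n orig) * cmod (G L \<omega> z k orig))"
proof -
  have "green_increment L \<omega> z = cmod (\<Sum>(n, k)\<in>boundary_pairs L. G (Suc L) \<omega> z n orig * G L \<omega> z k orig)"
    unfolding green_increment_def geometric_resolvent_identity[OF assms] boundary_pairs_def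
    by (subst sum.Sigma) simp_all
  also have "\<dots> \<le> (\<Sum>(n, k)\<in>boundary_pairs L. cmod (G (Suc L) \<omega> z n orig) * cmod (G L \<omega> z k orig))"
    by (rule order_trans[OF norm_sum]) (simp add: case_prod_unfold norm_mult)
  finally show ?thesis .
qed

text \<open>
  Write the increment as \<open>D\<^sup>1\<^sup>-\<^sup>s\<^sup>/\<^sup>2 D\<^sup>s\<^sup>/\<^sup>2\<close>. The first factor is bounded deterministically by the kernel, the
  second by subadditivity of \<open>t \<mapsto> t\<^sup>s\<^sup>/\<^sup>2\<close> and \<open>(ab)\<^sup>s\<^sup>/\<^sup>2 \<le> a\<^sup>s + b\<^sup>s\<close>. The power \<open>s/2\<close> is forced by the product of
  two Green functions, for which only separate moments of order \<open>s\<close> are given.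
\<close>

lemma green_increment_split:
  assumes \<eta>: "0 < \<eta>" and s: "0 < s" "s < 1"
  shows "green_increment L \<omega> (Complex x \<eta>) \<le> 2 * pair_bound L * kernel s \<eta> *
    (\<Sum>(n, k)\<in>boundary_pairs L. cmod (G (Suc L) \<omega> (Complex x \<eta>) n orig) powr s + cmod (G L \<omega> (Complex x \<eta>) k orig) powr s)"
proof -
  let ?z = "Complex x \<eta>"
  define D where "D = green_increment L \<omega> ?z"
  have z: "0 < Im ?z" using \<eta> by simp
  have D0: "0 \<le> D" by (simp add: D_def green_increment_def)
  have G_le: "cmod (G L' \<omega> ?z n1 n2) \<le> 1 / \<eta>" for L' n1 n2 using G_norm_le[OF z, of L' \<omega> n1 n2] by simp
  have D1: "D \<le> 2 / \<eta>"
    unfolding D_def green_increment_def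
    using norm_triangle_ineq4[of "G L \<omega> ?z orig orig" "G (Suc L) \<omega> ?z orig orig"]
      G_le[of L orig orig] G_le[of "Suc L" orig orig] by (simp add: field_simps)
  have D2: "D \<le> pair_bound L / \<eta>\<^sup>2"
  proof -
    have "D \<le> (\<Sum>(n, k)\<in>boundary_pairs L. cmod (G (Suc L) \<omega> ?z n orig) * cmod (G L \<omega> ?z k orig))"
      unfolding D_def by (rule green_increment_sum[OF z])
    also have "\<dots> \<le> (\<Sum>(n, k)\<in>boundary_pairs L. (1 / \<eta>) * (1 / \<eta>))"
      by (rule sum_mono) (auto intro!: mult_mono G_le simp del: times_divide_eq_left times_divide_eq_right, use \<eta> in auto)
    also have "\<dots> = real (card (boundary_pairs L)) * (1 / \<eta>\<^sup>2)" by (simp add: power2_eq_square case_prod_unfold)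
    also have "\<dots> \<le> pair_bound L * (1 / \<eta>\<^sup>2)" by (intro mult_right_mono card_boundary_pairs) simp
    finally show ?thesis by simp
  qed
  have P1: "1 \<le> pair_bound L" by (rule pair_bound_ge_1)
  have up: "c powr (1 - s / 2) \<le> c" if "1 \<le> c" for c :: real
    using powr_mono[of "1 - s / 2" 1 c] that s by simp
  have quot: "(a / b) powr r = a powr r * b powr (- r)" for a b r :: real
    unfolding powr_minus divide_inverse[symmetric] by (rule powr_divide)
  have kern: "D powr (1 - s / 2) \<le> 2 * pair_bound L * kernel s \<eta>"
  proof (cases "\<eta> \<le> 1")
    case True
    have "D powr (1 - s / 2) \<le> (2 / \<eta>) powr (1 - s / 2)" using D0 D1 s by (intro powr_mono2) auto
    also have "\<dots> = 2 powr (1 - s / 2) * \<eta> powr (- (1 - s / 2))"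
      by (rule quot)
    also have "\<eta> powr (- (1 - s / 2)) = kernel s \<eta>" using True by (simp only: kernel_def minus_diff_eq if_True)
    also have "2 powr (1 - s / 2) * kernel s \<eta> \<le> 2 * pair_bound L * kernel s \<eta>"
      using up[of 2] P1 by (intro mult_right_mono) (auto simp: kernel_def intro: order_trans)
    finally show ?thesis .
  next
    case False
    have "D powr (1 - s / 2) \<le> (pair_bound L / \<eta>\<^sup>2) powr (1 - s / 2)" using D0 D2 s by (intro powr_mono2) auto
    also have "\<dots> = pair_bound L powr (1 - s / 2) * (\<eta>\<^sup>2) powr (- (1 - s / 2))"
      by (rule quot)
    also have "(\<eta>\<^sup>2) powr (- (1 - s / 2)) = kernel s \<eta>"
    proof -
      have "\<eta>\<^sup>2 = \<eta> powr 2" using \<eta> by (simp add: powr_numeral)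
      then have "(\<eta>\<^sup>2) powr (- (1 - s / 2)) = \<eta> powr (2 * (- (1 - s / 2)))" by (simp only: powr_powr)
      also have "2 * (- (1 - s / 2)) = s - 2" by simp
      finally show ?thesis using False by (simp add: kernel_def)
    qed
    also have "pair_bound L powr (1 - s / 2) * kernel s \<eta> \<le> 2 * pair_bound L * kernel s \<eta>"
      using up[OF P1] P1 by (intro mult_right_mono) (auto simp: kernel_def)
    finally show ?thesis .
  qed
  have frac: "D powr (s / 2) \<le> (\<Sum>(n, k)\<in>boundary_pairs L. cmod (G (Suc L) \<omega> ?z n orig) powr s + cmod (G L \<omega> ?z k orig) powr s)"
  proof -
    have "D powr (s / 2) \<le> (\<Sum>(n, k)\<in>boundary_pairs L. cmod (G (Suc L) \<omega> ?z n orig) * cmod (G L \<omega> ?z k orig)) powr (s / 2)"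
      unfolding D_def using s green_increment_sum[OF z] D0[unfolded D_def] by (intro powr_mono2) auto
    also have "\<dots> \<le> (\<Sum>p\<in>boundary_pairs L. (case p of (n, k) \<Rightarrow> cmod (G (Suc L) \<omega> ?z n orig) * cmod (G L \<omega> ?z k orig)) powr (s / 2))"
      using s by (intro powr_subadditive finite_boundary_pairs) (auto split: prod.splits)
    also have "\<dots> \<le> (\<Sum>(n, k)\<in>boundary_pairs L. cmod (G (Suc L) \<omega> ?z n orig) powr s + cmod (G L \<omega> ?z k orig) powr s)"
    proof (rule sum_mono)
      fix p :: "'v \<times> 'v"
      have half: "(a * b) powr (s / 2) \<le> a powr s + b powr s" if "0 \<le> a" "0 \<le> b" for a b :: real
      proof -
        have sq: "c powr s = (c powr (s / 2))\<^sup>2" for c :: real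
          using powr_add[of c "s / 2" "s / 2"] by (simp add: power2_eq_square)
        show ?thesis
          unfolding powr_mult sq[of a] sq[of b]
          using sum_squares_bound[of "a powr (s / 2)" "b powr (s / 2)"]
            mult_nonneg_nonneg[OF powr_ge_zero[of a "s / 2"] powr_ge_zero[of b "s / 2"]] by linarith
      qed
      show "(case p of (n, k) \<Rightarrow> cmod (G (Suc L) \<omega> ?z n orig) * cmod (G L \<omega> ?z k orig)) powr (s / 2)
        \<le> (case p of (n, k) \<Rightarrow> cmod (G (Suc L) \<omega> ?z n orig) powr s + cmod (G L \<omega> ?z k orig) powr s)"
        by (cases p) (simp add: half)
    qed
    finally show ?thesis .
  qed
  have "D = D powr (1 - s / 2) * D powr (s / 2)"
    using D0 by (cases "D = 0") (simp_all flip: powr_add)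
  also have "\<dots> \<le> (2 * pair_bound L * kernel s \<eta>) * (\<Sum>(n, k)\<in>boundary_pairs L. cmod (G (Suc L) \<omega> ?z n orig) powr s + cmod (G L \<omega> ?z k orig) powr s)"
    by (rule mult_mono[OF kern frac]) (use P1 in \<open>auto simp: kernel_def\<close>)
  finally show ?thesis by (simp add: D_def)
qed

end

section \<open>Exponential smallness of the increments\<close>

context anderson_model
begin

context
  fixes \<nu> :: "'v \<Rightarrow> real measure" and J :: "real set" and s C \<xi> x :: real
  assumes \<nu>_prob: "\<And>n. prob_space (\<nu> n)" and \<nu>_sets: "\<And>n. sets (\<nu> n) = sets borel"
    and moment_bound: "fractional_moment_bound adj orig lam \<nu> J s C \<xi>"
    and s: "0 < s" "s < 1" and C: "0 < C" and \<xi>: "0 < \<xi>" and x: "x \<in> J"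
begin

lemma coordinate_measurable: "(\<lambda>\<omega>. \<omega> n) \<in> borel_measurable (PiM UNIV \<nu>)"
  using measurable_component_singleton[of n UNIV \<nu>] measurable_cong_sets[OF refl \<nu>_sets] by blast

lemma moment_at:
  assumes L: "0 < L" and \<eta>: "0 < \<eta>"
  shows "(\<integral>\<^sup>+\<omega>. ennreal (cmod (G L \<omega> (Complex x \<eta>) n1 n2) powr s) \<partial>PiM UNIV \<nu>)
    \<le> ennreal (C * exp (- \<xi> * real (lattice_dist adj n1 n2)))"
proof -
  have "Complex x \<eta> \<in> {z. Re z \<in> J \<and> Im z > 0}" using x \<eta> by simp
  then have "(\<integral>\<^sup>+\<omega>. ennreal (cmod (G L \<omega> (Complex x \<eta>) n1 n2) powr s) \<partial>PiM UNIV \<nu>)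
    \<le> (SUP z\<in>{z. Re z \<in> J \<and> Im z > 0}. \<integral>\<^sup>+\<omega>. ennreal (cmod (G L \<omega> z n1 n2) powr s) \<partial>PiM UNIV \<nu>)"
    by (rule SUP_upper)
  also have "\<dots> \<le> ennreal (C * exp (- \<xi> * real (lattice_dist adj n1 n2)))"
    using moment_bound L unfolding fractional_moment_bound_def by blast
  finally show ?thesis .
qed

lemma G_fixed_measurable: "0 < \<eta> \<Longrightarrow> (\<lambda>\<omega>. G L \<omega> (Complex x \<eta>) n1 n2) \<in> borel_measurable (PiM UNIV \<nu>)"
  by (rule G_measurable) (auto intro: coordinate_measurable)

lemma green_increment_moment:
  assumes L: "0 < L" and \<eta>: "0 < \<eta>"
  shows "(\<integral>\<^sup>+\<omega>. ennreal (green_increment L \<omega> (Complex x \<eta>)) \<partial>PiM UNIV \<nu>)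
    \<le> ennreal (4 * (pair_bound L)\<^sup>2 * C * exp (- \<xi> * real L)) * ennreal (kernel s \<eta>)"
proof -
  let ?z = "Complex x \<eta>"
  let ?e = "ennreal (C * exp (- \<xi> * real L))"
  let ?u = "\<lambda>n \<omega>. cmod (G (Suc L) \<omega> ?z n orig) powr s" and ?v = "\<lambda>k \<omega>. cmod (G L \<omega> ?z k orig) powr s"
  have P: "0 \<le> pair_bound L" using pair_bound_ge_1[of L] by simp
  have k0: "0 \<le> kernel s \<eta>" by (simp add: kernel_def)
  note [measurable] = G_fixed_measurable[OF \<eta>]
  have pair: "(\<integral>\<^sup>+\<omega>. ennreal (?u n \<omega> + ?v k \<omega>) \<partial>PiM UNIV \<nu>) \<le> 2 * ?e" if "(n, k) \<in> boundary_pairs L" for n k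
  proof -
    have d: "lattice_dist adj n orig = Suc L" "lattice_dist adj k orig = L"
      using that boundary_dist[of k L n] by (auto simp: boundary_pairs_def)
    have "(\<integral>\<^sup>+\<omega>. ennreal (?u n \<omega> + ?v k \<omega>) \<partial>PiM UNIV \<nu>)
        = (\<integral>\<^sup>+\<omega>. ennreal (?u n \<omega>) \<partial>PiM UNIV \<nu>) + (\<integral>\<^sup>+\<omega>. ennreal (?v k \<omega>) \<partial>PiM UNIV \<nu>)"
      by (subst nn_integral_add[symmetric]) (auto intro!: nn_integral_cong simp: ennreal_plus)
    also have "\<dots> \<le> ?e + ?e"
    proof (rule add_mono)
      have "(\<integral>\<^sup>+\<omega>. ennreal (?u n \<omega>) \<partial>PiM UNIV \<nu>) \<le> ennreal (C * exp (- \<xi> * real (Suc L)))"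
        using moment_at[of "Suc L" \<eta> n orig] \<eta> by (simp only: d zero_less_Suc)
      also have "\<dots> \<le> ?e" using C \<xi> by (intro ennreal_leI mult_left_mono) auto
      finally show "(\<integral>\<^sup>+\<omega>. ennreal (?u n \<omega>) \<partial>PiM UNIV \<nu>) \<le> ?e" .
      show "(\<integral>\<^sup>+\<omega>. ennreal (?v k \<omega>) \<partial>PiM UNIV \<nu>) \<le> ?e"
        using moment_at[OF L \<eta>, of k orig] by (simp only: d)
    qed
    finally show ?thesis by (simp add: mult_2)
  qed
  have "(\<integral>\<^sup>+\<omega>. ennreal (green_increment L \<omega> ?z) \<partial>PiM UNIV \<nu>)
      \<le> (\<integral>\<^sup>+\<omega>. ennreal (2 * pair_bound L * kernel s \<eta>) * (\<Sum>p\<in>boundary_pairs L. ennreal (?u (fst p) \<omega> + ?v (snd p) \<omega>)) \<partial>PiM UNIV \<nu>)"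
  proof (rule nn_integral_mono)
    fix \<omega>
    have "ennreal (green_increment L \<omega> ?z) \<le> ennreal (2 * pair_bound L * kernel s \<eta> * (\<Sum>p\<in>boundary_pairs L. ?u (fst p) \<omega> + ?v (snd p) \<omega>))"
      using green_increment_split[OF \<eta> s, of L \<omega> x] by (intro ennreal_leI) (simp add: case_prod_unfold)
    also have "\<dots> = ennreal (2 * pair_bound L * kernel s \<eta>) * (\<Sum>p\<in>boundary_pairs L. ennreal (?u (fst p) \<omega> + ?v (snd p) \<omega>))"
    proof -
      have "(\<Sum>p\<in>boundary_pairs L. ennreal (?u (fst p) \<omega> + ?v (snd p) \<omega>)) = ennreal (\<Sum>p\<in>boundary_pairs L. ?u (fst p) \<omega> + ?v (snd p) \<omega>)"
        by (rule sum_ennreal) simp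
      then show ?thesis using P k0 by (simp only:) (rule ennreal_mult, auto intro!: sum_nonneg)
    qed
    finally show "ennreal (green_increment L \<omega> ?z) \<le> \<dots>" .
  qed
  also have "\<dots> = ennreal (2 * pair_bound L * kernel s \<eta>) * (\<Sum>p\<in>boundary_pairs L. \<integral>\<^sup>+\<omega>. ennreal (?u (fst p) \<omega> + ?v (snd p) \<omega>) \<partial>PiM UNIV \<nu>)"
    by (subst nn_integral_cmult) (simp_all add: nn_integral_sum)
  also have "\<dots> \<le> ennreal (2 * pair_bound L * kernel s \<eta>) * (\<Sum>p\<in>boundary_pairs L. 2 * ?e)"
    by (intro mult_left_mono sum_mono) (use pair in auto)
  also have "\<dots> = ennreal (2 * pair_bound L * kernel s \<eta>) * ennreal (real (card (boundary_pairs L)) * (2 * (C * exp (- \<xi> * real L))))"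
    using C by (simp add: ennreal_mult ennreal_of_nat_eq_real_of_nat)
  also have "\<dots> \<le> ennreal (2 * pair_bound L * kernel s \<eta>) * ennreal (pair_bound L * (2 * (C * exp (- \<xi> * real L))))"
    using C by (intro mult_left_mono ennreal_leI mult_right_mono card_boundary_pairs) auto
  also have "\<dots> = ennreal (4 * (pair_bound L)\<^sup>2 * C * exp (- \<xi> * real L) * kernel s \<eta>)"
    using P k0 C by (subst ennreal_mult[symmetric]) (auto simp: power2_eq_square ac_simps)
  also have "\<dots> = ennreal (4 * (pair_bound L)\<^sup>2 * C * exp (- \<xi> * real L)) * ennreal (kernel s \<eta>)"
    using C k0 by (intro ennreal_mult) auto
  finally show ?thesis .
qed

text \<open>
  Tonelli exchanges expectation and the integral over the vertical line; both Green functions in a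
  boundary pair are at distance at least \<open>L\<close> from the origin.
\<close>

lemma fermi_increment_expectation:
  assumes L: "0 < L" and \<kappa>: "(\<integral>\<^sup>+\<eta>. indicator {0<..} \<eta> * ennreal (kernel s \<eta>) \<partial>lborel) \<le> ennreal \<kappa>"
  shows "(\<integral>\<^sup>+\<omega>. ennreal \<bar>fermi (Suc L) \<omega> x - fermi L \<omega> x\<bar> \<partial>PiM UNIV \<nu>)
    \<le> ennreal (4 * (pair_bound L)\<^sup>2 * C * exp (- \<xi> * real L)) * ennreal \<kappa>"
proof -
  let ?c = "ennreal (4 * (pair_bound L)\<^sup>2 * C * exp (- \<xi> * real L))"
  interpret P: product_prob_space \<nu> UNIV by (intro product_prob_spaceI \<nu>_prob)
  interpret pair_sigma_finite "PiM UNIV \<nu>" lborel by unfold_locales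
  let ?f = "\<lambda>\<omega> \<eta>. indicator {0<..} \<eta> * ennreal (green_increment L \<omega> (Complex x \<eta>))"
  have meas: "case_prod ?f \<in> borel_measurable (PiM UNIV \<nu> \<Otimes>\<^sub>M lborel)"
  proof -
    let ?g = "\<lambda>L p. indicator {0<..} (snd p) * G L (fst p) (Complex x (snd p)) orig orig"
    have [measurable]: "?g L' \<in> borel_measurable (PiM UNIV \<nu> \<Otimes>\<^sub>M lborel)" for L'
    proof (rule G_half_plane_measurable)
      show "(\<lambda>p. fst p n) \<in> borel_measurable (PiM UNIV \<nu> \<Otimes>\<^sub>M lborel)" for n
        using measurable_compose[OF measurable_fst coordinate_measurable] .
    qed simp
    have "case_prod ?f = (\<lambda>p. ennreal (cmod (?g L p - ?g (Suc L) p)))"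
      by (auto simp: fun_eq_iff green_increment_def indicator_def)
    then show ?thesis by simp
  qed
  have "(\<integral>\<^sup>+\<omega>. ennreal \<bar>fermi (Suc L) \<omega> x - fermi L \<omega> x\<bar> \<partial>PiM UNIV \<nu>)
      \<le> (\<integral>\<^sup>+\<omega>. \<integral>\<^sup>+\<eta>. ?f \<omega> \<eta> \<partial>lborel \<partial>PiM UNIV \<nu>)"
    by (intro nn_integral_mono fermi_increment_le)
  also have "\<dots> = (\<integral>\<^sup>+\<eta>. \<integral>\<^sup>+\<omega>. ?f \<omega> \<eta> \<partial>PiM UNIV \<nu> \<partial>lborel)" by (rule Fubini'[OF meas, symmetric])
  also have "\<dots> \<le> (\<integral>\<^sup>+\<eta>. ?c * (indicator {0<..} \<eta> * ennreal (kernel s \<eta>)) \<partial>lborel)"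
  proof (rule nn_integral_mono)
    fix \<eta> :: real
    show "(\<integral>\<^sup>+\<omega>. ?f \<omega> \<eta> \<partial>PiM UNIV \<nu>) \<le> ?c * (indicator {0<..} \<eta> * ennreal (kernel s \<eta>))"
      using green_increment_moment[OF L, of \<eta>] by (cases "0 < \<eta>") auto
  qed
  also have "\<dots> = ?c * (\<integral>\<^sup>+\<eta>. indicator {0<..} \<eta> * ennreal (kernel s \<eta>) \<partial>lborel)"
    by (rule nn_integral_cmult) (simp add: kernel_def[abs_def])
  also have "\<dots> \<le> ?c * ennreal \<kappa>" using \<kappa> by (intro mult_left_mono) auto
  finally show ?thesis .
qed

text \<open>
  The Lorentzian integral equals \<open>\<eta> Im G\<close> and lies in \<open>[0, 1]\<close>, so it is at most its own \<open>s\<close>-th power.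
\<close>

lemma atom_bound:
  assumes L: "0 < L" and \<eta>: "0 < \<eta>"
  shows "(\<integral>\<^sup>+\<omega>. ennreal (\<integral>t. \<eta>\<^sup>2 / ((t - x)\<^sup>2 + \<eta>\<^sup>2) \<partial>box_measure L \<omega>) \<partial>PiM UNIV \<nu>) \<le> ennreal (\<eta> powr s * C)"
proof -
  have le: "(\<integral>t. \<eta>\<^sup>2 / ((t - x)\<^sup>2 + \<eta>\<^sup>2) \<partial>box_measure L \<omega>) \<le> \<eta> powr s * cmod (G L \<omega> (Complex x \<eta>) orig orig) powr s" for \<omega>
  proof -
    interpret real_distribution "box_measure L \<omega>" by (rule box_measure_distribution)
    define a where "a = (\<integral>t. \<eta>\<^sup>2 / ((t - x)\<^sup>2 + \<eta>\<^sup>2) \<partial>box_measure L \<omega>)"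
    have frac: "0 \<le> \<eta>\<^sup>2 / ((t - x)\<^sup>2 + \<eta>\<^sup>2)" "\<eta>\<^sup>2 / ((t - x)\<^sup>2 + \<eta>\<^sup>2) \<le> 1" for t
      using \<eta> by (simp_all add: divide_le_eq_1 sum_power2_gt_zero_iff)
    have "integrable (box_measure L \<omega>) (\<lambda>t. \<eta>\<^sup>2 / ((t - x)\<^sup>2 + \<eta>\<^sup>2))"
      by (rule integrable_const_bound[of _ 1]) (use frac in auto)
    then have a1: "a \<le> 1" unfolding a_def by (rule integral_le_const) (use frac in auto)
    have a0: "0 \<le> a" unfolding a_def using frac(1) by (intro integral_nonneg_AE) simp
    have "a = \<eta> * Im (G L \<omega> (Complex x \<eta>) orig orig)"
      unfolding a_def G_box_measure(2)[OF \<eta>] by (subst integral_mult_right_zero[symmetric]) (simp add: power2_eq_square)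
    also have "\<dots> \<le> \<eta> * cmod (G L \<omega> (Complex x \<eta>) orig orig)"
      using \<eta> abs_Im_le_cmod[of "G L \<omega> (Complex x \<eta>) orig orig"] by (intro mult_left_mono) auto
    finally have "a powr s \<le> (\<eta> * cmod (G L \<omega> (Complex x \<eta>) orig orig)) powr s"
      using a0 s by (intro powr_mono2) auto
    moreover have "a \<le> a powr s" using powr_mono'[of s 1 a] a0 a1 s by (cases "a = 0") auto
    ultimately show ?thesis using \<eta> unfolding a_def[symmetric] by (simp add: powr_mult)
  qed
  note [measurable] = G_fixed_measurable[OF \<eta>]
  have "(\<integral>\<^sup>+\<omega>. ennreal (\<integral>t. \<eta>\<^sup>2 / ((t - x)\<^sup>2 + \<eta>\<^sup>2) \<partial>box_measure L \<omega>) \<partial>PiM UNIV \<nu>)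
      \<le> (\<integral>\<^sup>+\<omega>. ennreal (\<eta> powr s) * ennreal (cmod (G L \<omega> (Complex x \<eta>) orig orig) powr s) \<partial>PiM UNIV \<nu>)"
    by (intro nn_integral_mono) (simp add: ennreal_mult[symmetric] le ennreal_leI)
  also have "\<dots> = ennreal (\<eta> powr s) * (\<integral>\<^sup>+\<omega>. ennreal (cmod (G L \<omega> (Complex x \<eta>) orig orig) powr s) \<partial>PiM UNIV \<nu>)"
    by (rule nn_integral_cmult) measurable
  also have "\<dots> \<le> ennreal (\<eta> powr s) * ennreal C"
    using moment_at[OF L \<eta>, of orig orig] by (intro mult_left_mono) auto
  finally show ?thesis using C by (simp add: ennreal_mult)
qed

end

end

locale density_model = anderson_model adj K orig lam + smooth_density "\<lambda>i. (deriv ^^ i) g" m R B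
  for adj :: "'v \<Rightarrow> 'v \<Rightarrow> bool" and K orig lam g m R B +
  fixes \<mu> :: "real measure"
  assumes mu_prob: "prob_space \<mu>" and mu_density: "\<mu> = density lborel (\<lambda>x. ennreal (g x))"
    and g_nonneg: "\<And>x. 0 \<le> g x"
begin

definition mass :: "nat \<Rightarrow> real" where "mass k = (\<integral>y. \<bar>(deriv ^^ k) g y\<bar> \<partial>lborel)"

text \<open>
  The site distributions obtained when the derivatives recorded by the word are normalised. Outside
  the word the original distribution is kept literally, to match the form of the moment hypothesis.
\<close>

definition site_measure :: "'v list \<Rightarrow> 'v \<Rightarrow> real measure" where
  "site_measure w n = (if n \<in> set w then deriv_measure g (count_list w n) else \<mu>)"

lemma deriv_integrable: "k \<le> m \<Longrightarrow> integrable lborel (\<lambda>t. \<bar>(deriv ^^ k) g t\<bar>)"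
proof (rule Bochner_Integration.integrable_bound[of _ "\<lambda>t. B * indicator {- R..R} t"])
  assume k: "k \<le> m"
  show "integrable lborel (\<lambda>t. B * indicator {- R..R} t :: real)"
    by (intro integrable_mult_right integrable_real_indicator) (auto simp: emeasure_lborel_Icc_eq)
  note [measurable] = F_measurable[OF k]
  show "(\<lambda>t. \<bar>(deriv ^^ k) g t\<bar>) \<in> borel_measurable lborel" by simp
  show "AE t in lborel. norm \<bar>(deriv ^^ k) g t\<bar> \<le> norm (B * indicator {- R..R} t :: real)"
  proof (rule AE_I2)
    fix t
    show "norm \<bar>(deriv ^^ k) g t\<bar> \<le> norm (B * indicator {- R..R} t :: real)"
      using F_bound[OF k, of t] F_support[OF k, of t] by (cases "R < \<bar>t\<bar>") (auto simp: indicator_def abs_le_iff)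
  qed
qed

lemma mass_nonneg: "0 \<le> mass k"
  unfolding mass_def by (rule integral_nonneg_AE) simp

lemma nn_integral_deriv: "k \<le> m \<Longrightarrow> (\<integral>\<^sup>+t. ennreal \<bar>(deriv ^^ k) g t\<bar> \<partial>lborel) = ennreal (mass k)"
  unfolding mass_def by (rule nn_integral_eq_integral[OF deriv_integrable]) auto

lemma mass_0: "mass 0 = 1"
proof -
  interpret prob_space \<mu> by (rule mu_prob)
  have [measurable]: "g \<in> borel_measurable borel" using F_measurable[of 0] by simp
  have "emeasure \<mu> UNIV = 1" using emeasure_space_1 mu_density by simp
  then have "(\<integral>\<^sup>+t. ennreal \<bar>(deriv ^^ 0) g t\<bar> \<partial>lborel) = 1"
    using g_nonneg by (simp add: mu_density emeasure_density)
  then have "ennreal (mass 0) = 1" using nn_integral_deriv[of 0] by simp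
  then show ?thesis by simp
qed

lemma site_measure_density:
  assumes "count_list w n \<le> m"
  shows "site_measure w n = density lborel (\<lambda>t. ennreal (\<bar>(deriv ^^ count_list w n) g t\<bar> / mass (count_list w n)))"
proof (cases "n \<in> set w")
  case False
  then have "count_list w n = 0" by (simp add: count_list_0_iff)
  moreover have "site_measure w n = \<mu>" using False by (simp add: site_measure_def)
  ultimately show ?thesis using g_nonneg mu_density by (simp add: mass_0)
qed (simp add: site_measure_def deriv_measure_def mass_def)

lemma site_measure_prob:
  assumes k: "count_list w n \<le> m" and pos: "mass (count_list w n) \<noteq> 0"
  shows "prob_space (site_measure w n)"
proof (rule prob_spaceI)
  note [measurable] = F_measurable[OF k]
  let ?M = "mass (count_list w n)"
  have M: "0 < ?M" using pos mass_nonneg[of "count_list w n"] by simp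
  have "emeasure (site_measure w n) (space (site_measure w n))
      = (\<integral>\<^sup>+t. ennreal (1 / ?M) * ennreal \<bar>(deriv ^^ count_list w n) g t\<bar> \<partial>lborel)"
    unfolding site_measure_density[OF k] using M by (simp add: emeasure_density ennreal_mult[symmetric])
  also have "\<dots> = ennreal (1 / ?M) * ennreal ?M" by (subst nn_integral_cmult) (simp_all add: nn_integral_deriv k)
  also have "\<dots> = 1" using M by (simp add: ennreal_mult[symmetric])
  finally show "emeasure (site_measure w n) (space (site_measure w n)) = 1" .
qed

lemma sets_site_measure: "sets (site_measure w n) = sets borel"
proof -
  have "sets \<mu> = sets borel" by (subst mu_density) simp
  then show ?thesis by (simp add: site_measure_def deriv_measure_def)
qed

context
  fixes \<Lambda> :: "'v set" and w :: "'v list"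
  assumes fin: "finite \<Lambda>" and w: "set w \<subseteq> \<Lambda>" and len: "length w \<le> m"
begin

lemma counts: "count_list w n \<le> m"
  using count_list_le_length[of w n] len by simp

lemma weight_abs: "ennreal \<bar>weight \<Lambda> c (count_list w) x \<omega>\<bar> = (\<Prod>n\<in>\<Lambda>. ennreal \<bar>(deriv ^^ count_list w n) g (\<omega> n + c * x)\<bar>)"
  unfolding weight_def abs_prod by (rule prod_ennreal[symmetric]) simp

text \<open>
  Translation invariance of Lebesgue measure moves the energy into \<open>H\<close>, and the remaining weight is
  the density of the normalised site distributions times their total masses.
\<close>

lemma weight_expectation:
  fixes H :: "('v \<Rightarrow> real) \<Rightarrow> ennreal"
  assumes pos: "\<And>n. n \<in> \<Lambda> \<Longrightarrow> mass (count_list w n) \<noteq> 0"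
    and H: "H \<in> borel_measurable (PiM \<Lambda> (\<lambda>_. lborel))"
  shows "(\<integral>\<^sup>+\<omega>. H \<omega> * ennreal \<bar>weight \<Lambda> c (count_list w) x \<omega>\<bar> \<partial>PiM \<Lambda> (\<lambda>_. lborel))
    = ennreal (\<Prod>n\<in>\<Lambda>. mass (count_list w n)) * (\<integral>\<^sup>+\<omega>. H (\<lambda>n\<in>\<Lambda>. \<omega> n - c * x) \<partial>PiM UNIV (site_measure w))"
proof -
  let ?l = "PiM \<Lambda> (\<lambda>_. lborel :: real measure)"
  let ?\<nu> = "site_measure w"
  let ?T = "\<lambda>\<omega>. \<lambda>n\<in>\<Lambda>. - (c * x) + \<omega> n"
  let ?k = "count_list w"
  have M: "0 < mass (?k n)" if "n \<in> \<Lambda>" for n using pos[OF that] mass_nonneg[of "?k n"] by simp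
  have prob: "prob_space (?\<nu> n)" for n
  proof (cases "n \<in> \<Lambda>")
    case True
    then show ?thesis by (intro site_measure_prob counts pos)
  next
    case False
    then have "?k n = 0" using w by (auto simp: count_list_0_iff)
    then show ?thesis by (intro site_measure_prob counts) (simp add: mass_0)
  qed
  interpret P: product_prob_space ?\<nu> UNIV by (intro product_prob_spaceI prob)
  have sets_PiM: "sets (PiM \<Lambda> ?\<nu>) = sets ?l" by (rule sets_PiM_cong) (simp_all add: sets_site_measure)
  have T: "?T \<in> measurable ?l ?l" by (rule measurable_restrict) simp
  have HT: "(\<lambda>\<omega>. H (?T \<omega>)) \<in> borel_measurable ?l" by (rule measurable_compose[OF T H])
  have weight_m: "weight \<Lambda> c ?k x \<in> borel_measurable ?l" by (rule weight_measurable) (rule counts)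
  define D where "D \<omega> = (\<Prod>n\<in>\<Lambda>. ennreal (\<bar>(deriv ^^ ?k n) g (\<omega> n)\<bar> / mass (?k n)))" for \<omega>
  have density: "PiM \<Lambda> ?\<nu> = density ?l D"
    unfolding D_def
  proof (rule PiM_density[OF fin])
    fix n assume "n \<in> \<Lambda>"
    note [measurable] = F_measurable[OF counts]
    show "(\<lambda>t. ennreal (\<bar>(deriv ^^ ?k n) g t\<bar> / mass (?k n))) \<in> borel_measurable borel" by simp
    show "?\<nu> n = density lborel (\<lambda>t. ennreal (\<bar>(deriv ^^ ?k n) g t\<bar> / mass (?k n)))" by (rule site_measure_density[OF counts])
  next
    show "sigma_finite_measure (?\<nu> n)" for n using prob_space_imp_sigma_finite[OF prob] .
  qed
  have D_m: "D \<in> borel_measurable ?l"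
    unfolding D_def[abs_def]
    by (intro borel_measurable_prod_ennreal measurable_compose[OF measurable_component_singleton])
      (use F_measurable[OF counts] in auto)
  have "(\<integral>\<^sup>+\<omega>. H \<omega> * ennreal \<bar>weight \<Lambda> c ?k x \<omega>\<bar> \<partial>?l) = (\<integral>\<^sup>+\<omega>. H \<omega> * ennreal \<bar>weight \<Lambda> c ?k x \<omega>\<bar> \<partial>distr ?l ?l ?T)"
    by (simp only: PiM_lborel_translation[OF fin])
  also have "\<dots> = (\<integral>\<^sup>+\<omega>. H (?T \<omega>) * ennreal \<bar>weight \<Lambda> c ?k x (?T \<omega>)\<bar> \<partial>?l)"
    using H weight_m by (intro nn_integral_distr T) simp
  also have "\<dots> = (\<integral>\<^sup>+\<omega>. ennreal (\<Prod>n\<in>\<Lambda>. mass (?k n)) * (D \<omega> * H (?T \<omega>)) \<partial>?l)"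
  proof (rule nn_integral_cong)
    fix \<omega>
    have "ennreal \<bar>weight \<Lambda> c ?k x (?T \<omega>)\<bar> = (\<Prod>n\<in>\<Lambda>. ennreal \<bar>(deriv ^^ ?k n) g (\<omega> n)\<bar>)"
      unfolding weight_abs by (rule prod.cong) auto
    also have "\<dots> = (\<Prod>n\<in>\<Lambda>. ennreal (mass (?k n)) * ennreal (\<bar>(deriv ^^ ?k n) g (\<omega> n)\<bar> / mass (?k n)))"
    proof (rule prod.cong[OF refl])
      fix n assume "n \<in> \<Lambda>"
      then have "0 < mass (?k n)" by (rule M)
      then show "ennreal \<bar>(deriv ^^ ?k n) g (\<omega> n)\<bar> = ennreal (mass (?k n)) * ennreal (\<bar>(deriv ^^ ?k n) g (\<omega> n)\<bar> / mass (?k n))"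
        by (simp add: ennreal_mult[symmetric])
    qed
    also have "\<dots> = ennreal (\<Prod>n\<in>\<Lambda>. mass (?k n)) * D \<omega>"
      unfolding prod.distrib D_def by (simp add: prod_ennreal mass_nonneg)
    finally show "H (?T \<omega>) * ennreal \<bar>weight \<Lambda> c ?k x (?T \<omega>)\<bar> = ennreal (\<Prod>n\<in>\<Lambda>. mass (?k n)) * (D \<omega> * H (?T \<omega>))"
      by (simp add: ac_simps)
  qed
  also have "\<dots> = ennreal (\<Prod>n\<in>\<Lambda>. mass (?k n)) * (\<integral>\<^sup>+\<omega>. D \<omega> * H (?T \<omega>) \<partial>?l)"
    using D_m HT by (intro nn_integral_cmult) simp
  also have "(\<integral>\<^sup>+\<omega>. D \<omega> * H (?T \<omega>) \<partial>?l) = (\<integral>\<^sup>+\<omega>. H (?T \<omega>) \<partial>PiM \<Lambda> ?\<nu>)"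
    unfolding density by (rule nn_integral_density[OF D_m HT, symmetric])
  also have "\<dots> = (\<integral>\<^sup>+\<omega>. H (?T \<omega>) \<partial>distr (PiM UNIV ?\<nu>) (PiM \<Lambda> ?\<nu>) (\<lambda>\<omega>. restrict \<omega> \<Lambda>))"
    by (subst P.distr_PiM_restrict_finite[OF fin]) auto
  also have "\<dots> = (\<integral>\<^sup>+\<omega>. H (?T (restrict \<omega> \<Lambda>)) \<partial>PiM UNIV ?\<nu>)"
  proof (rule nn_integral_distr)
    show "(\<lambda>\<omega>. restrict \<omega> \<Lambda>) \<in> measurable (PiM UNIV ?\<nu>) (PiM \<Lambda> ?\<nu>)" by (rule measurable_restrict_subset) simp
    have "(\<lambda>\<omega>. H (?T \<omega>)) \<in> borel_measurable (PiM \<Lambda> ?\<nu>)" using HT measurable_cong_sets[OF sets_PiM refl] by blast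
    then show "(\<lambda>\<omega>. H (?T \<omega>)) \<in> borel_measurable (distr (PiM UNIV ?\<nu>) (PiM \<Lambda> ?\<nu>) (\<lambda>\<omega>. restrict \<omega> \<Lambda>))" by simp
  qed
  also have "\<dots> = (\<integral>\<^sup>+\<omega>. H (\<lambda>n\<in>\<Lambda>. \<omega> n - c * x) \<partial>PiM UNIV ?\<nu>)"
    by (rule nn_integral_cong) (simp add: restrict_def if_distrib cong: if_cong)
  finally show ?thesis .
qed

text \<open>
  If a derivative of the density has mass zero, its normalisation is meaningless and the
  corresponding measure is zero; but then the weight vanishes almost everywhere.
\<close>

lemma weight_degenerate:
  assumes n: "n \<in> \<Lambda>" "mass (count_list w n) = 0"
  shows "(\<integral>\<^sup>+\<omega>. ennreal \<bar>weight \<Lambda> c (count_list w) x \<omega>\<bar> \<partial>PiM \<Lambda> (\<lambda>_. lborel)) = 0"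
proof -
  interpret l: product_sigma_finite "\<lambda>_::'v. lborel :: real measure" by unfold_locales
  have meas: "(\<lambda>t. ennreal \<bar>(deriv ^^ count_list w k) g (t + c * x)\<bar>) \<in> borel_measurable lborel" for k
    using F_measurable[OF counts, of k] by simp
  have "(\<integral>\<^sup>+t. ennreal \<bar>(deriv ^^ count_list w n) g (t + c * x)\<bar> \<partial>lborel)
      = (\<integral>\<^sup>+t. ennreal \<bar>(deriv ^^ count_list w n) g t\<bar> \<partial>distr lborel borel ((+) (c * x)))"
    using F_measurable[OF counts, of n] by (subst nn_integral_distr) (simp_all add: add.commute)
  also have "\<dots> = 0" by (simp add: lborel_distr_plus nn_integral_deriv[OF counts] n(2))
  finally have "(\<Prod>k\<in>\<Lambda>. \<integral>\<^sup>+t. ennreal \<bar>(deriv ^^ count_list w k) g (t + c * x)\<bar> \<partial>lborel) = 0"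
    using n(1) fin by (auto simp: prod_zero_iff)
  then show ?thesis unfolding weight_abs using l.product_nn_integral_prod[OF fin meas] by simp
qed

end

end

section \<open>Summation of the increments\<close>

text \<open>
  The zeroth function of the witness sequence is replaced; derivatives within \<open>S\<close> only depend on
  values on \<open>S\<close>.
\<close>

lemma C_diff_on_cong:
  assumes "C_diff_on p f S" and eq: "\<And>x. x \<in> S \<Longrightarrow> f x = g x"
  shows "C_diff_on p g S"
proof -
  obtain F where F: "F 0 = f" "\<And>i x. i < p \<Longrightarrow> x \<in> S \<Longrightarrow> (F i has_real_derivative F (Suc i) x) (at x within S)"
      "\<And>i. i \<le> p \<Longrightarrow> continuous_on S (F i)"
    using assms(1) unfolding C_diff_on_def by auto
  let ?F = "F(0 := g)"
  have eq': "F i x = ?F i x" if "x \<in> S" for i x using that eq F(1) by simp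
  have "(?F i has_real_derivative ?F (Suc i) x) (at x within S)" if "i < p" "x \<in> S" for i x
  proof (rule has_field_derivative_transform_within[where d = 1])
    show "(F i has_real_derivative ?F (Suc i) x) (at x within S)" using F(2)[OF that] by simp
  qed (use that eq' in auto)
  moreover have "continuous_on S (?F i)" if "i \<le> p" for i
  proof -
    have "continuous_on S (?F i) \<longleftrightarrow> continuous_on S (F i)" by (rule continuous_on_cong[OF refl]) (use eq' in simp)
    then show ?thesis using F(3)[OF that] by simp
  qed
  ultimately show ?thesis unfolding C_diff_on_def by (intro exI[of _ ?F]) simp
qed

lemma C_diff_on_series:
  fixes T :: "nat \<Rightarrow> nat \<Rightarrow> real \<Rightarrow> real"
  assumes J: "convex J"
    and deriv: "\<And>j L x. j < p \<Longrightarrow> (T j L has_real_derivative T (Suc j) L x) (at x)"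
    and cont: "\<And>j L. j \<le> p \<Longrightarrow> continuous_on J (T j L)"
    and bound: "\<And>j. j \<le> p \<Longrightarrow> \<exists>M. summable M \<and> (\<forall>L. \<forall>x\<in>J. \<bar>T j L x\<bar> \<le> M L)"
  shows "C_diff_on p (\<lambda>x. \<Sum>L. T 0 L x) J"
proof -
  define F where "F j x = (\<Sum>L. T j L x)" for j x
  have unif: "uniform_limit J (\<lambda>n x. \<Sum>L<n. T j L x) (F j) sequentially" and summ: "x \<in> J \<Longrightarrow> summable (\<lambda>L. T j L x)"
    if j: "j \<le> p" for j x
  proof -
    obtain M where M: "summable M" "\<And>L x. x \<in> J \<Longrightarrow> \<bar>T j L x\<bar> \<le> M L" using bound[OF j] by blast
    show "uniform_limit J (\<lambda>n x. \<Sum>L<n. T j L x) (F j) sequentially"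
      unfolding F_def by (rule Weierstrass_m_test[of _ _ M]) (use M in auto)
    assume "x \<in> J"
    then show "summable (\<lambda>L. T j L x)"
      by (intro summable_comparison_test'[OF M(1), of 0]) (simp add: M(2))
  qed
  have "(F j has_real_derivative F (Suc j) x) (at x within J)" if j: "j < p" and x: "x \<in> J" for j x
  proof -
    have "\<exists>g. \<forall>y\<in>J. (\<lambda>L. T j L y) sums g y \<and> (g has_real_derivative F (Suc j) y) (at y within J)"
    proof (rule has_field_derivative_series[OF J])
      show "(T j L has_real_derivative T (Suc j) L y) (at y within J)" for L y
        by (rule has_field_derivative_at_within) (rule deriv[OF j])
      show "uniform_limit J (\<lambda>n y. \<Sum>i<n. T (Suc j) i y) (F (Suc j)) sequentially" using unif[of "Suc j"] j by simp
      show "x \<in> J" by (rule x)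
      show "summable (\<lambda>L. T j L x)" using summ[of j x] j x by simp
    qed
    then obtain g where gs: "\<And>y. y \<in> J \<Longrightarrow> (\<lambda>L. T j L y) sums g y"
      and gd: "\<And>y. y \<in> J \<Longrightarrow> (g has_real_derivative F (Suc j) y) (at y within J)"
      by blast
    have "g y = F j y" if "y \<in> J" for y using gs[OF that] by (simp add: F_def sums_iff)
    then show ?thesis
      by (intro has_field_derivative_transform_within[where d = 1, OF gd[OF x]]) (use x in auto)
  qed
  moreover have "continuous_on J (F j)" if j: "j \<le> p" for j
    by (rule uniform_limit_theorem[OF _ unif[OF j]]) (auto intro!: always_eventually continuous_on_sum cont j)
  ultimately have "C_diff_on p (F 0) J" unfolding C_diff_on_def by blast
  then show ?thesis by (simp add: F_def[abs_def])
qed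

context density_model
begin

definition mass_bound :: real where "mass_bound = 1 + (\<Sum>k\<le>m. mass k)"

lemma mass_le: "k \<le> m \<Longrightarrow> mass k \<le> mass_bound" and mass_bound_ge_1: "1 \<le> mass_bound"
proof -
  show "1 \<le> mass_bound" by (simp add: mass_bound_def sum_nonneg mass_nonneg)
  assume "k \<le> m"
  then have "mass k \<le> (\<Sum>k\<le>m. mass k)" by (intro member_le_sum) (auto simp: mass_nonneg)
  then show "mass k \<le> mass_bound" by (simp add: mass_bound_def)
qed

text \<open>
  Vertices outside the word carry mass one, so the product has at most \<open>length w\<close> relevant factors,
  independently of the size of the box.
\<close>

lemma prod_mass_le:
  assumes fin: "finite \<Lambda>" and w: "set w \<subseteq> \<Lambda>" and len: "length w \<le> m"
  shows "(\<Prod>n\<in>\<Lambda>. mass (count_list w n)) \<le> mass_bound ^ length w"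
proof -
  have "(\<Prod>n\<in>\<Lambda>. mass (count_list w n)) = (\<Prod>n\<in>set w. mass (count_list w n))"
    by (rule prod.mono_neutral_right[OF fin w]) (simp add: mass_0)
  also have "\<dots> \<le> (\<Prod>n\<in>set w. mass_bound)"
    using count_list_le_length[of w] len by (intro prod_mono conjI mass_nonneg mass_le) (metis order_trans)
  also have "\<dots> = mass_bound ^ card (set w)" by simp
  also have "\<dots> \<le> mass_bound ^ length w" by (intro power_increasing card_length mass_bound_ge_1)
  finally show ?thesis .
qed

lemma smoothed_word_le:
  assumes fin: "finite \<Lambda>" and w: "set w \<subseteq> \<Lambda>" and len: "length w \<le> m"
    and h: "h \<in> borel_measurable (PiM \<Lambda> (\<lambda>_. lborel))" "\<And>\<omega>. \<bar>h \<omega>\<bar> \<le> 1" and b: "0 \<le> b"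
    and le: "(\<And>n. mass (count_list w n) \<noteq> 0) \<Longrightarrow>
      (\<integral>\<^sup>+\<omega>. ennreal \<bar>h (\<lambda>n\<in>\<Lambda>. \<omega> n - c * x)\<bar> \<partial>PiM UNIV (site_measure w)) \<le> ennreal b"
  shows "\<bar>smoothed_word \<Lambda> c h w x\<bar> \<le> mass_bound ^ length w * b"
proof -
  note \<alpha> = counts[OF fin w len]
  have mb: "0 \<le> mass_bound ^ length w * b" using b mass_bound_ge_1 by simp
  have "ennreal \<bar>smoothed_word \<Lambda> c h w x\<bar> \<le> (\<integral>\<^sup>+\<omega>. ennreal (norm (h \<omega> * weight \<Lambda> c (count_list w) x \<omega>)) \<partial>PiM \<Lambda> (\<lambda>_. lborel))"
    unfolding smoothed_word_def real_norm_def[symmetric]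
    by (rule integral_norm_bound_ennreal, rule weighted_integrable[OF fin h]) (rule \<alpha>)
  also have "\<dots> = (\<integral>\<^sup>+\<omega>. ennreal \<bar>h \<omega>\<bar> * ennreal \<bar>weight \<Lambda> c (count_list w) x \<omega>\<bar> \<partial>PiM \<Lambda> (\<lambda>_. lborel))"
    by (simp add: abs_mult ennreal_mult)
  also have "\<dots> \<le> ennreal (mass_bound ^ length w * b)"
  proof (cases "\<forall>n\<in>\<Lambda>. mass (count_list w n) \<noteq> 0")
    case True
    have all: "mass (count_list w n) \<noteq> 0" for n
    proof (cases "n \<in> \<Lambda>")
      case False
      then have "count_list w n = 0" using w by (auto simp: count_list_0_iff)
      then show ?thesis by (simp add: mass_0)
    qed (use True in blast)
    have "(\<integral>\<^sup>+\<omega>. ennreal \<bar>h \<omega>\<bar> * ennreal \<bar>weight \<Lambda> c (count_list w) x \<omega>\<bar> \<partial>PiM \<Lambda> (\<lambda>_. lborel))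
        = ennreal (\<Prod>n\<in>\<Lambda>. mass (count_list w n)) * (\<integral>\<^sup>+\<omega>. ennreal \<bar>h (\<lambda>n\<in>\<Lambda>. \<omega> n - c * x)\<bar> \<partial>PiM UNIV (site_measure w))"
      by (rule weight_expectation[OF fin w len all]) (use h(1) in simp)
    also have "\<dots> \<le> ennreal (mass_bound ^ length w) * ennreal b"
      by (intro mult_mono le[OF all] ennreal_leI prod_mass_le fin w len) auto
    also have "\<dots> = ennreal (mass_bound ^ length w * b)"
      using mass_bound_ge_1 b by (simp add: ennreal_mult)
    finally show ?thesis .
  next
    case False
    then obtain n where n: "n \<in> \<Lambda>" "mass (count_list w n) = 0" by blast
    have "(\<integral>\<^sup>+\<omega>. ennreal \<bar>h \<omega>\<bar> * ennreal \<bar>weight \<Lambda> c (count_list w) x \<omega>\<bar> \<partial>PiM \<Lambda> (\<lambda>_. lborel))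
        \<le> (\<integral>\<^sup>+\<omega>. 1 * ennreal \<bar>weight \<Lambda> c (count_list w) x \<omega>\<bar> \<partial>PiM \<Lambda> (\<lambda>_. lborel))"
      by (intro nn_integral_mono mult_right_mono) (use h(2) in \<open>auto simp: ennreal_le_1\<close>)
    also have "\<dots> = 0" using weight_degenerate[OF fin w len n] by simp
    finally show ?thesis by simp
  qed
  finally show ?thesis using mb by (simp add: ennreal_le_iff)
qed

definition mean :: "nat \<Rightarrow> real \<Rightarrow> real" where
  "mean L x = (\<integral>\<omega>. fermi L \<omega> x \<partial>PiM UNIV (\<lambda>_. \<mu>))"

lemma fermi_box_measurable:
  "box L \<subseteq> \<Lambda> \<Longrightarrow> (\<lambda>\<omega>. fermi L \<omega> x) \<in> borel_measurable (PiM \<Lambda> (\<lambda>_. lborel))"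
proof (rule fermi_measurable)
  fix n assume "box L \<subseteq> \<Lambda>" "n \<in> box L"
  then show "(\<lambda>\<omega>. \<omega> n) \<in> borel_measurable (PiM \<Lambda> (\<lambda>_. lborel))"
    using measurable_component_singleton[of n \<Lambda> "\<lambda>_. lborel :: real measure"] by auto
qed

lemma fermi_abs: "\<bar>fermi L \<omega> x\<bar> \<le> 1"
  using fermi_range[of L \<omega> x] by simp

lemma fermi_restrict:
  assumes "box L \<subseteq> \<Lambda>"
  shows "fermi L (\<lambda>n\<in>\<Lambda>. \<omega> n - 1 / lam * x) 0 = fermi L \<omega> x"
proof -
  have "fermi L (\<lambda>n\<in>\<Lambda>. \<omega> n - 1 / lam * x) 0 = fermi L (\<lambda>n. \<omega> n - x / lam) 0"
    by (rule fermi_cong) (use assms in auto)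
  then show ?thesis using fermi_shift[of L \<omega> x] by simp
qed

lemma fermi_product_measurable: "(\<lambda>\<omega>. fermi L \<omega> x) \<in> borel_measurable (PiM UNIV (\<lambda>_. \<mu>))"
proof (rule fermi_measurable)
  fix n
  have "sets \<mu> = sets borel" by (subst mu_density) simp
  then show "(\<lambda>\<omega>. \<omega> n) \<in> borel_measurable (PiM UNIV (\<lambda>_. \<mu>))"
    using measurable_component_singleton[of n UNIV "\<lambda>_. \<mu>"] measurable_cong_sets[OF refl \<open>sets \<mu> = sets borel\<close>] by blast
qed

lemma smoothed_0: "smoothed \<Lambda> c h 0 x = smoothed_word \<Lambda> c h [] x"
proof -
  have "words \<Lambda> 0 = {[]}" by (auto simp: words_def)
  then show ?thesis by (simp add: smoothed_def)
qed

text \<open>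
  The empty word: no derivatives, and all site distributions equal \<open>\<mu>\<close>. The box of integration may be
  larger than the box of the operator, which is needed to subtract consecutive means.
\<close>

lemma mean_eq_smoothed:
  assumes fin: "finite \<Lambda>" and sub: "box L \<subseteq> \<Lambda>"
  shows "smoothed \<Lambda> (1 / lam) (\<lambda>\<omega>. fermi L \<omega> 0) 0 x = mean L x"
proof -
  let ?W = "weight \<Lambda> (1 / lam) (count_list []) x" and ?h = "\<lambda>\<omega>. fermi L \<omega> 0"
  have W0: "0 \<le> ?W \<omega>" for \<omega> by (simp add: weight_def prod_nonneg g_nonneg)
  have site: "site_measure [] = (\<lambda>_. \<mu>)" by (simp add: site_measure_def fun_eq_iff)
  have "(\<integral>\<^sup>+\<omega>. ennreal (?h \<omega> * ?W \<omega>) \<partial>PiM \<Lambda> (\<lambda>_. lborel))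
      = (\<integral>\<^sup>+\<omega>. ennreal (?h \<omega>) * ennreal \<bar>?W \<omega>\<bar> \<partial>PiM \<Lambda> (\<lambda>_. lborel))"
    using W0 fermi_range by (simp add: ennreal_mult)
  also have "\<dots> = ennreal (\<Prod>n\<in>\<Lambda>. mass (count_list [] n)) * (\<integral>\<^sup>+\<omega>. ennreal (?h (\<lambda>n\<in>\<Lambda>. \<omega> n - 1 / lam * x)) \<partial>PiM UNIV (site_measure []))"
    by (rule weight_expectation[OF fin]) (use fermi_box_measurable[OF sub, of 0] in \<open>simp_all add: mass_0\<close>)
  also have "\<dots> = (\<integral>\<^sup>+\<omega>. ennreal (fermi L \<omega> x) \<partial>PiM UNIV (\<lambda>_. \<mu>))"
    unfolding fermi_restrict[OF sub] site by (simp add: mass_0)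
  finally have eq: "(\<integral>\<^sup>+\<omega>. ennreal (?h \<omega> * ?W \<omega>) \<partial>PiM \<Lambda> (\<lambda>_. lborel)) = (\<integral>\<^sup>+\<omega>. ennreal (fermi L \<omega> x) \<partial>PiM UNIV (\<lambda>_. \<mu>))" .
  have "smoothed_word \<Lambda> (1 / lam) ?h [] x = enn2real (\<integral>\<^sup>+\<omega>. ennreal (?h \<omega> * ?W \<omega>) \<partial>PiM \<Lambda> (\<lambda>_. lborel))"
    unfolding smoothed_word_def
    by (rule integral_eq_nn_integral)
      (use W0 fermi_range in \<open>auto intro!: borel_measurable_times fermi_box_measurable sub weight_measurable\<close>)
  also have "\<dots> = mean L x"
    unfolding eq mean_def by (rule integral_eq_nn_integral[symmetric]) (use fermi_range in \<open>auto intro: fermi_product_measurable\<close>)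
  finally show ?thesis by (simp only: smoothed_0)
qed

text \<open>
  The increments at energy zero; the series starts with the box of radius one because the moment
  hypothesis concerns positive radii.
\<close>

definition layer :: "nat \<Rightarrow> ('v \<Rightarrow> real) \<Rightarrow> real" where
  "layer L \<omega> = (if L = 0 then fermi 1 \<omega> 0 else fermi (Suc L) \<omega> 0 - fermi L \<omega> 0)"

definition dos_term :: "nat \<Rightarrow> nat \<Rightarrow> real \<Rightarrow> real" where
  "dos_term j L = smoothed (box (Suc L)) (1 / lam) (layer L) j"

lemma layer_measurable: "layer L \<in> borel_measurable (PiM (box (Suc L)) (\<lambda>_. lborel))"
proof -
  have "(\<lambda>\<omega>. fermi L' \<omega> 0) \<in> borel_measurable (PiM (box (Suc L)) (\<lambda>_. lborel))" if "L' \<le> Suc L" for L'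
    by (rule fermi_box_measurable) (rule box_mono[OF that])
  then show ?thesis unfolding layer_def[abs_def] by (cases "L = 0") simp_all
qed

lemma layer_abs: "\<bar>layer L \<omega>\<bar> \<le> 1"
  using fermi_range[of 1 \<omega> 0] fermi_range[of "Suc L" \<omega> 0] fermi_range[of L \<omega> 0] by (auto simp: layer_def abs_le_iff)

lemma sum_dos_term: "(\<Sum>L<Suc n. dos_term 0 L x) = mean (Suc n) x"
proof (induction n)
  case 0
  show ?case using mean_eq_smoothed[of "box 1" 1 x] by (simp add: dos_term_def layer_def[abs_def])
next
  case (Suc n)
  let ?B = "box (Suc (Suc n))"
  have sub: "box (Suc n) \<subseteq> ?B" by (rule box_mono) simp
  have int: "integrable (PiM ?B (\<lambda>_. lborel)) (\<lambda>\<omega>. fermi L \<omega> 0 * weight ?B (1 / lam) (count_list []) x \<omega>)" if "box L \<subseteq> ?B" for L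
    by (rule weighted_integrable[OF finite_box fermi_box_measurable[OF that] fermi_abs]) simp
  have "dos_term 0 (Suc n) x = smoothed_word ?B (1 / lam) (\<lambda>\<omega>. fermi (Suc (Suc n)) \<omega> 0 - fermi (Suc n) \<omega> 0) [] x"
    by (simp add: dos_term_def smoothed_0 layer_def[abs_def])
  also have "\<dots> = smoothed_word ?B (1 / lam) (\<lambda>\<omega>. fermi (Suc (Suc n)) \<omega> 0) [] x - smoothed_word ?B (1 / lam) (\<lambda>\<omega>. fermi (Suc n) \<omega> 0) [] x"
    unfolding smoothed_word_def left_diff_distrib by (rule Bochner_Integration.integral_diff[OF int int]) (rule order_refl sub)+
  also have "\<dots> = mean (Suc (Suc n)) x - mean (Suc n) x"
    by (simp only: smoothed_0[symmetric] mean_eq_smoothed[OF finite_box order_refl] mean_eq_smoothed[OF finite_box sub])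
  finally show ?case using Suc by simp
qed

lemma dos_term_le:
  assumes j: "j \<le> m" and b: "0 \<le> b"
    and le: "\<And>w. set w \<subseteq> box (Suc L) \<Longrightarrow> length w = j \<Longrightarrow> (\<And>n. mass (count_list w n) \<noteq> 0) \<Longrightarrow>
      (\<integral>\<^sup>+\<omega>. ennreal \<bar>layer L (\<lambda>n\<in>box (Suc L). \<omega> n - 1 / lam * x)\<bar> \<partial>PiM UNIV (site_measure w)) \<le> ennreal b"
  shows "\<bar>dos_term j L x\<bar> \<le> (mass_bound / lam * real (card (box (Suc L)))) ^ j * b"
proof -
  let ?B = "box (Suc L)"
  have "\<bar>\<Sum>w\<in>words ?B j. smoothed_word ?B (1 / lam) (layer L) w x\<bar> \<le> (\<Sum>w\<in>words ?B j. mass_bound ^ j * b)"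
  proof (rule order_trans[OF sum_abs], rule sum_mono)
    fix w assume "w \<in> words ?B j"
    then have w: "set w \<subseteq> ?B" "length w = j" by (auto simp: words_def)
    then show "\<bar>smoothed_word ?B (1 / lam) (layer L) w x\<bar> \<le> mass_bound ^ j * b"
      using smoothed_word_le[OF finite_box w(1) _ layer_measurable layer_abs b, of "1 / lam" x] le[OF w] j by simp
  qed
  also have "\<dots> = real (card ?B) ^ j * (mass_bound ^ j * b)"
    by (simp add: card_words[OF finite_box layer_measurable layer_abs])
  finally have "(1 / lam) ^ j * \<bar>\<Sum>w\<in>words ?B j. smoothed_word ?B (1 / lam) (layer L) w x\<bar> \<le> (1 / lam) ^ j * (real (card ?B) ^ j * (mass_bound ^ j * b))"
    using lam_pos by (intro mult_left_mono) auto
  then show ?thesis using lam_pos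
    by (simp add: dos_term_def smoothed_def abs_mult power_mult_distrib power_divide ac_simps)
qed

lemma dos_term_deriv: "j < m \<Longrightarrow> (dos_term j L has_real_derivative dos_term (Suc j) L x) (at x)"
  unfolding dos_term_def by (rule smoothed_deriv[OF finite_box layer_measurable layer_abs])

lemma dos_term_continuous: "j \<le> m \<Longrightarrow> continuous_on S (dos_term j L)"
  unfolding dos_term_def by (rule smoothed_continuous[OF finite_box layer_measurable layer_abs])

end

text \<open>
  With \<open>q = (K + 1)\<^sup>2 \<ge> K + 2\<close> the summand is at most a constant times \<open>(q\<^sup>p\<^sup>+\<^sup>2 exp (-\<xi>))\<^sup>L\<close>: \<open>j\<close> powers of the
  volume come from the choice of the word and two from the boundary pairs. The ratio is below one
  since \<open>\<xi> > (p + 2) ln q\<close>.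
\<close>

lemma geometric_majorant:
  fixes K j p :: nat and D a \<xi> :: real
  assumes K: "1 \<le> K" and j: "j \<le> p" and a: "0 \<le> a" and D: "0 \<le> D"
    and \<xi>: "\<xi> > 2 * ln (real K + 1) * (3 + real p)"
    and N: "\<And>L. real (N L) \<le> (real K + 2) ^ L"
  shows "summable (\<lambda>L. (a * real (N (Suc L))) ^ j * (D * ((real K + 1) * real (N (Suc L)))\<^sup>2 * exp (- \<xi> * real L)))"
proof -
  define q where "q = (real K + 1)\<^sup>2"
  have q1: "1 \<le> q" unfolding q_def by (intro one_le_power) simp
  have Kq: "real K + 2 \<le> q"
  proof -
    have "1 * 1 \<le> real K * real K" using K by (intro mult_mono) auto
    then show ?thesis using K by (simp add: q_def power2_eq_square algebra_simps)
  qed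
  have Nq: "real (N (Suc L)) \<le> q ^ Suc L" for L
    using N[of "Suc L"] power_mono[OF Kq, of "Suc L"] by linarith
  define r where "r = q ^ (p + 2) * exp (- \<xi>)"
  have r0: "0 \<le> r" using q1 by (simp add: r_def)
  have lnq: "q = exp (2 * ln (real K + 1))"
  proof -
    have "exp (2 * ln (real K + 1)) = exp (ln (real K + 1)) ^ 2" using exp_of_nat_mult[of 2 "ln (real K + 1)"] by simp
    also have "exp (ln (real K + 1)) = real K + 1" by (rule exp_ln) simp
    finally show ?thesis by (simp only: q_def)
  qed
  have "r = exp (real (p + 2) * (2 * ln (real K + 1)) - \<xi>)"
    by (simp only: r_def lnq exp_of_nat_mult[symmetric] exp_add[symmetric] diff_conv_add_uminus)
  also have "\<dots> < exp 0"
  proof -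
    have "0 \<le> ln (real K + 1)" by simp
    then have "real (p + 2) * (2 * ln (real K + 1)) \<le> 2 * ln (real K + 1) * (3 + real p)" by (simp add: algebra_simps)
    then have "real (p + 2) * (2 * ln (real K + 1)) - \<xi> < 0" using \<xi> by linarith
    then show ?thesis by (simp only: exp_less_cancel_iff)
  qed
  finally have r1: "r < 1" by simp
  let ?A = "a ^ j * (D * (real K + 1)\<^sup>2) * q ^ (p + 2)"
  show ?thesis
  proof (rule summable_comparison_test'[of "\<lambda>L. ?A * r ^ L" 0])
    show "summable (\<lambda>L. ?A * r ^ L)" by (intro summable_mult summable_geometric) (use r0 r1 in simp)
    fix L
    let ?n = "real (N (Suc L))"
    have "?n ^ (j + 2) \<le> (q ^ Suc L) ^ (j + 2)" by (intro power_mono Nq) simp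
    also have "\<dots> \<le> (q ^ Suc L) ^ (p + 2)" by (intro power_increasing one_le_power q1) (use j in simp)
    also have "(q ^ Suc L) ^ (p + 2) = (q ^ (p + 2)) ^ Suc L" by (simp only: power_mult[symmetric] mult.commute)
    finally have n: "?n ^ (j + 2) \<le> q ^ (p + 2) * (q ^ (p + 2)) ^ L" by (simp only: power_Suc)
    have "(a * ?n) ^ j * (D * ((real K + 1) * ?n)\<^sup>2 * exp (- \<xi> * real L))
        = a ^ j * (D * (real K + 1)\<^sup>2) * (?n ^ (j + 2)) * exp (- \<xi> * real L)"
      by (simp add: power_mult_distrib power_add power2_eq_square[of ?n])
    also have "\<dots> \<le> a ^ j * (D * (real K + 1)\<^sup>2) * (q ^ (p + 2) * (q ^ (p + 2)) ^ L) * exp (- \<xi> * real L)"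
      by (intro mult_right_mono mult_left_mono n) (use a D in auto)
    also have "\<dots> = ?A * r ^ L"
    proof -
      have "exp (- \<xi> * real L) = exp (- \<xi>) ^ L" by (simp add: exp_of_nat_mult[symmetric] mult.commute)
      then show ?thesis unfolding r_def power_mult_distrib by (simp only: ac_simps)
    qed
    finally show "norm ((a * ?n) ^ j * (D * ((real K + 1) * ?n)\<^sup>2 * exp (- \<xi> * real L))) \<le> ?A * r ^ L"
      using a D by (simp add: abs_mult)
  qed
qed

context density_model
begin

context
  fixes J :: "real set" and s C \<xi> :: real and p :: nat
  assumes K: "1 \<le> K" and s: "0 < s" "s < 1" and C: "0 < C" and p: "p \<le> m"
    and \<xi>: "\<xi> > 2 * ln (real K + 1) * (3 + real p)"
    and base: "fractional_moment_bound adj orig lam (\<lambda>n. \<mu>) J s C \<xi>"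
    and tilted: "\<And>S k. finite S \<Longrightarrow> (\<And>n. n \<in> S \<Longrightarrow> 1 \<le> k n \<and> k n \<le> m) \<Longrightarrow>
      fractional_moment_bound adj orig lam (\<lambda>n. if n \<in> S then deriv_measure g (k n) else \<mu>) J s C \<xi>"
begin

lemma rate_pos: "0 < \<xi>"
proof -
  have "0 \<le> 2 * ln (real K + 1) * (3 + real p)" by simp
  then show ?thesis using \<xi> by linarith
qed

lemma site_measure_moments:
  assumes w: "set w \<subseteq> \<Lambda>" "finite \<Lambda>" and len: "length w \<le> m"
  shows "fractional_moment_bound adj orig lam (site_measure w) J s C \<xi>"
proof -
  have "fractional_moment_bound adj orig lam (\<lambda>n. if n \<in> set w then deriv_measure g (count_list w n) else \<mu>) J s C \<xi>"
  proof (rule tilted)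
    fix n assume "n \<in> set w"
    then have "count_list w n \<noteq> 0" by (simp add: count_list_0_iff)
    then show "1 \<le> count_list w n \<and> count_list w n \<le> m" using counts[OF w(2,1) len, of n] by simp
  qed simp
  then show ?thesis by (simp add: site_measure_def[abs_def])
qed

text \<open>
  The first term is bounded because all measures are normalised; all others use the moment
  hypothesis for the site distributions of the word.
\<close>

lemma dos_terms_summable:
  assumes j: "j \<le> p"
  shows "\<exists>M. summable M \<and> (\<forall>L. \<forall>x\<in>J. \<bar>dos_term j L x\<bar> \<le> M L)"
proof -
  obtain \<kappa> where \<kappa>: "0 \<le> \<kappa>" "(\<integral>\<^sup>+\<eta>. indicator {0<..} \<eta> * ennreal (kernel s \<eta>) \<partial>lborel) \<le> ennreal \<kappa>"
    using kernel_finite[OF s] by blast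
  let ?a = "mass_bound / lam" and ?n = "\<lambda>L. real (card (box (Suc L)))"
  let ?M = "\<lambda>L. (?a * ?n L) ^ j * ((4 * C * \<kappa>) * ((real K + 1) * ?n L)\<^sup>2 * exp (- \<xi> * real L))"
  have a0: "0 \<le> ?a" using mass_bound_ge_1 lam_pos by simp
  have card: "real (card (box L)) \<le> (real K + 2) ^ L" for L
    using card_box[of L] by (metis of_nat_add of_nat_le_iff of_nat_numeral of_nat_power)
  have "summable ?M" by (rule geometric_majorant[OF K j a0 _ \<xi> card]) (use C \<kappa> in simp)
  then have "summable (\<lambda>L. if L = 0 then (?a * ?n 0) ^ j else ?M L)"
    by (subst summable_cong[where g = ?M]) (rule eventually_sequentiallyI[of 1], simp, assumption)
  moreover have "\<bar>dos_term j L x\<bar> \<le> (if L = 0 then (?a * ?n 0) ^ j else ?M L)" if x: "x \<in> J" for L x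
  proof (cases "L = 0")
    case True
    have "\<bar>dos_term j L x\<bar> \<le> (?a * ?n L) ^ j * 1"
    proof (rule dos_term_le)
      show "j \<le> m" using j p by simp
      fix w assume w: "set w \<subseteq> box (Suc L)" and "length w = j" and nz: "\<And>n. mass (count_list w n) \<noteq> 0"
      then have len: "length w \<le> m" using j p by simp
      have "prob_space (PiM UNIV (site_measure w))"
        by (rule prob_space_PiM) (rule site_measure_prob[OF counts[OF finite_box w len] nz])
      then interpret P: prob_space "PiM UNIV (site_measure w)" .
      have "(\<integral>\<^sup>+\<omega>. ennreal \<bar>layer L (\<lambda>n\<in>box (Suc L). \<omega> n - 1 / lam * x)\<bar> \<partial>PiM UNIV (site_measure w)) \<le> (\<integral>\<^sup>+\<omega>. 1 \<partial>PiM UNIV (site_measure w))"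
        by (intro nn_integral_mono) (simp add: ennreal_le_1 layer_abs)
      also have "\<dots> = ennreal 1" by (simp add: P.emeasure_space_1)
      finally show "(\<integral>\<^sup>+\<omega>. ennreal \<bar>layer L (\<lambda>n\<in>box (Suc L). \<omega> n - 1 / lam * x)\<bar> \<partial>PiM UNIV (site_measure w)) \<le> ennreal 1" .
    qed simp
    then show ?thesis using True by simp
  next
    case False
    let ?b = "4 * (pair_bound L)\<^sup>2 * C * exp (- \<xi> * real L) * \<kappa>"
    have "\<bar>dos_term j L x\<bar> \<le> (?a * ?n L) ^ j * ?b"
    proof (rule dos_term_le)
      show "j \<le> m" using j p by simp
      show "0 \<le> ?b" using C \<kappa> by simp
      fix w assume w: "set w \<subseteq> box (Suc L)" and "length w = j" and nz: "\<And>n. mass (count_list w n) \<noteq> 0"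
      then have len: "length w \<le> m" using j p by simp
      have sub: "box L \<subseteq> box (Suc L)" by (rule box_mono) simp
      have lay: "layer L (\<lambda>n\<in>box (Suc L). \<omega> n - 1 / lam * x) = fermi (Suc L) \<omega> x - fermi L \<omega> x" for \<omega>
        using False by (simp only: layer_def if_False fermi_restrict[OF sub] fermi_restrict[OF order_refl])
      have "(\<integral>\<^sup>+\<omega>. ennreal \<bar>fermi (Suc L) \<omega> x - fermi L \<omega> x\<bar> \<partial>PiM UNIV (site_measure w))
          \<le> ennreal (4 * (pair_bound L)\<^sup>2 * C * exp (- \<xi> * real L)) * ennreal \<kappa>"
        by (rule fermi_increment_expectation[OF site_measure_prob[OF counts[OF finite_box w len] nz] sets_site_measure
              site_measure_moments[OF w finite_box len] s C rate_pos x _ \<kappa>(2)]) (use False in simp)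
      also have "\<dots> = ennreal ?b" using C \<kappa> by (intro ennreal_mult[symmetric]) auto
      finally show "(\<integral>\<^sup>+\<omega>. ennreal \<bar>layer L (\<lambda>n\<in>box (Suc L). \<omega> n - 1 / lam * x)\<bar> \<partial>PiM UNIV (site_measure w)) \<le> ennreal ?b"
        unfolding lay .
    qed
    also have "?b = (4 * C * \<kappa>) * ((real K + 1) * ?n L)\<^sup>2 * exp (- \<xi> * real L)"
      by (simp add: pair_bound_def ac_simps)
    finally show ?thesis using False by simp
  qed
  ultimately show ?thesis by blast
qed

end

end

section \<open>Convergence to the integrated density of states\<close>

text \<open>
  A function that agrees almost everywhere with a measurable one is measurable for the completion.
  The integrand of the integrated density of states is accessible only in this way.
\<close>

lemma measurable_completion_AE:
  fixes f g :: "'a \<Rightarrow> real"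
  assumes f: "f \<in> borel_measurable M" and eq: "AE x in M. f x = g x"
  shows "g \<in> borel_measurable (completion M)"
proof (rule measurableI)
  fix A :: "real set" assume A: "A \<in> sets borel"
  show "g -` A \<inter> space (completion M) \<in> sets (completion M)"
  proof (rule completion.in_sets_AE)
    show "f -` A \<inter> space M \<in> sets (completion M)"
      using measurable_sets[OF f A] by (rule sets_completionI_sets)
    have "AE x in M. x \<in> f -` A \<inter> space M \<longleftrightarrow> x \<in> g -` A \<inter> space (completion M)"
      using eq by eventually_elim auto
    then show "AE x in completion M. x \<in> f -` A \<inter> space M \<longleftrightarrow> x \<in> g -` A \<inter> space (completion M)"
      by (rule AE_completion)
  qed simp
qed simp

lemma (in real_distribution) integral_sgn_atomless:
  assumes "measure M {x} = 0"
  shows "(1 - (\<integral>t. sgn (t - x) \<partial>M)) / 2 = measure M {..x}"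
proof -
  have int: "integrable M (indicator A :: real \<Rightarrow> real)" if "A \<in> sets borel" for A
    using that by (intro integrable_real_indicator) (auto simp: emeasure_eq_measure)
  have one: "measure M UNIV = 1" using prob_space space_eq_univ by metis
  have "(\<integral>t. sgn (t - x) \<partial>M) = (\<integral>t. 1 - 2 * indicator {..x} t + indicator {x} t \<partial>M)"
    by (intro Bochner_Integration.integral_cong) (auto simp: indicator_def)
  also have "\<dots> = 1 - 2 * measure M {..x} + measure M {x}"
    by (simp add: int one)
  finally show ?thesis using assms by simp
qed

lemma lorentzian_bounds:
  fixes t x \<eta> :: real
  assumes "0 < \<eta>"
  shows "0 \<le> \<eta>\<^sup>2 / ((t - x)\<^sup>2 + \<eta>\<^sup>2)" "\<eta>\<^sup>2 / ((t - x)\<^sup>2 + \<eta>\<^sup>2) \<le> 1"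
  using assms by (simp_all add: divide_le_eq_1 sum_power2_gt_zero_iff)

text \<open>
  The Lorentzian dominates the indicator of its centre.
\<close>

lemma (in real_distribution) atom_le_lorentzian:
  assumes \<eta>: "0 < \<eta>"
  shows "measure M {x} \<le> (\<integral>t. \<eta>\<^sup>2 / ((t - x)\<^sup>2 + \<eta>\<^sup>2) \<partial>M)"
proof -
  have "measure M {x} = (\<integral>t. indicator {x} t \<partial>M)" by simp
  also have "\<dots> \<le> (\<integral>t. \<eta>\<^sup>2 / ((t - x)\<^sup>2 + \<eta>\<^sup>2) \<partial>M)"
  proof (rule integral_mono)
    show "integrable M (indicator {x} :: real \<Rightarrow> real)" by (intro integrable_real_indicator) (auto simp: less_top[symmetric])
    show "integrable M (\<lambda>t. \<eta>\<^sup>2 / ((t - x)\<^sup>2 + \<eta>\<^sup>2))"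
      by (rule integrable_const_bound[of _ 1]) (use lorentzian_bounds[OF \<eta>] in auto)
    show "indicator {x} t \<le> \<eta>\<^sup>2 / ((t - x)\<^sup>2 + \<eta>\<^sup>2)" for t
      using lorentzian_bounds(1)[OF \<eta>, of t x] \<eta> by (cases "t = x") auto
  qed
  finally show ?thesis .
qed

context density_model
begin

definition potential_bound :: real where "potential_bound = max R 1"

text \<open>
  The vertex set is countable, so almost surely one bound holds at all sites.
\<close>

lemma potential_bounded: "AE \<omega> in PiM UNIV (\<lambda>_. \<mu>). \<forall>n::'v. \<bar>\<omega> n\<bar> \<le> potential_bound"
proof -
  have [measurable]: "g \<in> borel_measurable borel" using F_measurable[of 0] by simp
  have site: "AE t in \<mu>. \<bar>t\<bar> \<le> potential_bound"
  proof -
    have "AE t in density lborel (\<lambda>x. ennreal (g x)). \<bar>t\<bar> \<le> potential_bound"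
    proof (subst AE_density)
      have "\<bar>t\<bar> \<le> potential_bound" if "0 < ennreal (g t)" for t
        using F_support[of 0 t] that by (cases "R < \<bar>t\<bar>") (auto simp: potential_bound_def)
      then show "AE t in lborel. 0 < ennreal (g t) \<longrightarrow> \<bar>t\<bar> \<le> potential_bound" by simp
    qed simp
    then show ?thesis unfolding mu_density[symmetric] .
  qed
  have "AE \<omega> in PiM UNIV (\<lambda>_. \<mu>). \<forall>n\<in>UNIV. \<bar>\<omega> (n::'v)\<bar> \<le> potential_bound"
    by (rule AE_ball_countable') (rule AE_PiM_component[where P = "\<lambda>t. \<bar>t\<bar> \<le> potential_bound"], rule mu_prob, simp_all add: site countable_vertices)
  then show ?thesis by simp
qed

context
  fixes J :: "real set" and s C \<xi> x :: real
  assumes s: "0 < s" "s < 1" and C: "0 < C" and \<xi>: "0 < \<xi>" and x: "x \<in> J"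
    and base: "fractional_moment_bound adj orig lam (\<lambda>n. \<mu>) J s C \<xi>"
begin

text \<open>
  Fatou's lemma in \<open>L\<close> for fixed \<open>\<eta>\<close> bounds the expectation of the limiting Lorentzian integral by
  \<open>C \<eta>\<^sup>s\<close>. The lower limits \<open>u k\<close> are measurable functions, whereas measurability of the limiting
  measure in \<open>\<omega>\<close> is not known beforehand; their infimum over \<open>\<eta> = 1/(k + 1)\<close> vanishes almost surely and
  dominates the atom.
\<close>

lemma dos_atomless: "AE \<omega> in PiM UNIV (\<lambda>_. \<mu>). measure (dos_measure potential_bound \<omega>) {x} = 0"
proof -
  let ?P = "PiM UNIV (\<lambda>_::'v. \<mu>)"
  have sets_mu: "sets \<mu> = sets borel" by (subst mu_density) simp
  define \<eta> where "\<eta> k = 1 / real (Suc k)" for k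
  have \<eta>0: "0 < \<eta> k" for k by (simp add: \<eta>_def)
  let ?\<phi> = "\<lambda>k L \<omega>. \<integral>t. (\<eta> k)\<^sup>2 / ((t - x)\<^sup>2 + (\<eta> k)\<^sup>2) \<partial>box_measure L \<omega>"
  have \<phi>_measurable [measurable]: "?\<phi> k L \<in> borel_measurable ?P" for k L
  proof -
    have "(\<lambda>\<omega>. G L \<omega> (Complex x (\<eta> k)) orig orig) \<in> borel_measurable ?P"
    proof (rule G_measurable)
      show "(\<lambda>\<omega>. \<omega> n) \<in> borel_measurable ?P" for n
        using measurable_component_singleton[of n UNIV "\<lambda>_::'v. \<mu>"] measurable_cong_sets[OF refl sets_mu] by blast
    qed (use \<eta>0 in auto)
    then have "(\<lambda>\<omega>. \<eta> k * Im (G L \<omega> (Complex x (\<eta> k)) orig orig)) \<in> borel_measurable ?P" by measurable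
    moreover have "?\<phi> k L \<omega> = \<eta> k * Im (G L \<omega> (Complex x (\<eta> k)) orig orig)" for \<omega>
      unfolding G_box_measure(2)[OF \<eta>0] by (subst integral_mult_right_zero[symmetric]) (simp add: power2_eq_square)
    ultimately show ?thesis by simp
  qed
  define u where "u k \<omega> = liminf (\<lambda>L. ennreal (?\<phi> k L \<omega>))" for k \<omega>
  have [measurable]: "u k \<in> borel_measurable ?P" for k unfolding u_def[abs_def] by measurable
  have u_small: "(\<integral>\<^sup>+\<omega>. u k \<omega> \<partial>?P) \<le> ennreal (\<eta> k powr s * C)" for k
  proof -
    have "(\<integral>\<^sup>+\<omega>. u k \<omega> \<partial>?P) \<le> liminf (\<lambda>L. \<integral>\<^sup>+\<omega>. ennreal (?\<phi> k L \<omega>) \<partial>?P)"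
      unfolding u_def by (rule nn_integral_liminf) simp
    also have "\<dots> \<le> ennreal (\<eta> k powr s * C)"
    proof (rule Liminf_le)
      show "eventually (\<lambda>L. (\<integral>\<^sup>+\<omega>. ennreal (?\<phi> k L \<omega>) \<partial>?P) \<le> ennreal (\<eta> k powr s * C)) sequentially"
      proof (rule eventually_sequentiallyI[of 1])
        fix L :: nat assume "1 \<le> L"
        then have "0 < L" by simp
        then show "(\<integral>\<^sup>+\<omega>. ennreal (?\<phi> k L \<omega>) \<partial>?P) \<le> ennreal (\<eta> k powr s * C)"
          by (rule atom_bound[OF mu_prob sets_mu base s C \<xi> x _ \<eta>0])
      qed
    qed simp
    finally show ?thesis .
  qed
  have "(\<integral>\<^sup>+\<omega>. (INF k. u k \<omega>) \<partial>?P) \<le> 0"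
  proof (rule LIMSEQ_le_const)
    show "(\<lambda>k. ennreal (\<eta> k powr s * C)) \<longlonglongrightarrow> 0"
    proof -
      have "(\<lambda>k. \<eta> k powr s * C) \<longlonglongrightarrow> 0" unfolding \<eta>_def using s by real_asymp
      then show ?thesis using tendsto_ennrealI by fastforce
    qed
    show "\<exists>N. \<forall>k\<ge>N. (\<integral>\<^sup>+\<omega>. (INF k. u k \<omega>) \<partial>?P) \<le> ennreal (\<eta> k powr s * C)"
    proof (intro exI allI impI)
      fix k
      have "(\<integral>\<^sup>+\<omega>. (INF k. u k \<omega>) \<partial>?P) \<le> (\<integral>\<^sup>+\<omega>. u k \<omega> \<partial>?P)" by (intro nn_integral_mono INF_lower) simp
      then show "(\<integral>\<^sup>+\<omega>. (INF k. u k \<omega>) \<partial>?P) \<le> ennreal (\<eta> k powr s * C)" using u_small[of k] by (rule order_trans)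
    qed
  qed
  then have "(\<integral>\<^sup>+\<omega>. (INF k. u k \<omega>) \<partial>?P) = 0" by simp
  then have "AE \<omega> in ?P. (INF k. u k \<omega>) = 0" by (subst (asm) nn_integral_0_iff_AE) auto
  with potential_bounded show ?thesis
  proof eventually_elim
    case (elim \<omega>)
    let ?N = "dos_measure potential_bound \<omega>"
    have W: "\<And>n. \<bar>\<omega> n\<bar> \<le> potential_bound" "0 < potential_bound"
      using elim(1) by (auto simp: potential_bound_def)
    interpret N: real_distribution ?N by (rule dos_measure_distribution[OF W])
    have "ennreal (measure ?N {x}) \<le> u k \<omega>" for k
    proof -
      have "(\<lambda>L. ?\<phi> k L \<omega>) \<longlonglongrightarrow> (\<integral>t. (\<eta> k)\<^sup>2 / ((t - x)\<^sup>2 + (\<eta> k)\<^sup>2) \<partial>?N)"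
      proof (rule weak_conv_imp_bdd_ae_continuous_conv[OF box_measure_distribution N.real_distribution_axioms box_measure_converges[OF W], where B = 1])
        have "isCont (\<lambda>t. (\<eta> k)\<^sup>2 / ((t - x)\<^sup>2 + (\<eta> k)\<^sup>2)) t" for t
          using \<eta>0[of k] by (intro continuous_intros) (simp add: sum_power2_eq_zero_iff)
        then show "emeasure ?N {t. \<not> isCont (\<lambda>t. (\<eta> k)\<^sup>2 / ((t - x)\<^sup>2 + (\<eta> k)\<^sup>2)) t} = 0" by simp
        show "norm ((\<eta> k)\<^sup>2 / ((t - x)\<^sup>2 + (\<eta> k)\<^sup>2)) \<le> 1" for t
          using lorentzian_bounds[OF \<eta>0, of k t x] by simp
      qed simp
      then have "(\<lambda>L. ennreal (?\<phi> k L \<omega>)) \<longlonglongrightarrow> ennreal (\<integral>t. (\<eta> k)\<^sup>2 / ((t - x)\<^sup>2 + (\<eta> k)\<^sup>2) \<partial>?N)"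
        by (rule tendsto_ennrealI)
      then have "u k \<omega> = ennreal (\<integral>t. (\<eta> k)\<^sup>2 / ((t - x)\<^sup>2 + (\<eta> k)\<^sup>2) \<partial>?N)"
        unfolding u_def by (intro lim_imp_Liminf) simp_all
      then show ?thesis using N.atom_le_lorentzian[OF \<eta>0, of x k] by (simp add: ennreal_leI)
    qed
    then have "ennreal (measure ?N {x}) \<le> (INF k. u k \<omega>)" by (intro INF_greatest)
    then have "ennreal (measure ?N {x}) = 0" using elim(2) by simp
    then show ?case by simp
  qed
qed

text \<open>
  The sign function is discontinuous only at \<open>x\<close>, which carries no mass of the limit.
\<close>

lemma fermi_converges:
  "AE \<omega> in PiM UNIV (\<lambda>_. \<mu>). (\<lambda>L. fermi L \<omega> x) \<longlonglongrightarrow>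
    Re (ell2_inner (delta orig) (spectral_measure (anderson_dom \<omega>) (anderson adj lam \<omega>) {..x} (delta orig)))"
  using potential_bounded dos_atomless
proof eventually_elim
  case (elim \<omega>)
  let ?N = "dos_measure potential_bound \<omega>"
  have W: "\<And>n. \<bar>\<omega> n\<bar> \<le> potential_bound" "0 < potential_bound"
    using elim(1) by (auto simp: potential_bound_def)
  interpret N: real_distribution ?N by (rule dos_measure_distribution[OF W])
  have "(\<lambda>L. \<integral>t. sgn (t - x) \<partial>box_measure L \<omega>) \<longlonglongrightarrow> (\<integral>t. sgn (t - x) \<partial>?N)"
  proof (rule weak_conv_imp_bdd_ae_continuous_conv[OF box_measure_distribution N.real_distribution_axioms box_measure_converges[OF W], where B = 1])
    have "isCont (\<lambda>t. sgn (t - x)) t" if "t \<noteq> x" for t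
      using that by (intro continuous_intros) auto
    then have "{t. \<not> isCont (\<lambda>t. sgn (t - x)) t} \<subseteq> {x}" by auto
    then have "emeasure ?N {t. \<not> isCont (\<lambda>t. sgn (t - x)) t} \<le> emeasure ?N {x}" by (intro emeasure_mono) auto
    also have "\<dots> = 0" using elim(2) by (simp add: N.emeasure_eq_measure)
    finally show "emeasure ?N {t. \<not> isCont (\<lambda>t. sgn (t - x)) t} = 0" by simp
    show "norm (sgn (t - x)) \<le> 1" for t by (simp add: sgn_if)
  qed simp
  then have "(\<lambda>L. fermi L \<omega> x) \<longlonglongrightarrow> (1 - (\<integral>t. sgn (t - x) \<partial>?N)) / 2"
    unfolding fermi_eq_sgn by (intro tendsto_intros) auto
  then show ?case
    unfolding N.integral_sgn_atomless[OF elim(2)] by (subst dos_measure_spectral[OF W]) auto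
qed

lemma mean_converges: "(\<lambda>L. mean L x) \<longlonglongrightarrow> integrated_dos adj orig lam \<mu> x"
proof -
  let ?P = "PiM UNIV (\<lambda>_::'v. \<mu>)"
  let ?h = "\<lambda>\<omega>. Re (ell2_inner (delta orig) (spectral_measure (anderson_dom \<omega>) (anderson adj lam \<omega>) {..x} (delta orig)))"
  interpret P: prob_space ?P by (rule prob_space_PiM) (rule mu_prob)
  have "AE \<omega> in ?P. lim (\<lambda>L. fermi L \<omega> x) = ?h \<omega>"
    using fermi_converges by eventually_elim (rule limI)
  then have h: "?h \<in> borel_measurable (completion ?P)"
    by (rule measurable_completion_AE[rotated]) (intro borel_measurable_lim_metric fermi_product_measurable)
  have "(\<lambda>L. \<integral>\<omega>. fermi L \<omega> x \<partial>completion ?P) \<longlonglongrightarrow> (\<integral>\<omega>. ?h \<omega> \<partial>completion ?P)"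
  proof (rule integral_dominated_convergence[where w = "\<lambda>_. 1"])
    show "?h \<in> borel_measurable (completion ?P)" by (rule h)
    show "(\<lambda>\<omega>. fermi L \<omega> x) \<in> borel_measurable (completion ?P)" for L
      by (rule measurable_completion[OF fermi_product_measurable])
    show "integrable (completion ?P) (\<lambda>_. 1::real)" by (subst integrable_completion) auto
    show "AE \<omega> in completion ?P. (\<lambda>L. fermi L \<omega> x) \<longlonglongrightarrow> ?h \<omega>" by (rule AE_completion[OF fermi_converges])
    show "AE \<omega> in completion ?P. norm (fermi L \<omega> x) \<le> 1" for L using fermi_abs by simp
  qed
  then show ?thesis
    unfolding integrated_dos_def mean_def by (simp only: integral_completion[OF fermi_product_measurable])
qed

end

theorem integrated_dos_smooth:
  fixes J :: "real set" and s C \<xi> :: real and p :: nat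
  assumes K: "1 \<le> K" and s: "0 < s" "s < 1" and C: "0 < C" and p: "p \<le> m" and J: "convex J"
    and \<xi>: "\<xi> > 2 * ln (real K + 1) * (3 + real p)"
    and base: "fractional_moment_bound adj orig lam (\<lambda>n. \<mu>) J s C \<xi>"
    and tilted: "\<And>S k. finite S \<Longrightarrow> (\<And>n. n \<in> S \<Longrightarrow> 1 \<le> k n \<and> k n \<le> m) \<Longrightarrow>
      fractional_moment_bound adj orig lam (\<lambda>n. if n \<in> S then deriv_measure g (k n) else \<mu>) J s C \<xi>"
  shows "C_diff_on p (integrated_dos adj orig lam \<mu>) J"
proof (rule C_diff_on_cong)
  have summ: "\<exists>M. summable M \<and> (\<forall>L. \<forall>x\<in>J. \<bar>dos_term j L x\<bar> \<le> M L)" if "j \<le> p" for j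
  proof (rule dos_terms_summable[OF K s C p \<xi> base _ that])
    show "fractional_moment_bound adj orig lam (\<lambda>n. if n \<in> S then deriv_measure g (k n) else \<mu>) J s C \<xi>"
      if "finite S" "\<And>n. n \<in> S \<Longrightarrow> 1 \<le> k n \<and> k n \<le> m" for S k
      using that by (rule tilted)
  qed
  have rate: "0 < \<xi>"
  proof -
    have "0 \<le> 2 * ln (real K + 1) * (3 + real p)" by simp
    then show ?thesis using \<xi> by linarith
  qed
  show "C_diff_on p (\<lambda>x. \<Sum>L. dos_term 0 L x) J"
    by (rule C_diff_on_series[OF J]) (use p in \<open>auto intro!: dos_term_deriv dos_term_continuous summ\<close>)
  fix x assume x: "x \<in> J"
  obtain M where M: "summable M" "\<And>L x. x \<in> J \<Longrightarrow> \<bar>dos_term 0 L x\<bar> \<le> M L" using summ[of 0] by auto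
  have "summable (\<lambda>L. dos_term 0 L x)"
    by (rule summable_comparison_test'[OF M(1), of 0]) (simp add: M(2) x)
  then have "(\<lambda>n. \<Sum>L<Suc n. dos_term 0 L x) \<longlonglongrightarrow> (\<Sum>L. dos_term 0 L x)"
    by (intro LIMSEQ_Suc summable_LIMSEQ)
  then have "(\<lambda>n. mean (Suc n) x) \<longlonglongrightarrow> (\<Sum>L. dos_term 0 L x)" by (simp only: sum_dos_term)
  moreover have "(\<lambda>n. mean (Suc n) x) \<longlonglongrightarrow> integrated_dos adj orig lam \<mu> x"
    by (intro LIMSEQ_Suc mean_converges[OF s C rate x base])
  ultimately show "(\<Sum>L. dos_term 0 L x) = integrated_dos adj orig lam \<mu> x" by (rule LIMSEQ_unique)
qed

end

theorem theorem1p3: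
  fixes adj :: "'v \<Rightarrow> 'v \<Rightarrow> bool" and orig :: 'v
    and K m p :: nat and lam :: real
    and \<mu> :: "real measure" and g :: "real \<Rightarrow> real"
    and J :: "real set" and s C\<^sub>s \<xi>\<^sub>s :: real
  assumes "bethe_lattice adj K" and "1 \<le> K" and "0 < lam" and "1 \<le> m"
    and "prob_space \<mu>"
    and "\<mu> = density lborel (\<lambda>x. ennreal (g x))" and "\<forall>x. 0 \<le> g x"
    and "C_diff_compact_support m g"
    and "compact J" and "is_interval J"
    and "0 < s" and "s < 1" and "0 < C\<^sub>s" and "0 < \<xi>\<^sub>s"
    and "fractional_moment_bound adj orig lam (\<lambda>n. \<mu>) J s C\<^sub>s \<xi>\<^sub>s"
    and "1 \<le> p" and "p \<le> m"
    and "\<xi>\<^sub>s > 2 * ln (real K + 1) * (3 + real p)"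
    and "\<forall>S k. finite S \<and> (\<forall>n\<in>S. 1 \<le> k n \<and> k n \<le> m) \<longrightarrow>
           fractional_moment_bound adj orig lam
             (\<lambda>n. if n \<in> S then deriv_measure g (k n) else \<mu>) J s C\<^sub>s \<xi>\<^sub>s"
  shows "C_diff_on p (integrated_dos adj orig lam \<mu>) J"
proof -
  obtain R B where smooth: "smooth_density (\<lambda>i. (deriv ^^ i) g) m R B"
    using C_diff_compact_support_smooth[OF \<open>C_diff_compact_support m g\<close>] .
  interpret density_model adj K orig lam g m R B \<mu>
  proof (rule density_model.intro)
    show "anderson_model adj K lam"
      by (intro anderson_model.intro anderson_model_axioms.intro bethe.intro) fact+
    show "smooth_density (\<lambda>i. (deriv ^^ i) g) m R B" by (rule smooth)
    show "density_model_axioms g \<mu>"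
    proof (rule density_model_axioms.intro)
      show "0 \<le> g x" for x using \<open>\<forall>x. 0 \<le> g x\<close> by (rule spec)
    qed fact+
  qed
  show ?thesis
  proof (rule integrated_dos_smooth[where s = s and C = "C\<^sub>s" and \<xi> = "\<xi>\<^sub>s"])
    show "convex J" using \<open>is_interval J\<close> by (rule is_interval_convex)
    show "fractional_moment_bound adj orig lam (\<lambda>n. if n \<in> S then deriv_measure g (k n) else \<mu>) J s C\<^sub>s \<xi>\<^sub>s"
      if "finite S" "\<And>n. n \<in> S \<Longrightarrow> 1 \<le> k n \<and> k n \<le> m" for S k
      using assms(19) that by blast
  qed fact+
qed

end
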